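(* Let $n\ge 3$ and let $G$ be either ${\mathrm{O}}(n)$ or ${\mathrm{Sp}}(n)$ ($n$ even in the latter case). For every $d=0,1,2,\dots$ there is an isomorphism of $G\times G$-modules \[\mathcal{O}(\mathcal{C}(G))_d\cong \bigoplus_{k=0}^{\lfloor d/2\rfloor}\ \bigoplus_{\lambda\in\Lambda(G)_{d-2k}} V_\lambda\otimes V_\lambda .\] In particular, for $d\ge 2$, \[\mathcal{O}(\mathcal{C}(G))_d\cong \mathcal{O}(\mathcal{C}(G))_{d-2}\oplus \bigoplus_{\lambda\in\Lambda(G)_d} V_\lambda\otimes V_\lambda .\]
   Context: All vector spaces are over $\mathbb{C}$. ${\mathrm{O}}(n)=\{M\in\mathbb{C}^{n\times n}\mid M^TM=I\}$; for $n=2m$, ${\mathrm{Sp}}(n)=\{M\in\mathbb{C}^{n\times n}\mid M^TJM=J\}$ where $J$ is block diagonal with $m$ blocks $\begin{pmatrix}0&1\\-1&0\end{pmatrix}$. The cone $\mathcal{C}(G)$ of $G$ is the Zariski closure in $\mathbb{C}^{n\times n}$ of $\{cM\mid c\in\mathbb{C},\ M\in G\}$. Its coordinate ring $\mathcal{O}(\mathcal{C}(G))$ is the quotient of the polynomial ring $\mathbb{C}[x_{ij}\mid 1\le i,j\le n]$ (standard grading, $x_{ij}$ the $(i,j)$-entry function) by the homogeneous vanishing ideal of $\mathcal{C}(G)$; it inherits the grading, $\mathcal{O}(\mathcal{C}(G))_d$ denoting the degree $d$ component. $G\times G$ acts on $\mathbb{C}^{n\times n}$ by $(g,h)\cdot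 M=gMh^{-1}$, hence on $\mathcal{O}(\mathcal{C}(G))$ and each $\mathcal{O}(\mathcal{C}(G))_d$. Let $\mathrm{Par}(n)$ be the set of $\lambda=(\lambda_1,\dots,\lambda_n)\in\mathbb{Z}_{\ge0}^n$ with $\lambda_1\ge\dots\ge\lambda_n$. Set $\Lambda({\mathrm{O}}(n))=\{\lambda\in\mathrm{Par}(n)\mid |\{i:\lambda_i>0\}|+|\{i:\lambda_i>1\}|\le n\}$ and, for $n=2m$, $\Lambda({\mathrm{Sp}}(n))=\mathrm{Par}(m)$; $\Lambda(G)_d$ is the set of $\lambda\in\Lambda(G)$ with $\sum_i\lambda_i=d$. For $\lambda\in\Lambda(G)$, $V_\lambda$ is the irreducible representation of $G$ labeled by $\lambda$ in the standard (Weyl) labeling, in which $V_\lambda$ occurs in $\mathrm{T}^{|\lambda|}(\mathbb{C}^n)$ and $V_{(1,0,\dots,0)}\cong\mathbb{C}^n$ is the defining representation. *)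

theory Defs
  imports Complex_Main "Jordan_Normal_Form.Matrix" "HOL-Combinatorics.Permutations"
begin

definition orth :: "nat \<Rightarrow> complex mat set" where
  "orth n = {M \<in> carrier_mat n n. transpose_mat M * M = 1\<^sub>m n}"

definition Jmat :: "nat \<Rightarrow> complex mat" where
  "Jmat n = mat n n (\<lambda>(i,j). if even i \<and> j = i + 1 then 1
                              else if odd i \<and> i = j + 1 then -1 else 0)"

definition symp :: "nat \<Rightarrow> complex mat set" where
  "symp n = {M \<in> carrier_mat n n. transpose_mat M * Jmat n * M = Jmat n}"

definition cone :: "complex mat set \<Rightarrow> complex mat set" where
  "cone G = {smult_mat c M | c M. M \<in> G}"

definition monom :: "nat \<Rightarrow> (nat \<Rightarrow> nat \<Rightarrow> nat) \<Rightarrow> complex mat \<Rightarrow> complex" where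
  "monom n a M = (\<Prod>i<n. \<Prod>j<n. (M $$ (i,j)) ^ a i j)"

definition exps :: "nat \<Rightarrow> nat \<Rightarrow> (nat \<Rightarrow> nat \<Rightarrow> nat) set" where
  "exps n d = {a. (\<forall>i j. (n \<le> i \<or> n \<le> j) \<longrightarrow> a i j = 0) \<and> (\<Sum>i<n. \<Sum>j<n. a i j) = d}"

definition hompoly :: "nat \<Rightarrow> nat \<Rightarrow> (complex mat \<Rightarrow> complex) set" where
  "hompoly n d = {(\<lambda>M. \<Sum>a\<in>exps n d. c a * monom n a M) | c. True}"

text \<open>O(C(G))_d = restrictions to C(G) of homogeneous degree d polynomials (the vanishing
  ideal of the Zariski closure of the cone equals that of the cone itself); functions are
  extended by 0 outside the cone.\<close>
definition coord :: "nat \<Rightarrow> complex mat set \<Rightarrow> nat \<Rightarrow> (complex mat \<Rightarrow> complex) set" where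
  "coord n G d = {(\<lambda>M. if M \<in> cone G then p M else 0) | p. p \<in> hompoly n d}"

definition inv_m :: "complex mat \<Rightarrow> complex mat" where
  "inv_m g = (SOME h. h \<in> carrier_mat (dim_row g) (dim_row g) \<and>
                      g * h = 1\<^sub>m (dim_row g) \<and> h * g = 1\<^sub>m (dim_row g))"

text \<open>(g,h).M = g M h^-1, hence ((g,h).f)(M) = f(g^-1 M h)\<close>
definition coord_act :: "nat \<Rightarrow> complex mat \<times> complex mat \<Rightarrow> (complex mat \<Rightarrow> complex)
                          \<Rightarrow> (complex mat \<Rightarrow> complex)" where
  "coord_act n \<gamma> f = (\<lambda>M. if M \<in> carrier_mat n n then f (inv_m (fst \<gamma>) * M * snd \<gamma>) else 0)"

definition idx :: "nat \<Rightarrow> nat \<Rightarrow> nat list set" where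
  "idx n d = {w. length w = d \<and> (\<forall>x\<in>set w. x < n)}"

text \<open>tensors in T^d(C^n), given by their coefficients w.r.t. the standard basis\<close>
definition tensors :: "nat \<Rightarrow> nat \<Rightarrow> (nat list \<Rightarrow> complex) set" where
  "tensors n d = {T. \<forall>w. w \<notin> idx n d \<longrightarrow> T w = 0}"

text \<open>kernel of all contractions with the invariant bilinear form with matrix B\<close>
definition traceless :: "complex mat \<Rightarrow> nat \<Rightarrow> (nat list \<Rightarrow> complex) \<Rightarrow> bool" where
  "traceless B d T \<longleftrightarrow> (\<forall>i j w. i < j \<and> j < d \<and> length w = d \<longrightarrow>
      (\<Sum>a<dim_row B. \<Sum>b<dim_row B. B $$ (a,b) * T (w[i:=a, j:=b])) = 0)"

definition permT :: "nat \<Rightarrow> (nat \<Rightarrow> nat) \<Rightarrow> (nat list \<Rightarrow> complex) \<Rightarrow> (nat list \<Rightarrow> complex)" where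
  "permT d \<sigma> T = (\<lambda>w. if length w = d then T (map (\<lambda>k. w ! \<sigma> k) [0..<d]) else 0)"

definition row_start :: "nat list \<Rightarrow> nat \<Rightarrow> nat" where
  "row_start lam r = sum_list (take r lam)"

definition row_set :: "nat list \<Rightarrow> nat \<Rightarrow> nat set" where
  "row_set lam r = {row_start lam r ..< row_start lam r + lam ! r}"

definition col_set :: "nat list \<Rightarrow> nat \<Rightarrow> nat set" where
  "col_set lam c = {row_start lam r + c | r. r < length lam \<and> c < lam ! r}"

definition row_group :: "nat list \<Rightarrow> (nat \<Rightarrow> nat) set" where
  "row_group lam = {\<sigma>. \<sigma> permutes {..<sum_list lam} \<and>
                        (\<forall>r<length lam. \<sigma> ` row_set lam r = row_set lam r)}"

definition col_group :: "nat list \<Rightarrow> (nat \<Rightarrow> nat) set" where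
  "col_group lam = {\<sigma>. \<sigma> permutes {..<sum_list lam} \<and>
                        (\<forall>c. \<sigma> ` col_set lam c = col_set lam c)}"

text \<open>Young symmetrizer of the row-by-row filled tableau of shape lam\<close>
definition young_sym :: "nat list \<Rightarrow> (nat list \<Rightarrow> complex) \<Rightarrow> (nat list \<Rightarrow> complex)" where
  "young_sym lam T = (\<lambda>w. \<Sum>p\<in>row_group lam. \<Sum>q\<in>col_group lam.
        of_int (sign q) * permT (sum_list lam) (p \<circ> q) T w)"

text \<open>V_lambda = (traceless tensors of degree |lam|) . c_lambda (Weyl; Fulton-Harris 17.3, 19.5)\<close>
definition weyl_module :: "complex mat \<Rightarrow> nat list \<Rightarrow> (nat list \<Rightarrow> complex) set" where
  "weyl_module B lam = {young_sym lam T | T.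
       T \<in> tensors (dim_row B) (sum_list lam) \<and> traceless B (sum_list lam) T}"

definition tens_act :: "nat \<Rightarrow> nat \<Rightarrow> complex mat \<Rightarrow> (nat list \<Rightarrow> complex) \<Rightarrow> (nat list \<Rightarrow> complex)" where
  "tens_act n d g T = (\<lambda>w. if w \<in> idx n d then
       \<Sum>u\<in>idx n d. (\<Prod>k<d. g $$ (w ! k, u ! k)) * T u else 0)"

definition fspan :: "('a \<Rightarrow> complex) set \<Rightarrow> ('a \<Rightarrow> complex) set" where
  "fspan S = {(\<lambda>x. \<Sum>i<k. c i * s i x) | (k::nat) (c::nat \<Rightarrow> complex) s. \<forall>i<k. s i \<in> S}"

definition tensor_sq :: "('a \<Rightarrow> complex) set \<Rightarrow> ('a \<times> 'a \<Rightarrow> complex) set" where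
  "tensor_sq V = fspan {(\<lambda>(a,b). S a * T b) | S T. S \<in> V \<and> T \<in> V}"

definition pair_act :: "nat \<Rightarrow> nat \<Rightarrow> complex mat \<times> complex mat
      \<Rightarrow> (nat list \<times> nat list \<Rightarrow> complex) \<Rightarrow> (nat list \<times> nat list \<Rightarrow> complex)" where
  "pair_act n d \<gamma> X = (\<lambda>(w,w'). if w \<in> idx n d \<and> w' \<in> idx n d then
      \<Sum>u\<in>idx n d. \<Sum>u'\<in>idx n d. (\<Prod>k<d. fst \<gamma> $$ (w ! k, u ! k)) *
                                  (\<Prod>k<d. snd \<gamma> $$ (w' ! k, u' ! k)) * X (u,u') else 0)"

definition idx_dsum :: "'i set \<Rightarrow> ('i \<Rightarrow> ('p \<Rightarrow> complex) set) \<Rightarrow> ('i \<times> 'p \<Rightarrow> complex) set" where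
  "idx_dsum I V = {X. (\<forall>i\<in>I. (\<lambda>p. X (i,p)) \<in> V i) \<and> (\<forall>i p. i \<notin> I \<longrightarrow> X (i,p) = 0)}"

definition idx_act :: "('i \<Rightarrow> 'g \<Rightarrow> ('p \<Rightarrow> complex) \<Rightarrow> ('p \<Rightarrow> complex))
      \<Rightarrow> 'g \<Rightarrow> ('i \<times> 'p \<Rightarrow> complex) \<Rightarrow> ('i \<times> 'p \<Rightarrow> complex)" where
  "idx_act \<alpha> \<gamma> X = (\<lambda>(i,p). \<alpha> i \<gamma> (\<lambda>q. X (i,q)) p)"

definition sum_carrier :: "('a \<Rightarrow> complex) set \<Rightarrow> ('b \<Rightarrow> complex) set \<Rightarrow> ('a + 'b \<Rightarrow> complex) set" where
  "sum_carrier V W = {X. (X \<circ> Inl) \<in> V \<and> (X \<circ> Inr) \<in> W}"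

definition sum_act :: "('g \<Rightarrow> ('a \<Rightarrow> complex) \<Rightarrow> ('a \<Rightarrow> complex)) \<Rightarrow> ('g \<Rightarrow> ('b \<Rightarrow> complex) \<Rightarrow> ('b \<Rightarrow> complex))
      \<Rightarrow> 'g \<Rightarrow> ('a + 'b \<Rightarrow> complex) \<Rightarrow> ('a + 'b \<Rightarrow> complex)" where
  "sum_act \<alpha> \<beta> \<gamma> X = (\<lambda>z. case z of Inl a \<Rightarrow> \<alpha> \<gamma> (X \<circ> Inl) a | Inr b \<Rightarrow> \<beta> \<gamma> (X \<circ> Inr) b)"

definition gmod_iso :: "'g set \<Rightarrow> ('a \<Rightarrow> complex) set \<Rightarrow> ('g \<Rightarrow> ('a \<Rightarrow> complex) \<Rightarrow> ('a \<Rightarrow> complex))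
      \<Rightarrow> ('b \<Rightarrow> complex) set \<Rightarrow> ('g \<Rightarrow> ('b \<Rightarrow> complex) \<Rightarrow> ('b \<Rightarrow> complex)) \<Rightarrow> bool" where
  "gmod_iso \<Gamma> V \<alpha> W \<beta> \<longleftrightarrow> (\<exists>\<phi>. bij_betw \<phi> V W \<and>
      (\<forall>u\<in>V. \<forall>v\<in>V. \<phi> (\<lambda>x. u x + v x) = (\<lambda>y. \<phi> u y + \<phi> v y)) \<and>
      (\<forall>c. \<forall>u\<in>V. \<phi> (\<lambda>x. c * u x) = (\<lambda>y. c * \<phi> u y)) \<and>
      (\<forall>\<gamma>\<in>\<Gamma>. \<forall>u\<in>V. \<phi> (\<alpha> \<gamma> u) = \<beta> \<gamma> (\<phi> u)))"

definition LamO :: "nat \<Rightarrow> nat list set" where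
  "LamO n = {lam. length lam = n \<and> sorted_wrt (\<ge>) lam \<and>
      card {i. i < n \<and> lam ! i > 0} + card {i. i < n \<and> lam ! i > 1} \<le> n}"

definition LamSp :: "nat \<Rightarrow> nat list set" where
  "LamSp m = {lam. length lam = m \<and> sorted_wrt (\<ge>) lam}"

definition sum_index :: "nat list set \<Rightarrow> nat \<Rightarrow> (nat \<times> nat list) set" where
  "sum_index \<Lambda> d = {(k, lam). k \<le> d div 2 \<and> lam \<in> \<Lambda> \<and> sum_list lam = d - 2 * k}"

end

theory Submission
  imports "HOL-Library.FuncSet" "Jordan_Normal_Form.Determinant" Defs
begin

text \<open>
  A homogeneous polynomial of degree d is the evaluation of a tensor X in T^d \<otimes> T^d that is invariant under
  simultaneous permutations of both factors; composing with B makes evaluation equivariant. Orthogonally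
  to all insertions of the form b into one factor lie the harmonic X, those annihilated by every
  contraction in either factor. On the cone, the product of two entries paired by b is a multiple of
  the quadric q defined by M^T B M = q B, so that every polynomial of degree d is q times one of degree d - 2 plus a
  harmonic one. This sum is direct: by the first fundamental theorem and the double commutant argument, a
  harmonic invariant X lies in the linear span of the operators g \<otimes> ... \<otimes> g, hence is
  determined by its values on the group, and it is orthogonal to everything divisible by q.

  The first fundamental theorem follows from the vanishing of harmonic invariant tensors t of positive degree:
  the Casimir element gives (n - e) t + (sum of all (i k) t, k \<noteq> i) = 0 for every slot i, and comparing with
  a translate of t that is antisymmetric in as many slots as possible leaves only the determinant
  tensor of O(n), which a reflection excludes.

  Finally X is mapped to the family of its images under c \<otimes> c, for c the Young symmetrizers of the shapes
  of size d. This is injective on harmonic X because some Young symmetrizer does not annihilate a nonzero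
  tensor up to a permutation of its slots, and a harmonic tensor can only have a shape in
  \<Lambda>(G): antisymmetry in two disjoint sets of slots of total size > n (for Sp(n): in one set of size
  > n/2) forces a harmonic tensor to vanish. It is surjective since c^2 is a nonzero multiple of c and symmetrizers
  of different shapes annihilate each other.
\<close>

section \<open>Symmetrizers and Young tableaux\<close>

text \<open>Orthogonality and positivity refer to one Hermitian form on tensors, \<open>fip\<close>,
  and three facts make it effective. The form b is real, so contraction and insertion are adjoint to
  each other. The group is closed under conjugate transposition, so the orthogonal complement of the
  span of its operators is stable under it. The row and column symmetrizers are self-adjoint, so for
  a Young symmetrizer c the product c c* cannot kill a tensor that c* does not kill. On the side of
  the symmetric group the tool is the sum of all transpositions, which is central. On a tensor that
  is symmetric, or antisymmetric, for a colouring of the slots with least colour sum it acts by a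
  number that is read off from the colouring; a symmetric minimum and an antisymmetric minimum in
  the same module give two such numbers, and their equality forces rows and columns to fit together
  to a tableau. Since q = 1 on the group, divisibility by q becomes a statement about values on the
  group: they are values of a polynomial of degree d - 2. Homogeneity carries such statements from
  the group to the cone.\<close>

abbreviation pinv :: "('a \<Rightarrow> 'b) \<Rightarrow> 'b \<Rightarrow> 'a" where
  "pinv \<equiv> inv_into UNIV"

text \<open>Slots are permuted by precomposition in the index function. Permutations act on index
  functions from the right, hence on tensors from the left, as \<open>pact_pact\<close>
  records.\<close>

definition pact :: "('k \<Rightarrow> 'k) \<Rightarrow> (('k \<Rightarrow> 'i) \<Rightarrow> complex) \<Rightarrow> ('k \<Rightarrow> 'i) \<Rightarrow> complex" where
  "pact p t = (\<lambda>f. t (f \<circ> p))"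

lemma pact_pact [simp]: "pact p (pact q t) = pact (p \<circ> q) t"
  by (simp add: pact_def fun_eq_iff comp_assoc)

lemma pact_id [simp]: "pact id t = t" "pact (\<lambda>x. x) t = t"
  by (simp_all add: pact_def fun_eq_iff comp_def)

text \<open>The Young subgroup of the partition of D into the level sets of r. The row group and the
  column group of a tableau are its cases for the row and the column function.\<close>

definition stab :: "'k set \<Rightarrow> ('k \<Rightarrow> nat) \<Rightarrow> ('k \<Rightarrow> 'k) set" where
  "stab D r = {p. p permutes D \<and> (\<forall>x\<in>D. r (p x) = r x)}"

lemma finite_stab: "finite D \<Longrightarrow> finite (stab D r)"
  unfolding stab_def using finite_permutations[of D] by (rule rev_finite_subset) auto

lemma stab_id: "id \<in> stab D r"
  by (simp add: stab_def)

lemma stab_permutes: "p \<in> stab D r \<Longrightarrow> p permutes D"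
  by (simp add: stab_def)

lemma stab_comp: "p \<in> stab D r \<Longrightarrow> q \<in> stab D r \<Longrightarrow> p \<circ> q \<in> stab D r"
  by (auto simp: stab_def permutes_compose permutes_in_image)

lemma stab_inv: assumes "p \<in> stab D r" shows "pinv p \<in> stab D r"
proof -
  have p: "p permutes D" using assms by (simp add: stab_def)
  have "r (pinv p x) = r x" if "x \<in> D" for x
  proof -
    have "pinv p x \<in> D" using permutes_in_image[OF permutes_inv[OF p]] that by simp
    then have "r (p (pinv p x)) = r (pinv p x)" using assms by (simp add: stab_def)
    then show ?thesis using permutes_inverses[OF p] by simp
  qed
  then show ?thesis using permutes_inv[OF p] by (simp add: stab_def)
qed

lemma stab_transpose: "x \<in> D \<Longrightarrow> y \<in> D \<Longrightarrow> r x = r y \<Longrightarrow> transpose x y \<in> stab D r"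
  by (auto simp: stab_def permutes_swap_id transpose_def)

lemma bij_betw_stab_right: "p \<in> stab D r \<Longrightarrow> bij_betw (\<lambda>q. q \<circ> p) (stab D r) (stab D r)"
  by (rule bij_betwI[where g = "\<lambda>q. q \<circ> pinv p"])
     (auto simp: stab_comp stab_inv comp_assoc permutes_inv_o[OF stab_permutes])

lemma bij_betw_stab_left: "p \<in> stab D r \<Longrightarrow> bij_betw (\<lambda>q. p \<circ> q) (stab D r) (stab D r)"
  by (rule bij_betwI[where g = "\<lambda>q. pinv p \<circ> q"])
     (auto simp: stab_comp stab_inv comp_assoc[symmetric] permutes_inv_o[OF stab_permutes])

lemma bij_betw_stab_inv: "bij_betw pinv (stab D r) (stab D r)"
  by (rule bij_betwI[where g = pinv]) (auto simp: stab_inv permutes_inv_inv[OF stab_permutes])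

lemma stab_sign_comp:
  assumes "finite D" "p \<in> stab D r" "q \<in> stab D s"
  shows "sign (p \<circ> q) = sign p * sign q"
  using assms by (intro sign_compose permutes_imp_permutation[of D]) (auto simp: stab_def)

text \<open>Not divided by the order of the group, to match the Young symmetrizer of the given
  definitions; hence the factors \<open>card (stab D r)\<close> from here on.\<close>

definition symz :: "'k set \<Rightarrow> ('k \<Rightarrow> nat) \<Rightarrow> (('k \<Rightarrow> 'i) \<Rightarrow> complex) \<Rightarrow> ('k \<Rightarrow> 'i) \<Rightarrow> complex" where
  "symz D r t = (\<lambda>f. \<Sum>p\<in>stab D r. t (f \<circ> p))"

definition asymz :: "'k set \<Rightarrow> ('k \<Rightarrow> nat) \<Rightarrow> (('k \<Rightarrow> 'i) \<Rightarrow> complex) \<Rightarrow> ('k \<Rightarrow> 'i) \<Rightarrow> complex" where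
  "asymz D r t = (\<lambda>f. \<Sum>p\<in>stab D r. of_int (sign p) * t (f \<circ> p))"

lemma symz_pact: "p \<in> stab D r \<Longrightarrow> symz D r (pact p t) = symz D r t"
  using sum.reindex_bij_betw[OF bij_betw_stab_right, of p D r "\<lambda>p. t (_ \<circ> p)"]
  by (simp add: symz_def pact_def fun_eq_iff comp_assoc)

lemma pact_symz: "p \<in> stab D r \<Longrightarrow> pact p (symz D r t) = symz D r t"
  using sum.reindex_bij_betw[OF bij_betw_stab_left, of p D r "\<lambda>p. t (_ \<circ> p)"]
  by (simp add: symz_def pact_def fun_eq_iff comp_assoc)

lemma sign_sq: "of_int (sign p) * (of_int (sign p) * (z::complex)) = z"
  by (cases p rule: sign_cases) auto

lemma asymz_pact:
  assumes "finite D" "p \<in> stab D r"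
  shows "asymz D r (pact p t) = (\<lambda>f. of_int (sign p) * asymz D r t f)"
proof
  fix f
  have "asymz D r t f = (\<Sum>q\<in>stab D r. of_int (sign (q \<circ> p)) * t (f \<circ> (q \<circ> p)))"
    unfolding asymz_def
    by (rule sum.reindex_bij_betw[OF bij_betw_stab_right, symmetric]) fact
  also have "\<dots> = (\<Sum>q\<in>stab D r. of_int (sign p) * (of_int (sign q) * t (f \<circ> (q \<circ> p))))"
    using assms by (intro sum.cong) (auto simp: stab_sign_comp)
  also have "\<dots> = of_int (sign p) * asymz D r (pact p t) f"
    by (simp add: asymz_def pact_def comp_assoc sum_distrib_left)
  finally show "asymz D r (pact p t) f = of_int (sign p) * asymz D r t f"
    by (simp add: sign_sq)
qed

lemma pact_asymz:
  assumes "finite D" "p \<in> stab D r"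
  shows "pact p (asymz D r t) = (\<lambda>f. of_int (sign p) * asymz D r t f)"
proof
  fix f
  have "asymz D r t f = (\<Sum>q\<in>stab D r. of_int (sign (p \<circ> q)) * t (f \<circ> (p \<circ> q)))"
    unfolding asymz_def
    by (rule sum.reindex_bij_betw[OF bij_betw_stab_left, symmetric]) fact
  also have "\<dots> = (\<Sum>q\<in>stab D r. of_int (sign p) * (of_int (sign q) * t (f \<circ> (p \<circ> q))))"
    using assms by (intro sum.cong) (auto simp: stab_sign_comp)
  also have "\<dots> = of_int (sign p) * pact p (asymz D r t) f"
    by (simp add: asymz_def pact_def comp_assoc sum_distrib_left)
  finally show "pact p (asymz D r t) f = of_int (sign p) * asymz D r t f"
    by (simp add: sign_sq)
qed

lemma symz_scale: "symz D r (\<lambda>f. c * t f) = (\<lambda>f. c * symz D r t f)"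
  by (simp add: symz_def sum_distrib_left)

lemma asymz_scale: "asymz D r (\<lambda>f. c * t f) = (\<lambda>f. c * asymz D r t f)"
  by (simp add: asymz_def sum_distrib_left mult.left_commute)

lemma pact_scale: "pact p (\<lambda>f. c * t f) = (\<lambda>f. c * pact p t f)"
  by (simp add: pact_def)

lemma symz_sum: "symz D r (\<lambda>f. \<Sum>a\<in>A. c a * t a f) = (\<lambda>f. \<Sum>a\<in>A. c a * symz D r (t a) f)"
  unfolding symz_def by (subst sum.swap) (simp add: sum_distrib_left)

lemma asymz_sum: "asymz D r (\<lambda>f. \<Sum>a\<in>A. c a * t a f) = (\<lambda>f. \<Sum>a\<in>A. c a * asymz D r (t a) f)"
  unfolding asymz_def sum_distrib_left by (subst sum.swap) (simp add: mult.left_commute)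

lemma pact_sum: "pact p (\<lambda>f. \<Sum>a\<in>A. c a * t a f) = (\<lambda>f. \<Sum>a\<in>A. c a * pact p (t a) f)"
  by (simp add: pact_def)

text \<open>The symmetric case s = 1 and the antisymmetric case s = -1 share one predicate, so that
  the minimality argument below is proved once and then applied to rows and to columns.\<close>

definition csym :: "complex \<Rightarrow> 'k set \<Rightarrow> ('k \<Rightarrow> nat) \<Rightarrow> (('k \<Rightarrow> 'i) \<Rightarrow> complex) \<Rightarrow> bool" where
  "csym s D r v \<longleftrightarrow> (\<forall>x\<in>D. \<forall>y\<in>D. x \<noteq> y \<longrightarrow> r x = r y \<longrightarrow> pact (transpose x y) v = (\<lambda>f. s * v f))"

text \<open>A Young subgroup is generated by its transpositions: composing p with the transposition
  of a moved x and p x stays in the subgroup, makes x a fixed point and unfixes nothing, so the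
  number of moved points decreases.\<close>

lemma stab_induct [consumes 2, case_names id swap]:
  assumes "p \<in> stab D r" "finite D" "P id"
    and step: "\<And>x y q. x \<in> D \<Longrightarrow> y \<in> D \<Longrightarrow> x \<noteq> y \<Longrightarrow> r x = r y \<Longrightarrow> q \<in> stab D r \<Longrightarrow> P q
      \<Longrightarrow> P (transpose x y \<circ> q)"
  shows "P p"
  using assms(1)
proof (induction "card {x\<in>D. p x \<noteq> x}" arbitrary: p rule: less_induct)
  case less
  show ?case
  proof (cases "\<exists>x\<in>D. p x \<noteq> x")
    case False
    then have "p = id" using less.prems permutes_not_in[of p D] by (auto simp: stab_def fun_eq_iff)
    then show ?thesis using assms(3) by simp
  next
    case True
    then obtain x where x: "x \<in> D" "p x \<noteq> x" by blast
    have pD: "p permutes D" using less.prems by (rule stab_permutes)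
    have px: "p x \<in> D" "r (p x) = r x" using less.prems x pD by (auto simp: stab_def permutes_in_image)
    define q where "q = transpose x (p x) \<circ> p"
    have q: "q \<in> stab D r" unfolding q_def using x px less.prems by (intro stab_comp stab_transpose) auto
    have inj: "p y \<noteq> p x" if "y \<noteq> x" for y using permutes_inj[OF pD] that by (auto dest: injD)
    have "{y\<in>D. q y \<noteq> y} \<subset> {x\<in>D. p x \<noteq> x}"
    proof
      show "{y\<in>D. q y \<noteq> y} \<subseteq> {x\<in>D. p x \<noteq> x}"
        using x inj by (auto simp: q_def transpose_def split: if_splits)
      have "q x = x" by (simp add: q_def)
      then show "{y\<in>D. q y \<noteq> y} \<noteq> {x\<in>D. p x \<noteq> x}" using x by auto
    qed
    then have "card {y\<in>D. q y \<noteq> y} < card {x\<in>D. p x \<noteq> x}" using assms(2) by (intro psubset_card_mono) auto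
    then have "P q" using less.hyps q by blast
    then have "P (transpose x (p x) \<circ> q)" using x px q by (intro step) auto
    then show ?thesis by (simp add: q_def comp_assoc[symmetric])
  qed
qed

lemma csym_pos_pact:
  assumes "csym 1 D r v" "finite D" "p \<in> stab D r"
  shows "pact p v = v"
  using assms(3,2)
proof (induction rule: stab_induct)
  case (swap x y q)
  have "pact (transpose x y \<circ> q) v = pact (transpose x y) (pact q v)" by simp
  also have "\<dots> = v" using swap assms(1) unfolding csym_def by simp
  finally show ?case .
qed simp

lemma csym_neg_pact:
  assumes "csym (-1) D r v" "finite D" "p \<in> stab D r"
  shows "pact p v = (\<lambda>f. of_int (sign p) * v f)"
  using assms(3,2)
proof (induction rule: stab_induct)
  case (swap x y q)
  have "pact (transpose x y \<circ> q) v = pact (transpose x y) (pact q v)" by simp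
  also have "\<dots> = (\<lambda>f. of_int (sign q) * pact (transpose x y) v f)" using swap by (simp add: pact_def)
  also have "\<dots> = (\<lambda>f. of_int (sign (transpose x y \<circ> q)) * v f)"
    using swap(1-4) assms(1) stab_sign_comp[OF assms(2) stab_transpose[OF swap(1,2,4)] swap(5)]
    by (simp add: csym_def sign_swap_id)
  finally show ?case .
qed simp

lemma symz_csym:
  assumes "csym 1 D r v" "finite D"
  shows "symz D r v = (\<lambda>f. of_nat (card (stab D r)) * v f)"
proof
  fix f
  have "v (f \<circ> p) = v f" if "p \<in> stab D r" for p
    using csym_pos_pact[OF assms that] by (metis pact_def)
  then show "symz D r v f = of_nat (card (stab D r)) * v f" by (simp add: symz_def)
qed

lemma asymz_csym:
  assumes "csym (-1) D r v" "finite D"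
  shows "asymz D r v = (\<lambda>f. of_nat (card (stab D r)) * v f)"
proof
  fix f
  have "of_int (sign p) * v (f \<circ> p) = v f" if "p \<in> stab D r" for p
    using csym_neg_pact[OF assms that] by (metis pact_def sign_sq)
  then show "asymz D r v f = of_nat (card (stab D r)) * v f" by (simp add: asymz_def)
qed

lemma card_stab_pos: "finite D \<Longrightarrow> card (stab D r) > 0"
  using stab_id finite_stab card_gt_0_iff by blast

lemma csym_asymz: "finite D \<Longrightarrow> csym (-1) D r (asymz D r t)"
  unfolding csym_def by (auto simp: pact_asymz stab_transpose sign_swap_id)

lemma csym_symz: "csym 1 D r (symz D r t)"
  unfolding csym_def by (auto simp: pact_symz stab_transpose)

lemma symz_symz: "finite D \<Longrightarrow> symz D r (symz D r t) = (\<lambda>f. of_nat (card (stab D r)) * symz D r t f)"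
  by (intro symz_csym csym_symz)

lemma asymz_asymz: "finite D \<Longrightarrow> asymz D r (asymz D r t) = (\<lambda>f. of_nat (card (stab D r)) * asymz D r t f)"
  by (intro asymz_csym csym_asymz)

text \<open>If v is symmetric (s = 1) or antisymmetric (s = -1) in the slots of C, then so is the following
  tensor in the slots of C and x; it vanishes when v minimises the sum of the colours.\<close>

definition move :: "complex \<Rightarrow> 'k set \<Rightarrow> 'k \<Rightarrow> (('k \<Rightarrow> 'i) \<Rightarrow> complex) \<Rightarrow> ('k \<Rightarrow> 'i) \<Rightarrow> complex" where
  "move s C x v = (\<lambda>f. v f + s * (\<Sum>y\<in>C. pact (transpose x y) v f))"

lemma comp_transpose_eq: "bij p \<Longrightarrow> transpose x y \<circ> p = p \<circ> transpose (pinv p x) (pinv p y)"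
proof -
  assume p: "bij p"
  have "transpose x y (p z) = p (transpose (pinv p x) (pinv p y) z)" for z
  proof -
    have 1: "p (pinv p x) = x" "p (pinv p y) = y" using p by (simp_all add: bij_is_surj surj_f_inv_f)
    have 2: "p z = x \<longleftrightarrow> z = pinv p x" "p z = y \<longleftrightarrow> z = pinv p y"
      using p by (metis 1 bij_inv_eq_iff)+
    show ?thesis using 1 2 by (auto simp: transpose_def)
  qed
  then show ?thesis by (auto simp: fun_eq_iff)
qed

text \<open>In the symmetric group of x and the slots of colour i, the identity and the
  transpositions of x with these slots represent the cosets of the subgroup that fixes x. The
  s-twisted sum over representatives of an s-symmetric v is s-symmetric for the larger group. For
  the other colours the sum is only reindexed.\<close>

lemma csym_move:
  assumes v: "csym s D r v" and s: "s * s = 1" and x: "x \<in> D" "r x \<noteq> i" and fin: "finite D"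
  shows "csym s D (r(x := i)) (move s {y\<in>D. r y = i} x v)"
proof -
  let ?C = "{y\<in>D. r y = i}"
  have finC: "finite ?C" using fin by simp
  have xC: "x \<notin> ?C" using x by simp
  have ss: "s * (s * z) = z" for z using s by (simp flip: mult.assoc)
  have A: "pact (transpose x z) (move s ?C x v) = (\<lambda>f. s * move s ?C x v f)" if z: "z \<in> ?C" for z
  proof
    fix f
    have xz: "x \<noteq> z" using z xC by blast
    have B: "v (f \<circ> (transpose x z \<circ> transpose x y)) = s * pact (transpose x y) v f" if "y \<in> ?C - {z}" for y
    proof -
      \<comment> \<open>Moving (x z) past (x y) leaves (y z), which exchanges two slots of colour i,
        where the symmetry of v is known.\<close>
      have e: "transpose x z \<circ> transpose x y = transpose x y \<circ> transpose y z"
        using that z xC by (auto simp: fun_eq_iff transpose_def)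
      have "v (f \<circ> (transpose x z \<circ> transpose x y)) = pact (transpose y z) v (f \<circ> transpose x y)"
        unfolding e by (simp add: pact_def comp_assoc)
      also have "pact (transpose y z) v = (\<lambda>f. s * v f)" using v that z by (auto simp: csym_def)
      finally show ?thesis unfolding pact_def .
    qed
    have sumC: "(\<Sum>y\<in>?C. g y) = g z + (\<Sum>y\<in>?C - {z}. g y)" for g :: "'a \<Rightarrow> complex"
      using finC z by (subst sum.remove[where x = z]) auto
    have B': "(\<Sum>y\<in>?C - {z}. v (f \<circ> (transpose x z \<circ> transpose x y))) = (\<Sum>y\<in>?C - {z}. s * pact (transpose x y) v f)"
      by (rule sum.cong[OF refl B])
    have "pact (transpose x z) (move s ?C x v) f =
        pact (transpose x z) v f + s * (v f + (\<Sum>y\<in>?C - {z}. v (f \<circ> (transpose x z \<circ> transpose x y))))"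
      unfolding move_def sumC by (simp add: pact_def comp_assoc)
    then have "pact (transpose x z) (move s ?C x v) f =
        pact (transpose x z) v f + s * (v f + (\<Sum>y\<in>?C - {z}. s * pact (transpose x y) v f))"
      unfolding B' .
    also have "\<dots> = s * (v f + s * (pact (transpose x z) v f + (\<Sum>y\<in>?C - {z}. pact (transpose x y) v f)))"
      by (simp add: ss distrib_left sum_distrib_left[symmetric])
    also have "\<dots> = s * move s ?C x v f" unfolding move_def sumC ..
    finally show "pact (transpose x z) (move s ?C x v) f = s * move s ?C x v f" .
  qed
  have B: "pact (transpose y z) (move s ?C x v) = (\<lambda>f. s * move s ?C x v f)"
    if yz: "y \<in> D" "z \<in> D" "y \<noteq> z" "y \<noteq> x" "z \<noteq> x" "r y = r z" for y z
  proof
    fix f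
    have vyz: "pact (transpose y z) v = (\<lambda>f. s * v f)" using v yz by (auto simp: csym_def)
    \<comment> \<open>y and z have the same colour, so their transposition maps \<open>?C\<close> to
      itself and may be used to reindex.\<close>
    have "(\<Sum>u\<in>?C. pact (transpose x u) v (f \<circ> transpose y z)) =
        (\<Sum>u\<in>?C. pact (transpose x (transpose y z u)) v (f \<circ> transpose y z))"
      using yz by (intro sum.reindex_bij_betw[symmetric] bij_betwI[where g = "transpose y z"])
        (auto simp: transpose_def)
    also have "\<dots> = (\<Sum>u\<in>?C. s * pact (transpose x u) v f)"
    proof (rule sum.cong[OF refl])
      fix u assume "u \<in> ?C"
      have "transpose y z \<circ> transpose x (transpose y z u) = transpose x u \<circ> transpose y z"
        using yz by (auto simp: fun_eq_iff transpose_def)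
      then have "pact (transpose x (transpose y z u)) v (f \<circ> transpose y z) = pact (transpose y z) v (f \<circ> transpose x u)"
        by (simp add: pact_def comp_assoc)
      then show "pact (transpose x (transpose y z u)) v (f \<circ> transpose y z) = s * pact (transpose x u) v f"
        by (simp add: vyz) (simp add: pact_def)
    qed
    finally show "pact (transpose y z) (move s ?C x v) f = s * move s ?C x v f"
      using fun_cong[OF vyz, of f]
      by (simp add: pact_def[of "transpose y z"] move_def sum_distrib_left[symmetric] distrib_left mult.left_commute)
  qed
  show ?thesis unfolding csym_def
  proof (intro ballI impI)
    fix y z assume yz: "y \<in> D" "z \<in> D" "y \<noteq> z" "(r(x := i)) y = (r(x := i)) z"
    consider "y = x" | "z = x" "y \<noteq> x" | "y \<noteq> x" "z \<noteq> x" by blast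
    then show "pact (transpose y z) (move s ?C x v) = (\<lambda>f. s * move s ?C x v f)"
    proof cases
      case 1 then show ?thesis using A[of z] yz by auto
    next
      case 2 then show ?thesis using A[of y] yz by (auto simp: transpose_commute)
    next
      case 3 then show ?thesis using B yz by auto
    qed
  qed
qed

section \<open>Minimal colourings and the sum of all transpositions\<close>

definition perm_closed :: "'k set \<Rightarrow> (('k \<Rightarrow> 'i) \<Rightarrow> complex) set \<Rightarrow> bool" where
  "perm_closed D M \<longleftrightarrow> (\<forall>u\<in>M. \<forall>v\<in>M. (\<lambda>f. u f + v f) \<in> M) \<and> (\<forall>c. \<forall>u\<in>M. (\<lambda>f. c * u f) \<in> M)
     \<and> (\<forall>x\<in>D. \<forall>y\<in>D. \<forall>u\<in>M. pact (transpose x y) u \<in> M)"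

lemma perm_closed_add: "perm_closed D M \<Longrightarrow> u \<in> M \<Longrightarrow> v \<in> M \<Longrightarrow> (\<lambda>f. u f + v f) \<in> M"
  by (simp add: perm_closed_def)

lemma perm_closed_scale: "perm_closed D M \<Longrightarrow> u \<in> M \<Longrightarrow> (\<lambda>f. c * u f) \<in> M"
  by (simp add: perm_closed_def)

lemma perm_closed_sum:
  assumes "perm_closed D M" "v \<in> M" "finite A" "\<And>a. a \<in> A \<Longrightarrow> g a \<in> M"
  shows "(\<lambda>f. \<Sum>a\<in>A. g a f) \<in> M"
  using assms(3,4)
proof (induction A rule: finite_induct)
  case empty
  have "(\<lambda>f. 0 * v f) \<in> M" using assms(1,2) by (rule perm_closed_scale)
  then show ?case by simp
next
  case (insert a A)
  then have "(\<lambda>f. g a f + (\<Sum>a\<in>A. g a f)) \<in> M" using assms(1) by (intro perm_closed_add[of D]) auto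
  then show ?case using insert by simp
qed

lemma move_mem:
  assumes "perm_closed D M" "v \<in> M" "finite D" "C \<subseteq> D" "x \<in> D"
  shows "move s C x v \<in> M"
proof -
  have "(\<lambda>f. \<Sum>y\<in>C. pact (transpose x y) v f) \<in> M"
    using assms by (intro perm_closed_sum[OF assms(1,2)]) (auto simp: perm_closed_def intro: finite_subset)
  then have "(\<lambda>f. s * (\<Sum>y\<in>C. pact (transpose x y) v f)) \<in> M" using assms(1) by (intro perm_closed_scale)
  then show ?thesis unfolding move_def using assms(1,2) by (intro perm_closed_add)
qed

text \<open>Minimise the sum of the colours over all pairs of a colouring and a nonzero vector of M
  that is s-symmetric for it. Moving a slot x to a lower colour keeps the symmetry, stays in M and
  lowers the sum, so the moved vector has to be zero.\<close>

lemma exists_minimal_colouring: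
  assumes "perm_closed D M" "v0 \<in> M" "v0 \<noteq> (\<lambda>f. 0)" "finite D" and s: "s * s = 1"
  obtains r v where "v \<in> M" "v \<noteq> (\<lambda>f. 0)" "csym s D r v"
    "\<And>x i. x \<in> D \<Longrightarrow> i < r x \<Longrightarrow> move s {y\<in>D. r y = i} x v = (\<lambda>f. 0)"
proof -
  define P where "P = (\<lambda>(r, v). v \<in> M \<and> v \<noteq> (\<lambda>f. 0) \<and> csym s D r v)"
  \<comment> \<open>Pairwise distinct colours impose no condition, so v0 itself starts the
    descent.\<close>
  obtain r0 :: "'a \<Rightarrow> nat" where "inj_on r0 D" using assms(4) finite_imp_inj_to_nat_seg by blast
  then have "P (r0, v0)" using assms by (auto simp: P_def csym_def dest: inj_onD)
  then obtain rv where rv: "P rv" "\<And>y. P y \<Longrightarrow> (\<Sum>x\<in>D. fst rv x) \<le> (\<Sum>x\<in>D. fst y x)"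
    using ex_has_least_nat[of P "(r0, v0)" "\<lambda>rv. \<Sum>x\<in>D. fst rv x"] by blast
  obtain r v where [simp]: "rv = (r, v)" by (cases rv)
  have v: "v \<in> M" "v \<noteq> (\<lambda>f. 0)" "csym s D r v" using rv(1) by (auto simp: P_def)
  have "move s {y\<in>D. r y = i} x v = (\<lambda>f. 0)" if x: "x \<in> D" "i < r x" for x i
  proof (rule ccontr)
    assume "move s {y\<in>D. r y = i} x v \<noteq> (\<lambda>f. 0)"
    moreover have "csym s D (r(x := i)) (move s {y\<in>D. r y = i} x v)"
      using v s x assms(4) by (intro csym_move) auto
    moreover have "move s {y\<in>D. r y = i} x v \<in> M" using v x assms by (intro move_mem) auto
    ultimately have "P (r(x := i), move s {y\<in>D. r y = i} x v)" by (simp add: P_def)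
    from rv(2)[OF this] have "(\<Sum>z\<in>D. r z) \<le> (\<Sum>z\<in>D. (r(x := i)) z)" by simp
    moreover have "(\<Sum>z\<in>D. (r(x := i)) z) < (\<Sum>z\<in>D. r z)"
      using x assms(4) by (intro sum_strict_mono_ex1) auto
    ultimately show False by simp
  qed
  then show ?thesis using that v by blast
qed

text \<open>Ordered pairs, in agreement with \<open>transp_sum\<close>: both count every
  transposition twice.\<close>

definition npairs :: "'k set \<Rightarrow> ('k \<Rightarrow> nat) \<Rightarrow> nat" where
  "npairs D r = card {(x, y). x \<in> D \<and> y \<in> D \<and> x \<noteq> y \<and> r x = r y}"

definition transp_sum :: "'k set \<Rightarrow> (('k \<Rightarrow> 'i) \<Rightarrow> complex) \<Rightarrow> ('k \<Rightarrow> 'i) \<Rightarrow> complex" where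
  "transp_sum D v = (\<lambda>f. \<Sum>(x, y)\<in>{(x, y). x \<in> D \<and> y \<in> D \<and> x \<noteq> y}. v (f \<circ> transpose x y))"

text \<open>Pairs of equal colour contribute s v each. For a slot x and a colour i < r x, the
  vanishing of the move says that the transpositions of x with that colour class add up to -s v,
  which makes -s (r x) v for all lower colours together; the pairs in the other order double this.
  If r is the row function of a tableau and s = 1, the eigenvalue is twice the sum of the contents,
  column minus row.\<close>

lemma transp_sum_minimal:
  assumes fin: "finite D" and v: "csym s D r v" and s: "s * s = 1"
    and m: "\<And>x i. x \<in> D \<Longrightarrow> i < r x \<Longrightarrow> move s {y\<in>D. r y = i} x v = (\<lambda>f. 0)"
  shows "transp_sum D v f = s * (of_nat (npairs D r) - 2 * of_nat (\<Sum>x\<in>D. r x)) * v f"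
proof -
  let ?A = "{(x, y). x \<in> D \<and> y \<in> D \<and> x \<noteq> y}"
  let ?E = "{(x, y). x \<in> D \<and> y \<in> D \<and> x \<noteq> y \<and> r x = r y}"
  let ?L = "{(x, y). x \<in> D \<and> y \<in> D \<and> r y < r x}"
  let ?U = "{(x, y). x \<in> D \<and> y \<in> D \<and> r x < r y}"
  define g where "g = (\<lambda>(x, y). v (f \<circ> transpose x y))"
  have fDD: "finite (D \<times> D)" using fin by simp
  have f: "finite ?E" "finite ?L" "finite ?U" by (rule finite_subset[OF _ fDD], force)+
  have A: "?A = ?E \<union> (?L \<union> ?U)" by auto
  have "sum g ?A = sum g ?E + (sum g ?L + sum g ?U)"
    unfolding A by (subst sum.union_disjoint[OF f(1) finite_UnI[OF f(2,3)]], force,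
      subst sum.union_disjoint[OF f(2,3)], auto)
  moreover have "sum g ?U = sum g ?L"
    by (rule sum.reindex_bij_witness[where i = prod.swap and j = prod.swap])
       (auto simp: g_def transpose_commute)
  moreover have "sum g ?E = of_nat (npairs D r) * (s * v f)"
  proof -
    have "sum g ?E = (\<Sum>xy\<in>?E. s * v f)"
    proof (rule sum.cong[OF refl])
      fix xy assume "xy \<in> ?E"
      then obtain x y where "xy = (x, y)" "x \<in> D" "y \<in> D" "x \<noteq> y" "r x = r y" by blast
      then show "g xy = s * v f" using v unfolding csym_def g_def by (auto simp: pact_def fun_eq_iff)
    qed
    then show ?thesis by (simp add: npairs_def)
  qed
  moreover have "sum g ?L = - s * of_nat (\<Sum>x\<in>D. r x) * v f"
  proof -
    have mv: "(\<Sum>y\<in>{y\<in>D. r y = i}. g (x, y)) = - s * v f" if "x \<in> D" "i < r x" for x i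
    proof -
      have "v f + s * (\<Sum>y\<in>{y\<in>D. r y = i}. g (x, y)) = 0"
        using fun_cong[OF m[OF that], of f] by (simp add: move_def g_def pact_def)
      then have "s * (v f + s * (\<Sum>y\<in>{y\<in>D. r y = i}. g (x, y))) = 0" by simp
      then have "s * v f + (\<Sum>y\<in>{y\<in>D. r y = i}. g (x, y)) = 0"
        using s by (simp add: distrib_left flip: mult.assoc)
      then show ?thesis by (simp add: eq_neg_iff_add_eq_0 add.commute)
    qed
    have "?L = Sigma D (\<lambda>x. {y\<in>D. r y < r x})" by auto
    then have "sum g ?L = (\<Sum>x\<in>D. \<Sum>y\<in>{y\<in>D. r y < r x}. g (x, y))"
      using fin by (simp add: sum.Sigma)
    also have "\<dots> = (\<Sum>x\<in>D. - s * of_nat (r x) * v f)"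
    proof (rule sum.cong[OF refl])
      fix x assume x: "x \<in> D"
      have "(\<Sum>y\<in>{y\<in>D. r y < r x}. g (x, y)) = (\<Sum>i<r x. \<Sum>y\<in>{y\<in>{y\<in>D. r y < r x}. r y = i}. g (x, y))"
        using fin by (intro sum.group[symmetric]) auto
      also have "\<dots> = (\<Sum>i<r x. - s * v f)"
      proof (rule sum.cong[OF refl])
        fix i assume "i \<in> {..<r x}"
        then have "{y\<in>{y\<in>D. r y < r x}. r y = i} = {y\<in>D. r y = i}" by auto
        then show "(\<Sum>y\<in>{y\<in>{y\<in>D. r y < r x}. r y = i}. g (x, y)) = - s * v f"
          using mv[OF x] \<open>i \<in> {..<r x}\<close> by simp
      qed
      finally show "(\<Sum>y\<in>{y\<in>D. r y < r x}. g (x, y)) = - s * of_nat (r x) * v f" by simp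
    qed
    also have "\<dots> = - s * of_nat (\<Sum>x\<in>D. r x) * v f" by (simp add: sum_distrib_left sum_distrib_right sum_negf)
    finally show ?thesis .
  qed
  ultimately show ?thesis unfolding transp_sum_def g_def[symmetric] by (simp add: algebra_simps)
qed

text \<open>Centrality: conjugation by p permutes the transpositions.\<close>

lemma transp_sum_pact:
  assumes p: "p permutes D"
  shows "transp_sum D (pact p v) = pact p (transp_sum D v)"
proof
  fix f
  let ?A = "{(x, y). x \<in> D \<and> y \<in> D \<and> x \<noteq> y}"
  have "transp_sum D (pact p v) f = (\<Sum>(x, y)\<in>?A. v (f \<circ> p \<circ> transpose (pinv p x) (pinv p y)))"
    unfolding transp_sum_def pact_def
    by (simp add: comp_assoc comp_transpose_eq[OF permutes_bij[OF p]])
  also have "\<dots> = (\<Sum>(x, y)\<in>?A. v (f \<circ> p \<circ> transpose x y))"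
    by (rule sum.reindex_bij_witness[where i = "map_prod p p" and j = "map_prod (pinv p) (pinv p)"])
      (auto simp: permutes_inverses[OF p] permutes_in_image[OF p] permutes_in_image[OF permutes_inv[OF p]],
        metis permutes_inverses[OF p], metis permutes_inverses[OF p])
  finally show "transp_sum D (pact p v) f = pact p (transp_sum D v) f"
    by (simp add: transp_sum_def pact_def)
qed

definition perm_span :: "'k set \<Rightarrow> (('k \<Rightarrow> 'i) \<Rightarrow> complex) \<Rightarrow> (('k \<Rightarrow> 'i) \<Rightarrow> complex) set" where
  "perm_span D t = {(\<lambda>f. \<Sum>p | p permutes D. c p * pact p t f) | c. True}"

lemma perm_span_base: "finite D \<Longrightarrow> t \<in> perm_span D t"
  unfolding perm_span_def
proof (intro CollectI exI[of _ "\<lambda>p. if p = id then 1 else 0"] conjI TrueI ext)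
  fix f assume "finite D"
  then show "t f = (\<Sum>p | p permutes D. (if p = id then 1 else 0) * pact p t f)"
    by (subst sum.remove[of _ id]) (auto simp: finite_permutations intro!: sum.neutral)
qed

lemma perm_closed_perm_span: assumes "finite D" shows "perm_closed D (perm_span D t)"
  unfolding perm_closed_def
proof (intro conjI ballI allI)
  fix u v assume "u \<in> perm_span D t" "v \<in> perm_span D t"
  then obtain a b where "u = (\<lambda>f. \<Sum>p | p permutes D. a p * pact p t f)" "v = (\<lambda>f. \<Sum>p | p permutes D. b p * pact p t f)"
    by (auto simp: perm_span_def)
  then have "(\<lambda>f. u f + v f) = (\<lambda>f. \<Sum>p | p permutes D. (a p + b p) * pact p t f)"
    by (simp add: sum.distrib distrib_right)
  then show "(\<lambda>f. u f + v f) \<in> perm_span D t" by (auto simp: perm_span_def)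
next
  fix c u assume "u \<in> perm_span D t"
  then obtain a where "u = (\<lambda>f. \<Sum>p | p permutes D. a p * pact p t f)" by (auto simp: perm_span_def)
  then have "(\<lambda>f. c * u f) = (\<lambda>f. \<Sum>p | p permutes D. (c * a p) * pact p t f)"
    by (simp add: sum_distrib_left mult.assoc)
  then show "(\<lambda>f. c * u f) \<in> perm_span D t" unfolding perm_span_def by (intro CollectI exI[of _ "\<lambda>p. c * a p"]) simp
next
  fix x y u assume xy: "x \<in> D" "y \<in> D" and "u \<in> perm_span D t"
  then obtain a where a: "u = (\<lambda>f. \<Sum>p | p permutes D. a p * pact p t f)" by (auto simp: perm_span_def)
  have tr: "transpose x y permutes D" using xy by (rule permutes_swap_id)
  have "pact (transpose x y) u = (\<lambda>f. \<Sum>p | p permutes D. a p * pact (transpose x y \<circ> p) t f)"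
    by (simp add: a pact_def comp_assoc)
  also have "\<dots> = (\<lambda>f. \<Sum>p | p permutes D. a (transpose x y \<circ> p) * pact p t f)"
  proof
    fix f
    show "(\<Sum>p | p permutes D. a p * pact (transpose x y \<circ> p) t f) = (\<Sum>p | p permutes D. a (transpose x y \<circ> p) * pact p t f)"
      by (rule sum.reindex_bij_witness[where i = "\<lambda>p. transpose x y \<circ> p" and j = "\<lambda>p. transpose x y \<circ> p"])
        (auto simp: permutes_compose[OF _ tr] comp_assoc[symmetric])
  qed
  finally show "pact (transpose x y) u \<in> perm_span D t" unfolding perm_span_def by (intro CollectI exI[of _ "\<lambda>p. a (transpose x y \<circ> p)"]) simp
qed

text \<open>A central element that acts on a generator by a scalar acts by this scalar on the whole
  module generated by it.\<close>

lemma transp_sum_perm_span: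
  assumes "w \<in> perm_span D v" "\<And>f. transp_sum D v f = c * v f"
  shows "transp_sum D w f = c * w f"
proof -
  obtain a where a: "w = (\<lambda>f. \<Sum>p | p permutes D. a p * pact p v f)" using assms(1) by (auto simp: perm_span_def)
  have "transp_sum D w f = (\<Sum>p | p permutes D. a p * transp_sum D (pact p v) f)"
    unfolding a transp_sum_def case_prod_unfold by (subst sum.swap) (simp add: sum_distrib_left)
  also have "\<dots> = (\<Sum>p | p permutes D. a p * (c * pact p v f))"
  proof (rule sum.cong[OF refl])
    fix p assume "p \<in> {p. p permutes D}"
    then have "transp_sum D (pact p v) f = pact p (transp_sum D v) f" by (simp add: transp_sum_pact)
    then show "a p * transp_sum D (pact p v) f = a p * (c * pact p v f)" using assms(2) by (simp add: pact_def)
  qed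
  also have "\<dots> = c * w f" by (simp add: a sum_distrib_left mult.left_commute)
  finally show ?thesis .
qed

text \<open>A tableau on the slot set D is given by its row and column functions; its shape need not be named.\<close>

definition tableau :: "'k set \<Rightarrow> ('k \<Rightarrow> nat) \<Rightarrow> ('k \<Rightarrow> nat) \<Rightarrow> bool" where
  "tableau D r c \<longleftrightarrow> inj_on (\<lambda>x. (r x, c x)) D \<and>
     (\<forall>x\<in>D. (\<forall>i<r x. \<exists>y\<in>D. c y = c x \<and> r y = i) \<and> (\<forall>j<c x. \<exists>y\<in>D. r y = r x \<and> c y = j))"

lemma tableau_commute: "tableau D r c \<longleftrightarrow> tableau D c r"
  unfolding tableau_def inj_on_def by auto

section \<open>Tableaux characterized by counting pairs\<close>

lemma npairs_below:
  fixes r c :: "'k \<Rightarrow> nat"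
  assumes "finite D" and inj: "inj_on (\<lambda>x. (r x, c x)) D"
  shows "npairs D c = 2 * (\<Sum>x\<in>D. card {y\<in>D. c y = c x \<and> r y < r x})"
proof -
  let ?L = "{(x, y). x \<in> D \<and> y \<in> D \<and> c y = c x \<and> r y < r x}"
  let ?U = "{(x, y). x \<in> D \<and> y \<in> D \<and> c y = c x \<and> r x < r y}"
  have fDD: "finite (D \<times> D)" using assms by simp
  have f: "finite ?L" "finite ?U" by (rule finite_subset[OF _ fDD], force)+
  have "{(x, y). x \<in> D \<and> y \<in> D \<and> x \<noteq> y \<and> c x = c y} = ?L \<union> ?U"
    (is "?l = ?r")
  proof (rule Set.set_eqI)
    fix ab :: "'k \<times> 'k"
    obtain a b where [simp]: "ab = (a, b)" by (cases ab)
    have "r a < r b \<or> r b < r a" if "a \<in> D" "b \<in> D" "a \<noteq> b" "c a = c b"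
      using inj_onD[OF inj, of a b] that by (cases "r a" "r b" rule: linorder_cases) auto
    then show "ab \<in> ?l \<longleftrightarrow> ab \<in> ?r" by auto
  qed
  then have "npairs D c = card ?L + card ?U"
    unfolding npairs_def by (simp, subst card_Un_disjoint[OF f], auto)
  moreover have "card ?U = card ?L"
    by (rule bij_betw_same_card[where f = prod.swap], rule bij_betwI[where g = prod.swap]) auto
  moreover have "?L = Sigma D (\<lambda>x. {y\<in>D. c y = c x \<and> r y < r x})" by auto
  then have "card ?L = (\<Sum>x\<in>D. card {y\<in>D. c y = c x \<and> r y < r x})"
    using assms(1) by (simp add: card_SigmaI)
  ultimately show ?thesis by simp
qed

text \<open>The slots above x in its column have distinct row numbers less than r x. There are r x
  of them exactly when no row number is skipped, which is one half of being a tableau.\<close>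

lemma card_below_le:
  assumes "inj_on (\<lambda>x. (r x, c x)) D"
  shows "card {y\<in>D. c y = c x \<and> r y < r x} \<le> r x"
    and "finite D \<Longrightarrow> card {y\<in>D. c y = c x \<and> r y < r x} = r x \<longleftrightarrow> (\<forall>i<r x. \<exists>y\<in>D. c y = c x \<and> r y = i)"
proof -
  let ?L = "{y\<in>D. c y = c x \<and> r y < r x}"
  have inj: "inj_on r ?L" using assms by (auto simp: inj_on_def)
  have sub: "r ` ?L \<subseteq> {..<r x}" by auto
  have card: "card ?L = card (r ` ?L)" using card_image[OF inj] by simp
  also have "\<dots> \<le> r x" using card_mono[OF _ sub] by simp
  finally show "card ?L \<le> r x" .
  have "card ?L = r x \<longleftrightarrow> r ` ?L = {..<r x}"
  proof
    assume "card ?L = r x"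
    then show "r ` ?L = {..<r x}" using card by (intro card_subset_eq[OF finite_lessThan sub]) simp
  next
    assume "r ` ?L = {..<r x}"
    then have "card (r ` ?L) = r x" by simp
    then show "card ?L = r x" using card by simp
  qed
  also have "\<dots> \<longleftrightarrow> (\<forall>i<r x. \<exists>y\<in>D. c y = c x \<and> r y = i)"
  proof -
    have "r ` ?L = {..<r x} \<longleftrightarrow> {..<r x} \<subseteq> r ` ?L" using sub by blast
    also have "\<dots> \<longleftrightarrow> (\<forall>i<r x. i \<in> r ` ?L)" by (simp only: subset_iff lessThan_iff)
    also have "\<dots> \<longleftrightarrow> (\<forall>i<r x. \<exists>y\<in>D. c y = c x \<and> r y = i)"
    proof (rule all_cong)
      fix i assume "i < r x"
      show "i \<in> r ` ?L \<longleftrightarrow> (\<exists>y\<in>D. c y = c x \<and> r y = i)"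
      proof
        assume "\<exists>y\<in>D. c y = c x \<and> r y = i"
        then obtain y where "y \<in> D" "c y = c x" "r y = i" by blast
        then show "i \<in> r ` ?L" using \<open>i < r x\<close> by (intro image_eqI[of _ _ y]) auto
      qed blast
    qed
    finally show ?thesis .
  qed
  finally show "card ?L = r x \<longleftrightarrow> (\<forall>i<r x. \<exists>y\<in>D. c y = c x \<and> r y = i)" .
qed

lemma npairs_le:
  assumes "finite D" "inj_on (\<lambda>x. (r x, c x)) D"
  shows "npairs D c \<le> 2 * (\<Sum>x\<in>D. r x)"
  unfolding npairs_below[OF assms] using card_below_le(1)[OF assms(2)] by (simp add: sum_mono)

lemma inj_pair_commute: "inj_on (\<lambda>x. (r x, c x)) D \<longleftrightarrow> inj_on (\<lambda>x. (c x, r x)) D"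
  by (auto simp: inj_on_def)

lemma tableau_npairs:
  assumes "finite D" "tableau D r c"
  shows "npairs D c = 2 * (\<Sum>x\<in>D. r x)"
proof -
  have inj: "inj_on (\<lambda>x. (r x, c x)) D" using assms by (simp add: tableau_def)
  have "card {y\<in>D. c y = c x \<and> r y < r x} = r x" if "x \<in> D" for x
    unfolding card_below_le(2)[OF inj assms(1)] using assms(2) that by (auto simp: tableau_def)
  then show ?thesis unfolding npairs_below[OF assms(1) inj] by simp
qed

lemma tableau_column_complete:
  assumes "finite D" "inj_on (\<lambda>x. (r x, c x)) D" "2 * (\<Sum>x\<in>D. r x) \<le> npairs D c" "x \<in> D" "i < r x"
  shows "\<exists>y\<in>D. c y = c x \<and> r y = i"
proof -
  have "card {y\<in>D. c y = c x \<and> r y < r x} = r x"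
  proof (rule ccontr)
    assume "card {y\<in>D. c y = c x \<and> r y < r x} \<noteq> r x"
    then have "card {y\<in>D. c y = c x \<and> r y < r x} < r x" using card_below_le(1)[OF assms(2), of x] by simp
    then have "(\<Sum>x\<in>D. card {y\<in>D. c y = c x \<and> r y < r x}) < (\<Sum>x\<in>D. r x)"
      using card_below_le(1)[OF assms(2)] assms(1,4) by (intro sum_strict_mono_ex1) auto
    then show False using assms(3) npairs_below[OF assms(1,2)] by simp
  qed
  then show ?thesis using card_below_le(2)[OF assms(2,1), of x] assms(5) by blast
qed

text \<open>Each of the two numbers \<open>npairs\<close> is bounded by its sum, so an opposite
  inequality for the totals makes both bounds sharp, and sharpness says that neither columns nor
  rows have gaps. One numerical condition is all that a comparison of eigenvalues can
  deliver.\<close>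

lemma tableauI_npairs:
  assumes "finite D" "inj_on (\<lambda>x. (r x, c x)) D"
    "2 * (\<Sum>x\<in>D. r x) + 2 * (\<Sum>x\<in>D. c x) \<le> npairs D r + npairs D c"
  shows "tableau D r c"
proof -
  note inj' = assms(2)[unfolded inj_pair_commute[of r]]
  have "npairs D c \<le> 2 * (\<Sum>x\<in>D. r x)" "npairs D r \<le> 2 * (\<Sum>x\<in>D. c x)"
    using npairs_le[OF assms(1,2)] npairs_le[OF assms(1) inj'] by auto
  then have "2 * (\<Sum>x\<in>D. r x) \<le> npairs D c" "2 * (\<Sum>x\<in>D. c x) \<le> npairs D r" using assms(3) by linarith+
  then show ?thesis unfolding tableau_def
    using tableau_column_complete[OF assms(1,2)] tableau_column_complete[OF assms(1) inj'] assms(2) by blast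
qed

lemma down_closed_nat: "finite A \<Longrightarrow> (\<And>x y. x \<in> A \<Longrightarrow> y < x \<Longrightarrow> y \<in> A) \<Longrightarrow> A = {..<card (A :: nat set)}"
proof -
  assume A: "finite A" "\<And>x y. x \<in> A \<Longrightarrow> y < x \<Longrightarrow> y \<in> A"
  show ?thesis
  proof (cases "A = {}")
    case False
    have "A = {..Max A}"
    proof (intro equalityI subsetI)
      fix x assume "x \<in> {..Max A}"
      then show "x \<in> A" using A(2)[OF Max_in[OF A(1) False], of x] Max_in[OF A(1) False] by (cases "x = Max A") auto
    qed (use A in auto)
    then have "A = {..<Suc (Max A)}" by (simp add: lessThan_Suc_atMost)
    then show ?thesis by (metis card_lessThan)
  qed auto
qed

lemma tableau_row:
  assumes "finite D" "tableau D r c"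
  shows "(\<exists>x\<in>D. r x = i \<and> c x = j) \<longleftrightarrow> j < card {x\<in>D. r x = i}"
proof -
  let ?R = "{x\<in>D. r x = i}"
  have "inj_on c ?R" using assms(2) by (auto simp: tableau_def inj_on_def)
  then have card: "card (c ` ?R) = card ?R" by (rule card_image)
  have "c ` ?R = {..<card (c ` ?R)}"
  proof (rule down_closed_nat)
    fix a b assume "a \<in> c ` ?R" "b < a"
    then show "b \<in> c ` ?R" using assms(2) by (fastforce simp: tableau_def image_iff)
  qed (use assms in auto)
  then have "j \<in> c ` ?R \<longleftrightarrow> j < card ?R" using card by auto
  then show ?thesis by auto
qed

lemma tableau_col:
  assumes "finite D" "tableau D r c"
  shows "(\<exists>x\<in>D. r x = i \<and> c x = j) \<longleftrightarrow> i < card {x\<in>D. c x = j}"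
  using tableau_row[OF assms(1) assms(2)[unfolded tableau_commute[of D r]], of j i] by (metis (lifting))

text \<open>The row lengths determine the set of cells of a tableau; p sends a slot to the slot in
  the same cell of the other tableau.\<close>

lemma tableau_transfer:
  assumes "finite D" "tableau D r c" "tableau D r' c'"
    "\<And>i. card {x\<in>D. r x = i} = card {x\<in>D. r' x = i}"
  obtains p where "p permutes D" "\<And>x. x \<in> D \<Longrightarrow> r' (p x) = r x" "\<And>x. x \<in> D \<Longrightarrow> c' (p x) = c x"
proof -
  have ex: "(\<exists>x\<in>D. r x = i \<and> c x = j) \<longleftrightarrow> (\<exists>x\<in>D. r' x = i \<and> c' x = j)" for i j
    using tableau_row[OF assms(1,2)] tableau_row[OF assms(1,3)] assms(4) by simp
  have inj: "inj_on (\<lambda>x. (r x, c x)) D" "inj_on (\<lambda>x. (r' x, c' x)) D" using assms by (auto simp: tableau_def)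
  have "\<forall>x\<in>D. \<exists>y\<in>D. r' y = r x \<and> c' y = c x" using ex by metis
  then obtain q where q: "\<And>x. x \<in> D \<Longrightarrow> q x \<in> D \<and> r' (q x) = r x \<and> c' (q x) = c x" by metis
  define p where "p = (\<lambda>x. if x \<in> D then q x else x)"
  have "inj_on p D" using q inj(1) by (simp add: inj_on_def p_def) metis
  moreover have "p ` D \<subseteq> D" using q by (auto simp: p_def)
  ultimately have "bij_betw p D D" using assms(1) by (simp add: bij_betw_def endo_inj_surj)
  then have "p permutes D" by (rule bij_imp_permutes) (simp add: p_def)
  then show ?thesis using that[of p] q by (auto simp: p_def)
qed

section \<open>Relabelling of slots and products of Young symmetrizers\<close>

lemma npairs_comp:
  assumes "p permutes D" shows "npairs D (r \<circ> p) = npairs D r"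
  unfolding npairs_def
  by (rule bij_betw_same_card[where f = "map_prod p p"], rule bij_betwI[where g = "map_prod (pinv p) (pinv p)"])
     (auto simp: permutes_in_image[OF assms] permutes_in_image[OF permutes_inv[OF assms]] permutes_inverses[OF assms],
        metis permutes_inverses[OF assms], metis permutes_inverses[OF assms])

lemma sum_comp_permutes: "p permutes D \<Longrightarrow> (\<Sum>x\<in>D. (r \<circ> p) x) = (\<Sum>x\<in>D. r x)"
  using sum.permute[of p D r] by simp

lemma card_fibre_comp:
  assumes "p permutes D" shows "card {x\<in>D. (r \<circ> p) x = i} = card {x\<in>D. r x = i}"
  by (rule bij_betw_same_card[where f = p], rule bij_betwI[where g = "pinv p"])
     (auto simp: permutes_in_image[OF assms] permutes_in_image[OF permutes_inv[OF assms]] permutes_inverses[OF assms])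

lemma csym_pact:
  assumes "csym s D r v" "p permutes D"
  shows "csym s D (r \<circ> pinv p) (pact p v)"
  unfolding csym_def
proof (intro ballI impI)
  fix x y assume xy: "x \<in> D" "y \<in> D" "x \<noteq> y" "(r \<circ> pinv p) x = (r \<circ> pinv p) y"
  have D: "pinv p x \<in> D" "pinv p y \<in> D" using xy permutes_in_image[OF permutes_inv[OF assms(2)]] by auto
  have ne: "pinv p x \<noteq> pinv p y" using xy(3) by (metis permutes_inverses(1)[OF assms(2)])
  have "pact (transpose x y) (pact p v) = pact p (pact (transpose (pinv p x) (pinv p y)) v)"
    using comp_transpose_eq[OF permutes_bij[OF assms(2)], of x y] by simp
  also have "pact (transpose (pinv p x) (pinv p y)) v = (\<lambda>f. s * v f)" using assms(1) D ne xy by (auto simp: csym_def)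
  finally show "pact (transpose x y) (pact p v) = (\<lambda>f. s * pact p v f)" by (simp add: pact_scale)
qed

text \<open>The transposition of two slots in the same row and the same column would fix v and
  change the sign of its antisymmetrization, which would then vanish.\<close>

lemma asymz_csym_pos_inj:
  assumes "finite D" "csym 1 D r v" "asymz D c v \<noteq> (\<lambda>f. 0)"
  shows "inj_on (\<lambda>x. (r x, c x)) D"
proof (rule inj_onI, rule ccontr)
  fix x y assume xy: "x \<in> D" "y \<in> D" "(r x, c x) = (r y, c y)" "x \<noteq> y"
  then have "pact (transpose x y) v = v" using assms(2) by (auto simp: csym_def)
  moreover have "asymz D c (pact (transpose x y) v) = (\<lambda>f. - asymz D c v f)"
    using xy by (subst asymz_pact[OF assms(1) stab_transpose]) (auto simp: sign_swap_id)
  ultimately have eq: "asymz D c v = (\<lambda>f. - asymz D c v f)" by simp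
  have "asymz D c v f = 0" for f using fun_cong[OF eq, of f] by simp
  then show False using assms(3) by auto
qed

lemma symz_csym_neg_inj:
  assumes "finite D" "csym (-1) D c v" "symz D r v \<noteq> (\<lambda>f. 0)"
  shows "inj_on (\<lambda>x. (r x, c x)) D"
proof (rule inj_onI, rule ccontr)
  fix x y assume xy: "x \<in> D" "y \<in> D" "(r x, c x) = (r y, c y)" "x \<noteq> y"
  then have "pact (transpose x y) v = (\<lambda>f. -1 * v f)" using assms(2) unfolding csym_def by blast
  moreover have "symz D r (pact (transpose x y) v) = symz D r v"
    using xy by (intro symz_pact stab_transpose) auto
  ultimately have eq: "symz D r v = (\<lambda>f. - symz D r v f)" using symz_scale[of D r "-1" v] by simp
  have "symz D r v f = 0" for f using fun_cong[OF eq, of f] by simp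
  then show False using assms(3) by auto
qed

text \<open>Take v minimal symmetric in the module of t and w minimal antisymmetric in the module of
  v. The sum of all transpositions acts on w by the scalar that belongs to v and by the one that
  belongs to w; their equality is the numerical condition of \<open>tableauI_npairs\<close>.\<close>

theorem exists_nonvanishing_tableau:
  fixes t :: "('k \<Rightarrow> 'i) \<Rightarrow> complex"
  assumes "finite D" "t \<noteq> (\<lambda>f. 0)"
  obtains r c p where "tableau D r c" "p permutes D" "asymz D c (symz D r (pact p t)) \<noteq> (\<lambda>f. 0)"
proof -
  obtain r v where v: "v \<in> perm_span D t" "v \<noteq> (\<lambda>f. 0)" "csym 1 D r v"
    and vm: "\<And>x i. x \<in> D \<Longrightarrow> i < r x \<Longrightarrow> move 1 {y\<in>D. r y = i} x v = (\<lambda>f. 0)"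
    by (rule exists_minimal_colouring[OF perm_closed_perm_span[OF assms(1)] perm_span_base[OF assms(1)] assms(2,1), of 1], simp, rule that)
  obtain c w where w: "w \<in> perm_span D v" "w \<noteq> (\<lambda>f. 0)" "csym (-1) D c w"
    and wm: "\<And>x i. x \<in> D \<Longrightarrow> i < c x \<Longrightarrow> move (-1) {y\<in>D. c y = i} x w = (\<lambda>f. 0)"
    by (rule exists_minimal_colouring[OF perm_closed_perm_span[OF assms(1)] perm_span_base[OF assms(1)] v(2) assms(1), of "-1"], simp, rule that)
  have Zv: "transp_sum D v f = (of_nat (npairs D r) - 2 * of_nat (\<Sum>x\<in>D. r x)) * v f" for f
    using transp_sum_minimal[OF assms(1) v(3) _ vm] by simp
  have Zw: "transp_sum D w f = (of_nat (npairs D r) - 2 * of_nat (\<Sum>x\<in>D. r x)) * w f" for f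
    using transp_sum_perm_span[OF w(1) Zv] .
  have Zw': "transp_sum D w f = - (of_nat (npairs D c) - 2 * of_nat (\<Sum>x\<in>D. c x)) * w f" for f
    using transp_sum_minimal[OF assms(1) w(3) _ wm] by simp
  obtain f0 where "w f0 \<noteq> 0" using w(2) by auto
  with Zw[of f0] Zw'[of f0] have "(of_nat (npairs D r) - 2 * of_nat (\<Sum>x\<in>D. r x) :: complex) = - (of_nat (npairs D c) - 2 * of_nat (\<Sum>x\<in>D. c x))"
    by simp
  then have "(of_nat (npairs D r + npairs D c) :: complex) = of_nat (2 * (\<Sum>x\<in>D. r x) + 2 * (\<Sum>x\<in>D. c x))"
    by (simp add: algebra_simps)
  then have eq: "npairs D r + npairs D c = 2 * (\<Sum>x\<in>D. r x) + 2 * (\<Sum>x\<in>D. c x)"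
    unfolding of_nat_eq_iff .
  \<comment> \<open>w is a combination of translates of v, and antisymmetrization multiplies w by a
    nonzero number; some translate of v therefore survives it.\<close>
  have "\<exists>p. p permutes D \<and> asymz D c (pact p v) \<noteq> (\<lambda>f. 0)"
  proof (rule ccontr)
    assume "\<nexists>p. p permutes D \<and> asymz D c (pact p v) \<noteq> (\<lambda>f. 0)"
    then have z: "asymz D c (pact p v) = (\<lambda>f. 0)" if "p permutes D" for p using that by blast
    obtain a where a: "w = (\<lambda>f. \<Sum>p | p permutes D. a p * pact p v f)" using w(1) by (auto simp: perm_span_def)
    have "asymz D c w f0 = 0" unfolding a asymz_sum using z by (intro sum.neutral) auto
    then show False using asymz_csym[OF w(3) assms(1)] \<open>w f0 \<noteq> 0\<close> card_stab_pos[OF assms(1), of c] by simp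
  qed
  then obtain p where p: "p permutes D" "asymz D c (pact p v) \<noteq> (\<lambda>f. 0)" by blast
  define r' where "r' = r \<circ> pinv p"
  have cs: "csym 1 D r' (pact p v)" unfolding r'_def using v(3) p(1) by (rule csym_pact)
  have inj: "inj_on (\<lambda>x. (r' x, c x)) D" using asymz_csym_pos_inj[OF assms(1) cs p(2)] .
  have tab: "tableau D r' c"
    using eq npairs_comp[OF permutes_inv[OF p(1)], of r] sum_comp_permutes[OF permutes_inv[OF p(1)], of r]
    by (intro tableauI_npairs[OF assms(1) inj]) (simp add: r'_def comp_def)
  \<comment> \<open>The same argument one level down: symmetrization multiplies
    \<open>pact p v\<close> by a nonzero number, and \<open>pact p v\<close> is a combination of
    translates of t.\<close>
  have "\<exists>q. q permutes D \<and> asymz D c (symz D r' (pact q t)) \<noteq> (\<lambda>f. 0)"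
  proof (rule ccontr)
    assume "\<nexists>q. q permutes D \<and> asymz D c (symz D r' (pact q t)) \<noteq> (\<lambda>f. 0)"
    then have z: "asymz D c (symz D r' (pact q t)) = (\<lambda>f. 0)" if "q permutes D" for q using that by blast
    obtain a where a: "v = (\<lambda>f. \<Sum>p | p permutes D. a p * pact p t f)" using v(1) by (auto simp: perm_span_def)
    have "asymz D c (symz D r' (pact p v)) = (\<lambda>f. 0)"
      unfolding a pact_sum symz_sum asymz_sum using z p(1)
      by (intro ext sum.neutral) (auto simp: permutes_compose)
    moreover have "asymz D c (symz D r' (pact p v)) = (\<lambda>f. of_nat (card (stab D r')) * asymz D c (pact p v) f)"
      unfolding symz_csym[OF cs assms(1)] asymz_scale ..
    ultimately show False using p(2) card_stab_pos[OF assms(1), of r'] by (auto simp: fun_eq_iff)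
  qed
  then show ?thesis using that tab by blast
qed

text \<open>The first nonvanishing makes the pair of translated first rows and second columns
  injective; the second bounds \<open>npairs D c1\<close> by twice the sum of r2 and
  \<open>npairs D r2\<close> by twice the sum of c1. With the tableau identities these are the
  hypotheses of \<open>tableauI_npairs\<close>, so the rows of the first and the columns of the
  second shape form a common tableau, and the column lengths determine the row lengths.\<close>

lemma same_shape_of_nonzero:
  assumes fin: "finite D" and T1: "tableau D r1 c1" and T2: "tableau D r2 c2"
    and p: "p permutes D" and q: "q permutes D"
    and nz1: "asymz D c2 (pact p (symz D r1 t)) \<noteq> (\<lambda>f. 0)"
    and nz2: "symz D r2 (pact q (asymz D c1 u)) \<noteq> (\<lambda>f. 0)"
  shows "card {x\<in>D. r1 x = i} = card {x\<in>D. r2 x = i}"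
proof -
  define r1' where "r1' = r1 \<circ> pinv p"
  define c1' where "c1' = c1 \<circ> pinv q"
  note ip = permutes_inv[OF p] and iq = permutes_inv[OF q]
  have inj1: "inj_on (\<lambda>x. (r1' x, c2 x)) D"
    unfolding r1'_def by (rule asymz_csym_pos_inj[OF fin csym_pact[OF csym_symz p] nz1])
  have inj2: "inj_on (\<lambda>x. (r2 x, c1' x)) D"
    unfolding c1'_def by (rule symz_csym_neg_inj[OF fin csym_pact[OF csym_asymz[OF fin] q] nz2])
  have n: "npairs D r1' = npairs D r1" "npairs D c1' = npairs D c1"
    unfolding r1'_def c1'_def by (rule npairs_comp[OF ip], rule npairs_comp[OF iq])
  have s: "(\<Sum>x\<in>D. r1' x) = (\<Sum>x\<in>D. r1 x)" "(\<Sum>x\<in>D. c1' x) = (\<Sum>x\<in>D. c1 x)"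
    unfolding r1'_def c1'_def by (rule sum_comp_permutes[OF ip], rule sum_comp_permutes[OF iq])
  have T1': "tableau D c1 r1" and T2': "tableau D c2 r2" using T1 T2 tableau_commute by blast+
  have e: "npairs D c1 = 2 * (\<Sum>x\<in>D. r1 x)" "npairs D r1 = 2 * (\<Sum>x\<in>D. c1 x)"
     "npairs D c2 = 2 * (\<Sum>x\<in>D. r2 x)" "npairs D r2 = 2 * (\<Sum>x\<in>D. c2 x)"
    using tableau_npairs[OF fin] T1 T1' T2 T2' by blast+
  have "npairs D c1' \<le> 2 * (\<Sum>x\<in>D. r2 x)" "npairs D r2 \<le> 2 * (\<Sum>x\<in>D. c1' x)"
    using npairs_le[OF fin inj2] npairs_le[OF fin inj2[unfolded inj_pair_commute[of r2]]] by auto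
  then have T12: "tableau D r1' c2" using n s e by (intro tableauI_npairs[OF fin inj1]) linarith
  have "j < card {x\<in>D. r1' x = i} \<longleftrightarrow> i < card {x\<in>D. c2 x = j}" for j
    using tableau_row[OF fin T12, of i j] tableau_col[OF fin T12, of i j] by simp
  moreover have "j < card {x\<in>D. r2 x = i} \<longleftrightarrow> i < card {x\<in>D. c2 x = j}" for j
    using tableau_row[OF fin T2, of i j] tableau_col[OF fin T2, of i j] by simp
  moreover have "card {x\<in>D. r1' x = i} = card {x\<in>D. r1 x = i}"
    unfolding r1'_def by (rule card_fibre_comp[OF ip])
  ultimately have l: "j < card {x\<in>D. r1 x = i} \<longleftrightarrow> j < card {x\<in>D. r2 x = i}" for j by simp
  show ?thesis using l[of "card {x\<in>D. r1 x = i}"] l[of "card {x\<in>D. r2 x = i}"] by simp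
qed

text \<open>Von Neumann's dichotomy. If two slots share a row and a translated column, the result is
  zero. Otherwise rows and translated columns form a tableau with the same row lengths, so p is a
  row permutation times a column permutation; the first is absorbed by \<open>symz\<close> and the
  second gives a sign. The scalar does not depend on t.\<close>

lemma symz_pact_asymz:
  assumes fin: "finite D" and T: "tableau D r c" and p: "p permutes D"
  obtains e :: int where "\<And>t :: ('k \<Rightarrow> 'i) \<Rightarrow> complex. symz D r (pact p (asymz D c t)) = (\<lambda>f. of_int e * symz D r (asymz D c t) f)"
proof (cases "inj_on (\<lambda>x. (r x, (c \<circ> pinv p) x)) D")
  case False
  have "symz D r (pact p (asymz D c t)) = (\<lambda>f. 0)" for t :: "('k \<Rightarrow> 'i) \<Rightarrow> complex"
    using symz_csym_neg_inj[OF fin csym_pact[OF csym_asymz[OF fin] p], of r c t] False by blast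
  then show ?thesis using that[of 0] by simp
next
  case True
  note ip = permutes_inv[OF p]
  have T': "tableau D c r" using T tableau_commute by blast
  have T1: "tableau D r (c \<circ> pinv p)"
    using tableau_npairs[OF fin T] tableau_npairs[OF fin T'] npairs_comp[OF ip, of c] sum_comp_permutes[OF ip, of c]
    by (intro tableauI_npairs[OF fin True]) linarith
  obtain q where q: "q permutes D" "\<And>x. x \<in> D \<Longrightarrow> r (q x) = r x" "\<And>x. x \<in> D \<Longrightarrow> c (q x) = (c \<circ> pinv p) x"
    by (rule tableau_transfer[OF fin T1 T]) (rule refl, rule that)
  have qr: "q \<in> stab D r" using q by (simp add: stab_def)
  have "c (q (p x)) = c x" if "x \<in> D" for x
    using q(3)[of "p x"] that permutes_in_image[OF p] permutes_inverses[OF p] by simp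
  then have qc: "q \<circ> p \<in> stab D c" using permutes_compose[OF p q(1)] by (simp add: stab_def)
  have "symz D r (pact p (asymz D c t)) = (\<lambda>f. of_int (sign (q \<circ> p)) * symz D r (asymz D c t) f)" for t :: "('k \<Rightarrow> 'i) \<Rightarrow> complex"
  proof -
    have "symz D r (pact p (asymz D c t)) = symz D r (pact (pinv q \<circ> (q \<circ> p)) (asymz D c t))"
      by (simp add: comp_assoc[symmetric] permutes_inv_o[OF q(1)])
    also have "\<dots> = symz D r (pact (pinv q) (pact (q \<circ> p) (asymz D c t)))" by simp
    also have "\<dots> = symz D r (pact (q \<circ> p) (asymz D c t))" by (rule symz_pact[OF stab_inv[OF qr]])
    also have "\<dots> = (\<lambda>f. of_int (sign (q \<circ> p)) * symz D r (asymz D c t) f)"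
      unfolding pact_asymz[OF fin qc] symz_scale ..
    finally show ?thesis .
  qed
  then show ?thesis using that by blast
qed

definition yng :: "'k set \<Rightarrow> ('k \<Rightarrow> nat) \<Rightarrow> ('k \<Rightarrow> nat) \<Rightarrow> (('k \<Rightarrow> 'i) \<Rightarrow> complex) \<Rightarrow> ('k \<Rightarrow> 'i) \<Rightarrow> complex" where
  "yng D r c t = symz D r (asymz D c t)"

lemma yng_sum: "yng D r c (\<lambda>f. \<Sum>a\<in>A. k a * t a f) = (\<lambda>f. \<Sum>a\<in>A. k a * yng D r c (t a) f)"
  by (simp add: yng_def asymz_sum symz_sum)

text \<open>Expanding the inner factors shows that a nonzero composite has a nonzero term of each of
  the two kinds in \<open>same_shape_of_nonzero\<close>, and then the shapes agree.\<close>

lemma yng_pact_yng_other: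
  assumes fin: "finite D" and T1: "tableau D r1 c1" and T2: "tableau D r2 c2" and p: "p permutes D"
    and ne: "card {x\<in>D. r1 x = i} \<noteq> card {x\<in>D. r2 x = i}"
  shows "yng D r2 c2 (pact p (yng D r1 c1 t)) = (\<lambda>f. 0)"
proof (rule ccontr)
  assume nz: "yng D r2 c2 (pact p (yng D r1 c1 t)) \<noteq> (\<lambda>f. 0)"
  have nz1: "asymz D c2 (pact p (symz D r1 (asymz D c1 t))) \<noteq> (\<lambda>f. 0)"
    using nz by (auto simp: yng_def symz_def)
  have "yng D r2 c2 (pact p (yng D r1 c1 t)) =
      (\<lambda>f. \<Sum>p'\<in>stab D r2. \<Sum>q\<in>stab D c2. \<Sum>s\<in>stab D r1. of_int (sign q) * asymz D c1 t (f \<circ> p' \<circ> q \<circ> p \<circ> s))"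
    by (simp add: yng_def symz_def asymz_def[of D c2] pact_def sum_distrib_left)
  also have "\<dots> = (\<lambda>f. \<Sum>q\<in>stab D c2. \<Sum>s\<in>stab D r1. of_int (sign q) * symz D r2 (pact (q \<circ> p \<circ> s) (asymz D c1 t)) f)"
  proof
    fix f
    have "(\<Sum>p'\<in>stab D r2. \<Sum>q\<in>stab D c2. \<Sum>s\<in>stab D r1. of_int (sign q) * asymz D c1 t (f \<circ> p' \<circ> q \<circ> p \<circ> s))
      = (\<Sum>q\<in>stab D c2. \<Sum>p'\<in>stab D r2. \<Sum>s\<in>stab D r1. of_int (sign q) * asymz D c1 t (f \<circ> p' \<circ> q \<circ> p \<circ> s))"
      by (rule sum.swap)
    also have "\<dots> = (\<Sum>q\<in>stab D c2. \<Sum>s\<in>stab D r1. \<Sum>p'\<in>stab D r2. of_int (sign q) * asymz D c1 t (f \<circ> p' \<circ> q \<circ> p \<circ> s))"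
      by (rule sum.cong[OF refl], rule sum.swap)
    finally show "(\<Sum>p'\<in>stab D r2. \<Sum>q\<in>stab D c2. \<Sum>s\<in>stab D r1. of_int (sign q) * asymz D c1 t (f \<circ> p' \<circ> q \<circ> p \<circ> s)) =
      (\<Sum>q\<in>stab D c2. \<Sum>s\<in>stab D r1. of_int (sign q) * symz D r2 (pact (q \<circ> p \<circ> s) (asymz D c1 t)) f)"
      by (simp add: symz_def pact_def sum_distrib_left comp_assoc)
  qed
  finally have eq: "yng D r2 c2 (pact p (yng D r1 c1 t)) =
      (\<lambda>f. \<Sum>q\<in>stab D c2. \<Sum>s\<in>stab D r1. of_int (sign q) * symz D r2 (pact (q \<circ> p \<circ> s) (asymz D c1 t)) f)" .
  have "\<exists>q\<in>stab D c2. \<exists>s\<in>stab D r1. symz D r2 (pact (q \<circ> p \<circ> s) (asymz D c1 t)) \<noteq> (\<lambda>f. 0)"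
  proof (rule ccontr)
    assume "\<not> ?thesis"
    then have "symz D r2 (pact (q \<circ> p \<circ> s) (asymz D c1 t)) f = 0" if "q \<in> stab D c2" "s \<in> stab D r1" for q s f
      using that by (metis (full_types))
    then have "yng D r2 c2 (pact p (yng D r1 c1 t)) = (\<lambda>f. 0)" unfolding eq by simp
    then show False using nz by simp
  qed
  then obtain q s where qs: "q \<in> stab D c2" "s \<in> stab D r1" "symz D r2 (pact (q \<circ> p \<circ> s) (asymz D c1 t)) \<noteq> (\<lambda>f. 0)"
    by blast
  have "q \<circ> p \<circ> s permutes D" using qs p by (intro permutes_compose) (auto dest: stab_permutes)
  from same_shape_of_nonzero[OF fin T1 T2 p this nz1 qs(3), of i] show False using ne by blast
qed

lemma symz_combination_asymz:
  assumes fin: "finite D" and T: "tableau D r c" and A: "finite A" "\<And>a. a \<in> A \<Longrightarrow> g a permutes D"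
  obtains e :: int where "\<And>t :: ('k \<Rightarrow> 'i) \<Rightarrow> complex.
     symz D r (\<lambda>f. \<Sum>a\<in>A. of_int (k a) * pact (g a) (asymz D c t) f) = (\<lambda>f. of_int e * symz D r (asymz D c t) f)"
proof -
  have "\<exists>e::int. \<forall>t :: ('k \<Rightarrow> 'i) \<Rightarrow> complex. symz D r (pact (g a) (asymz D c t)) = (\<lambda>f. of_int e * symz D r (asymz D c t) f)"
    if a: "a \<in> A" for a
    using symz_pact_asymz[OF fin T A(2)[OF a]] by metis
  then obtain e where e: "\<And>a (t :: ('k \<Rightarrow> 'i) \<Rightarrow> complex). a \<in> A \<Longrightarrow>
      symz D r (pact (g a) (asymz D c t)) = (\<lambda>f. of_int (e a) * symz D r (asymz D c t) f)" by metis
  have "symz D r (\<lambda>f. \<Sum>a\<in>A. of_int (k a) * pact (g a) (asymz D c t) f) =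
      (\<lambda>f. of_int (\<Sum>a\<in>A. k a * e a) * symz D r (asymz D c t) f)" for t :: "('k \<Rightarrow> 'i) \<Rightarrow> complex"
    unfolding symz_sum
    by (rule ext, simp add: sum_distrib_right, rule sum.cong[OF refl]) (simp add: e mult.assoc)
  then show ?thesis using that by blast
qed

text \<open>In the group algebra, c p c is a multiple of the Young symmetrizer c. The multiple is
  recorded as an integer because the surjectivity argument divides by a sum of squares of such
  multiples, which has to be positive.\<close>

lemma yng_pact_yng:
  assumes fin: "finite D" and T: "tableau D r c" and p: "p permutes D"
  obtains e :: int where "\<And>t :: ('k \<Rightarrow> 'i) \<Rightarrow> complex. yng D r c (pact p (yng D r c t)) = (\<lambda>f. of_int e * yng D r c t f)"
proof -
  define A where "A = stab D c \<times> stab D r"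
  have eq: "asymz D c (pact p (symz D r u)) = (\<lambda>f. \<Sum>a\<in>A. of_int (sign (fst a)) * pact (fst a \<circ> p \<circ> snd a) u f)"
    for u :: "('k \<Rightarrow> 'i) \<Rightarrow> complex"
    unfolding A_def using sum.cartesian_product[of "\<lambda>q s. of_int (sign q) * pact (q \<circ> p \<circ> s) u _" "stab D r" "stab D c"]
    by (simp add: asymz_def symz_def pact_def sum_distrib_left comp_assoc case_prod_unfold)
  have "finite A" "\<And>a. a \<in> A \<Longrightarrow> fst a \<circ> p \<circ> snd a permutes D"
    using fin p by (auto simp: A_def finite_stab intro!: permutes_compose dest: stab_permutes)
  then obtain e where "\<And>t :: ('k \<Rightarrow> 'i) \<Rightarrow> complex.
     symz D r (\<lambda>f. \<Sum>a\<in>A. of_int (sign (fst a)) * pact (fst a \<circ> p \<circ> snd a) (asymz D c t) f) = (\<lambda>f. of_int e * symz D r (asymz D c t) f)"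
    by (rule symz_combination_asymz[OF fin T, where k = "\<lambda>a. sign (fst a)" and g = "\<lambda>a. fst a \<circ> p \<circ> snd a"]) (assumption, rule that)
  then have "yng D r c (pact p (yng D r c t)) = (\<lambda>f. of_int e * yng D r c t f)" for t :: "('k \<Rightarrow> 'i) \<Rightarrow> complex"
    unfolding yng_def eq by simp
  then show ?thesis using that by blast
qed

section \<open>The Hermitian form and positivity of symmetrizers\<close>

definition fip :: "'f set \<Rightarrow> ('f \<Rightarrow> complex) \<Rightarrow> ('f \<Rightarrow> complex) \<Rightarrow> complex" where
  "fip F s t = (\<Sum>f\<in>F. s f * cnj (t f))"

lemma fip_self: "fip F t t = of_real (\<Sum>f\<in>F. (cmod (t f))\<^sup>2)"
  by (simp add: fip_def complex_norm_square[symmetric])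

lemma fip_self_eq_0: "finite F \<Longrightarrow> fip F t t = 0 \<Longrightarrow> f \<in> F \<Longrightarrow> t f = 0"
  unfolding fip_self of_real_eq_0_iff by (subst (asm) sum_nonneg_eq_0_iff) auto

lemma fip_zero_right: "(\<And>f. f \<in> F \<Longrightarrow> t f = 0) \<Longrightarrow> fip F s t = 0"
  by (simp add: fip_def)

lemma fip_scale_left: "fip F (\<lambda>f. c * s f) t = c * fip F s t"
  by (simp add: fip_def sum_distrib_left mult.assoc)

lemma fip_scale_right: "fip F s (\<lambda>f. c * t f) = cnj c * fip F s t"
  by (simp add: fip_def sum_distrib_left mult.left_commute)

text \<open>Covers two cases: tensors, with F = \<open>Ix n S\<close>, and the group algebra, with F
  the set of permutations of D.\<close>

definition closed_ix :: "'k set \<Rightarrow> ('k \<Rightarrow> 'i) set \<Rightarrow> bool" where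
  "closed_ix D F \<longleftrightarrow> finite F \<and> (\<forall>p f. p permutes D \<longrightarrow> f \<in> F \<longrightarrow> f \<circ> p \<in> F)"

lemma bij_betw_closed_ix:
  assumes "closed_ix D F" "p permutes D" shows "bij_betw (\<lambda>f. f \<circ> p) F F"
  using assms permutes_inv[OF assms(2)]
  by (intro bij_betwI[where g = "\<lambda>f. f \<circ> pinv p"]) (auto simp: closed_ix_def comp_assoc permutes_inv_o[OF assms(2)])

lemma fip_pact_left:
  assumes "closed_ix D F" "p permutes D"
  shows "fip F (pact p s) t = fip F s (pact (pinv p) t)"
proof -
  have "fip F s (pact (pinv p) t) = (\<Sum>f\<in>F. s (f \<circ> p) * cnj (pact (pinv p) t (f \<circ> p)))"
    unfolding fip_def by (rule sum.reindex_bij_betw[OF bij_betw_closed_ix[OF assms], symmetric])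
  also have "\<dots> = fip F (pact p s) t"
    by (simp add: fip_def pact_def comp_assoc permutes_inv_o[OF assms(2)])
  finally show ?thesis by simp
qed

lemma symz_alt: "symz D r t = (\<lambda>f. \<Sum>p\<in>stab D r. 1 * pact p t f)"
  by (simp add: symz_def pact_def)

lemma asymz_alt: "asymz D r t = (\<lambda>f. \<Sum>p\<in>stab D r. of_int (sign p) * pact p t f)"
  by (simp add: asymz_def pact_def)

lemma fip_sum_left: "fip F (\<lambda>f. \<Sum>a\<in>A. c a * s a f) t = (\<Sum>a\<in>A. c a * fip F (s a) t)"
  by (simp add: fip_def sum_distrib_left sum_distrib_right mult.assoc) (rule sum.swap)

lemma fip_sum_right: "fip F s (\<lambda>f. \<Sum>a\<in>A. c a * t a f) = (\<Sum>a\<in>A. cnj (c a) * fip F s (t a))"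
  by (simp add: fip_def sum_distrib_left sum_distrib_right mult.left_commute) (rule sum.swap)

lemma fip_symz: assumes "closed_ix D F" shows "fip F (symz D r s) t = fip F s (symz D r t)"
proof -
  have "fip F (symz D r s) t = (\<Sum>p\<in>stab D r. fip F s (pact (pinv p) t))"
    unfolding symz_alt fip_sum_left by (rule sum.cong) (auto simp: fip_pact_left[OF assms stab_permutes])
  also have "\<dots> = (\<Sum>p\<in>stab D r. fip F s (pact p t))"
    by (rule sum.reindex_bij_betw[OF bij_betw_stab_inv])
  also have "\<dots> = fip F s (symz D r t)" unfolding symz_alt fip_sum_right by simp
  finally show ?thesis .
qed

lemma fip_asymz: assumes "closed_ix D F" "finite D" shows "fip F (asymz D r s) t = fip F s (asymz D r t)"
proof -
  have "fip F (asymz D r s) t = (\<Sum>p\<in>stab D r. of_int (sign (pinv p)) * fip F s (pact (pinv p) t))"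
    unfolding asymz_alt fip_sum_left
    by (rule sum.cong) (auto simp: fip_pact_left[OF assms(1) stab_permutes]
        sign_inverse[OF permutes_imp_permutation[OF assms(2) stab_permutes]])
  also have "\<dots> = (\<Sum>p\<in>stab D r. of_int (sign p) * fip F s (pact p t))"
    by (rule sum.reindex_bij_betw[OF bij_betw_stab_inv])
  also have "\<dots> = fip F s (asymz D r t)" unfolding asymz_alt fip_sum_right by simp
  finally show ?thesis .
qed

text \<open>As the symmetrizers are self-adjoint, the squared norm of
  \<open>asymz D c (symz D r t)\<close> is the pairing of t with the fourfold product of the
  hypothesis.\<close>

lemma asymz_symz_zero:
  assumes F: "closed_ix D F" and fin: "finite D"
    and z: "\<And>f. f \<in> F \<Longrightarrow> symz D r (asymz D c (asymz D c (symz D r t))) f = 0" and "f \<in> F"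
  shows "asymz D c (symz D r t) f = 0"
proof -
  have "fip F (asymz D c (symz D r t)) (asymz D c (symz D r t)) = fip F t (symz D r (asymz D c (asymz D c (symz D r t))))"
    by (simp add: fip_symz[OF F] fip_asymz[OF F fin])
  also have "\<dots> = 0" by (rule fip_zero_right) (rule z)
  finally show ?thesis using fip_self_eq_0[OF _ _ assms(4)] F unfolding closed_ix_def by blast
qed

text \<open>This happens in the regular representation, where tensors are functions of permutations.
  Applied to the delta function t at \<open>id\<close>, the symmetrizer c has value 1 at
  \<open>id\<close>, because row group and column group meet only in \<open>id\<close>. If c c t
  were zero, a first norm computation would kill the antisymmetrization of c t, and a second one
  then c t itself.\<close>

lemma yng_yng_nonzero:
  assumes fin: "finite D" and T: "tableau D r c"
  obtains t :: "('k \<Rightarrow> 'k) \<Rightarrow> complex" where "yng D r c (yng D r c t) \<noteq> (\<lambda>f. 0)"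
proof -
  define F where "F = {p. p permutes D}"
  have F: "closed_ix D F" unfolding closed_ix_def F_def using fin
    by (auto simp: finite_permutations permutes_compose)
  define t :: "('k \<Rightarrow> 'k) \<Rightarrow> complex" where "t = (\<lambda>f. if f = id then 1 else 0)"
  have inj: "inj_on (\<lambda>x. (r x, c x)) D" using T by (simp add: tableau_def)
  have pq: "p = id \<and> q = id" if "p \<in> stab D r" "q \<in> stab D c" "p \<circ> q = id" for p q
  proof -
    have "q x = x" for x
    proof (cases "x \<in> D")
      case True
      then have qx: "q x \<in> D" "c (q x) = c x" using that(2) by (auto simp: stab_def permutes_in_image)
      have "p (q x) = x" using that(3) by (metis comp_apply id_apply)
      then have "r (q x) = r x" using that(1) qx by (auto simp: stab_def)
      then show ?thesis using inj_onD[OF inj _ qx(1) True] qx by simp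
    next
      case False then show ?thesis using that(2) permutes_not_in by (auto simp: stab_def)
    qed
    then have "q = id" by auto
    then show ?thesis using that(3) by simp
  qed
  have "yng D r c t id = (\<Sum>p\<in>stab D r. \<Sum>q\<in>stab D c. of_int (sign q) * (if p \<circ> q = id then 1 else 0))"
    by (simp add: yng_def symz_def asymz_def t_def)
  also have "\<dots> = (\<Sum>p\<in>stab D r. \<Sum>q\<in>stab D c. if q = id then (if p = id then 1 else 0) else 0)"
    by (intro sum.cong refl) (auto dest: pq)
  also have "\<dots> = 1" using stab_id[of D r] stab_id[of D c] finite_stab[OF fin] by simp
  finally have nz: "yng D r c t id \<noteq> 0" by simp
  have "yng D r c (yng D r c t) \<noteq> (\<lambda>f. 0)"
  proof
    assume z: "yng D r c (yng D r c t) = (\<lambda>f. 0)"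
    have "fip F (asymz D c (yng D r c t)) (asymz D c (yng D r c t)) = of_nat (card (stab D c)) * fip F (yng D r c t) (asymz D c (yng D r c t))"
      unfolding fip_asymz[OF F fin] by (simp add: asymz_asymz[OF fin] fip_scale_right)
    also have "fip F (yng D r c t) (asymz D c (yng D r c t)) = fip F (asymz D c t) (yng D r c (yng D r c t))"
      by (simp add: yng_def fip_symz[OF F])
    also have "\<dots> = 0" unfolding z by (simp add: fip_def)
    finally have 1: "asymz D c (yng D r c t) f = 0" if "f \<in> F" for f
      using that fip_self_eq_0[of F "asymz D c (yng D r c t)" f] F by (auto simp: closed_ix_def)
    have "fip F (yng D r c t) (yng D r c t) = fip F (asymz D c t) (symz D r (yng D r c t))"
      by (simp add: yng_def fip_symz[OF F])
    also have "symz D r (yng D r c t) = (\<lambda>f. of_nat (card (stab D r)) * yng D r c t f)"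
      by (simp add: yng_def symz_symz[OF fin])
    also have "fip F (asymz D c t) \<dots> = of_nat (card (stab D r)) * fip F t (asymz D c (yng D r c t))"
      by (simp add: fip_scale_right fip_asymz[OF F fin])
    also have "fip F t (asymz D c (yng D r c t)) = 0" by (rule fip_zero_right) (rule 1)
    finally have "yng D r c t id = 0" using fip_self_eq_0[of F "yng D r c t" id] F by (auto simp: closed_ix_def F_def)
    then show False using nz by simp
  qed
  then show ?thesis using that by blast
qed

section \<open>Tensors, contractions and harmonic tensors\<close>

definition subsp :: "('a \<Rightarrow> complex) set \<Rightarrow> bool" where
  "subsp U \<longleftrightarrow> (\<lambda>x. 0) \<in> U \<and> (\<forall>u\<in>U. \<forall>v\<in>U. (\<lambda>x. u x + v x) \<in> U) \<and> (\<forall>c. \<forall>u\<in>U. (\<lambda>x. c * u x) \<in> U)"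

lemma subsp_add: "subsp U \<Longrightarrow> u \<in> U \<Longrightarrow> v \<in> U \<Longrightarrow> (\<lambda>x. u x + v x) \<in> U"
  by (simp add: subsp_def)

lemma subsp_scale: "subsp U \<Longrightarrow> u \<in> U \<Longrightarrow> (\<lambda>x. c * u x) \<in> U"
  by (simp add: subsp_def)

lemma subsp_zero: "subsp U \<Longrightarrow> (\<lambda>x. 0) \<in> U"
  by (simp add: subsp_def)

lemma subsp_diff: "subsp U \<Longrightarrow> u \<in> U \<Longrightarrow> v \<in> U \<Longrightarrow> (\<lambda>x. u x - v x) \<in> U"
  using subsp_add[of U u "\<lambda>x. -1 * v x"] subsp_scale[of U v "-1"] by simp

lemma subsp_sum:
  assumes "subsp U" "\<And>a. a \<in> A \<Longrightarrow> g a \<in> U"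
  shows "(\<lambda>x. \<Sum>a\<in>A. c a * g a x) \<in> U"
proof (cases "finite A")
  case True
  then show ?thesis using assms(2)
  proof (induction A rule: finite_induct)
    case (insert a A)
    then have "(\<lambda>x. c a * g a x + (\<Sum>a\<in>A. c a * g a x)) \<in> U"
      by (intro subsp_add[OF assms(1)] subsp_scale[OF assms(1)]) auto
    then show ?case using insert by simp
  qed (simp add: subsp_zero[OF assms(1)])
qed (simp add: subsp_zero[OF assms(1)])

lemma fip_diff_left: "fip F (\<lambda>f. s f - u f) t = fip F s t - fip F u t"
  by (simp add: fip_def left_diff_distrib sum_subtractf)

lemma fip_add_left: "fip F (\<lambda>f. s f + u f) t = fip F s t + fip F u t"
  by (simp add: fip_def distrib_right sum.distrib)

lemma fip_add_right: "fip F s (\<lambda>f. t f + u f) = fip F s t + fip F s u"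
  by (simp add: fip_def distrib_left sum.distrib)

lemma fip_commute: "fip F s t = cnj (fip F t s)"
  by (simp add: fip_def mult.commute)

text \<open>Gram-Schmidt by induction on the coordinates. Functions in U may have any values outside
  I, so U need not have finite dimension; only the values on I enter the form, and the projection is
  determined only there.\<close>

lemma orthogonal_decomposition:
  assumes "finite I" "subsp U"
  shows "\<exists>u\<in>U. \<forall>v\<in>U. fip I (\<lambda>i. x i - u i) v = 0"
  using assms
proof (induction I arbitrary: U x rule: finite_induct)
  case empty
  then show ?case by (intro bexI[of _ "\<lambda>x. 0"]) (auto simp: fip_def subsp_zero)
next
  case (insert k I)
  \<comment> \<open>U is U0 plus at most one further direction, spanned by the vector z below, which
    is made orthogonal to U0.\<close>
  define U0 where "U0 = {u\<in>U. u k = 0}"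
  have U0: "subsp U0" using insert.prems by (auto simp: subsp_def U0_def)
  have ext: "fip (insert k I) s v = fip I s v" if "v \<in> U0" for s v
    using insert.hyps that by (simp add: fip_def U0_def)
  show ?case
  proof (cases "U0 = U")
    case True
    then show ?thesis using insert.IH[OF U0, of x] ext by simp
  next
    case False
    then obtain w where w: "w \<in> U" "w k \<noteq> 0" by (auto simp: U0_def)
    obtain w0 where w0: "w0 \<in> U0" "\<And>v. v \<in> U0 \<Longrightarrow> fip I (\<lambda>i. w i - w0 i) v = 0"
      using insert.IH[OF U0] by blast
    define z where "z = (\<lambda>i. w i - w0 i)"
    have zU: "z \<in> U" unfolding z_def using w w0 by (intro subsp_diff[OF insert.prems]) (auto simp: U0_def)
    have zk: "z k \<noteq> 0" using w w0 by (simp add: z_def U0_def)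
    have zo: "fip (insert k I) z v = 0" if "v \<in> U0" for v using w0(2)[OF that] ext[OF that] by (simp add: z_def)
    have zz: "fip (insert k I) z z \<noteq> 0"
      using fip_self_eq_0[of "insert k I" z k] insert.hyps zk by auto
    obtain x0 where x0: "x0 \<in> U0" "\<And>v. v \<in> U0 \<Longrightarrow> fip I (\<lambda>i. x i - x0 i) v = 0"
      using insert.IH[OF U0] by blast
    define c where "c = fip (insert k I) x z / fip (insert k I) z z"
    define u where "u = (\<lambda>i. x0 i + c * z i)"
    have uU: "u \<in> U" unfolding u_def using x0 zU
      by (intro subsp_add[OF insert.prems] subsp_scale[OF insert.prems]) (auto simp: U0_def)
    have du: "fip (insert k I) (\<lambda>i. x i - u i) v = fip (insert k I) (\<lambda>i. x i - x0 i) v - c * fip (insert k I) z v" for v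
      unfolding u_def fip_diff_left fip_add_left fip_scale_left by simp
    have o0: "fip (insert k I) (\<lambda>i. x i - u i) v = 0" if "v \<in> U0" for v
      using zo[OF that] x0(2)[OF that] ext[OF that, of "\<lambda>i. x i - x0 i"] by (simp add: du)
    have oz: "fip (insert k I) (\<lambda>i. x i - u i) z = 0"
    proof -
      have "fip (insert k I) x0 z = 0" using zo[OF x0(1)] fip_commute[of "insert k I" x0 z] by simp
      then show ?thesis unfolding du unfolding fip_diff_left using zz by (simp add: c_def)
    qed
    have "fip (insert k I) (\<lambda>i. x i - u i) v = 0" if v: "v \<in> U" for v
    proof -
      define a where "a = v k / z k"
      have "(\<lambda>i. v i - a * z i) \<in> U" using v zU
        by (intro subsp_diff[OF insert.prems] subsp_scale[OF insert.prems])
      then have "(\<lambda>i. v i - a * z i) \<in> U0" using zk by (simp add: U0_def a_def)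
      from o0[OF this] have "fip (insert k I) (\<lambda>i. x i - u i) (\<lambda>i. (v i - a * z i) + a * z i) = 0"
        unfolding fip_add_right fip_scale_right oz by simp
      then show ?thesis by simp
    qed
    then show ?thesis using uU by blast
  qed
qed

text \<open>The difference of two projections of x lies in U and is orthogonal to itself.\<close>

lemma fip_eq_zero_of_diff:
  assumes "finite I" "subsp U" "u \<in> U" "w \<in> U"
    "\<And>v. v \<in> U \<Longrightarrow> fip I (\<lambda>i. x i - u i) v = 0" "\<And>v. v \<in> U \<Longrightarrow> fip I (\<lambda>i. x i - w i) v = 0" "i \<in> I"
  shows "u i = w i"
proof -
  let ?d = "\<lambda>i. u i - w i"
  have d: "?d \<in> U" using assms by (intro subsp_diff)
  have "fip I ?d ?d = fip I (\<lambda>i. x i - w i) ?d - fip I (\<lambda>i. x i - u i) ?d"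
    unfolding fip_diff_left by simp
  also have "\<dots> = 0" using assms d by simp
  finally show ?thesis using fip_self_eq_0[OF assms(1) _ assms(7), of ?d] by simp
qed

section \<open>Tensors as functions of index assignments\<close>

definition Ix :: "nat \<Rightarrow> 'k set \<Rightarrow> ('k \<Rightarrow> nat) set" where
  "Ix n S = PiE S (\<lambda>_. {..<n})"

lemma finite_Ix: "finite S \<Longrightarrow> finite (Ix n S)"
  by (simp add: Ix_def finite_PiE)

lemma Ix_empty: "Ix n {} = {\<lambda>_. undefined}"
  by (simp add: Ix_def)

lemma Ix_lt: "f \<in> Ix n S \<Longrightarrow> k \<in> S \<Longrightarrow> f k < n"
  by (auto simp: Ix_def)

lemma restrict_Ix: "(\<And>k. k \<in> S \<Longrightarrow> f k < n) \<Longrightarrow> restrict f S \<in> Ix n S"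
  by (auto simp: Ix_def)

lemma sum_Ix_insert:
  assumes "i \<notin> S"
  shows "(\<Sum>f\<in>Ix n (insert i S). F f) = (\<Sum>a<n. \<Sum>f\<in>Ix n S. F (f(i := a)))"
proof -
  have inj: "inj_on (\<lambda>(y, g). g(i := y)) ({..<n} \<times> PiE S (\<lambda>_. {..<n}))"
    using inj_combinator[OF assms, of "\<lambda>_. {..<n}"] .
  have "(\<Sum>f\<in>Ix n (insert i S). F f) = (\<Sum>(y, g)\<in>{..<n} \<times> PiE S (\<lambda>_. {..<n}). F (g(i := y)))"
    unfolding Ix_def PiE_insert_eq
    by (subst sum.reindex[OF inj]) (simp add: case_prod_unfold)
  then show ?thesis by (simp add: Ix_def sum.cartesian_product)
qed

lemma closed_ix_Ix: "finite S \<Longrightarrow> closed_ix S (Ix n S)"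
  unfolding closed_ix_def
  by (auto simp: finite_Ix) (auto simp: Ix_def PiE_def Pi_def extensional_def permutes_in_image permutes_not_in)

text \<open>The set S of slots is arbitrary; values outside S are ignored, so that contraction and insertion
  change S but not the type.\<close>

definition tens :: "nat \<Rightarrow> 'k set \<Rightarrow> (('k \<Rightarrow> nat) \<Rightarrow> complex) \<Rightarrow> bool" where
  "tens n S t \<longleftrightarrow> (\<forall>f g. (\<forall>k\<in>S. f k = g k) \<longrightarrow> t f = t g) \<and> (\<forall>f. (\<exists>k\<in>S. n \<le> f k) \<longrightarrow> t f = 0)"

lemma tens_cong: "tens n S t \<Longrightarrow> (\<And>k. k \<in> S \<Longrightarrow> f k = g k) \<Longrightarrow> t f = t g"
  by (simp add: tens_def)

lemma tens_zero: "tens n S t \<Longrightarrow> k \<in> S \<Longrightarrow> n \<le> f k \<Longrightarrow> t f = 0"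
  by (auto simp: tens_def)

lemma tens_eqI:
  assumes "tens n S s" "tens n S t" "\<And>f. f \<in> Ix n S \<Longrightarrow> s f = t f"
  shows "s = t"
proof
  fix f
  show "s f = t f"
  proof (cases "\<forall>k\<in>S. f k < n")
    case True
    then have "restrict f S \<in> Ix n S" by (intro restrict_Ix) auto
    moreover have "s f = s (restrict f S)" "t f = t (restrict f S)"
      using assms by (auto intro!: tens_cong[of n S])
    ultimately show ?thesis using assms(3) by simp
  next
    case False then show ?thesis using assms by (auto simp: not_less tens_zero)
  qed
qed

lemma tens_null: "tens n S (\<lambda>f. 0)"
  by (simp add: tens_def)

lemma tens_add: "tens n S s \<Longrightarrow> tens n S t \<Longrightarrow> tens n S (\<lambda>f. s f + t f)"
  unfolding tens_def by (metis add_0)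

lemma tens_scale: "tens n S t \<Longrightarrow> tens n S (\<lambda>f. c * t f)"
  unfolding tens_def by (metis mult_zero_right)

lemma tens_diff: "tens n S s \<Longrightarrow> tens n S t \<Longrightarrow> tens n S (\<lambda>f. s f - t f)"
  unfolding tens_def by (metis diff_zero)

lemma tens_sum: "(\<And>a. a \<in> A \<Longrightarrow> tens n S (t a)) \<Longrightarrow> tens n S (\<lambda>f. \<Sum>a\<in>A. t a f)"
  unfolding tens_def by (auto intro!: sum.cong sum.neutral)

lemma tens_cnj: "tens n S t \<Longrightarrow> tens n S (\<lambda>f. cnj (t f))"
  unfolding tens_def by (metis complex_cnj_zero)

lemma tens_pact:
  assumes "tens n S t" "p permutes S" shows "tens n S (pact p t)"
proof -
  have "t (f \<circ> p) = t (g \<circ> p)" if "\<And>k. k \<in> S \<Longrightarrow> f k = g k" for f g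
    using assms(2) that by (intro tens_cong[OF assms(1)]) (simp add: permutes_in_image)
  moreover have "t (f \<circ> p) = 0" if "k \<in> S" "n \<le> f k" for f k
    using assms(2) that
    by (intro tens_zero[OF assms(1), of "pinv p k"])
       (auto simp: permutes_in_image[OF permutes_inv[OF assms(2)]] permutes_inverses[OF assms(2)])
  ultimately show ?thesis unfolding tens_def pact_def by blast
qed

lemma tens_fip_zero: "finite S \<Longrightarrow> tens n S t \<Longrightarrow> fip (Ix n S) t t = 0 \<Longrightarrow> t = (\<lambda>f. 0)"
  using fip_self_eq_0[OF finite_Ix] by (intro tens_eqI[of n S]) (auto simp: tens_null)

lemma tens_pact_transpose: "tens n S t \<Longrightarrow> i \<in> S \<Longrightarrow> j \<in> S \<Longrightarrow> tens n S (pact (transpose i j) t)"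
  by (intro tens_pact permutes_swap_id)

lemma fip_pact_transpose:
  assumes "finite S" "i \<in> S" "j \<in> S"
  shows "fip (Ix n S) (pact (transpose i j) s) t = fip (Ix n S) s (pact (transpose i j) t)"
  using fip_pact_left[OF closed_ix_Ix[OF assms(1)] permutes_swap_id[OF assms(2,3)]] by simp

text \<open>Instances are the identity matrix with e = 1 and J with e = -1. Reality makes
  contraction and insertion adjoint to each other; orthonormality lets two copies of b that are
  joined by a summation cancel.\<close>

locale bform =
  fixes n :: nat and b :: "nat \<Rightarrow> nat \<Rightarrow> complex" and e :: complex
  assumes b_zero: "\<not> (x < n \<and> y < n) \<Longrightarrow> b x y = 0"
    and b_real: "cnj (b x y) = b x y"
    and b_sym: "b y x = e * b x y"
    and e_sq: "e * e = 1"
    and b_orth: "x < n \<Longrightarrow> y < n \<Longrightarrow> (\<Sum>c<n. b x c * b y c) = (if x = y then 1 else 0)"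
begin

lemma b_orth': "x < n \<Longrightarrow> y < n \<Longrightarrow> (\<Sum>c<n. b c x * b c y) = (if x = y then 1 else 0)"
proof -
  assume "x < n" "y < n"
  have "b c x * b c y = b x c * b y c" for c
    using b_sym[of c x] b_sym[of c y] e_sq by (simp add: mult.assoc mult.left_commute)
  then show ?thesis using b_orth \<open>x < n\<close> \<open>y < n\<close> by simp
qed

definition ctr :: "'k \<Rightarrow> 'k \<Rightarrow> (('k \<Rightarrow> nat) \<Rightarrow> complex) \<Rightarrow> ('k \<Rightarrow> nat) \<Rightarrow> complex" where
  "ctr i j t = (\<lambda>f. \<Sum>x<n. \<Sum>y<n. b x y * t (f(i := x, j := y)))"

definition ins :: "'k \<Rightarrow> 'k \<Rightarrow> (('k \<Rightarrow> nat) \<Rightarrow> complex) \<Rightarrow> ('k \<Rightarrow> nat) \<Rightarrow> complex" where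
  "ins i j t = (\<lambda>f. b (f i) (f j) * t f)"

definition harm :: "'k set \<Rightarrow> (('k \<Rightarrow> nat) \<Rightarrow> complex) \<Rightarrow> bool" where
  "harm S t \<longleftrightarrow> (\<forall>i\<in>S. \<forall>j\<in>S. i \<noteq> j \<longrightarrow> ctr i j t = (\<lambda>f. 0))"

lemma ctr_tens: "tens n (insert i (insert j S)) t \<Longrightarrow> i \<notin> S \<Longrightarrow> j \<notin> S \<Longrightarrow> tens n S (ctr i j t)"
  unfolding ctr_def
proof (intro tens_sum tens_scale)
  fix x y assume t: "tens n (insert i (insert j S)) t" and ij: "i \<notin> S" "j \<notin> S"
  have "t (f(i := x, j := y)) = t (g(i := x, j := y))" if "\<forall>k\<in>S. f k = g k" for f g
    using that ij by (intro tens_cong[OF t]) auto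
  moreover have "t (f(i := x, j := y)) = 0" if "k \<in> S" "n \<le> f k" for f k
    using that ij by (intro tens_zero[OF t, of k]) auto
  ultimately show "tens n S (\<lambda>f. t (f(i := x, j := y)))" unfolding tens_def by blast
qed

lemma ins_tens: "tens n S t \<Longrightarrow> tens n (insert i (insert j S)) (ins i j t)"
  unfolding ins_def tens_def by (auto simp: b_zero) 

lemma ctr_commute: "i \<noteq> j \<Longrightarrow> ctr j i t f = e * ctr i j t f"
proof -
  assume ij: "i \<noteq> j"
  have "ctr j i t f = (\<Sum>y<n. \<Sum>x<n. b x y * t (f(j := x, i := y)))"
    unfolding ctr_def by (rule sum.swap)
  also have "\<dots> = (\<Sum>x<n. \<Sum>y<n. e * (b x y * t (f(i := x, j := y))))"
  proof (intro sum.cong refl)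
    fix x y
    have "f(j := y, i := x) = f(i := x, j := y)" using ij by (rule fun_upd_twist[symmetric])
    then show "b y x * t (f(j := y, i := x)) = e * (b x y * t (f(i := x, j := y)))"
      by (simp add: b_sym[of y x])
  qed
  finally show ?thesis by (simp add: ctr_def sum_distrib_left)
qed

text \<open>The two operations are adjoint because b is real. Later arguments that turn a
  contraction into a pairing or a norm go through this identity.\<close>

lemma fip_ctr:
  assumes t: "tens n (insert i (insert j S)) t" and s: "tens n S s" and ij: "i \<noteq> j" "i \<notin> S" "j \<notin> S" and "finite S"
  shows "fip (Ix n S) (ctr i j t) s = fip (Ix n (insert i (insert j S))) t (ins i j s)"
proof -
  have "fip (Ix n (insert i (insert j S))) t (ins i j s) =
      (\<Sum>x<n. \<Sum>y<n. \<Sum>f\<in>Ix n S. t (f(j := y, i := x)) * cnj (ins i j s (f(j := y, i := x))))"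
    unfolding fip_def using ij by (simp add: sum_Ix_insert)
  also have "\<dots> = (\<Sum>x<n. \<Sum>y<n. \<Sum>f\<in>Ix n S. b x y * t (f(i := x, j := y)) * cnj (s f))"
  proof (intro sum.cong refl)
    fix x y f
    have "s (f(i := x, j := y)) = s f" using ij by (intro tens_cong[OF s]) auto
    moreover have "f(j := y, i := x) = f(i := x, j := y)" using ij by (intro fun_upd_twist[symmetric])
    ultimately show "t (f(j := y, i := x)) * cnj (ins i j s (f(j := y, i := x))) = b x y * t (f(i := x, j := y)) * cnj (s f)"
      using ij by (simp add: ins_def b_real)
  qed
  also have "\<dots> = (\<Sum>f\<in>Ix n S. \<Sum>x<n. \<Sum>y<n. b x y * t (f(i := x, j := y)) * cnj (s f))"
    by (simp add: sum.swap[of _ "Ix n S"])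
  also have "\<dots> = fip (Ix n S) (ctr i j t) s"
    by (simp add: fip_def ctr_def sum_distrib_right)
  finally show ?thesis by simp
qed

lemma ctr_lin:
  "ctr i j (\<lambda>f. s f + t f) f = ctr i j s f + ctr i j t f"
  "ctr i j (\<lambda>f. s f - t f) f = ctr i j s f - ctr i j t f"
  "ctr i j (\<lambda>f. c * t f) f = c * ctr i j t f"
  "ctr i j (\<lambda>f. \<Sum>a\<in>A. g a f) f = (\<Sum>a\<in>A. ctr i j (g a) f)"
proof -
  show "ctr i j (\<lambda>f. s f + t f) f = ctr i j s f + ctr i j t f"
    by (simp add: ctr_def distrib_left sum.distrib)
  show "ctr i j (\<lambda>f. s f - t f) f = ctr i j s f - ctr i j t f"
    by (simp add: ctr_def right_diff_distrib sum_subtractf)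
  show "ctr i j (\<lambda>f. c * t f) f = c * ctr i j t f"
    by (simp add: ctr_def sum_distrib_left mult.left_commute)
  show "ctr i j (\<lambda>f. \<Sum>a\<in>A. g a f) f = (\<Sum>a\<in>A. ctr i j (g a) f)"
    unfolding ctr_def sum_distrib_left by (simp add: sum.swap[of _ A])
qed

lemma ctr_pact:
  assumes "bij p" shows "ctr i j (pact p t) = pact p (ctr (pinv p i) (pinv p j) t)"
proof -
  have eq: "f(i := x, j := y) \<circ> p = (f \<circ> p)(pinv p i := x, pinv p j := y)" for f x y
  proof
    fix k
    have "p k = l \<longleftrightarrow> k = pinv p l" for l using assms by (metis bij_inv_eq_iff)
    then show "(f(i := x, j := y) \<circ> p) k = ((f \<circ> p)(pinv p i := x, pinv p j := y)) k" by auto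
  qed
  show ?thesis unfolding ctr_def pact_def eq ..
qed

lemma harm_pact:
  assumes "harm S t" "p permutes S" shows "harm S (pact p t)"
  unfolding harm_def
proof (intro ballI impI)
  fix i j assume ij: "i \<in> S" "j \<in> S" "i \<noteq> j"
  have "pinv p i \<in> S" "pinv p j \<in> S" using ij permutes_in_image[OF permutes_inv[OF assms(2)]] by auto
  moreover have "pinv p i \<noteq> pinv p j" using ij by (metis permutes_inverses(1)[OF assms(2)])
  ultimately have "ctr (pinv p i) (pinv p j) t = (\<lambda>f. 0)" using assms(1) by (auto simp: harm_def)
  then show "ctr i j (pact p t) = (\<lambda>f. 0)" unfolding ctr_pact[OF permutes_bij[OF assms(2)]] by (simp add: pact_def)
qed

lemma harm_add: "harm S s \<Longrightarrow> harm S t \<Longrightarrow> harm S (\<lambda>f. s f + t f)"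
  by (simp add: harm_def ctr_lin fun_eq_iff)

lemma harm_scale: "harm S t \<Longrightarrow> harm S (\<lambda>f. c * t f)"
  by (simp add: harm_def ctr_lin fun_eq_iff)

lemma harm_sum: "(\<And>a. a \<in> A \<Longrightarrow> harm S (g a)) \<Longrightarrow> harm S (\<lambda>f. \<Sum>a\<in>A. g a f)"
  by (simp add: harm_def ctr_lin fun_eq_iff)

lemma harm_cnj: assumes "harm S t" shows "harm S (\<lambda>f. cnj (t f))"
proof -
  have "ctr i j (\<lambda>f. cnj (t f)) f = cnj (ctr i j t f)" for i j f by (simp add: ctr_def b_real)
  then show ?thesis using assms unfolding harm_def by (metis complex_cnj_zero)
qed

lemma harm_asymz: "harm S t \<Longrightarrow> harm S (asymz S c t)"
  unfolding asymz_alt by (intro harm_sum harm_scale harm_pact) (auto dest: stab_permutes)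

lemma harm_symz: "harm S t \<Longrightarrow> harm S (symz S c t)"
  unfolding symz_alt by (intro harm_sum harm_scale harm_pact) (auto dest: stab_permutes)

end

lemma sum_swap3: "(\<Sum>l\<in>B. \<Sum>p\<in>P. \<Sum>q\<in>Q. F l p q) = (\<Sum>p\<in>P. \<Sum>q\<in>Q. \<Sum>l\<in>B. F l p q)"
  by (subst sum.swap, rule sum.cong[OF refl], rule sum.swap)

lemma sum_swap4:
  "(\<Sum>k\<in>A. \<Sum>l\<in>B k. \<Sum>p\<in>P. \<Sum>q\<in>Q. F k l p q) = (\<Sum>p\<in>P. \<Sum>q\<in>Q. \<Sum>k\<in>A. \<Sum>l\<in>B k. F k l p q)"
  by (rule trans[OF sum.cong[OF refl sum_swap3] sum_swap3])

section \<open>Vanishing of antisymmetric harmonic tensors\<close>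

abbreviation antis :: "'k set \<Rightarrow> (('k \<Rightarrow> 'i) \<Rightarrow> complex) \<Rightarrow> bool" where
  "antis C t \<equiv> csym (-1) C (\<lambda>_. 0) t"

lemma antis_move:
  assumes "antis C t" "i \<notin> C" "finite C"
  shows "antis (insert i C) (move (-1) C i t)"
proof -
  \<comment> \<open>Two colours, 0 on C and 1 at i: joining i to C is the move of i to colour
    0.\<close>
  define r :: "'a \<Rightarrow> nat" where "r = (\<lambda>x. if x = i then 1 else 0)"
  have C: "{y\<in>insert i C. r y = 0} = C" using assms(2) by (auto simp: r_def)
  have "csym (-1) (insert i C) r t" using assms(1) by (auto simp: csym_def r_def)
  then have "csym (-1) (insert i C) (r(i := 0)) (move (-1) {y\<in>insert i C. r y = 0} i t)"
    using assms by (intro csym_move) (auto simp: r_def)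
  moreover have "r(i := 0) = (\<lambda>_. 0)" by (auto simp: r_def)
  ultimately show ?thesis unfolding C by simp
qed

text \<open>On a tensor that is already antisymmetric every term equals z. Together with the
  self-adjointness in \<open>fip_move\<close> this makes the squared norm of an antisymmetrized
  tensor a positive multiple of its pairing with the original tensor.\<close>

lemma move_antis:
  assumes "antis (insert i C) z" "i \<notin> C"
  shows "move (-1) C i z = (\<lambda>f. of_nat (Suc (card C)) * z f)"
proof
  fix f
  have "pact (transpose i k) z f = - z f" if "k \<in> C" for k
    using assms that unfolding csym_def by (metis insertCI mult_minus1)
  then show "move (-1) C i z f = of_nat (Suc (card C)) * z f"
    by (simp add: move_def algebra_simps)
qed

lemma antis_move_disjoint:
  assumes "antis E t" "E \<inter> insert i C = {}"
  shows "antis E (move (-1) C i t)"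
  unfolding csym_def
proof (intro ballI impI ext)
  fix x y f assume xy: "x \<in> E" "y \<in> E" "x \<noteq> y"
  then have a: "pact (transpose x y) t g = - t g" for g using assms(1) unfolding csym_def by (metis mult_minus1)
  have "pact (transpose i k) t (f \<circ> transpose x y) = - pact (transpose i k) t f" if "k \<in> C" for k
  proof -
    have "transpose x y \<circ> transpose i k = transpose i k \<circ> transpose x y"
      using xy that assms(2) by (intro ext) (auto simp: transpose_def)
    then have "pact (transpose i k) t (f \<circ> transpose x y) = pact (transpose x y) t (f \<circ> transpose i k)"
      by (simp add: pact_def comp_assoc)
    then show ?thesis by (simp add: a) (simp add: pact_def)
  qed
  then show "pact (transpose x y) (move (-1) C i t) f = -1 * move (-1) C i t f"
    using a[of f] by (simp add: pact_def[of "transpose x y"] move_def sum_negf)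
qed

lemma fip_move:
  assumes "finite S" "i \<in> S" "C \<subseteq> S"
  shows "fip (Ix n S) (move (-1) C i s) t = fip (Ix n S) s (move (-1) C i t)"
proof -
  have 1: "move (-1) C i u = (\<lambda>f. u f + -1 * (\<Sum>k\<in>C. 1 * pact (transpose i k) u f))" for u :: "('a \<Rightarrow> nat) \<Rightarrow> complex"
    by (simp add: move_def)
  have "(\<Sum>k\<in>C. fip (Ix n S) (pact (transpose i k) s) t) = (\<Sum>k\<in>C. fip (Ix n S) s (pact (transpose i k) t))"
    using assms by (intro sum.cong refl fip_pact_transpose) auto
  then show ?thesis
    unfolding 1 fip_add_left fip_add_right fip_scale_left fip_scale_right fip_sum_left fip_sum_right by simp
qed

lemma tens_move: "tens n S t \<Longrightarrow> i \<in> S \<Longrightarrow> C \<subseteq> S \<Longrightarrow> tens n S (move s C i t)"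
  unfolding move_def by (intro tens_add tens_scale tens_sum tens_pact_transpose) auto

lemma antis_zero:
  assumes "antis C t" "k \<in> C" "l \<in> C" "k \<noteq> l" "f k = f l" shows "t f = 0"
proof -
  have "f \<circ> transpose k l = f" using assms(5) by (auto simp: transpose_def fun_eq_iff)
  then have "pact (transpose k l) t f = t f" by (simp add: pact_def)
  moreover have "pact (transpose k l) t f = - t f" using assms(1-4) unfolding csym_def by (metis mult_minus1)
  ultimately show ?thesis by simp
qed

lemma antis_card_le:
  assumes "tens n S t" "antis C t" "C \<subseteq> S" "finite C" "t \<noteq> (\<lambda>f. 0)"
  shows "card C \<le> n"
proof (rule ccontr)
  assume c: "\<not> card C \<le> n"
  have "t f = 0" if f: "f \<in> Ix n S" for f
  proof -
    have "f ` C \<subseteq> {..<n}" using f assms(3) by (auto simp: Ix_def)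
    then have "card (f ` C) < card C" using c card_mono[of "{..<n}" "f ` C"] by simp
    then have "\<not> inj_on f C" by (rule pigeonhole)
    then obtain k l where "k \<in> C" "l \<in> C" "k \<noteq> l" "f k = f l" by (auto simp: inj_on_def)
    then show ?thesis using antis_zero assms(2) by metis
  qed
  then have "t = (\<lambda>f. 0)" by (intro tens_eqI[OF assms(1) tens_null])
  then show False using assms(5) by simp
qed

context bform
begin

lemma sum_delta_fun_upd: "y < n \<Longrightarrow> (\<Sum>x<n. (if x = y then 1 else 0) * (F x :: complex)) = F y"
  by (simp add: if_distrib[of "\<lambda>z. z * _"] cong: if_cong)

text \<open>A copy of b that shares one summed index with another copy renames an index. In
  \<open>b_contract0\<close> both indices are shared, a closed loop, and its value is n.\<close>

lemma b_contract1:
  assumes "y < n" shows "(\<Sum>x<n. \<Sum>z<n. b x z * (b y z * F x)) = F y"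
proof -
  have "(\<Sum>x<n. \<Sum>z<n. b x z * (b y z * F x)) = (\<Sum>x<n. (\<Sum>z<n. b x z * b y z) * F x)"
    by (simp add: sum_distrib_right mult.assoc)
  also have "\<dots> = (\<Sum>x<n. (if x = y then 1 else 0) * F x)"
    using assms by (intro sum.cong refl) (simp add: b_orth)
  finally show ?thesis using sum_delta_fun_upd[OF assms] by simp
qed

lemma b_contract2:
  assumes "y < n" shows "(\<Sum>x<n. \<Sum>z<n. b x z * (b x y * F z)) = F y"
proof -
  have "(\<Sum>x<n. \<Sum>z<n. b x z * (b x y * F z)) = (\<Sum>z<n. \<Sum>x<n. b x z * (b x y * F z))" by (rule sum.swap)
  also have "\<dots> = (\<Sum>z<n. (\<Sum>x<n. b x z * b x y) * F z)"
    by (simp add: sum_distrib_right mult.assoc)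
  also have "\<dots> = (\<Sum>z<n. (if z = y then 1 else 0) * F z)"
    using assms by (intro sum.cong refl) (simp add: b_orth')
  finally show ?thesis using sum_delta_fun_upd[OF assms] by simp
qed

lemma b_contract0: "(\<Sum>x<n. \<Sum>z<n. b x z * (b x z * F)) = of_nat n * F"
proof -
  have "(\<Sum>x<n. \<Sum>z<n. b x z * (b x z * F)) = (\<Sum>x<n. (\<Sum>z<n. b x z * b x z) * F)"
    by (simp add: sum_distrib_right mult.assoc)
  also have "\<dots> = (\<Sum>x<n. F)" by (intro sum.cong refl) (simp add: b_orth)
  finally show ?thesis by simp
qed

text \<open>In the applications z is an antisymmetrization of the insertion of t. Its squared norm
  is d times its pairing with that insertion, hence by adjunction d c times the squared norm of t,
  while d c < 0.\<close>

lemma norm_argument: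
  assumes S: "finite S" "i \<notin> S" "j \<notin> S" "i \<noteq> j" and t: "tens n S t" and z: "tens n (insert i (insert j S)) z"
    and c: "ctr i j z = (\<lambda>f. of_real c * t f)" and "c < 0" and "d > 0"
    and zz: "fip (Ix n (insert i (insert j S))) z z = of_real d * fip (Ix n (insert i (insert j S))) (ins i j t) z"
  shows "t = (\<lambda>f. 0)"
proof -
  let ?S = "insert i (insert j S)"
  have "fip (Ix n ?S) (ins i j t) z = cnj (fip (Ix n S) (ctr i j z) t)"
    using fip_ctr[OF z t S(4,2,3,1)] fip_commute by metis
  also have "\<dots> = of_real c * fip (Ix n S) t t"
    unfolding c fip_scale_left fip_self by simp
  finally have "of_real (\<Sum>f\<in>Ix n ?S. (cmod (z f))\<^sup>2) = (of_real (d * c * (\<Sum>f\<in>Ix n S. (cmod (t f))\<^sup>2)) :: complex)"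
    using zz unfolding fip_self by simp
  then have "(\<Sum>f\<in>Ix n ?S. (cmod (z f))\<^sup>2) = d * c * (\<Sum>f\<in>Ix n S. (cmod (t f))\<^sup>2)"
    unfolding of_real_eq_iff .
  moreover have "(\<Sum>f\<in>Ix n ?S. (cmod (z f))\<^sup>2) \<ge> 0" by (intro sum_nonneg) auto
  moreover have "d * c < 0" using assms by (simp add: mult_pos_neg)
  ultimately have "(\<Sum>f\<in>Ix n S. (cmod (t f))\<^sup>2) \<le> 0"
    by (metis mult_neg_pos not_le)
  moreover have "(\<Sum>f\<in>Ix n S. (cmod (t f))\<^sup>2) \<ge> 0" by (intro sum_nonneg) auto
  ultimately have "fip (Ix n S) t t = 0" unfolding fip_self by simp
  then show ?thesis using tens_fip_zero[OF S(1) t] by simp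
qed

lemma ins_tens_eval:
  assumes "tens n S t" "\<And>k. k \<in> S \<Longrightarrow> g k = f k"
  shows "ins i j t g = b (g i) (g j) * t f"
  unfolding ins_def using tens_cong[OF assms(1), of g f] assms(2) by simp

text \<open>The contraction of the antisymmetrised insertion is a multiple of t, whereas its pairing with t is a
  squared norm.\<close>

lemma harm_antis_two_columns:
  fixes S :: "nat set"
  assumes S: "finite S" and t: "tens n S t" and h: "harm S t"
    and C: "C \<subseteq> S" "E \<subseteq> S" "C \<inter> E = {}" and a: "antis C t" "antis E t" and gt: "card C + card E > n"
  shows "t = (\<lambda>f. 0)"
proof -
  \<comment> \<open>Two slots outside S receive the inserted form; slots are natural numbers here,
    so fresh ones exist.\<close>
  obtain i where i: "i \<notin> S" using S ex_new_if_finite infinite_UNIV_nat by blast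
  obtain j where j: "j \<notin> insert i S" using S ex_new_if_finite[of "insert i S"] infinite_UNIV_nat by blast
  note ij = i j
  let ?S = "insert i (insert j S)"
  have fC: "finite C" "finite E" using C S finite_subset by blast+
  define x where "x = ins i j t"
  \<comment> \<open>j joins the antisymmetric set E, then i joins C. The sets are disjoint, so the
    second step keeps the first antisymmetry.\<close>
  define z where "z = move (-1) C i (move (-1) E j x)"
  have tr: "pact (transpose k l) x = (\<lambda>f. - x f)" if kl: "k \<in> S" "l \<in> S" "k \<noteq> l" "pact (transpose k l) t = (\<lambda>f. - t f)" for k l
  proof
    fix f :: "nat \<Rightarrow> nat"
    have "(f \<circ> transpose k l) i = f i" "(f \<circ> transpose k l) j = f j" using kl ij by (auto simp: transpose_def)
    then show "pact (transpose k l) x f = - x f" using fun_cong[OF kl(4), of f] unfolding x_def ins_def pact_def by simp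
  qed
  have xa: "antis C x" "antis E x" using a C unfolding csym_def by (auto intro!: tr)
  have tx: "tens n ?S x" unfolding x_def using t by (rule ins_tens)
  have ta: "antis (insert j E) (move (-1) E j x)" using xa(2) j C fC by (intro antis_move) auto
  have ta': "antis C (move (-1) E j x)" using j C by (intro antis_move_disjoint[OF xa(1)]) auto
  have zC: "antis (insert i C) z" unfolding z_def using i C fC by (intro antis_move[OF ta']) auto
  have zE: "antis (insert j E) z" unfolding z_def using ij C by (intro antis_move_disjoint[OF ta]) auto
  have tz: "tens n ?S z" unfolding z_def using C by (intro tens_move tx) auto
  have "fip (Ix n ?S) z z = fip (Ix n ?S) x (move (-1) E j (move (-1) C i z))"
    using S C by (subst (1) z_def) (simp add: fip_move subset_insertI2)
  also have "move (-1) C i z = (\<lambda>f. of_nat (Suc (card C)) * z f)" using zC i C by (intro move_antis) auto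
  also have "move (-1) E j \<dots> = (\<lambda>f. of_nat (Suc (card C)) * move (-1) E j z f)"
    by (simp add: move_def pact_def sum_distrib_left algebra_simps)
  also have "move (-1) E j z = (\<lambda>f. of_nat (Suc (card E)) * z f)" using zE j C by (intro move_antis) auto
  finally have zz: "fip (Ix n ?S) z z = of_real (real (Suc (card C)) * real (Suc (card E))) * fip (Ix n ?S) x z"
    by (simp only: fip_scale_right) simp
  \<comment> \<open>Expanding z gives four kinds of terms. With both new slots in place the loop
    contributes n (\<open>T1\<close>); exchanging one of them with a slot of E or of C contributes
    -1 for each such slot (\<open>T2\<close>, \<open>T3\<close>); exchanging both contracts t
    itself, which is zero (\<open>T4\<close>).\<close>
  have ctrz: "ctr i j z = (\<lambda>f. of_real (real n - real (card C) - real (card E)) * t f)"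
  proof (rule tens_eqI[of n S])
    show "tens n S (ctr i j z)" using tz ij by (intro ctr_tens) auto
    show "tens n S (\<lambda>f. of_real (real n - real (card C) - real (card E)) * t f)" using t by (rule tens_scale)
    fix f assume f: "f \<in> Ix n S"
    define T1 where "T1 = (\<Sum>p<n. \<Sum>q<n. b p q * (b p q * t f))"
    define T2 where "T2 = (\<lambda>l. \<Sum>p<n. \<Sum>q<n. b p q * (b p (f l) * t (f(l := q))))"
    define T3 where "T3 = (\<lambda>k. \<Sum>p<n. \<Sum>q<n. b p q * (b (f k) q * t (f(k := p))))"
    define T4 where "T4 = (\<lambda>k l. \<Sum>p<n. \<Sum>q<n. b p q * (b (f k) (f l) * t (f(k := p, l := q))))"
    have "z (f(i := p, j := q)) = b p q * t f - (\<Sum>l\<in>E. b p (f l) * t (f(l := q)))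
        - (\<Sum>k\<in>C. b (f k) q * t (f(k := p)) - (\<Sum>l\<in>E. b (f k) (f l) * t (f(k := p, l := q))))" for p q
    proof -
      let ?g = "f(i := p, j := q)"
      have g: "?g i = p" "?g j = q" "\<And>k. k \<in> S \<Longrightarrow> ?g k = f k" using ij by auto
      have 1: "x ?g = b p q * t f" unfolding x_def using ins_tens_eval[OF t, of ?g f i j] g by simp
      have 2: "x (?g \<circ> transpose j l) = b p (f l) * t (f(l := q))" if "l \<in> E" for l
      proof -
        have l: "l \<in> S" "l \<noteq> i" "l \<noteq> j" using that C ij by auto
        have "x (?g \<circ> transpose j l) = b ((?g \<circ> transpose j l) i) ((?g \<circ> transpose j l) j) * t (f(l := q))"
          unfolding x_def using l ij by (intro ins_tens_eval[OF t]) (auto simp: transpose_def)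
        then show ?thesis using l ij by (simp add: transpose_def)
      qed
      have 3: "x (?g \<circ> transpose i k) = b (f k) q * t (f(k := p))" if "k \<in> C" for k
      proof -
        have k: "k \<in> S" "k \<noteq> i" "k \<noteq> j" using that C ij by auto
        have "x (?g \<circ> transpose i k) = b ((?g \<circ> transpose i k) i) ((?g \<circ> transpose i k) j) * t (f(k := p))"
          unfolding x_def using k ij by (intro ins_tens_eval[OF t]) (auto simp: transpose_def)
        then show ?thesis using k ij by (simp add: transpose_def)
      qed
      have 4: "x (?g \<circ> transpose i k \<circ> transpose j l) = b (f k) (f l) * t (f(k := p, l := q))" if "k \<in> C" "l \<in> E" for k l
      proof -
        let ?h = "?g \<circ> transpose i k \<circ> transpose j l"
        have k: "k \<in> S" "k \<noteq> i" "k \<noteq> j" "l \<in> S" "l \<noteq> i" "l \<noteq> j" "k \<noteq> l" using that C ij by auto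
        have "x ?h = b (?h i) (?h j) * t (f(k := p, l := q))"
          unfolding x_def using k ij by (intro ins_tens_eval[OF t]) (auto simp: transpose_def)
        then show ?thesis using k ij by (simp add: transpose_def)
      qed
      show ?thesis unfolding z_def move_def pact_def using 1 2 3 4 by (simp add: sum_subtractf)
    qed
    then have "ctr i j z f = T1 - (\<Sum>l\<in>E. T2 l) - (\<Sum>k\<in>C. T3 k - (\<Sum>l\<in>E. T4 k l))"
    proof -
      assume z: "\<And>p q. z (f(i := p, j := q)) = b p q * t f - (\<Sum>l\<in>E. b p (f l) * t (f(l := q)))
        - (\<Sum>k\<in>C. b (f k) q * t (f(k := p)) - (\<Sum>l\<in>E. b (f k) (f l) * t (f(k := p, l := q))))"
      have "(\<Sum>k\<in>C. \<Sum>l\<in>E. T4 k l) = (\<Sum>p<n. \<Sum>q<n. b p q * (\<Sum>k\<in>C. \<Sum>l\<in>E. b (f k) (f l) * t (f(k := p, l := q))))"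
        unfolding T4_def sum_distrib_left by (rule sum_swap4)
      moreover have "(\<Sum>k\<in>C. T3 k) = (\<Sum>p<n. \<Sum>q<n. b p q * (\<Sum>k\<in>C. b (f k) q * t (f(k := p))))"
        unfolding T3_def sum_distrib_left by (rule sum_swap3)
      moreover have "(\<Sum>k\<in>E. T2 k) = (\<Sum>p<n. \<Sum>q<n. b p q * (\<Sum>l\<in>E. b p (f l) * t (f(l := q))))"
        unfolding T2_def sum_distrib_left by (rule sum_swap3)
      moreover have "b p q * (u1 - u2 - (u3 - u4)) = b p q * u1 - b p q * u2 - (b p q * u3 - b p q * u4)" for p q u1 u2 u3 u4
        by (simp add: algebra_simps)
      ultimately show ?thesis unfolding ctr_def T1_def z
        by (simp only: sum_subtractf)
    qed
    also have "T1 = of_nat n * t f" unfolding T1_def by (rule b_contract0)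
    also have "(\<Sum>l\<in>E. T2 l) = (\<Sum>l\<in>E. t f)"
    proof (rule sum.cong[OF refl])
      fix l assume "l \<in> E"
      then have "f l < n" using f C by (auto intro: Ix_lt)
      from b_contract2[OF this, of "\<lambda>q. t (f(l := q))"] show "T2 l = t f" by (simp add: T2_def)
    qed
    also have "(\<Sum>k\<in>C. T3 k - (\<Sum>l\<in>E. T4 k l)) = (\<Sum>k\<in>C. t f)"
    proof (rule sum.cong[OF refl])
      fix k assume k: "k \<in> C"
      then have "f k < n" using f C by (auto intro: Ix_lt)
      from b_contract1[OF this, of "\<lambda>q. t (f(k := q))"] have 3: "T3 k = t f" by (simp add: T3_def)
      have "T4 k l = 0" if "l \<in> E" for l
      proof -
        have kl: "k \<in> S" "l \<in> S" "k \<noteq> l" using that k C by auto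
        have "T4 k l = b (f k) (f l) * ctr k l t f"
          unfolding T4_def ctr_def by (simp add: sum_distrib_left mult.left_commute)
        also have "ctr k l t = (\<lambda>f. 0)" using h kl by (simp add: harm_def)
        finally show ?thesis by simp
      qed
      then show "T3 k - (\<Sum>l\<in>E. T4 k l) = t f" using 3 by simp
    qed
    finally show "ctr i j z f = of_real (real n - real (card C) - real (card E)) * t f"
      by (simp add: algebra_simps)
  qed
  show ?thesis
    by (rule norm_argument[OF S i _ _ t tz ctrz _ _ zz[unfolded x_def]]) (use j gt in auto)
qed

text \<open>For e = -1 the inserted form is itself antisymmetric, so both new slots can join the
  same set C. This is why a single column with more than n/2 slots is already impossible.\<close>

lemma harm_antis_column:
  fixes S :: "nat set"
  assumes S: "finite S" and t: "tens n S t" and h: "harm S t"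
    and C: "C \<subseteq> S" and a: "antis C t" and gt: "2 * card C > n" and e: "e = -1"
  shows "t = (\<lambda>f. 0)"
proof -
  obtain i where i: "i \<notin> S" using S ex_new_if_finite infinite_UNIV_nat by blast
  obtain j where j: "j \<notin> insert i S" using S ex_new_if_finite[of "insert i S"] infinite_UNIV_nat by blast
  note ij = i j
  let ?S = "insert i (insert j S)"
  have fC: "finite C" using C S finite_subset by blast+
  have iC: "i \<notin> C" "j \<notin> C" "i \<noteq> j" using ij C by auto
  define x where "x = ins i j t"
  \<comment> \<open>j joins C first, then i joins C together with j, so that z is antisymmetric in
    all these slots.\<close>
  define z where "z = move (-1) (insert j C) i (move (-1) C j x)"
  have tr: "pact (transpose k l) x = (\<lambda>f. - x f)" if kl: "k \<in> S" "l \<in> S" "k \<noteq> l" "pact (transpose k l) t = (\<lambda>f. - t f)" for k l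
  proof
    fix f :: "nat \<Rightarrow> nat"
    have "(f \<circ> transpose k l) i = f i" "(f \<circ> transpose k l) j = f j" using kl ij by (auto simp: transpose_def)
    then show "pact (transpose k l) x f = - x f" using fun_cong[OF kl(4), of f] unfolding x_def ins_def pact_def by simp
  qed
  have xa: "antis C x" using a C unfolding csym_def by (auto intro!: tr)
  have tx: "tens n ?S x" unfolding x_def using t by (rule ins_tens)
  have ta: "antis (insert j C) (move (-1) C j x)" using xa iC fC by (intro antis_move) auto
  have zi: "antis (insert i (insert j C)) z" unfolding z_def using iC fC by (intro antis_move[OF ta]) auto
  then have zj: "antis (insert j C) z" unfolding csym_def by auto
  have tz: "tens n ?S z" unfolding z_def using C by (intro tens_move tx) auto
  have "fip (Ix n ?S) z z = fip (Ix n ?S) x (move (-1) C j (move (-1) (insert j C) i z))"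
  proof -
    have "insert j C \<subseteq> ?S" "C \<subseteq> ?S" using C by auto
    then show ?thesis using S by (subst (1) z_def) (simp add: fip_move)
  qed
  also have "move (-1) (insert j C) i z = (\<lambda>f. of_nat (Suc (card (insert j C))) * z f)" using zi iC by (intro move_antis) auto
  also have "move (-1) C j \<dots> = (\<lambda>f. of_nat (Suc (card (insert j C))) * move (-1) C j z f)"
    by (simp add: move_def pact_def sum_distrib_left algebra_simps)
  also have "move (-1) C j z = (\<lambda>f. of_nat (Suc (card C)) * z f)" using zj iC by (intro move_antis) auto
  finally have zz: "fip (Ix n ?S) z z = of_real (real (Suc (card (insert j C))) * real (Suc (card C))) * fip (Ix n ?S) x z"
    by (simp only: fip_scale_right) simp
  \<comment> \<open>Compared with two disjoint sets, each contribution appears once more, through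
    permutations that also exchange the roles of i and j; there the sign e = -1 of b compensates the
    sign of that exchange. Hence 2 n - 2 |C| - 2 |C|.\<close>
  have ctrz: "ctr i j z = (\<lambda>f. of_real (2 * (real n - 2 * real (card C))) * t f)"
  proof (rule tens_eqI[of n S])
    show "tens n S (ctr i j z)" using tz ij by (intro ctr_tens) auto
    show "tens n S (\<lambda>f. of_real (2 * (real n - 2 * real (card C))) * t f)" using t by (rule tens_scale)
    fix f assume f: "f \<in> Ix n S"
    define T1 where "T1 = (\<Sum>p<n. \<Sum>q<n. b p q * (b p q * t f))"
    define T2 where "T2 = (\<lambda>l. \<Sum>p<n. \<Sum>q<n. b p q * (b p (f l) * t (f(l := q))))"
    define T3 where "T3 = (\<lambda>k. \<Sum>p<n. \<Sum>q<n. b p q * (b (f k) q * t (f(k := p))))"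
    define T4 where "T4 = (\<lambda>k l. \<Sum>p<n. \<Sum>q<n. b p q * (b (f k) (f l) * t (f(k := p, l := q))))"
    have "z (f(i := p, j := q)) = 2 * (b p q * t f) - 2 * (\<Sum>l\<in>C. b p (f l) * t (f(l := q)))
        - 2 * (\<Sum>k\<in>C. b (f k) q * t (f(k := p)))
        + (\<Sum>k\<in>C. \<Sum>l\<in>C - {k}. b (f k) (f l) * t (f(k := p, l := q)))" for p q
    proof -
      let ?g = "f(i := p, j := q)"
      have g: "?g i = p" "?g j = q" "\<And>k. k \<in> S \<Longrightarrow> ?g k = f k" using ij by auto
      have 1: "x ?g = b p q * t f" unfolding x_def using ins_tens_eval[OF t, of ?g f i j] g by simp
      have 2: "x (?g \<circ> transpose j l) = b p (f l) * t (f(l := q))" if "l \<in> C" for l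
      proof -
        have l: "l \<in> S" "l \<noteq> i" "l \<noteq> j" using that C ij by auto
        have "x (?g \<circ> transpose j l) = b ((?g \<circ> transpose j l) i) ((?g \<circ> transpose j l) j) * t (f(l := q))"
          unfolding x_def using l ij by (intro ins_tens_eval[OF t]) (auto simp: transpose_def)
        then show ?thesis using l ij by (simp add: transpose_def)
      qed
      have 3: "x (?g \<circ> transpose i k) = b (f k) q * t (f(k := p))" if "k \<in> C" for k
      proof -
        have k: "k \<in> S" "k \<noteq> i" "k \<noteq> j" using that C ij by auto
        have "x (?g \<circ> transpose i k) = b ((?g \<circ> transpose i k) i) ((?g \<circ> transpose i k) j) * t (f(k := p))"
          unfolding x_def using k ij by (intro ins_tens_eval[OF t]) (auto simp: transpose_def)
        then show ?thesis using k ij by (simp add: transpose_def)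
      qed
      have 4: "x (?g \<circ> transpose i k \<circ> transpose j l) = b (f k) (f l) * t (f(k := p, l := q))" if "k \<in> C" "l \<in> C - {k}" for k l
      proof -
        let ?h = "?g \<circ> transpose i k \<circ> transpose j l"
        have k: "k \<in> S" "k \<noteq> i" "k \<noteq> j" "l \<in> S" "l \<noteq> i" "l \<noteq> j" "k \<noteq> l" using that C ij by auto
        have "x ?h = b (?h i) (?h j) * t (f(k := p, l := q))"
          unfolding x_def using k ij by (intro ins_tens_eval[OF t]) (auto simp: transpose_def)
        then show ?thesis using k ij by (simp add: transpose_def)
      qed
      have 5: "x (?g \<circ> transpose i k \<circ> transpose j k) = - (b p (f k) * t (f(k := q)))" if "k \<in> C" for k
      proof -
        let ?h = "?g \<circ> transpose i k \<circ> transpose j k"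
        have k: "k \<in> S" "k \<noteq> i" "k \<noteq> j" using that C ij by auto
        have "x ?h = b (?h i) (?h j) * t (f(k := q))"
          unfolding x_def using k ij by (intro ins_tens_eval[OF t]) (auto simp: transpose_def)
        then show ?thesis using k ij b_sym[of "f k" p] e by (simp add: transpose_def)
      qed
      have 6: "x (?g \<circ> transpose i j) = - (b p q * t f)"
      proof -
        let ?h = "?g \<circ> transpose i j"
        have "x ?h = b (?h i) (?h j) * t f"
          unfolding x_def using ij by (intro ins_tens_eval[OF t]) (auto simp: transpose_def)
        then show ?thesis using ij b_sym[of q p] e by (simp add: transpose_def)
      qed
      have 7: "x (?g \<circ> transpose i j \<circ> transpose j l) = - (b (f l) q * t (f(l := p)))" if "l \<in> C" for l
      proof -
        let ?h = "?g \<circ> transpose i j \<circ> transpose j l"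
        have k: "l \<in> S" "l \<noteq> i" "l \<noteq> j" using that C ij by auto
        have "x ?h = b (?h i) (?h j) * t (f(l := p))"
          unfolding x_def using k ij by (intro ins_tens_eval[OF t]) (auto simp: transpose_def)
        then show ?thesis using k ij b_sym[of q "f l"] e by (simp add: transpose_def)
      qed
      have y: "move (-1) C j x h = x h - (\<Sum>l\<in>C. x (h \<circ> transpose j l))" for h by (simp add: move_def pact_def)
      have z0: "z ?g = move (-1) C j x ?g - move (-1) C j x (?g \<circ> transpose i j) - (\<Sum>k\<in>C. move (-1) C j x (?g \<circ> transpose i k))"
        unfolding z_def move_def[of _ "insert j C"] pact_def using fC iC by simp
      have s2: "(\<Sum>l\<in>C. x (?g \<circ> transpose j l)) = (\<Sum>l\<in>C. b p (f l) * t (f(l := q)))"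
        by (rule sum.cong[OF refl 2])
      have s7: "(\<Sum>l\<in>C. x (?g \<circ> transpose i j \<circ> transpose j l)) = - (\<Sum>l\<in>C. b (f l) q * t (f(l := p)))"
        unfolding sum_negf[symmetric] by (rule sum.cong[OF refl 7])
      have s45: "(\<Sum>l\<in>C. x (?g \<circ> transpose i k \<circ> transpose j l)) =
          - (b p (f k) * t (f(k := q))) + (\<Sum>l\<in>C - {k}. b (f k) (f l) * t (f(k := p, l := q)))" if k: "k \<in> C" for k
        unfolding sum.remove[OF fC k] 5[OF k] using 4[OF k] by simp
      have "(\<Sum>k\<in>C. move (-1) C j x (?g \<circ> transpose i k)) =
         (\<Sum>k\<in>C. b (f k) q * t (f(k := p)) - (- (b p (f k) * t (f(k := q))) + (\<Sum>l\<in>C - {k}. b (f k) (f l) * t (f(k := p, l := q)))))"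
        by (rule sum.cong[OF refl]) (simp only: y 3 s45)
      then show ?thesis unfolding z0 unfolding y 1 6 s2 s7
        by (simp add: sum_subtractf sum.distrib)
    qed
    then have "ctr i j z f = 2 * T1 - 2 * (\<Sum>l\<in>C. T2 l) - 2 * (\<Sum>k\<in>C. T3 k) + (\<Sum>k\<in>C. \<Sum>l\<in>C - {k}. T4 k l)"
    proof -
      assume z: "\<And>p q. z (f(i := p, j := q)) = 2 * (b p q * t f) - 2 * (\<Sum>l\<in>C. b p (f l) * t (f(l := q)))
        - 2 * (\<Sum>k\<in>C. b (f k) q * t (f(k := p)))
        + (\<Sum>k\<in>C. \<Sum>l\<in>C - {k}. b (f k) (f l) * t (f(k := p, l := q)))"
      have "(\<Sum>k\<in>C. \<Sum>l\<in>C - {k}. T4 k l) = (\<Sum>p<n. \<Sum>q<n. b p q * (\<Sum>k\<in>C. \<Sum>l\<in>C - {k}. b (f k) (f l) * t (f(k := p, l := q))))"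
        unfolding T4_def sum_distrib_left by (rule sum_swap4)
      moreover have "(\<Sum>k\<in>C. T3 k) = (\<Sum>p<n. \<Sum>q<n. b p q * (\<Sum>k\<in>C. b (f k) q * t (f(k := p))))"
        unfolding T3_def sum_distrib_left by (rule sum_swap3)
      moreover have "(\<Sum>k\<in>C. T2 k) = (\<Sum>p<n. \<Sum>q<n. b p q * (\<Sum>l\<in>C. b p (f l) * t (f(l := q))))"
        unfolding T2_def sum_distrib_left by (rule sum_swap3)
      moreover have "b p q * (2 * u1 - 2 * u2 - 2 * u3 + u4) = 2 * (b p q * u1) - 2 * (b p q * u2) - 2 * (b p q * u3) + b p q * u4" for p q u1 u2 u3 u4
        by (simp add: algebra_simps)
      ultimately show ?thesis unfolding ctr_def T1_def z
        by (simp add: sum_subtractf sum.distrib sum_distrib_left[symmetric])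
    qed
    also have "T1 = of_nat n * t f" unfolding T1_def by (rule b_contract0)
    also have "(\<Sum>l\<in>C. T2 l) = (\<Sum>l\<in>C. t f)"
    proof (rule sum.cong[OF refl])
      fix l assume "l \<in> C"
      then have "f l < n" using f C by (auto intro: Ix_lt)
      from b_contract2[OF this, of "\<lambda>q. t (f(l := q))"] show "T2 l = t f" by (simp add: T2_def)
    qed
    also have "(\<Sum>k\<in>C. T3 k) = (\<Sum>k\<in>C. t f)"
    proof (rule sum.cong[OF refl])
      fix k assume k: "k \<in> C"
      then have "f k < n" using f C by (auto intro: Ix_lt)
      from b_contract1[OF this, of "\<lambda>q. t (f(k := q))"] show "T3 k = t f" by (simp add: T3_def)
    qed
    also have "(\<Sum>k\<in>C. \<Sum>l\<in>C - {k}. T4 k l) = 0"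
    proof (intro sum.neutral ballI)
      fix k l assume "k \<in> C" "l \<in> C - {k}"
      then have kl: "k \<in> S" "l \<in> S" "k \<noteq> l" using C by auto
      have "T4 k l = b (f k) (f l) * ctr k l t f"
        unfolding T4_def ctr_def by (simp add: sum_distrib_left mult.left_commute)
      also have "ctr k l t = (\<lambda>f. 0)" using h kl by (simp add: harm_def)
      finally show "T4 k l = 0" by simp
    qed
    finally show "ctr i j z f = of_real (2 * (real n - 2 * real (card C))) * t f"
      by (simp add: algebra_simps)
  qed
  show ?thesis
    by (rule norm_argument[OF S i _ _ t tz ctrz _ _ zz[unfolded x_def]]) (use j gt in auto)
qed

end

section \<open>Invariant tensors\<close>

text \<open>The (f, u) entry of the tensor power of g with one factor for each slot of S.\<close>

definition gprod :: "'k set \<Rightarrow> (nat \<Rightarrow> nat \<Rightarrow> complex) \<Rightarrow> ('k \<Rightarrow> nat) \<Rightarrow> ('k \<Rightarrow> nat) \<Rightarrow> complex" where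
  "gprod S g f u = (\<Prod>k\<in>S. g (f k) (u k))"

definition gact :: "nat \<Rightarrow> 'k set \<Rightarrow> (nat \<Rightarrow> nat \<Rightarrow> complex) \<Rightarrow> (('k \<Rightarrow> nat) \<Rightarrow> complex) \<Rightarrow> ('k \<Rightarrow> nat) \<Rightarrow> complex" where
  "gact n S g t = (\<lambda>f. \<Sum>u\<in>Ix n S. gprod S g f u * t u)"

lemma gprod_cong: "(\<And>k. k \<in> S \<Longrightarrow> f k = f' k) \<Longrightarrow> (\<And>k. k \<in> S \<Longrightarrow> u k = u' k) \<Longrightarrow> gprod S g f u = gprod S g f' u'"
  unfolding gprod_def by (rule prod.cong) auto

lemma gact_cong: "(\<And>k. k \<in> S \<Longrightarrow> f k = f' k) \<Longrightarrow> gact n S g t f = gact n S g t f'"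
  unfolding gact_def by (intro sum.cong arg_cong2[where f = "(*)"] gprod_cong) auto

lemma gact_insert:
  assumes "i \<notin> S" "finite S"
  shows "gact n (insert i S) g t f = (\<Sum>x<n. g (f i) x * gact n S g (\<lambda>u. t (u(i := x))) f)"
proof -
  have "gprod (insert i S) g f (u(i := x)) = g (f i) x * gprod S g f u" for u x
    unfolding gprod_def using assms by (auto intro!: prod.cong)
  then show ?thesis unfolding gact_def sum_Ix_insert[OF assms(1)]
    by (simp add: sum_distrib_left mult.assoc)
qed

lemma gact_empty: "gact n {} g t f = t (\<lambda>_. undefined)"
  by (simp add: gact_def Ix_empty gprod_def)

lemma gact_sum: "gact n S g (\<lambda>f. \<Sum>a\<in>A. c a * t a f) = (\<lambda>f. \<Sum>a\<in>A. c a * gact n S g (t a) f)"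
  unfolding gact_def sum_distrib_left
  by (subst sum.swap) (simp add: mult.left_commute)

lemma gact_add: "gact n S g (\<lambda>f. s f + t f) = (\<lambda>f. gact n S g s f + gact n S g t f)"
  by (simp add: gact_def distrib_left sum.distrib)

lemma gact_diff: "gact n S g (\<lambda>f. s f - t f) = (\<lambda>f. gact n S g s f - gact n S g t f)"
  by (simp add: gact_def right_diff_distrib sum_subtractf)

lemma gact_scale: "gact n S g (\<lambda>f. c * t f) = (\<lambda>f. c * gact n S g t f)"
  by (simp add: gact_def sum_distrib_left mult.left_commute)

lemma gact_tens:
  assumes "finite S" "\<And>x y. n \<le> x \<Longrightarrow> g x y = 0"
  shows "tens n S (gact n S g t)"
  unfolding tens_def
proof (intro conjI allI impI)
  fix f f' :: "'a \<Rightarrow> nat" assume "\<forall>k\<in>S. f k = f' k"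
  then show "gact n S g t f = gact n S g t f'" by (intro gact_cong) auto
next
  fix f :: "'a \<Rightarrow> nat" assume "\<exists>k\<in>S. n \<le> f k"
  then obtain k where "k \<in> S" "n \<le> f k" by blast
  then have "gprod S g f u = 0" for u unfolding gprod_def using assms by (auto intro!: prod_zero bexI[of _ k])
  then show "gact n S g t f = 0" by (simp add: gact_def)
qed

lemma gact_pact:
  assumes "p permutes S" "finite S"
  shows "gact n S g (pact p t) = pact p (gact n S g t)"
proof
  fix f
  have "pact p (gact n S g t) f = (\<Sum>u\<in>Ix n S. gprod S g (f \<circ> p) (u \<circ> p) * t (u \<circ> p))"
    unfolding gact_def pact_def
    by (rule sum.reindex_bij_betw[OF bij_betw_closed_ix[OF closed_ix_Ix[OF assms(2)] assms(1)], symmetric])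
  moreover have "gprod S g (f \<circ> p) (u \<circ> p) = gprod S g f u" for u
    unfolding gprod_def using prod.permute[OF assms(1), of "\<lambda>k. g (f k) (u k)"] by simp
  ultimately show "gact n S g (pact p t) f = pact p (gact n S g t) f" by (simp add: gact_def pact_def)
qed

lemma prod_indicator: "finite S \<Longrightarrow> (\<Prod>k\<in>S. if P k then 1 else 0) = (if \<forall>k\<in>S. P k then 1 else (0::complex))"
  by (induction S rule: finite_induct) auto

lemma Ix_eq_iff: "f \<in> Ix n S \<Longrightarrow> u \<in> Ix n S \<Longrightarrow> f = u \<longleftrightarrow> (\<forall>k\<in>S. f k = u k)"
  by (auto simp: Ix_def intro: PiE_ext)

lemma sum_Ix_prod: "finite S \<Longrightarrow> (\<Sum>u\<in>Ix n S. \<Prod>k\<in>S. F k (u k)) = (\<Prod>k\<in>S. \<Sum>x<n. (F k x :: complex))"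
  unfolding Ix_def by (subst prod_sum_PiE) auto

lemma sum_Ix_prod2:
  "finite S \<Longrightarrow> (\<Sum>u\<in>Ix n S. \<Sum>v\<in>Ix n S. \<Prod>k\<in>S. F k (u k) (v k)) = (\<Prod>k\<in>S. \<Sum>x<n. \<Sum>y<n. (F k x y :: complex))"
  using sum_Ix_prod[of S "\<lambda>k x. \<Sum>y<n. F k x y" n] sum_Ix_prod[of S "\<lambda>k y. F k (_ k) y" n] by simp

lemma fip_gact:
  shows "fip (Ix n S) (gact n S g s) t = fip (Ix n S) s (gact n S (\<lambda>x y. cnj (g y x)) t)"
proof -
  have c: "cnj (gprod S (\<lambda>x y. cnj (g y x)) f u) = gprod S g u f" for f u
    by (simp add: gprod_def)
  have "fip (Ix n S) (gact n S g s) t = (\<Sum>f\<in>Ix n S. \<Sum>u\<in>Ix n S. gprod S g f u * s u * cnj (t f))"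
    by (simp add: fip_def gact_def sum_distrib_right)
  also have "\<dots> = (\<Sum>u\<in>Ix n S. \<Sum>f\<in>Ix n S. gprod S g f u * s u * cnj (t f))" by (rule sum.swap)
  also have "\<dots> = fip (Ix n S) s (gact n S (\<lambda>x y. cnj (g y x)) t)"
    by (simp add: fip_def gact_def sum_distrib_left c mult_ac)
  finally show ?thesis .
qed

text \<open>The isometry group of b through the properties that the argument consumes.
  \<open>g_lie\<close> presents the Lie algebra element attached to p and q as a combination of
  velocities at 0 of curves in the group; weights are allowed because the symplectic case takes
  three transvections. \<open>g_adj\<close> makes the span of the group operators closed under
  adjoints. \<open>g_refl\<close> gives the reflection that excludes the determinant tensor.\<close>

locale bgroup = bform +
  fixes Gr :: "(nat \<Rightarrow> nat \<Rightarrow> complex) set"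
  assumes g_zero: "g \<in> Gr \<Longrightarrow> \<not> (x < n \<and> y < n) \<Longrightarrow> g x y = 0"
    and g_inv: "g \<in> Gr \<Longrightarrow> i < n \<Longrightarrow> j < n \<Longrightarrow> (\<Sum>x<n. \<Sum>y<n. b x y * (g x i * g y j)) = b i j"
    and g_inv': "g \<in> Gr \<Longrightarrow> i < n \<Longrightarrow> j < n \<Longrightarrow> (\<Sum>x<n. \<Sum>y<n. b x y * (g i x * g j y)) = b i j"
    and g_one: "(\<lambda>x y. if x = y \<and> x < n then 1 else 0) \<in> Gr"
    and g_mult: "g \<in> Gr \<Longrightarrow> h \<in> Gr \<Longrightarrow> (\<lambda>x y. \<Sum>z<n. g x z * h z y) \<in> Gr"
    and g_adj: "g \<in> Gr \<Longrightarrow> (\<lambda>x y. cnj (g y x)) \<in> Gr"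
    and g_lie: "p < n \<Longrightarrow> q < n \<Longrightarrow> \<exists>(m::nat) w \<gamma> D.
       (\<forall>r<m. (\<forall>s::complex. \<gamma> r s \<in> Gr) \<and> (\<forall>i<n. \<forall>j<n. \<gamma> r 0 i j = (if i = j then 1 else 0)) \<and>
          (\<forall>i<n. \<forall>j<n. ((\<lambda>s. \<gamma> r s i j) has_field_derivative D r i j) (at 0))) \<and>
       (\<forall>i<n. \<forall>j<n. (\<Sum>r<m. w r * D r i j) = (if q = j then b p i else 0) - e * (if p = j then b q i else 0))"
    and g_refl: "e = 1 \<Longrightarrow> 0 < n \<Longrightarrow> (\<lambda>x y. if x = y \<and> x < n then (if x = 0 then -1 else 1) else 0) \<in> Gr"
begin

definition ginv :: "'k set \<Rightarrow> (('k \<Rightarrow> nat) \<Rightarrow> complex) \<Rightarrow> bool" where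
  "ginv S t \<longleftrightarrow> (\<forall>g\<in>Gr. gact n S g t = t)"

lemma ctr_gact:
  assumes "i \<noteq> j" "i \<notin> S" "j \<notin> S" "finite S" "g \<in> Gr"
  shows "ctr i j (gact n (insert i (insert j S)) g t) = gact n S g (ctr i j t)"
proof
  fix f
  define A where "A = (\<lambda>p q. gact n S g (\<lambda>u. t (u(i := p, j := q))) f)"
  have "gact n (insert i (insert j S)) g t (f(i := x, j := y)) = (\<Sum>p<n. \<Sum>q<n. g x p * (g y q * A p q))" for x y
  proof -
    have "gact n (insert i (insert j S)) g t (f(i := x, j := y)) =
        (\<Sum>p<n. g x p * (\<Sum>q<n. g y q * gact n S g (\<lambda>u. t (u(j := q, i := p))) (f(i := x, j := y))))"
      using assms by (simp add: gact_insert)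
    moreover have "gact n S g (\<lambda>u. t (u(j := q, i := p))) (f(i := x, j := y)) = A p q" for p q
      unfolding A_def fun_upd_twist[OF assms(1)] using assms by (intro gact_cong) auto
    ultimately show ?thesis by (simp add: sum_distrib_left)
  qed
  then have "ctr i j (gact n (insert i (insert j S)) g t) f = (\<Sum>x<n. \<Sum>y<n. \<Sum>p<n. \<Sum>q<n. b x y * (g x p * g y q) * A p q)"
    by (simp add: ctr_def sum_distrib_left mult.assoc)
  also have "\<dots> = (\<Sum>p<n. \<Sum>q<n. \<Sum>x<n. \<Sum>y<n. b x y * (g x p * g y q) * A p q)"
  proof -
    have "(\<Sum>x<n. \<Sum>y<n. \<Sum>p<n. \<Sum>q<n. F x y p q) = (\<Sum>p<n. \<Sum>q<n. \<Sum>x<n. \<Sum>y<n. F x y p q)" for F :: "nat \<Rightarrow> nat \<Rightarrow> nat \<Rightarrow> nat \<Rightarrow> complex"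
    proof -
      have "(\<Sum>x<n. \<Sum>y<n. \<Sum>p<n. \<Sum>q<n. F x y p q) = (\<Sum>x<n. \<Sum>p<n. \<Sum>y<n. \<Sum>q<n. F x y p q)"
        by (rule sum.cong[OF refl], rule sum.swap)
      also have "\<dots> = (\<Sum>p<n. \<Sum>x<n. \<Sum>q<n. \<Sum>y<n. F x y p q)"
        by (subst sum.swap, rule sum.cong[OF refl], rule sum.cong[OF refl], rule sum.swap)
      also have "\<dots> = (\<Sum>p<n. \<Sum>q<n. \<Sum>x<n. \<Sum>y<n. F x y p q)"
        by (rule sum.cong[OF refl], rule sum.swap)
      finally show ?thesis .
    qed
    then show ?thesis .
  qed
  also have "\<dots> = (\<Sum>p<n. \<Sum>q<n. b p q * A p q)"
    using g_inv[OF assms(5)] by (intro sum.cong refl) (simp add: sum_distrib_right[symmetric])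
  also have "\<dots> = gact n S g (ctr i j t) f"
    unfolding ctr_def A_def by (simp add: gact_sum gact_scale gact_sum[where c = "\<lambda>_. 1", simplified])
  finally show "ctr i j (gact n (insert i (insert j S)) g t) f = gact n S g (ctr i j t) f" .
qed

lemma gact_tens': "finite S \<Longrightarrow> g \<in> Gr \<Longrightarrow> tens n S (gact n S g t)"
  using g_zero by (intro gact_tens) auto

text \<open>Differentiate the constant function given by the action of \<open>\<gamma> s\<close> on
  t. At s = 0 the product rule leaves, in each term, one differentiated factor and entries of the
  identity in all other slots.\<close>

lemma lie_derivative_curve:
  assumes S: "finite S" and t: "tens n S t" "ginv S t" and f: "f \<in> Ix n S"
    and \<gamma>: "\<And>s::complex. \<gamma> s \<in> Gr" "\<And>i j. i < n \<Longrightarrow> j < n \<Longrightarrow> \<gamma> 0 i j = (if i = j then 1 else 0)"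
      "\<And>i j. i < n \<Longrightarrow> j < n \<Longrightarrow> ((\<lambda>s. \<gamma> s i j) has_field_derivative D i j) (at 0)"
  shows "(\<Sum>k\<in>S. \<Sum>x<n. D (f k) x * t (f(k := x))) = 0"
proof -
  have "((\<lambda>s. \<Sum>u\<in>Ix n S. (\<Prod>k\<in>S. \<gamma> s (f k) (u k)) * t u) has_field_derivative
      (\<Sum>u\<in>Ix n S. (\<Sum>k\<in>S. D (f k) (u k) * (\<Prod>j\<in>S - {k}. \<gamma> 0 (f j) (u j))) * t u)) (at 0)"
    using f by (intro DERIV_sum DERIV_cmult_right has_field_derivative_prod \<gamma>(3)) (auto simp: Ix_lt)
  moreover have "(\<lambda>s. \<Sum>u\<in>Ix n S. (\<Prod>k\<in>S. \<gamma> s (f k) (u k)) * t u) = (\<lambda>s. t f)"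
    using t(2) \<gamma>(1) by (auto simp: ginv_def gact_def gprod_def fun_eq_iff)
  ultimately have "((\<lambda>s::complex. t f) has_field_derivative
      (\<Sum>u\<in>Ix n S. (\<Sum>k\<in>S. D (f k) (u k) * (\<Prod>j\<in>S - {k}. \<gamma> 0 (f j) (u j))) * t u)) (at 0)" by simp
  then have "(\<Sum>u\<in>Ix n S. (\<Sum>k\<in>S. D (f k) (u k) * (\<Prod>j\<in>S - {k}. \<gamma> 0 (f j) (u j))) * t u) = 0"
    using DERIV_unique DERIV_const by blast
  also have "(\<Sum>u\<in>Ix n S. (\<Sum>k\<in>S. D (f k) (u k) * (\<Prod>j\<in>S - {k}. \<gamma> 0 (f j) (u j))) * t u)
     = (\<Sum>k\<in>S. \<Sum>u\<in>Ix n S. D (f k) (u k) * (\<Prod>j\<in>S - {k}. \<gamma> 0 (f j) (u j)) * t u)"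
    by (simp add: sum_distrib_right sum.swap[of _ S])
  also have "\<dots> = (\<Sum>k\<in>S. \<Sum>x<n. D (f k) x * t (f(k := x)))"
  proof (rule sum.cong[OF refl])
    fix k assume k: "k \<in> S"
    define R where "R = S - {k}"
    have SR: "S = insert k R" and kR: "k \<notin> R" and fR: "finite R" using k S by (auto simp: R_def)
    define f0 where "f0 = restrict f R"
    have f0: "f0 \<in> Ix n R" unfolding f0_def using Ix_lt[OF f] by (intro restrict_Ix) (auto simp: R_def)
    have "(\<Sum>u\<in>Ix n S. D (f k) (u k) * (\<Prod>j\<in>R. \<gamma> 0 (f j) (u j)) * t u) =
       (\<Sum>x<n. \<Sum>u\<in>Ix n R. D (f k) x * (\<Prod>j\<in>R. \<gamma> 0 (f j) ((u(k := x)) j)) * t (u(k := x)))"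
      unfolding SR sum_Ix_insert[OF kR] by simp
    also have "\<dots> = (\<Sum>x<n. \<Sum>u\<in>Ix n R. if u = f0 then D (f k) x * t (u(k := x)) else 0)"
    proof (intro sum.cong refl)
      fix x u assume u: "u \<in> Ix n R"
      have "(\<Prod>j\<in>R. \<gamma> 0 (f j) ((u(k := x)) j)) = (\<Prod>j\<in>R. if f j = u j then 1 else 0)"
        using kR Ix_lt[OF f] Ix_lt[OF u] by (intro prod.cong refl) (auto simp: \<gamma>(2) R_def)
      also have "\<dots> = (if u = f0 then 1 else 0)"
        unfolding prod_indicator[OF fR] using Ix_eq_iff[OF u f0] by (auto simp: f0_def)
      finally show "D (f k) x * (\<Prod>j\<in>R. \<gamma> 0 (f j) ((u(k := x)) j)) * t (u(k := x)) = (if u = f0 then D (f k) x * t (u(k := x)) else 0)"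
        by simp
    qed
    also have "\<dots> = (\<Sum>x<n. D (f k) x * t (f0(k := x)))" using f0 finite_Ix[OF fR] by simp
    finally have "(\<Sum>u\<in>Ix n S. D (f k) (u k) * (\<Prod>j\<in>R. \<gamma> 0 (f j) (u j)) * t u) = (\<Sum>x<n. D (f k) x * t (f0(k := x)))" .
    moreover have "t (f0(k := x)) = t (f(k := x))" for x
      using SR by (intro tens_cong[OF t(1)]) (auto simp: f0_def)
    ultimately show "(\<Sum>u\<in>Ix n S. D (f k) (u k) * (\<Prod>j\<in>S - {k}. \<gamma> 0 (f j) (u j)) * t u) = (\<Sum>x<n. D (f k) x * t (f(k := x)))"
      by (simp add: R_def)
  qed
  finally show ?thesis .
qed

lemma lie_derivative:
  assumes S: "finite S" and t: "tens n S t" "ginv S t" and f: "f \<in> Ix n S" and pq: "p < n" "q < n"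
  shows "(\<Sum>k\<in>S. b p (f k) * t (f(k := q)) - e * (b q (f k) * t (f(k := p)))) = 0"
proof -
  from g_lie[OF pq] obtain m :: nat and w \<gamma> D where L:
       "(\<forall>r<m. (\<forall>s::complex. \<gamma> r s \<in> Gr) \<and> (\<forall>i<n. \<forall>j<n. \<gamma> r 0 i j = (if i = j then 1 else 0)) \<and>
          (\<forall>i<n. \<forall>j<n. ((\<lambda>s. \<gamma> r s i j) has_field_derivative D r i j) (at 0))) \<and>
       (\<forall>i<n. \<forall>j<n. (\<Sum>r<m. w r * D r i j) = (if q = j then b p i else 0) - e * (if p = j then b q i else 0))"
    by (elim exE) (rule that)
  have \<gamma>: "\<And>s. \<gamma> r s \<in> Gr" "\<And>i j. i < n \<Longrightarrow> j < n \<Longrightarrow> \<gamma> r 0 i j = (if i = j then 1 else 0)"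
      "\<And>i j. i < n \<Longrightarrow> j < n \<Longrightarrow> ((\<lambda>s. \<gamma> r s i j) has_field_derivative D r i j) (at 0)" if "r < m" for r
    using conjunct1[OF L, rule_format, OF that] by simp_all
  have D: "\<And>i j. i < n \<Longrightarrow> j < n \<Longrightarrow> (\<Sum>r<m. w r * D r i j) = (if q = j then b p i else 0) - e * (if p = j then b q i else 0)"
    using conjunct2[OF L] by simp
  have "(\<Sum>k\<in>S. \<Sum>x<n. D r (f k) x * t (f(k := x))) = 0" if "r < m" for r
    by (rule lie_derivative_curve[OF S t f, of "\<gamma> r"]) (rule \<gamma>[OF that], assumption?, assumption?)+
  then have "0 = (\<Sum>r<m. w r * (\<Sum>k\<in>S. \<Sum>x<n. D r (f k) x * t (f(k := x))))" by simp
  also have "\<dots> = (\<Sum>k\<in>S. \<Sum>x<n. (\<Sum>r<m. w r * D r (f k) x) * t (f(k := x)))"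
    unfolding sum_distrib_left sum_distrib_right mult.assoc by (rule sum_swap3)
  also have "\<dots> = (\<Sum>k\<in>S. \<Sum>x<n. ((if q = x then b p (f k) else 0) - e * (if p = x then b q (f k) else 0)) * t (f(k := x)))"
    using Ix_lt[OF f] by (intro sum.cong refl) (simp add: D)
  also have "\<dots> = (\<Sum>k\<in>S. b p (f k) * t (f(k := q)) - e * (b q (f k) * t (f(k := p))))"
  proof (intro sum.cong refl)
    fix k
    have "(\<Sum>x<n. ((if q = x then b p (f k) else 0) - e * (if p = x then b q (f k) else 0)) * t (f(k := x))) =
       (\<Sum>x<n. (if q = x then b p (f k) * t (f(k := x)) else 0)) - (\<Sum>x<n. if p = x then e * (b q (f k) * t (f(k := x))) else 0)"
      unfolding sum_subtractf[symmetric] by (intro sum.cong) (auto simp: left_diff_distrib)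
    then show "(\<Sum>x<n. ((if q = x then b p (f k) else 0) - e * (if p = x then b q (f k) else 0)) * t (f(k := x))) =
       b p (f k) * t (f(k := q)) - e * (b q (f k) * t (f(k := p)))" using pq by simp
  qed
  finally show ?thesis by simp
qed

text \<open>This is the Casimir element with one leg placed in slot i, which annihilates invariants.\<close>

lemma casimir:
  assumes S: "finite S" and t: "tens n S t" "ginv S t" and h: "harm S t" and i: "i \<in> S"
  shows "(of_nat n - e) * t f + (\<Sum>k\<in>S - {i}. pact (transpose i k) t f) = 0"
proof -
  define C where "C = (\<lambda>f. (of_nat n - e) * t f + (\<Sum>k\<in>S - {i}. pact (transpose i k) t f))"
  have "C = (\<lambda>f. 0)"
  proof (rule tens_eqI[of n S])
    show "tens n S C" unfolding C_def using t(1) i by (intro tens_add tens_scale tens_sum tens_pact_transpose) auto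
    show "tens n S (\<lambda>f. 0)" by (rule tens_null)
    fix f assume f: "f \<in> Ix n S"
    define p where "p = f i"
    have p: "p < n" unfolding p_def using f i by (rule Ix_lt)
    \<comment> \<open>The identity of \<open>lie_derivative\<close> for the pair (x, p), taken at
      the index function f(i := q) and summed against b x q. The term k = i gives n - e; for k
      different from i the first part is the transposition of i and k, and the second is a
      contraction of t, hence zero.\<close>
    define H where "H = (\<lambda>x q k. b x ((f(i := q)) k) * t (f(i := q, k := p)) - e * (b p ((f(i := q)) k) * t (f(i := q, k := x))))"
    have "(\<Sum>k\<in>S. H x q k) = 0" if "x < n" "q < n" for x q
      unfolding H_def using that p f i
      by (intro lie_derivative[OF S t]) (auto simp: Ix_def PiE_def extensional_def)
    then have "0 = (\<Sum>x<n. \<Sum>q<n. b x q * (\<Sum>k\<in>S. H x q k))" by simp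
    also have "\<dots> = (\<Sum>k\<in>S. \<Sum>x<n. \<Sum>q<n. b x q * H x q k)"
      by (simp add: sum_distrib_left sum.swap[of _ S])
    also have "\<dots> = (\<Sum>x<n. \<Sum>q<n. b x q * H x q i) + (\<Sum>k\<in>S - {i}. \<Sum>x<n. \<Sum>q<n. b x q * H x q k)"
      using S i by (rule sum.remove)
    also have "(\<Sum>x<n. \<Sum>q<n. b x q * H x q i) = (of_nat n - e) * t f"
    proof -
      have "b x q * H x q i = b x q * (b x q * t f) - e * (b x q * (b p q * t (f(i := x))))" for x q
        by (simp add: H_def p_def right_diff_distrib mult.left_commute)
      then have "(\<Sum>x<n. \<Sum>q<n. b x q * H x q i) =
          (\<Sum>x<n. \<Sum>q<n. b x q * (b x q * t f)) - e * (\<Sum>x<n. \<Sum>q<n. b x q * (b p q * t (f(i := x))))"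
        by (simp add: sum_subtractf sum_distrib_left)
      also have "(\<Sum>x<n. \<Sum>q<n. b x q * (b p q * t (f(i := x)))) = t (f(i := p))"
        using b_contract1[OF p, of "\<lambda>x. t (f(i := x))"] by simp
      finally show ?thesis unfolding b_contract0 by (simp add: p_def left_diff_distrib)
    qed
    also have "(\<Sum>k\<in>S - {i}. \<Sum>x<n. \<Sum>q<n. b x q * H x q k) = (\<Sum>k\<in>S - {i}. pact (transpose i k) t f)"
    proof (rule sum.cong[OF refl])
      fix k assume k: "k \<in> S - {i}"
      then have fk: "f k < n" using f by (auto intro: Ix_lt)
      have "b x q * H x q k = b x q * (b x (f k) * t (f(i := q, k := p))) - e * b p (f k) * (b x q * t (f(i := q, k := x)))" for x q
        using k by (simp add: H_def right_diff_distrib mult.left_commute mult.assoc)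
      then have "(\<Sum>x<n. \<Sum>q<n. b x q * H x q k) =
          (\<Sum>x<n. \<Sum>q<n. b x q * (b x (f k) * t (f(i := q, k := p)))) - e * b p (f k) * (\<Sum>x<n. \<Sum>q<n. b x q * t (f(i := q, k := x)))"
        by (simp add: sum_subtractf sum_distrib_left)
      also have "(\<Sum>x<n. \<Sum>q<n. b x q * t (f(i := q, k := x))) = ctr k i t f"
        unfolding ctr_def using k by (simp add: fun_upd_twist)
      also have "ctr k i t f = 0" using h k i by (simp add: harm_def)
      also have "(\<Sum>x<n. \<Sum>q<n. b x q * (b x (f k) * t (f(i := q, k := p)))) = t (f(i := f k, k := p))"
        using b_contract2[OF fk, of "\<lambda>q. t (f(i := q, k := p))"] by simp
      also have "f(i := f k, k := p) = f \<circ> transpose i k" using k by (auto simp: p_def transpose_def fun_eq_iff)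
      finally show "(\<Sum>x<n. \<Sum>q<n. b x q * H x q k) = pact (transpose i k) t f" by (simp add: pact_def comp_def)
    qed
    finally show "C f = 0" by (simp add: C_def)
  qed
  then show ?thesis by (simp add: C_def fun_eq_iff)
qed

lemma e_cases: "e = 1 \<or> e = -1"
  using e_sq by (simp add: square_eq_1_iff)

text \<open>Let u be antisymmetric in a set A of largest possible size. For j outside A the
  vanishing of the move says that the transpositions of j with the slots of A add up to u. Summing
  the Casimir identity over the slots of A then gives |A| (n - e - |A| + 1) + |S - A| = 0, while |A|
  is at most n.\<close>

theorem harmonic_invariant_zero:
  assumes S: "finite S" "S \<noteq> {}" and t: "tens n S t" "ginv S t" "harm S t"
  shows "t = (\<lambda>f. 0)"
proof (rule ccontr)
  assume tn: "t \<noteq> (\<lambda>f. 0)"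
  define M where "M = {u. tens n S u \<and> ginv S u \<and> harm S u}"
  have M: "perm_closed S M" unfolding perm_closed_def M_def
    using S by (auto simp: tens_add tens_scale harm_add harm_scale tens_pact_transpose
        ginv_def gact_add gact_scale gact_pact permutes_swap_id harm_pact)
  define P where "P = (\<lambda>A. A \<subseteq> S \<and> (\<exists>u\<in>M. u \<noteq> (\<lambda>f. 0) \<and> antis A u))"
  have "P {}" unfolding P_def using t tn by (auto simp: M_def csym_def)
  moreover have "\<forall>A. P A \<longrightarrow> card A < Suc (card S)" unfolding less_Suc_eq_le using S by (auto simp: P_def card_mono)
  ultimately obtain A where A: "P A" "\<And>A'. P A' \<Longrightarrow> card A' \<le> card A"
    using ex_has_greatest_nat[of P "{}" card "Suc (card S)"] by blast
  obtain u where u: "u \<in> M" "u \<noteq> (\<lambda>f. 0)" "antis A u" and AS: "A \<subseteq> S" using A(1) by (auto simp: P_def)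
  have fA: "finite A" using AS S finite_subset by blast
  have mv: "(\<Sum>i\<in>A. pact (transpose j i) u f) = u f" if j: "j \<in> S - A" for j f
  proof -
    have "move (-1) A j u = (\<lambda>f. 0)"
    proof (rule ccontr)
      assume "move (-1) A j u \<noteq> (\<lambda>f. 0)"
      moreover have "move (-1) A j u \<in> M" using M u S AS j by (intro move_mem) auto
      moreover have "antis (insert j A) (move (-1) A j u)" using u j fA by (intro antis_move) auto
      ultimately have "P (insert j A)" using AS j by (auto simp: P_def)
      from A(2)[OF this] show False using j fA by simp
    qed
    then show ?thesis by (simp add: move_def fun_eq_iff)
  qed
  have uM: "tens n S u" "ginv S u" "harm S u" using u by (auto simp: M_def)
  obtain f where f: "u f \<noteq> 0" using u by auto
  have "(\<Sum>i\<in>A. (of_nat n - e) * u f + (\<Sum>k\<in>S - {i}. pact (transpose i k) u f)) = 0"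
    using casimir[OF S(1) uM] AS by (intro sum.neutral) auto
  also have "(\<Sum>i\<in>A. (of_nat n - e) * u f + (\<Sum>k\<in>S - {i}. pact (transpose i k) u f)) =
     (\<Sum>i\<in>A. (of_nat n - e) * u f + - (of_nat (card A) - 1) * u f + (\<Sum>k\<in>S - A. pact (transpose k i) u f))"
  proof (rule sum.cong[OF refl])
    fix i assume i: "i \<in> A"
    have "S - {i} = (A - {i}) \<union> (S - A)" using AS i by auto
    then have "(\<Sum>k\<in>S - {i}. pact (transpose i k) u f) = (\<Sum>k\<in>A - {i}. pact (transpose i k) u f) + (\<Sum>k\<in>S - A. pact (transpose i k) u f)"
      using S fA by (auto intro: sum.union_disjoint)
    also have "(\<Sum>k\<in>A - {i}. pact (transpose i k) u f) = (\<Sum>k\<in>A - {i}. - u f)"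
      using u(3) i unfolding csym_def by (intro sum.cong) auto
    also have "\<dots> = - (of_nat (card A) - 1) * u f"
      using i fA card_gt_0_iff[of A] by (auto simp: card_Diff_singleton of_nat_diff Suc_le_eq left_diff_distrib)
    finally show "(of_nat n - e) * u f + (\<Sum>k\<in>S - {i}. pact (transpose i k) u f) =
      (of_nat n - e) * u f + - (of_nat (card A) - 1) * u f + (\<Sum>k\<in>S - A. pact (transpose k i) u f)"
      by (simp add: transpose_commute)
  qed
  also have "\<dots> = of_nat (card A) * ((of_nat n - e) * u f + - (of_nat (card A) - 1) * u f) + (\<Sum>k\<in>S - A. \<Sum>i\<in>A. pact (transpose k i) u f)"
    unfolding sum.distrib[of "\<lambda>i. (of_nat n - e) * u f + - (of_nat (card A) - 1) * u f"] by (simp add: sum.swap[of _ A])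
  also have "(\<Sum>k\<in>S - A. \<Sum>i\<in>A. pact (transpose k i) u f) = of_nat (card (S - A)) * u f"
    using mv by simp
  finally have "(of_nat (card A) * (of_nat n - e - of_nat (card A) + 1) + of_nat (card (S - A))) * u f = 0"
    by (simp add: algebra_simps)
  then have eq: "of_nat (card A) * (of_nat n - e - of_nat (card A) + 1) + of_nat (card (S - A)) = (0::complex)" using f by simp
  have le: "card A \<le> n" using antis_card_le[OF uM(1) u(3) AS fA u(2)] .
  from e_cases show False
  proof
    \<comment> \<open>Here n + 2 - |A| is positive, so A and S - A are both empty.\<close>
    assume e: "e = -1"
    have c: "of_nat (n + 2 - card A) = (of_nat n + 2 - of_nat (card A) :: complex)" using le by (simp add: of_nat_diff)
    have "of_nat (card A * (n + 2 - card A) + card (S - A)) = (0::complex)"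
      unfolding of_nat_add of_nat_mult c[unfolded of_nat_add] c using eq e by (simp add: algebra_simps)
    then have "card A * (n + 2 - card A) + card (S - A) = 0" unfolding of_nat_eq_0_iff .
    then have "card A = 0" "card (S - A) = 0" using le by auto
    then show False using S fA AS by auto
  next
    \<comment> \<open>Both summands vanish: A is all of S and, being nonempty, has exactly n
      slots.\<close>
    assume e: "e = 1"
    have "of_nat (card A * (n - card A) + card (S - A)) = (0::complex)"
      unfolding of_nat_add of_nat_mult of_nat_diff[OF le] using eq e by (simp add: algebra_simps)
    then have z: "card A * (n - card A) + card (S - A) = 0" unfolding of_nat_eq_0_iff .
    then have SA: "S = A" using S AS by auto
    then have cA: "card A = n" "n > 0" using z le S fA card_gt_0_iff[of A] by auto
    let ?g = "\<lambda>x y. if x = y \<and> x < n then (if x = 0 then -1 else 1) else (0::complex)"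
    have "u = (\<lambda>f. 0)"
    proof (rule tens_eqI[OF uM(1) tens_null])
      fix f assume f: "f \<in> Ix n S"
      show "u f = 0"
      proof (cases "inj_on f A")
        case False
        then show ?thesis using antis_zero[OF u(3)] by (auto simp: inj_on_def)
      next
        case True
        have "f ` A \<subseteq> {..<n}" using Ix_lt[OF f] SA by auto
        then have img: "f ` A = {..<n}" using card_image[OF True] cA by (intro card_subset_eq) auto
        \<comment> \<open>An f that is injective on n slots takes the value 0 exactly once, so the
          reflection in the first coordinate acts on this entry by -1.\<close>
        have "gprod S ?g f v = (if v = f then -1 else 0)" if v: "v \<in> Ix n S" for v
        proof (cases "v = f")
          case True
          have "gprod S ?g f f = (\<Prod>k\<in>A. if f k = 0 then -1 else 1)"
            unfolding gprod_def SA[symmetric] using Ix_lt[OF f] by (intro prod.cong) auto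
          also have "\<dots> = (\<Prod>x\<in>f ` A. if x = 0 then -1 else 1)"
            using \<open>inj_on f A\<close> by (simp add: prod.reindex)
          also have "\<dots> = -1" unfolding img using cA by (simp add: prod.delta)
          finally show ?thesis using True by simp
        next
          case False
          then obtain k where "k \<in> S" "f k \<noteq> v k" using Ix_eq_iff[OF v f] by metis
          then show ?thesis using False S unfolding gprod_def by (auto intro!: prod_zero bexI[of _ k])
        qed
        then have "gact n S ?g u f = (\<Sum>v\<in>Ix n S. if v = f then - u v else 0)"
          unfolding gact_def by (intro sum.cong) auto
        also have "\<dots> = - u f" using f finite_Ix[OF S(1)] by simp
        finally have "u f = - u f" using uM(2) g_refl[OF e cA(2)] by (simp add: ginv_def)
        then show ?thesis by simp
      qed
    qed
    then show False using u by simp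
  qed
qed

end

section \<open>Matchings and the first fundamental theorem\<close>

lemma fspan_mem: "s \<in> A \<Longrightarrow> s \<in> fspan A"
  unfolding fspan_def by (intro CollectI exI[of _ 1] exI[of _ "\<lambda>_. 1"] exI[of _ "\<lambda>_. s"]) simp

lemma subsp_fspan: "subsp (fspan A)"
  unfolding subsp_def
proof (intro conjI ballI allI)
  show "(\<lambda>x. 0) \<in> fspan A" unfolding fspan_def by (intro CollectI exI[of _ 0]) simp
next
  fix u v assume "u \<in> fspan A" "v \<in> fspan A"
  then obtain k c s l d t where u: "u = (\<lambda>x. \<Sum>i<(k::nat). c i * s i x)" "\<forall>i<k. s i \<in> A"
    and v: "v = (\<lambda>x. \<Sum>i<(l::nat). d i * t i x)" "\<forall>i<l. t i \<in> A" unfolding fspan_def by blast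
  define c' where "c' = (\<lambda>i. if i < k then c i else d (i - k))"
  define s' where "s' = (\<lambda>i. if i < k then s i else t (i - k))"
  have "(\<Sum>i<k + l. c' i * s' i x) = (\<Sum>i<k. c i * s i x) + (\<Sum>i<l. d i * t i x)" for x
  proof -
    have "(\<Sum>i<k + l. c' i * s' i x) = (\<Sum>i<k. c' i * s' i x) + (\<Sum>i<l. c' (i + k) * s' (i + k) x)"
      by (induction l) (auto simp: add_ac)
    then show ?thesis by (simp add: c'_def s'_def)
  qed
  then have "(\<lambda>x. u x + v x) = (\<lambda>x. \<Sum>i<k + l. c' i * s' i x)" by (simp add: u v)
  moreover have "\<forall>i<k + l. s' i \<in> A" using u v by (auto simp: s'_def)
  ultimately show "(\<lambda>x. u x + v x) \<in> fspan A" unfolding fspan_def by blast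
next
  fix a u assume "u \<in> fspan A"
  then obtain k c s where u: "u = (\<lambda>x. \<Sum>i<(k::nat). c i * s i x)" "\<forall>i<k. s i \<in> A" unfolding fspan_def by blast
  have "(\<lambda>x. a * u x) = (\<lambda>x. \<Sum>i<k. (a * c i) * s i x)" by (simp add: u sum_distrib_left mult.assoc)
  then show "(\<lambda>x. a * u x) \<in> fspan A" using u(2) unfolding fspan_def
    by (intro CollectI exI[of _ k] exI[of _ "\<lambda>i. a * c i"] exI[of _ s]) simp
qed

lemma fspan_induct [consumes 1, case_names zero add]:
  assumes "u \<in> fspan A" "P (\<lambda>x. 0)" "\<And>c s u. s \<in> A \<Longrightarrow> P u \<Longrightarrow> P (\<lambda>x. u x + c * s x)"
  shows "P u"
proof -
  obtain k c s where u: "u = (\<lambda>x. \<Sum>i<(k::nat). c i * s i x)" "\<forall>i<k. s i \<in> A"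
    using assms(1) unfolding fspan_def by blast
  have "P (\<lambda>x. \<Sum>i<j. c i * s i x)" if "j \<le> k" for j
    using that by (induction j) (use assms(2,3) u(2) in auto)
  then show ?thesis using u(1) by simp
qed

context bform
begin

definition bprod :: "('k \<times> 'k) list \<Rightarrow> ('k \<Rightarrow> nat) \<Rightarrow> complex" where
  "bprod ps h = prod_list (map (\<lambda>(i, j). b (h i) (h j)) ps)"

definition matching :: "'k set \<Rightarrow> ('k \<times> 'k) list \<Rightarrow> bool" where
  "matching S ps \<longleftrightarrow> distinct (map fst ps @ map snd ps) \<and> set (map fst ps @ map snd ps) = S"

text \<open>The pairs come in every order and orientation; this changes products of b at most by a
  sign, so the span is that of the perfect matchings.\<close>

definition match :: "'k set \<Rightarrow> (('k \<Rightarrow> nat) \<Rightarrow> complex) set" where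
  "match S = {bprod ps | ps. matching S ps}"

lemma bprod_Cons: "bprod ((i, j) # ps) = ins i j (bprod ps)"
  by (simp add: bprod_def ins_def fun_eq_iff)

lemma bprod_middle: "bprod (as @ (i, j) # bs) = ins i j (bprod (as @ bs))"
  by (simp add: bprod_def ins_def fun_eq_iff)

lemma matching_Cons:
  assumes "matching S ((i, j) # ps)"
  obtains R where "matching R ps" "S = insert i (insert j R)" "i \<notin> R" "j \<notin> R" "i \<noteq> j"
  using assms that[of "set (map fst ps @ map snd ps)"] unfolding matching_def by auto

lemma matching_middle:
  assumes "matching S (as @ (i, j) # bs)"
  shows "matching (S - {i, j}) (as @ bs)" "i \<in> S" "j \<in> S" "i \<noteq> j"
  using assms unfolding matching_def by auto

lemma tens_bprod: "matching S ps \<Longrightarrow> tens n S (bprod ps)"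
proof (induction ps arbitrary: S)
  case Nil then show ?case by (auto simp: matching_def tens_def bprod_def)
next
  case (Cons ij ps)
  obtain i j where [simp]: "ij = (i, j)" by (cases ij)
  obtain R where R: "matching R ps" "S = insert i (insert j R)" "i \<notin> R" "j \<notin> R" "i \<noteq> j"
    using Cons.prems by (auto elim: matching_Cons)
  show ?case using ins_tens[OF Cons.IH[OF R(1)]] R by (simp add: bprod_Cons)
qed

lemma ins_match_span:
  assumes "v \<in> fspan (match R)" "i \<notin> R" "j \<notin> R" "i \<noteq> j"
  shows "ins i j v \<in> fspan (match (insert i (insert j R)))"
  using assms(1)
proof (induction rule: fspan_induct)
  case zero then show ?case by (simp add: ins_def subsp_zero[OF subsp_fspan])
next
  case (add c s u)
  obtain ps where ps: "matching R ps" "s = bprod ps" using add(1) by (auto simp: match_def)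
  have "matching (insert i (insert j R)) ((i, j) # ps)"
    using ps(1) assms unfolding matching_def by auto
  then have "ins i j s \<in> match (insert i (insert j R))" unfolding match_def ps(2) bprod_Cons[symmetric] by blast
  then have "(\<lambda>f. ins i j u f + c * ins i j s f) \<in> fspan (match (insert i (insert j R)))"
    by (intro subsp_add[OF subsp_fspan] subsp_scale[OF subsp_fspan] add fspan_mem)
  then show ?case by (simp add: ins_def distrib_left mult.left_commute)
qed

lemma tens_match_span: "u \<in> fspan (match S) \<Longrightarrow> tens n S u"
  by (induction rule: fspan_induct) (auto simp: tens_null match_def intro!: tens_add tens_scale tens_bprod)

end

context bgroup
begin

lemma ginv_ins:
  assumes "finite S" "i \<notin> S" "j \<notin> S" "i \<noteq> j" "ginv S t" "tens n S t"
  shows "ginv (insert i (insert j S)) (ins i j t)"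
  unfolding ginv_def
proof
  fix g assume g: "g \<in> Gr"
  let ?S = "insert i (insert j S)"
  show "gact n ?S g (ins i j t) = ins i j t"
  proof (rule tens_eqI[of n ?S])
    show "tens n ?S (gact n ?S g (ins i j t))" using assms g by (intro gact_tens') auto
    show "tens n ?S (ins i j t)" using assms(6) by (rule ins_tens)
    fix f assume f: "f \<in> Ix n ?S"
    have "t (u(j := y, i := x)) = t u" for u x y using assms by (intro tens_cong[OF assms(6)]) auto
    then have "ins i j t (u(j := y, i := x)) = b x y * t u" for u x y
      unfolding ins_def using assms(4) by simp
    then have "gact n ?S g (ins i j t) f = (\<Sum>x<n. g (f i) x * (\<Sum>y<n. g (f j) y * (b x y * gact n S g t f)))"
      using assms by (simp add: gact_insert gact_scale)
    also have "\<dots> = (\<Sum>x<n. \<Sum>y<n. b x y * (g (f i) x * g (f j) y)) * t f"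
      using assms(5) g by (simp add: ginv_def sum_distrib_left sum_distrib_right mult_ac)
    also have "\<dots> = ins i j t f" using g_inv'[OF g] Ix_lt[OF f] by (simp add: ins_def)
    finally show "gact n ?S g (ins i j t) f = ins i j t f" .
  qed
qed

lemma ginv_bprod: "matching S ps \<Longrightarrow> ginv S (bprod ps)"
proof (induction ps arbitrary: S)
  case Nil then show ?case by (auto simp: matching_def ginv_def bprod_def gact_empty)
next
  case (Cons ij ps)
  obtain i j where [simp]: "ij = (i, j)" by (cases ij)
  obtain R where R: "matching R ps" "S = insert i (insert j R)" "i \<notin> R" "j \<notin> R" "i \<noteq> j"
    using Cons.prems by (auto elim: matching_Cons)
  have "finite R" using R(1) unfolding matching_def by (metis List.finite_set)
  then show ?case using ginv_ins[OF _ R(3,4,5) Cons.IH[OF R(1)] tens_bprod[OF R(1)]] R by (simp add: bprod_Cons)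
qed

lemma ginv_match_span: "u \<in> fspan (match S) \<Longrightarrow> ginv S u"
proof (induction rule: fspan_induct)
  case zero then show ?case by (simp add: ginv_def gact_def)
next
  case (add c s u)
  then have "ginv S s" by (auto simp: match_def ginv_bprod)
  then show ?case using add by (simp add: ginv_def gact_add gact_scale)
qed

text \<open>Subtract the projection onto the span of the matchings. A contraction of the remainder h
  is invariant with two slots fewer, hence by induction a combination of matchings; its insertion
  lies in the span and is orthogonal to h, so by adjunction the contraction has norm zero. Thus h is
  harmonic and invariant, and it vanishes unless there are no slots at all.\<close>

theorem first_fundamental_theorem:
  assumes "finite S" "tens n S t" "ginv S t"
  shows "t \<in> fspan (match S)"
  using assms
proof (induction "card S" arbitrary: S t rule: less_induct)
  case less
  obtain u where u: "u \<in> fspan (match S)" "\<And>v. v \<in> fspan (match S) \<Longrightarrow> fip (Ix n S) (\<lambda>f. t f - u f) v = 0"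
    using orthogonal_decomposition[OF finite_Ix[OF less.prems(1), of n] subsp_fspan[of "match S"], of t] by blast
  define h where "h = (\<lambda>f. t f - u f)"
  have h: "tens n S h" "ginv S h"
    unfolding h_def using less.prems tens_match_span[OF u(1)] ginv_match_span[OF u(1)]
    by (auto simp: tens_diff ginv_def gact_diff)
  have "harm S h" unfolding harm_def
  proof (intro ballI impI)
    fix i j assume ij: "i \<in> S" "j \<in> S" "i \<noteq> j"
    define R where "R = S - {i, j}"
    have R: "S = insert i (insert j R)" "i \<notin> R" "j \<notin> R" "finite R" using ij less.prems(1) by (auto simp: R_def)
    have q: "tens n R (ctr i j h)" using h(1) R by (intro ctr_tens) auto
    have "ginv R (ctr i j h)" unfolding ginv_def
    proof
      fix g assume "g \<in> Gr"
      then show "gact n R g (ctr i j h) = ctr i j h"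
        using ctr_gact[OF ij(3) R(2,3,4), of g h] h(2) R(1) by (simp add: ginv_def)
    qed
    moreover have "card R < card S" unfolding R_def using ij less.prems(1) by (intro psubset_card_mono) auto
    ultimately have "ctr i j h \<in> fspan (match R)" using less.hyps[of R "ctr i j h"] q R(4) by blast
    then have "ins i j (ctr i j h) \<in> fspan (match S)" using ins_match_span[OF _ R(2,3) ij(3)] R(1) by simp
    then have "fip (Ix n S) h (ins i j (ctr i j h)) = 0" using u(2) by (simp add: h_def)
    then have "fip (Ix n R) (ctr i j h) (ctr i j h) = 0"
      using fip_ctr[OF h(1)[unfolded R(1)] q ij(3) R(2,3,4)] R(1) by simp
    then show "ctr i j h = (\<lambda>f. 0)" using tens_fip_zero[OF R(4) q] by simp
  qed
  show ?case
  proof (cases "S = {}")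
    case True
    have "bprod [] \<in> match S" unfolding match_def using True by (auto simp: matching_def intro!: exI[of _ "[]"])
    then have "(\<lambda>f. t (\<lambda>_. undefined) * bprod [] f) \<in> fspan (match S)"
      by (intro subsp_scale[OF subsp_fspan] fspan_mem)
    moreover have "t f = t (\<lambda>_. undefined)" for f using True by (intro tens_cong[OF less.prems(2)]) auto
    then have "t = (\<lambda>f. t (\<lambda>_. undefined) * bprod [] f)" by (auto simp: bprod_def)
    ultimately show ?thesis by simp
  next
    case False
    then have "h = (\<lambda>f. 0)" using harmonic_invariant_zero[OF less.prems(1) _ h \<open>harm S h\<close>] by blast
    then have "t = u" by (auto simp: h_def fun_eq_iff)
    then show ?thesis using u(1) by simp
  qed
qed

section \<open>The double commutant argument\<close>

text \<open>For D = \<open>{..<d}\<close> this is the model of the degree d component modulo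
  multiples of the quadric.\<close>

definition HH :: "'k set \<Rightarrow> (('k \<Rightarrow> nat) \<Rightarrow> ('k \<Rightarrow> nat) \<Rightarrow> complex) \<Rightarrow> bool" where
  "HH D X \<longleftrightarrow> (\<forall>u. tens n D (\<lambda>f. X f u)) \<and> (\<forall>f. tens n D (X f)) \<and> (\<forall>u. harm D (\<lambda>f. X f u)) \<and> (\<forall>f. harm D (X f))
     \<and> (\<forall>p f u. p permutes D \<longrightarrow> X (f \<circ> p) (u \<circ> p) = X f u)"

lemma traceless_pairing:
  assumes D: "finite D" "i \<in> D" "j \<in> D" "i \<noteq> j" and z: "tens n D z" "harm D z" and q: "tens n (D - {i, j}) q"
  shows "(\<Sum>v\<in>Ix n D. z v * (b (v i) (v j) * q v)) = 0"
proof -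
  define R where "R = D - {i, j}"
  have R: "D = insert i (insert j R)" "i \<notin> R" "j \<notin> R" "finite R" using D by (auto simp: R_def)
  have "(\<Sum>v\<in>Ix n D. z v * (b (v i) (v j) * q v)) = fip (Ix n D) z (ins i j (\<lambda>v. cnj (q v)))"
    by (simp add: fip_def ins_def b_real)
  also have "\<dots> = fip (Ix n R) (ctr i j z) (\<lambda>v. cnj (q v))"
    using fip_ctr[OF z(1)[unfolded R(1)] tens_cnj[OF q[folded R_def]] D(4) R(2,3,4), folded R(1)] by simp
  also have "ctr i j z = (\<lambda>f. 0)" using z(2) D by (simp add: harm_def)
  finally show ?thesis by (simp add: fip_def)
qed

text \<open>Reads a tensor on two copies of D as an operator. The second copy is paired through b,
  since g acts on both copies in the same way whereas an operator needs the inverse transpose on one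
  side.\<close>

definition diag_op :: "'k set \<Rightarrow> (('k + 'k \<Rightarrow> nat) \<Rightarrow> complex) \<Rightarrow> ('k \<Rightarrow> nat) \<Rightarrow> ('k \<Rightarrow> nat) \<Rightarrow> complex" where
  "diag_op D p f v = (\<Sum>w\<in>Ix n D. p (case_sum f w) * gprod D b v w)"

text \<open>A pair inside the left copy makes each column of the operator an insertion, and
  insertions pair to zero with harmonic tensors. \<open>diag_op_right_pair\<close> is the mirror
  image, where \<open>b_conj\<close> carries the pair through the copies of b.\<close>

lemma diag_op_left_pair:
  assumes D: "finite D" and p: "tens n ((D <+> D) - {Inl i, Inl j}) p'" and "p = ins (Inl i) (Inl j) p'"
    and ij: "i \<in> D" "j \<in> D" "i \<noteq> j" and z: "tens n D z" "harm D z"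
  shows "(\<Sum>v\<in>Ix n D. z v * diag_op D p v u) = 0"
proof -
  define q where "q = (\<lambda>v. \<Sum>w\<in>Ix n D. p' (case_sum v w) * gprod D b u w)"
  have "diag_op D p v u = b (v i) (v j) * q v" for v
    by (simp add: diag_op_def q_def assms(3) ins_def sum_distrib_left mult.assoc)
  moreover have "tens n (D - {i, j}) q" unfolding q_def
  proof (intro tens_sum)
    fix w assume "w \<in> Ix n D"
    have 1: "p' (case_sum v w) = p' (case_sum v' w)" if "\<forall>k\<in>D - {i, j}. v k = v' k" for v v'
      using that by (intro tens_cong[OF p]) auto
    have 2: "p' (case_sum v w) = 0" if "k \<in> D - {i, j}" "n \<le> v k" for v k
      using that by (intro tens_zero[OF p, of "Inl k"]) auto
    show "tens n (D - {i, j}) (\<lambda>v. p' (case_sum v w) * gprod D b u w)" unfolding tens_def using 1 2 by fastforce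
  qed
  ultimately show ?thesis using traceless_pairing[OF D ij z] by simp
qed

lemma b_conj: "x < n \<Longrightarrow> y < n \<Longrightarrow> (\<Sum>p<n. \<Sum>q<n. b p q * (b x p * b y q)) = b x y"
proof -
  assume xy: "x < n" "y < n"
  have "(\<Sum>p<n. \<Sum>q<n. b p q * (b x p * b y q)) = (\<Sum>p<n. \<Sum>q<n. b p q * (b y q * b x p))"
    by (simp add: mult.commute)
  also have "\<dots> = b x y" using b_contract1[OF xy(2), of "\<lambda>p. b x p"] .
  finally show ?thesis .
qed

lemma diag_op_right_pair:
  assumes D: "finite D" and p: "tens n ((D <+> D) - {Inr i, Inr j}) p'" and "p = ins (Inr i) (Inr j) p'"
    and ij: "i \<in> D" "j \<in> D" "i \<noteq> j" and z: "tens n D z" "harm D z"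
  shows "(\<Sum>v\<in>Ix n D. diag_op D p f v * z v) = 0"
proof -
  define R where "R = D - {i, j}"
  have R: "D = insert i (insert j R)" "i \<notin> R" "j \<notin> R" "finite R" using D ij by (auto simp: R_def)
  define q where "q = (\<lambda>v. \<Sum>w\<in>Ix n R. p' (case_sum f w) * gprod R b v w)"
  have dq: "diag_op D p f v = b (v i) (v j) * q v" if v: "v \<in> Ix n D" for v
  proof -
    have g: "gprod D b v (w(j := y, i := x)) = b (v i) x * (b (v j) y * gprod R b v w)" for w x y
    proof -
      have "gprod D b v (w(j := y, i := x)) = b (v i) x * (b (v j) y * (\<Prod>k\<in>R. b (v k) ((w(j := y, i := x)) k)))"
        unfolding gprod_def R(1) using R ij by simp
      also have "(\<Prod>k\<in>R. b (v k) ((w(j := y, i := x)) k)) = gprod R b v w"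
        unfolding gprod_def using R by (intro prod.cong) auto
      finally show ?thesis .
    qed
    have pp: "p (case_sum f (w(j := y, i := x))) = b x y * p' (case_sum f w)" for w x y
    proof -
      have "p' (case_sum f (w(j := y, i := x))) = p' (case_sum f w)" by (intro tens_cong[OF p]) (auto split: if_splits)
      then show ?thesis using ij by (simp add: assms(3) ins_def)
    qed
    have "diag_op D p f v = (\<Sum>x<n. \<Sum>y<n. \<Sum>w\<in>Ix n R. p (case_sum f (w(j := y, i := x))) * gprod D b v (w(j := y, i := x)))"
      unfolding diag_op_def by (subst (1) R(1)) (simp add: sum_Ix_insert R ij)
    also have "\<dots> = (\<Sum>x<n. \<Sum>y<n. b x y * (b (v i) x * b (v j) y) * q v)"
      unfolding g pp q_def sum_distrib_left by (intro sum.cong refl) (simp add: mult_ac)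
    also have "\<dots> = b (v i) (v j) * q v"
      unfolding sum_distrib_right[symmetric] using b_conj[of "v i" "v j"] Ix_lt[OF v] ij by simp
    finally show ?thesis .
  qed
  have tq: "tens n (D - {i, j}) q" unfolding q_def R_def[symmetric]
  proof (intro tens_sum tens_scale)
    fix w
    have 1: "gprod R b v w = gprod R b v' w" if "\<forall>k\<in>R. v k = v' k" for v v' using that by (intro gprod_cong) auto
    have 2: "gprod R b v w = 0" if "k \<in> R" "n \<le> v k" for v k
      unfolding gprod_def using that R(4) by (auto intro!: prod_zero bexI[of _ k] simp: b_zero)
    show "tens n R (\<lambda>v. gprod R b v w)" unfolding tens_def using 1 2 by blast
  qed
  have "(\<Sum>v\<in>Ix n D. diag_op D p f v * z v) = (\<Sum>v\<in>Ix n D. z v * (b (v i) (v j) * q v))"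
    by (intro sum.cong refl) (simp add: dq mult.commute)
  also have "\<dots> = 0" using traceless_pairing[OF D ij z tq] .
  finally show ?thesis .
qed

text \<open>Each pair is turned so that its slot in the left copy comes first; a turn costs a factor
  e, and these are collected in s.\<close>

lemma crossing_bprod:
  assumes "\<forall>(x, y)\<in>set ps. isl x \<noteq> isl y"
  shows "\<exists>s qs. (\<forall>h. bprod ps h = s * prod_list (map (\<lambda>(i, j). b (h (Inl i)) (h (Inr j))) qs)) \<and>
     mset (map Inl (map fst qs) @ map Inr (map snd qs)) = mset (map fst ps @ map snd ps)"
  using assms
proof (induction ps)
  case Nil then show ?case by (intro exI[of _ 1] exI[of _ "[]"]) (simp add: bprod_def)
next
  case (Cons xy ps)
  obtain s qs where IH: "\<And>h. bprod ps h = s * prod_list (map (\<lambda>(i, j). b (h (Inl i)) (h (Inr j))) qs)"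
     "mset (map Inl (map fst qs) @ map Inr (map snd qs)) = mset (map fst ps @ map snd ps)"
    using Cons by auto
  obtain x y where [simp]: "xy = (x, y)" by (cases xy)
  have "isl x \<noteq> isl y" using Cons.prems by simp
  then consider i j where "x = Inl i" "y = Inr j" | i j where "x = Inr j" "y = Inl i"
    by (cases x; cases y) auto
  then show ?case
  proof cases
    case 1
    show ?thesis using IH 1
      by (intro exI[of _ s] exI[of _ "(i, j) # qs"]) (auto simp: bprod_Cons ins_def)
  next
    case 2
    show ?thesis using IH 2
      by (intro exI[of _ "s * e"] exI[of _ "(i, j) # qs"]) (auto simp: bprod_Cons ins_def b_sym[of "_ (Inr j)" "_ (Inl i)"])
  qed
qed

text \<open>A matching whose pairs all join the two copies is the graph of a permutation.\<close>

lemma crossing_matching: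
  assumes m: "matching (D <+> D) ps" and c: "\<forall>(x, y)\<in>set ps. isl x \<noteq> isl y" and D: "finite D"
  obtains s \<tau> where "\<tau> permutes D" "\<And>h. bprod ps h = s * (\<Prod>k\<in>D. b (h (Inl k)) (h (Inr (\<tau> k))))"
proof -
  obtain s qs where qs: "\<And>h. bprod ps h = s * prod_list (map (\<lambda>(i, j). b (h (Inl i)) (h (Inr j))) qs)"
     "mset (map Inl (map fst qs) @ map Inr (map snd qs)) = mset (map fst ps @ map snd ps)"
    using crossing_bprod[OF c] by blast
  have dis: "distinct (map Inl (map fst qs) @ map Inr (map snd qs))"
    using m qs(2) mset_eq_imp_distinct_iff unfolding matching_def by blast
  have st: "set (map Inl (map fst qs) @ map Inr (map snd qs)) = D <+> D"
    using m mset_eq_setD[OF qs(2)] unfolding matching_def by simp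
  note dis' = dis[unfolded distinct_append]
  have d1: "distinct (map fst qs)" by (rule conjunct1[OF distinct_map[THEN iffD1, OF conjunct1[OF dis']]])
  have d2: "distinct (map snd qs)" by (rule conjunct1[OF distinct_map[THEN iffD1, OF conjunct1[OF conjunct2[OF dis']]]])
  have s1: "set (map fst qs) = D"
  proof (intro equalityI subsetI)
    fix x assume "x \<in> set (map fst qs)"
    then have "(Inl x :: 'a + 'a) \<in> D <+> D" unfolding st[symmetric] by auto
    then show "x \<in> D" by auto
  next
    fix x assume "x \<in> D"
    then have "(Inl x :: 'a + 'a) \<in> D <+> D" by auto
    then show "x \<in> set (map fst qs)" unfolding st[symmetric] by auto
  qed
  have s2: "set (map snd qs) = D"
  proof (intro equalityI subsetI)
    fix x assume "x \<in> set (map snd qs)"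
    then have "(Inr x :: 'a + 'a) \<in> D <+> D" unfolding st[symmetric] by auto
    then show "x \<in> D" by auto
  next
    fix x assume "x \<in> D"
    then have "(Inr x :: 'a + 'a) \<in> D <+> D" by auto
    then show "x \<in> set (map snd qs)" unfolding st[symmetric] by auto
  qed
  define \<tau> where "\<tau> = (\<lambda>k. if k \<in> D then the (map_of qs k) else k)"
  have \<tau>: "\<tau> i = j" if "(i, j) \<in> set qs" for i j
    using that d1 s1 by (force simp: \<tau>_def)
  have inj: "inj_on \<tau> D"
  proof (rule inj_onI)
    fix i i' assume "i \<in> D" "i' \<in> D" "\<tau> i = \<tau> i'"
    moreover from this obtain j j' where "(i, j) \<in> set qs" "(i', j') \<in> set qs" unfolding s1[symmetric] by auto
    ultimately show "i = i'" using \<tau> d2 by (metis distinct_map inj_onD prod.inject snd_conv)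
  qed
  have "\<tau> ` D \<subseteq> D"
  proof
    fix y assume "y \<in> \<tau> ` D"
    then obtain i j where "(i, j) \<in> set qs" "y = \<tau> i" unfolding s1[symmetric] by auto
    then show "y \<in> D" using \<tau> s2 by force
  qed
  then have "bij_betw \<tau> D D" using inj D by (simp add: bij_betw_def endo_inj_surj)
  then have per: "\<tau> permutes D" by (rule bij_imp_permutes) (simp add: \<tau>_def)
  have "prod_list (map (\<lambda>(i, j). b (h (Inl i)) (h (Inr j))) qs) = (\<Prod>k\<in>D. b (h (Inl k)) (h (Inr (\<tau> k))))" for h
  proof -
    have eq: "map (\<lambda>(i, j). b (h (Inl i)) (h (Inr j))) qs = map (\<lambda>k. b (h (Inl k)) (h (Inr (\<tau> k)))) (map fst qs)"
      using \<tau> by auto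
    show ?thesis unfolding eq prod.distinct_set_conv_list[OF d1, symmetric] s1 ..
  qed
  then show ?thesis by (intro that[OF per, of s]) (simp add: qs(1))
qed

text \<open>The copies have equally many slots, so pairs inside one copy are balanced by pairs
  inside the other. Weighting slots by +1 on the left and -1 on the right makes the total zero, and
  without pairs in one of the copies all summands have the same sign.\<close>

lemma matching_unbalanced:
  assumes m: "matching (D <+> D) ps" and D: "finite D" and nc: "\<not> (\<forall>(x, y)\<in>set ps. isl x \<noteq> isl y)"
  shows "(\<exists>i j. (Inl i, Inl j) \<in> set ps) \<and> (\<exists>i j. (Inr i, Inr j) \<in> set ps)"
proof -
  define \<sigma> :: "'a + 'a \<Rightarrow> int" where "\<sigma> = (\<lambda>x. if isl x then 1 else -1)"
  have "sum_list (map \<sigma> (map fst ps @ map snd ps)) = (\<Sum>x\<in>D <+> D. \<sigma> x)"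
    using m sum.distinct_set_conv_list[of "map fst ps @ map snd ps" \<sigma>] unfolding matching_def by auto
  also have "\<dots> = 0" using D by (simp add: sum.Plus \<sigma>_def)
  finally have z: "(\<Sum>(x, y)\<leftarrow>ps. \<sigma> x + \<sigma> y) = 0"
    by (simp add: sum_list_addf[symmetric] case_prod_unfold comp_def)
  have "\<exists>i j. (Inr i, Inr j) \<in> set ps"
  proof (rule ccontr)
    assume no: "\<nexists>i j. (Inr i, Inr j) \<in> set ps"
    have nn: "0 \<le> \<sigma> x + \<sigma> y" if "(x, y) \<in> set ps" for x y
      using no that by (cases x; cases y) (auto simp: \<sigma>_def)
    then have "\<forall>v\<in>set (map (\<lambda>(x, y). \<sigma> x + \<sigma> y) ps). v = 0"
      using z by (subst sum_list_nonneg_eq_0_iff[symmetric]) auto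
    then have "\<forall>(x, y)\<in>set ps. isl x \<noteq> isl y" by (fastforce simp: \<sigma>_def split: if_splits)
    then show False using nc by simp
  qed
  moreover have "\<exists>i j. (Inl i, Inl j) \<in> set ps"
  proof (rule ccontr)
    assume no: "\<nexists>i j. (Inl i, Inl j) \<in> set ps"
    have nn: "0 \<le> - (\<sigma> x + \<sigma> y)" if "(x, y) \<in> set ps" for x y
      using no that by (cases x; cases y) (auto simp: \<sigma>_def)
    have "(\<Sum>(x, y)\<leftarrow>ps. - (\<sigma> x + \<sigma> y)) = - (\<Sum>(x, y)\<leftarrow>ps. \<sigma> x + \<sigma> y)"
      by (induction ps) auto
    then have "\<forall>v\<in>set (map (\<lambda>(x, y). - (\<sigma> x + \<sigma> y)) ps). v = 0"
      using z nn by (subst sum_list_nonneg_eq_0_iff[symmetric]) auto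
    then have "\<forall>(x, y)\<in>set ps. isl x \<noteq> isl y" by (fastforce simp: \<sigma>_def split: if_splits)
    then show False using nc by simp
  qed
  ultimately show ?thesis by simp
qed

lemma gprod_b_orth:
  assumes "finite D" "v \<in> Ix n D" "v' \<in> Ix n D"
  shows "(\<Sum>w\<in>Ix n D. gprod D b v w * gprod D b v' w) = (if v = v' then 1 else 0)"
proof -
  have "(\<Sum>w\<in>Ix n D. gprod D b v w * gprod D b v' w) = (\<Prod>k\<in>D. \<Sum>x<n. b (v k) x * b (v' k) x)"
    unfolding gprod_def prod.distrib[symmetric] by (rule sum_Ix_prod[OF assms(1)])
  also have "\<dots> = (\<Prod>k\<in>D. if v k = v' k then 1 else 0)"
    using Ix_lt[OF assms(2)] Ix_lt[OF assms(3)] by (intro prod.cong) (auto simp: b_orth)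
  also have "\<dots> = (if v = v' then 1 else 0)"
    unfolding prod_indicator[OF assms(1)] using Ix_eq_iff[OF assms(2,3)] by auto
  finally show ?thesis .
qed

lemma comp_permutes_Ix: "finite D \<Longrightarrow> p permutes D \<Longrightarrow> f \<in> Ix n D \<Longrightarrow> f \<circ> p \<in> Ix n D"
  using closed_ix_Ix[of D n] by (auto simp: closed_ix_def)

text \<open>If some pair stays inside a copy, the products with Z in both orders are zero. Otherwise
  the operator is a multiple of a permutation of the slots, which commutes with Z because Z is
  invariant under simultaneous permutation.\<close>

lemma diag_op_commute:
  assumes D: "finite D" and Z: "HH D Z" and p: "p \<in> match (D <+> D)" and fu: "f \<in> Ix n D" "u \<in> Ix n D"
  shows "(\<Sum>v\<in>Ix n D. diag_op D p f v * Z v u) = (\<Sum>v\<in>Ix n D. Z f v * diag_op D p v u)"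
proof -
  obtain ps where ps: "matching (D <+> D) ps" "p = bprod ps" using p by (auto simp: match_def)
  show ?thesis
  proof (cases "\<forall>(x, y)\<in>set ps. isl x \<noteq> isl y")
    case False
    from matching_unbalanced[OF ps(1) D False] obtain i j i' j'
      where "(Inl i, Inl j) \<in> set ps" "(Inr i', Inr j') \<in> set ps" by blast
    then obtain as bs as' bs' where l: "ps = as @ (Inl i, Inl j) # bs" and r: "ps = as' @ (Inr i', Inr j') # bs'"
      by (meson split_list)
    note L = matching_middle[OF ps(1)[unfolded l]] and R = matching_middle[OF ps(1)[unfolded r]]
    have "(\<Sum>v\<in>Ix n D. Z f v * diag_op D p v u) = 0"
      using L Z by (intro diag_op_left_pair[OF D tens_bprod[OF L(1)]]) (auto simp: ps(2) l bprod_middle HH_def)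
    moreover have "(\<Sum>v\<in>Ix n D. diag_op D p f v * Z v u) = 0"
      using R Z by (intro diag_op_right_pair[OF D tens_bprod[OF R(1)]]) (auto simp: ps(2) r bprod_middle HH_def)
    ultimately show ?thesis by simp
  next
    case True
    obtain s \<tau> where \<tau>: "\<tau> permutes D" and bp: "\<And>h. bprod ps h = s * (\<Prod>k\<in>D. b (h (Inl k)) (h (Inr (\<tau> k))))"
      using crossing_matching[OF ps(1) True D] by blast
    have op: "diag_op D p f v = (if f = v \<circ> \<tau> then s else 0)" if fv: "f \<in> Ix n D" "v \<in> Ix n D" for f v
    proof -
      have "diag_op D p f v = (\<Sum>w\<in>Ix n D. s * (gprod D b f (w \<circ> \<tau>) * gprod D b v w))"
        by (simp add: diag_op_def ps(2) bp gprod_def mult.assoc)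
      also have "\<dots> = (\<Sum>w\<in>Ix n D. s * (gprod D b f (w \<circ> \<tau>) * gprod D b (v \<circ> \<tau>) (w \<circ> \<tau>)))"
        unfolding gprod_def using prod.permute[OF \<tau>, of "\<lambda>k. b (v k) (_ k)"] by simp
      also have "\<dots> = (\<Sum>w\<in>Ix n D. s * (gprod D b f w * gprod D b (v \<circ> \<tau>) w))"
        by (rule sum.reindex_bij_betw[OF bij_betw_closed_ix[OF closed_ix_Ix[OF D] \<tau>]])
      also have "\<dots> = s * (if f = v \<circ> \<tau> then 1 else 0)"
        unfolding sum_distrib_left[symmetric] gprod_b_orth[OF D fv(1) comp_permutes_Ix[OF D \<tau> fv(2)]] ..
      finally show ?thesis by simp
    qed
    have i\<tau>: "pinv \<tau> permutes D" using \<tau> by (rule permutes_inv)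
    have fe: "f = v \<circ> \<tau> \<longleftrightarrow> v = f \<circ> pinv \<tau>" for v
    proof
      assume "f = v \<circ> \<tau>" then show "v = f \<circ> pinv \<tau>" by (simp add: comp_assoc permutes_inv_o[OF \<tau>])
    next
      assume "v = f \<circ> pinv \<tau>" then show "f = v \<circ> \<tau>" by (simp add: comp_assoc permutes_inv_o[OF \<tau>])
    qed
    have "(\<Sum>v\<in>Ix n D. diag_op D p f v * Z v u) = (\<Sum>v\<in>Ix n D. if v = f \<circ> pinv \<tau> then s * Z v u else 0)"
      using fu by (intro sum.cong refl) (simp add: op fe)
    also have "\<dots> = s * Z (f \<circ> pinv \<tau>) u" using comp_permutes_Ix[OF D i\<tau> fu(1)] finite_Ix[OF D] by simp
    also have "Z (f \<circ> pinv \<tau>) u = Z ((f \<circ> pinv \<tau>) \<circ> \<tau>) (u \<circ> \<tau>)" using Z \<tau> unfolding HH_def by metis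
    also have "(f \<circ> pinv \<tau>) \<circ> \<tau> = f" by (simp add: comp_assoc permutes_inv_o[OF \<tau>])
    also have "s * Z f (u \<circ> \<tau>) = (\<Sum>v\<in>Ix n D. if v = u \<circ> \<tau> then Z f v * s else 0)"
      using comp_permutes_Ix[OF D \<tau> fu(2)] finite_Ix[OF D] by simp
    also have "\<dots> = (\<Sum>v\<in>Ix n D. Z f v * diag_op D p v u)"
      using fu by (intro sum.cong refl) (simp add: op)
    finally show ?thesis .
  qed
qed

lemma diag_op_commute_span:
  assumes D: "finite D" and Z: "HH D Z" and p: "p \<in> fspan (match (D <+> D))" and fu: "f \<in> Ix n D" "u \<in> Ix n D"
  shows "(\<Sum>v\<in>Ix n D. diag_op D p f v * Z v u) = (\<Sum>v\<in>Ix n D. Z f v * diag_op D p v u)"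
  using p
proof (induction rule: fspan_induct)
  case zero then show ?case by (simp add: diag_op_def)
next
  case (add c s p)
  have "diag_op D (\<lambda>x. p x + c * s x) f v = diag_op D p f v + c * diag_op D s f v" for f v
    by (simp add: diag_op_def distrib_right sum.distrib sum_distrib_left mult.assoc)
  then show ?case using add(2) diag_op_commute[OF D Z add(1) fu]
    by (simp add: distrib_left distrib_right sum.distrib mult.assoc mult.left_commute sum_distrib_left[symmetric])
qed

end

lemma sum_Ix_Plus:
  assumes "finite D"
  shows "(\<Sum>h\<in>Ix n (D <+> D). F h) = (\<Sum>f\<in>Ix n D. \<Sum>u\<in>Ix n D. F (case_sum f u))"
proof -
  have "(\<Sum>h\<in>Ix n (D <+> D). F h) = (\<Sum>(f, u)\<in>Ix n D \<times> Ix n D. F (case_sum f u))"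
  proof (rule sum.reindex_bij_witness[where i = "\<lambda>(f, u). case_sum f u" and j = "\<lambda>h. (h \<circ> Inl, h \<circ> Inr)"])
    fix h assume h: "h \<in> Ix n (D <+> D)"
    show "(case (h \<circ> Inl, h \<circ> Inr) of (f, u) \<Rightarrow> case_sum f u) = h"
      by (auto simp: fun_eq_iff split: sum.splits)
    show "(h \<circ> Inl, h \<circ> Inr) \<in> Ix n D \<times> Ix n D"
      using h by (auto simp: Ix_def PiE_def Pi_def extensional_def)
    show "(case (h \<circ> Inl, h \<circ> Inr) of (f, u) \<Rightarrow> F (case_sum f u)) = F h"
      using \<open>(case (h \<circ> Inl, h \<circ> Inr) of (f, u) \<Rightarrow> case_sum f u) = h\<close> by simp
  next
    fix x assume "x \<in> Ix n D \<times> Ix n D"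
    then obtain f u where x: "x = (f, u)" "f \<in> Ix n D" "u \<in> Ix n D" by blast
    show "((case x of (f, u) \<Rightarrow> case_sum f u) \<circ> Inl, (case x of (f, u) \<Rightarrow> case_sum f u) \<circ> Inr) = x"
      by (simp add: x comp_def)
    show "(case x of (f, u) \<Rightarrow> case_sum f u) \<in> Ix n (D <+> D)"
      using x by (auto simp: Ix_def PiE_def Pi_def extensional_def split: sum.splits)
  qed
  then show ?thesis by (simp add: sum.cartesian_product)
qed

lemma gprod_Plus: "finite D \<Longrightarrow> gprod (D <+> D) g (case_sum f u) (case_sum f' u') = gprod D g f f' * gprod D g u u'"
  unfolding gprod_def by (subst prod.Plus) auto

context bgroup
begin

lemma gprod_form_invariant:
  assumes "finite D" "g \<in> Gr" "v \<in> Ix n D" "u \<in> Ix n D"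
  shows "(\<Sum>x\<in>Ix n D. \<Sum>y\<in>Ix n D. gprod D g v x * (gprod D b x y * gprod D g u y)) = gprod D b v u"
proof -
  have "(\<Sum>x\<in>Ix n D. \<Sum>y\<in>Ix n D. gprod D g v x * (gprod D b x y * gprod D g u y)) =
      (\<Prod>k\<in>D. \<Sum>x<n. \<Sum>y<n. g (v k) x * (b x y * g (u k) y))"
    unfolding gprod_def prod.distrib[symmetric] by (rule sum_Ix_prod2[OF assms(1)])
  also have "\<dots> = gprod D b v u" unfolding gprod_def
  proof (rule prod.cong[OF refl])
    fix k assume "k \<in> D"
    then have "v k < n" "u k < n" using Ix_lt[OF assms(3)] Ix_lt[OF assms(4)] by auto
    from g_inv'[OF assms(2) this] show "(\<Sum>x<n. \<Sum>y<n. g (v k) x * (b x y * g (u k) y)) = b (v k) (u k)"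
      by (simp add: mult_ac)
  qed
  finally show ?thesis .
qed

text \<open>After composition with b, commuting with the group becomes invariance of a tensor on two
  copies of D, to which the first fundamental theorem applies.\<close>

lemma commutant_diag_op:
  assumes D: "finite D"
    and K: "\<And>g f v. g \<in> Gr \<Longrightarrow> f \<in> Ix n D \<Longrightarrow> v \<in> Ix n D \<Longrightarrow>
       (\<Sum>x\<in>Ix n D. K f x * gprod D g x v) = (\<Sum>x\<in>Ix n D. gprod D g f x * K x v)"
  obtains p where "p \<in> fspan (match (D <+> D))" "\<And>f v. f \<in> Ix n D \<Longrightarrow> v \<in> Ix n D \<Longrightarrow> K f v = diag_op D p f v"
proof -
  \<comment> \<open>Restricted and cut off, because the hypothesis describes K only on
    \<open>Ix n D\<close> while p has to be a tensor on all index functions.\<close>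
  define p where "p = (\<lambda>h. if \<forall>k\<in>D <+> D. h k < n then
      \<Sum>v\<in>Ix n D. K (restrict (h \<circ> Inl) D) v * gprod D b v (h \<circ> Inr) else 0)"
  have pe: "p (case_sum f u) = (\<Sum>v\<in>Ix n D. K f v * gprod D b v u)" if "f \<in> Ix n D" "u \<in> Ix n D" for f u
  proof -
    have r: "restrict f D = f" using that by (auto simp: Ix_def PiE_def extensional_restrict)
    have "\<forall>k\<in>D <+> D. case_sum f u k < n" using that by (auto simp: Ix_lt)
    then show ?thesis by (simp add: p_def comp_def r)
  qed
  have tp: "tens n (D <+> D) p"
    unfolding tens_def
  proof (intro conjI allI impI)
    fix h h' :: "'a + 'a \<Rightarrow> nat" assume eq: "\<forall>k\<in>D <+> D. h k = h' k"
    have 1: "restrict (h \<circ> Inl) D = restrict (h' \<circ> Inl) D" using eq by (auto simp: restrict_def fun_eq_iff)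
    have 2: "gprod D b v (h \<circ> Inr) = gprod D b v (h' \<circ> Inr)" for v using eq by (intro gprod_cong) auto
    have 3: "(\<forall>k\<in>D <+> D. h k < n) \<longleftrightarrow> (\<forall>k\<in>D <+> D. h' k < n)" using eq by simp
    show "p h = p h'" unfolding p_def 1 2 3 ..
  next
    fix h :: "'a + 'a \<Rightarrow> nat" assume "\<exists>k\<in>D <+> D. n \<le> h k"
    then show "p h = 0" by (auto simp: p_def not_less dest: leD)
  qed
  have fDD: "finite (D <+> D)" using D by simp
  have "ginv (D <+> D) p" unfolding ginv_def
  proof
    fix g assume g: "g \<in> Gr"
    show "gact n (D <+> D) g p = p"
    proof (rule tens_eqI[OF gact_tens'[OF fDD g] tp])
      fix h assume h: "h \<in> Ix n (D <+> D)"
      define f where "f = h \<circ> Inl"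
      define u where "u = h \<circ> Inr"
      have hf: "h = case_sum f u" by (auto simp: f_def u_def fun_eq_iff split: sum.splits)
      have fu: "f \<in> Ix n D" "u \<in> Ix n D" using h by (auto simp: f_def u_def Ix_def PiE_def Pi_def extensional_def)
      have "gact n (D <+> D) g p h =
         (\<Sum>f'\<in>Ix n D. \<Sum>u'\<in>Ix n D. gprod D g f f' * gprod D g u u' * (\<Sum>v\<in>Ix n D. K f' v * gprod D b v u'))"
        unfolding gact_def sum_Ix_Plus[OF D] hf gprod_Plus[OF D] by (intro sum.cong refl) (simp add: pe)
      also have "\<dots> = (\<Sum>f'\<in>Ix n D. \<Sum>u'\<in>Ix n D. \<Sum>v\<in>Ix n D. (gprod D g f f' * K f' v) * (gprod D b v u' * gprod D g u u'))"
        by (simp add: sum_distrib_left mult_ac)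
      also have "\<dots> = (\<Sum>u'\<in>Ix n D. \<Sum>v\<in>Ix n D. (\<Sum>f'\<in>Ix n D. gprod D g f f' * K f' v) * (gprod D b v u' * gprod D g u u'))"
        unfolding sum_distrib_right by (rule sum_swap3)
      also have "\<dots> = (\<Sum>u'\<in>Ix n D. \<Sum>v\<in>Ix n D. (\<Sum>x\<in>Ix n D. K f x * gprod D g x v) * (gprod D b v u' * gprod D g u u'))"
        by (intro sum.cong refl) (simp add: K[OF g fu(1)])
      also have "\<dots> = (\<Sum>u'\<in>Ix n D. \<Sum>v\<in>Ix n D. \<Sum>x\<in>Ix n D. K f x * (gprod D g x v * (gprod D b v u' * gprod D g u u')))"
        by (simp add: sum_distrib_right mult.assoc)
      also have "\<dots> = (\<Sum>x\<in>Ix n D. \<Sum>u'\<in>Ix n D. \<Sum>v\<in>Ix n D. K f x * (gprod D g x v * (gprod D b v u' * gprod D g u u')))"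
        by (rule sum_swap3[symmetric])
      also have "\<dots> = (\<Sum>x\<in>Ix n D. K f x * (\<Sum>v\<in>Ix n D. \<Sum>u'\<in>Ix n D. gprod D g x v * (gprod D b v u' * gprod D g u u')))"
        unfolding sum_distrib_left by (rule sum.cong[OF refl], rule sum.swap)
      also have "\<dots> = (\<Sum>x\<in>Ix n D. K f x * gprod D b x u)"
        by (intro sum.cong refl) (simp add: gprod_form_invariant[OF D g _ fu(2)])
      also have "\<dots> = p h" unfolding hf pe[OF fu] ..
      finally show "gact n (D <+> D) g p h = p h" .
    qed
  qed
  then have "p \<in> fspan (match (D <+> D))" using first_fundamental_theorem[OF fDD tp] by blast
  moreover have "K f v = diag_op D p f v" if fv: "f \<in> Ix n D" "v \<in> Ix n D" for f v
  proof -
    have "diag_op D p f v = (\<Sum>w\<in>Ix n D. \<Sum>x\<in>Ix n D. K f x * (gprod D b x w * gprod D b v w))"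
      unfolding diag_op_def using fv by (intro sum.cong refl) (simp add: pe sum_distrib_right mult.assoc)
    also have "\<dots> = (\<Sum>x\<in>Ix n D. K f x * (\<Sum>w\<in>Ix n D. gprod D b x w * gprod D b v w))"
      unfolding sum_distrib_left by (rule sum.swap)
    also have "\<dots> = (\<Sum>x\<in>Ix n D. if x = v then K f x else 0)"
      using fv by (intro sum.cong refl) (simp add: gprod_b_orth[OF D])
    also have "\<dots> = K f v" using fv finite_Ix[OF D] by simp
    finally show ?thesis by simp
  qed
  ultimately show ?thesis using that by blast
qed

definition gspan :: "'k set \<Rightarrow> (('k \<Rightarrow> nat) \<times> ('k \<Rightarrow> nat) \<Rightarrow> complex) set" where
  "gspan D = fspan ((\<lambda>g (f, u). gprod D g f u) ` Gr)"

lemma gprod_mult: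
  assumes "finite D"
  shows "(\<Sum>x\<in>Ix n D. gprod D g f x * gprod D h x u) = gprod D (\<lambda>x y. \<Sum>z<n. g x z * h z y) f u"
  unfolding gprod_def prod.distrib[symmetric] using sum_Ix_prod[OF assms, of "\<lambda>k z. g (f k) z * h z (u k)"] by simp

lemma gspan_left_mult:
  assumes D: "finite D" and a: "a \<in> gspan D" and g: "g \<in> Gr"
  shows "(\<lambda>(f, u). \<Sum>x\<in>Ix n D. gprod D g f x * a (x, u)) \<in> gspan D"
  using a unfolding gspan_def
proof (induction rule: fspan_induct)
  case zero
  have "(\<lambda>(f, u). \<Sum>x\<in>Ix n D. gprod D g f x * 0) = (\<lambda>x. 0)" by auto
  then show ?case by (simp add: subsp_zero[OF subsp_fspan])
next
  case (add c s a)
  obtain h where h: "h \<in> Gr" "s = (\<lambda>(f, u). gprod D h f u)" using add(1) by blast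
  have "(\<lambda>(f, u). gprod D (\<lambda>x y. \<Sum>z<n. g x z * h z y) f u) \<in> fspan ((\<lambda>g (f, u). gprod D g f u) ` Gr)"
    by (rule fspan_mem, rule image_eqI[OF refl g_mult[OF g h(1)]])
  from subsp_add[OF subsp_fspan add(2) subsp_scale[OF subsp_fspan this, of c]]
  show ?case by (rule back_subst[where P = "\<lambda>y. y \<in> _"])
    (auto simp: fun_eq_iff h(2) gprod_mult[OF D, symmetric] distrib_left sum.distrib sum_distrib_left mult.left_commute)
qed

text \<open>The adjoint of a group operator is again one, so the complement of the left-stable space
  \<open>gspan D\<close> is left-stable.\<close>

lemma gspan_orth_left_mult:
  assumes D: "finite D" and a: "\<And>a. a \<in> gspan D \<Longrightarrow> fip (Ix n D \<times> Ix n D) y a = 0" and g: "g \<in> Gr" and v: "v \<in> gspan D"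
  shows "fip (Ix n D \<times> Ix n D) (\<lambda>(f, u). \<Sum>x\<in>Ix n D. gprod D g f x * y (x, u)) v = 0"
proof -
  let ?h = "\<lambda>x y. cnj (g y x)"
  let ?v = "\<lambda>(f, u). \<Sum>x\<in>Ix n D. gprod D ?h f x * v (x, u)"
  have c: "cnj (gprod D ?h f x) = gprod D g x f" for f x by (simp add: gprod_def)
  have 1: "fip (Ix n D \<times> Ix n D) z w = (\<Sum>u\<in>Ix n D. fip (Ix n D) (\<lambda>f. z (f, u)) (\<lambda>f. w (f, u)))"
    for z w :: "('a \<Rightarrow> nat) \<times> ('a \<Rightarrow> nat) \<Rightarrow> complex"
    unfolding fip_def by (subst sum.swap) (simp add: sum.cartesian_product)
  have "fip (Ix n D) (\<lambda>f. \<Sum>x\<in>Ix n D. gprod D g f x * y (x, u)) (\<lambda>f. v (f, u))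
     = fip (Ix n D) (\<lambda>f. y (f, u)) (\<lambda>f. \<Sum>x\<in>Ix n D. gprod D ?h f x * v (x, u))" for u
    using fip_gact[of n D g "\<lambda>f. y (f, u)" "\<lambda>f. v (f, u)"] by (simp add: gact_def)
  then have "fip (Ix n D \<times> Ix n D) (\<lambda>(f, u). \<Sum>x\<in>Ix n D. gprod D g f x * y (x, u)) v = fip (Ix n D \<times> Ix n D) y ?v"
    unfolding 1 by simp
  also have "\<dots> = 0" by (rule a, rule gspan_left_mult[OF D v g_adj[OF g]])
  finally show ?thesis .
qed

text \<open>Double commutant argument: the orthogonal projection onto the span of the group operators has
  matrix blocks in the commutant, which the first fundamental theorem describes.\<close>

theorem HH_in_gspan:
  fixes D :: "'k set"
  assumes D: "finite D" and Z: "HH D Z"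
  obtains a where "a \<in> gspan D" "\<And>f u. f \<in> Ix n D \<Longrightarrow> u \<in> Ix n D \<Longrightarrow> Z f u = a (f, u)"
proof -
  let ?I = "Ix n D"
  have fI: "finite ?I" using D by (rule finite_Ix)
  have fII: "finite (?I \<times> ?I)" using fI by simp
  have sub: "subsp (gspan D)" unfolding gspan_def by (rule subsp_fspan)
  \<comment> \<open>Matrix units. \<open>Q v j\<close> is the projection of the unit at (v, j) onto
    the span of the group operators.\<close>
  define E :: "('k \<Rightarrow> nat) \<Rightarrow> ('k \<Rightarrow> nat) \<Rightarrow> ('k \<Rightarrow> nat) \<times> ('k \<Rightarrow> nat) \<Rightarrow> complex" where
    "E = (\<lambda>v j (f, u). if f = v \<and> u = j then (1::complex) else 0)"
  have "\<forall>v j. \<exists>q. q \<in> gspan D \<and> (\<forall>a\<in>gspan D. fip (?I \<times> ?I) (\<lambda>x. E v j x - q x) a = 0)"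
    using orthogonal_decomposition[OF fII sub] by blast
  then obtain Q where Q: "\<And>v j. Q v j \<in> gspan D"
    "\<And>v j a. a \<in> gspan D \<Longrightarrow> fip (?I \<times> ?I) (\<lambda>x. E v j x - Q v j x) a = 0" by metis
  \<comment> \<open>The span and its complement are stable under left multiplication by g, which
    therefore commutes with the projection. For fixed j and l this says that the block with entries
    \<open>Q v j (f, l)\<close> at (f, v) commutes with g.\<close>
  have comm: "(\<Sum>x\<in>?I. Q x j (f, l) * gprod D g x v) = (\<Sum>x\<in>?I. gprod D g f x * Q v j (x, l))"
    if g: "g \<in> Gr" and fv: "f \<in> ?I" "v \<in> ?I" and jl: "j \<in> ?I" "l \<in> ?I" for g f v j l
  proof -
    define x1 where "x1 = (\<lambda>(f, u). \<Sum>x\<in>?I. gprod D g f x * E v j (x, u))"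
    define a1 where "a1 = (\<lambda>y. \<Sum>x\<in>?I. gprod D g x v * Q x j y)"
    define a2 where "a2 = (\<lambda>(f, u). \<Sum>x\<in>?I. gprod D g f x * Q v j (x, u))"
    have 1: "a1 \<in> gspan D" unfolding a1_def by (rule subsp_sum[OF sub Q(1)])
    have 2: "a2 \<in> gspan D" unfolding a2_def by (rule gspan_left_mult[OF D Q(1) g])
    have o2: "fip (?I \<times> ?I) (\<lambda>y. x1 y - a2 y) a = 0" if "a \<in> gspan D" for a
    proof -
      have "(\<lambda>y. x1 y - a2 y) = (\<lambda>(f, u). \<Sum>x\<in>?I. gprod D g f x * (E v j (x, u) - Q v j (x, u)))"
        by (auto simp: x1_def a2_def fun_eq_iff right_diff_distrib sum_subtractf)
      then show ?thesis using gspan_orth_left_mult[OF D Q(2) g that] by simp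
    qed
    have o1: "fip (?I \<times> ?I) (\<lambda>y. x1 y - a1 y) a = 0" if "a \<in> gspan D" for a
    proof -
      have "fip (?I \<times> ?I) (\<lambda>y. x1 y - a1 y) a = fip (?I \<times> ?I) (\<lambda>y. \<Sum>x\<in>?I. gprod D g x v * (E x j y - Q x j y)) a"
        unfolding fip_def
      proof (rule sum.cong[OF refl])
        fix y assume "y \<in> ?I \<times> ?I"
        then obtain f u where y: "y = (f, u)" "f \<in> ?I" "u \<in> ?I" by blast
        have "x1 y = (\<Sum>x\<in>?I. if x = v then (if u = j then gprod D g f x else 0) else 0)"
          unfolding x1_def y E_def prod.case by (rule sum.cong) auto
        also have "\<dots> = (if u = j then gprod D g f v else 0)" using fI fv by simp
        also have "\<dots> = (\<Sum>x\<in>?I. if x = f then (if u = j then gprod D g x v else 0) else 0)" using fI y by simp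
        also have "\<dots> = (\<Sum>x\<in>?I. gprod D g x v * E x j y)"
          unfolding y E_def prod.case by (rule sum.cong) auto
        finally show "(x1 y - a1 y) * cnj (a y) = (\<Sum>x\<in>?I. gprod D g x v * (E x j y - Q x j y)) * cnj (a y)"
          by (simp add: a1_def right_diff_distrib sum_subtractf)
      qed
      also have "\<dots> = 0" unfolding fip_sum_left using Q(2)[OF that] by simp
      finally show ?thesis .
    qed
    have "a1 (f, l) = a2 (f, l)"
      by (rule fip_eq_zero_of_diff[OF fII sub 1 2 o1 o2]) (use fv jl in auto)
    then show ?thesis by (simp add: a1_def a2_def mult.commute)
  qed
  \<comment> \<open>The blocks are therefore combinations of matching operators, and those commute
    with Z.\<close>
  have ZK: "(\<Sum>v\<in>?I. Q v j (f, l) * Z v u) = (\<Sum>v\<in>?I. Z f v * Q u j (v, l))"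
    if fu: "f \<in> ?I" "u \<in> ?I" and jl: "j \<in> ?I" "l \<in> ?I" for f u j l
  proof -
    obtain p where p: "p \<in> fspan (match (D <+> D))"
      "\<And>f v. f \<in> ?I \<Longrightarrow> v \<in> ?I \<Longrightarrow> Q v j (f, l) = diag_op D p f v"
      by (rule commutant_diag_op[OF D, of "\<lambda>f v. Q v j (f, l)"]) (erule comm[OF _ _ _ jl], assumption+, rule that)
    show ?thesis using diag_op_commute_span[OF D Z p(1) fu] fu by (simp add: p(2))
  qed
  \<comment> \<open>The identity is a group operator, hence equal to its own projection, and this is
    the sum of the \<open>Q j j\<close>.\<close>
  have one: "(\<Sum>j\<in>?I. Q j j (v, l)) = (if v = l then 1 else 0)" if vl: "v \<in> ?I" "l \<in> ?I" for v l
  proof -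
    define x1 where "x1 = (\<lambda>(f, u). gprod D (\<lambda>x y. if x = y \<and> x < n then 1 else 0) f u)"
    have 1: "x1 \<in> gspan D" unfolding gspan_def x1_def by (rule fspan_mem, rule image_eqI[OF refl g_one])
    have x1: "x1 (f, u) = (if f = u then 1 else 0)" if "f \<in> ?I" "u \<in> ?I" for f u
      unfolding x1_def prod.case gprod_def prod_indicator[OF D] using Ix_eq_iff[OF that] Ix_lt[OF that(1)] by auto
    define a1 where "a1 = (\<lambda>y. \<Sum>j\<in>?I. 1 * Q j j y)"
    have 2: "a1 \<in> gspan D" unfolding a1_def by (rule subsp_sum[OF sub Q(1)])
    have o1: "fip (?I \<times> ?I) (\<lambda>y. x1 y - a1 y) a = 0" if "a \<in> gspan D" for a
    proof -
      have "fip (?I \<times> ?I) (\<lambda>y. x1 y - a1 y) a = fip (?I \<times> ?I) (\<lambda>y. \<Sum>j\<in>?I. 1 * (E j j y - Q j j y)) a"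
        unfolding fip_def
      proof (rule sum.cong[OF refl])
        fix y assume "y \<in> ?I \<times> ?I"
        then obtain f u where y: "y = (f, u)" "f \<in> ?I" "u \<in> ?I" by blast
        have "x1 y = (\<Sum>j\<in>?I. if j = f then (if u = j then 1 else 0) else 0)" unfolding y(1) x1[OF y(2,3)] using fI y by simp
        also have "\<dots> = (\<Sum>j\<in>?I. E j j y)" unfolding y E_def prod.case by (rule sum.cong) auto
        finally show "(x1 y - a1 y) * cnj (a y) = (\<Sum>j\<in>?I. 1 * (E j j y - Q j j y)) * cnj (a y)"
          by (simp add: a1_def sum_subtractf)
      qed
      also have "\<dots> = 0" unfolding fip_sum_left using Q(2)[OF that] by simp
      finally show ?thesis .
    qed
    have "a1 (v, l) = x1 (v, l)"
      by (rule fip_eq_zero_of_diff[OF fII sub 2 1 o1]) (use vl in \<open>auto simp: fip_def\<close>)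
    then show ?thesis using x1[OF vl] by (simp add: a1_def)
  qed
  \<comment> \<open>The projection of Z. Commuting Z past the blocks turns it into Z times the
    projected identity, which is Z.\<close>
  define a where "a = (\<lambda>y. \<Sum>j\<in>?I. 1 * (\<Sum>v\<in>?I. Z v j * Q v j y))"
  have "a \<in> gspan D" unfolding a_def by (intro subsp_sum[OF sub] Q(1))
  moreover have "Z f l = a (f, l)" if fl: "f \<in> ?I" "l \<in> ?I" for f l
  proof -
    have "a (f, l) = (\<Sum>j\<in>?I. \<Sum>v\<in>?I. Q v j (f, l) * Z v j)" by (simp add: a_def mult.commute)
    also have "\<dots> = (\<Sum>j\<in>?I. \<Sum>v\<in>?I. Z f v * Q j j (v, l))" by (intro sum.cong refl ZK) (use fl in auto)
    also have "\<dots> = (\<Sum>v\<in>?I. Z f v * (\<Sum>j\<in>?I. Q j j (v, l)))"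
      unfolding sum_distrib_left by (rule sum.swap)
    also have "\<dots> = (\<Sum>v\<in>?I. if v = l then Z f v else 0)" using fl by (intro sum.cong refl) (simp add: one)
    also have "\<dots> = Z f l" using fl fI by simp
    finally show ?thesis by simp
  qed
  ultimately show ?thesis using that by blast
qed

text \<open>The conjugate of X is harmonic too, hence a combination of group operators, and X plus
  the insertion pairs to zero with these. The insertion alone pairs to zero with harmonic tensors,
  so the squared norm of X is zero.\<close>

lemma HH_orthogonal_zero:
  assumes D: "finite D" and X: "HH D X"
    and i: "i \<in> D" "j \<in> D" "i \<noteq> j" and Y: "\<And>u. u \<in> Ix n D \<Longrightarrow> tens n (D - {i, j}) (\<lambda>f. Y f u)"
    and eq: "\<And>g. g \<in> Gr \<Longrightarrow> (\<Sum>f\<in>Ix n D. \<Sum>u\<in>Ix n D. (X f u + b (f i) (f j) * Y f u) * gprod D g f u) = 0"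
  shows "X f u = 0"
proof -
  let ?I = "Ix n D"
  have "HH D (\<lambda>f u. cnj (X f u))" using X unfolding HH_def by (auto intro: tens_cnj harm_cnj)
  then obtain a where a: "a \<in> gspan D" "\<And>f u. f \<in> ?I \<Longrightarrow> u \<in> ?I \<Longrightarrow> cnj (X f u) = a (f, u)"
    using HH_in_gspan[OF D] by blast
  have za: "(\<Sum>f\<in>?I. \<Sum>u\<in>?I. (X f u + b (f i) (f j) * Y f u) * a (f, u)) = 0"
    using a(1) unfolding gspan_def
  proof (induction rule: fspan_induct)
    case (add c s a)
    then obtain g where "g \<in> Gr" "s = (\<lambda>(f, u). gprod D g f u)" by blast
    then have "(\<Sum>f\<in>?I. \<Sum>u\<in>?I. (X f u + b (f i) (f j) * Y f u) * s (f, u)) = 0" using eq by simp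
    then show ?case using add(2)
      by (simp add: distrib_left sum.distrib mult.left_commute sum_distrib_left[symmetric])
  qed simp
  have "(\<Sum>f\<in>?I. \<Sum>u\<in>?I. b (f i) (f j) * Y f u * a (f, u)) = 0"
  proof -
    have "(\<Sum>f\<in>?I. b (f i) (f j) * Y f u * a (f, u)) = 0" if u: "u \<in> ?I" for u
    proof -
      have "(\<Sum>f\<in>?I. b (f i) (f j) * Y f u * a (f, u)) = (\<Sum>f\<in>?I. cnj (X f u) * (b (f i) (f j) * Y f u))"
        using u by (intro sum.cong refl) (simp add: a(2))
      also have "\<dots> = 0" using X Y[OF u] by (intro traceless_pairing[OF D i]) (auto simp: HH_def intro: tens_cnj harm_cnj)
      finally show ?thesis .
    qed
    then show ?thesis by (subst sum.swap) simp
  qed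
  with za have "(\<Sum>f\<in>?I. \<Sum>u\<in>?I. X f u * a (f, u)) = 0" by (simp add: distrib_right sum.distrib)
  moreover have "(\<Sum>f\<in>?I. \<Sum>u\<in>?I. X f u * a (f, u)) = fip (?I \<times> ?I) (\<lambda>(f, u). X f u) (\<lambda>(f, u). X f u)"
    unfolding fip_def sum.cartesian_product by (rule sum.cong) (auto simp: a(2)[symmetric])
  ultimately have z: "X f u = 0" if "f \<in> ?I" "u \<in> ?I" for f u
    using that fip_self_eq_0[of "?I \<times> ?I" "\<lambda>(f, u). X f u" "(f, u)"] finite_Ix[OF D] by auto
  have "(\<lambda>f. X f u) = (\<lambda>f. 0)" if u: "u \<in> ?I" for u
    using X z u by (intro tens_eqI[of n D]) (auto simp: HH_def tens_null)
  then have "X f = (\<lambda>u. 0)" using X by (intro tens_eqI[of n D]) (auto simp: HH_def tens_null dest: fun_cong)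
  then show ?thesis by simp
qed

text \<open>The version without an insertion, for degrees 0 and 1.\<close>

lemma HH_orthogonal_zero':
  assumes D: "finite D" and X: "HH D X"
    and eq: "\<And>g. g \<in> Gr \<Longrightarrow> (\<Sum>f\<in>Ix n D. \<Sum>u\<in>Ix n D. X f u * gprod D g f u) = 0"
  shows "X f u = 0"
proof -
  let ?I = "Ix n D"
  have "HH D (\<lambda>f u. cnj (X f u))" using X unfolding HH_def by (auto intro: tens_cnj harm_cnj)
  then obtain a where a: "a \<in> gspan D" "\<And>f u. f \<in> ?I \<Longrightarrow> u \<in> ?I \<Longrightarrow> cnj (X f u) = a (f, u)"
    using HH_in_gspan[OF D] by blast
  have za: "(\<Sum>f\<in>?I. \<Sum>u\<in>?I. X f u * a (f, u)) = 0"
    using a(1) unfolding gspan_def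
  proof (induction rule: fspan_induct)
    case (add c s a)
    then obtain g where "g \<in> Gr" "s = (\<lambda>(f, u). gprod D g f u)" by blast
    then have "(\<Sum>f\<in>?I. \<Sum>u\<in>?I. X f u * s (f, u)) = 0" using eq by simp
    then show ?case using add(2)
      by (simp add: distrib_left sum.distrib mult.left_commute sum_distrib_left[symmetric])
  qed simp
  moreover have "(\<Sum>f\<in>?I. \<Sum>u\<in>?I. X f u * a (f, u)) = fip (?I \<times> ?I) (\<lambda>(f, u). X f u) (\<lambda>(f, u). X f u)"
    unfolding fip_def sum.cartesian_product by (rule sum.cong) (auto simp: a(2)[symmetric])
  ultimately have z: "X f u = 0" if "f \<in> ?I" "u \<in> ?I" for f u
    using that fip_self_eq_0[of "?I \<times> ?I" "\<lambda>(f, u). X f u" "(f, u)"] finite_Ix[OF D] by auto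
  have "(\<lambda>f. X f u) = (\<lambda>f. 0)" if u: "u \<in> ?I" for u
    using X z u by (intro tens_eqI[of n D]) (auto simp: HH_def tens_null)
  then have "X f = (\<lambda>u. 0)" using X by (intro tens_eqI[of n D]) (auto simp: HH_def tens_null dest: fun_cong)
  then show ?thesis by simp
qed

end

section \<open>Polynomials as values of tensors\<close>

text \<open>The exponent after multiplication by x_ij. It allows inductions on the degree that add
  one factor, and so one slot, at a time.\<close>

definition exp_inc :: "nat \<Rightarrow> nat \<Rightarrow> (nat \<Rightarrow> nat \<Rightarrow> nat) \<Rightarrow> nat \<Rightarrow> nat \<Rightarrow> nat" where
  "exp_inc i j a = a(i := (a i)(j := Suc (a i j)))"

lemma exp_inc_apply: "exp_inc i j a x y = (if x = i \<and> y = j then Suc (a x y) else a x y)"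
  by (simp add: exp_inc_def)

lemma exps_alt: "exps n d = {a. (\<forall>i j. (n \<le> i \<or> n \<le> j) \<longrightarrow> a i j = 0) \<and> (\<Sum>(i, j)\<in>{..<n} \<times> {..<n}. a i j) = d}"
  by (simp add: exps_def sum.cartesian_product)

lemma monom_alt: "monom n a M = (\<Prod>(i, j)\<in>{..<n} \<times> {..<n}. (M $$ (i, j)) ^ a i j)"
  by (simp add: monom_def prod.cartesian_product)

lemma exp_inc_exps: assumes "i < n" "j < n" shows "exp_inc i j a \<in> exps n (Suc d) \<longleftrightarrow> a \<in> exps n d"
proof -
  have ij: "(i, j) \<in> {..<n} \<times> {..<n}" using assms by simp
  have "(\<Sum>(x, y)\<in>{..<n} \<times> {..<n} - {(i, j)}. exp_inc i j a x y) = (\<Sum>(x, y)\<in>{..<n} \<times> {..<n} - {(i, j)}. a x y)"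
    by (rule sum.cong) (auto simp: exp_inc_apply split: if_splits)
  then have S: "(\<Sum>(x, y)\<in>{..<n} \<times> {..<n}. exp_inc i j a x y) = Suc (\<Sum>(x, y)\<in>{..<n} \<times> {..<n}. a x y)"
    by (simp add: sum.remove[OF _ ij] exp_inc_apply)
  have Z: "(\<forall>x y. (n \<le> x \<or> n \<le> y) \<longrightarrow> exp_inc i j a x y = 0) \<longleftrightarrow> (\<forall>x y. (n \<le> x \<or> n \<le> y) \<longrightarrow> a x y = 0)"
    using assms by (auto simp: exp_inc_apply)
  show ?thesis unfolding exps_alt mem_Collect_eq S Z by simp
qed

lemma monom_exp_inc: assumes "i < n" "j < n" shows "monom n (exp_inc i j a) M = M $$ (i, j) * monom n a M"
proof -
  have ij: "(i, j) \<in> {..<n} \<times> {..<n}" using assms by simp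
  have "(\<Prod>(x, y)\<in>{..<n} \<times> {..<n} - {(i, j)}. (M $$ (x, y)) ^ exp_inc i j a x y) = (\<Prod>(x, y)\<in>{..<n} \<times> {..<n} - {(i, j)}. (M $$ (x, y)) ^ a x y)"
    by (rule prod.cong) (auto simp: exp_inc_apply split: if_splits)
  then show ?thesis unfolding monom_alt by (simp add: prod.remove[OF _ ij] exp_inc_apply)
qed

lemma exps_Suc_cases:
  assumes "a \<in> exps n (Suc d)"
  obtains i j a' where "i < n" "j < n" "a' \<in> exps n d" "a = exp_inc i j a'"
proof -
  have "(\<Sum>(x, y)\<in>{..<n} \<times> {..<n}. a x y) \<noteq> 0" using assms by (simp add: exps_alt)
  then obtain i j where ij: "i < n" "j < n" "a i j \<noteq> 0"
    by (auto dest!: sum.not_neutral_contains_not_neutral)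
  define a' where "a' = a(i := (a i)(j := a i j - 1))"
  have a: "a = exp_inc i j a'" using ij by (auto simp: exp_inc_apply a'_def fun_eq_iff)
  then have "a' \<in> exps n d" using assms exp_inc_exps[OF ij(1,2)] by simp
  then show ?thesis using that ij a by blast
qed

lemma exps_0: "exps n 0 = {\<lambda>i j. 0}"
proof (intro equalityI subsetI)
  fix a assume "a \<in> exps n 0"
  then have a: "\<And>i j. n \<le> i \<or> n \<le> j \<Longrightarrow> a i j = 0" "\<And>i j. i < n \<Longrightarrow> j < n \<Longrightarrow> a i j = 0" by (auto simp: exps_alt)
  have "a i j = 0" for i j using a[of i j] by linarith
  then show "a \<in> {\<lambda>i j. 0}" by auto
qed (simp add: exps_alt)

lemma finite_exps: "finite (exps n d)"
proof (induction d)
  case (Suc d)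
  have "exps n (Suc d) \<subseteq> (\<lambda>(i, j, a). exp_inc i j a) ` ({..<n} \<times> {..<n} \<times> exps n d)"
  proof
    fix a assume "a \<in> exps n (Suc d)"
    then obtain i j a' where "i < n" "j < n" "a' \<in> exps n d" "a = exp_inc i j a'" by (rule exps_Suc_cases)
    then show "a \<in> (\<lambda>(i, j, a). exp_inc i j a) ` ({..<n} \<times> {..<n} \<times> exps n d)"
      by (intro image_eqI[of _ _ "(i, j, a')"]) auto
  qed
  then show ?case using Suc finite_subset by blast
qed (simp add: exps_0)

text \<open>The homogeneous polynomial with coefficient tensor X, one slot for each factor of a
  monomial. X is not unique: by \<open>val_relabel\<close> a simultaneous permutation of its slots
  leaves the polynomial unchanged.\<close>

definition val :: "nat \<Rightarrow> nat \<Rightarrow> ((nat \<Rightarrow> nat) \<Rightarrow> (nat \<Rightarrow> nat) \<Rightarrow> complex) \<Rightarrow> (nat \<Rightarrow> nat \<Rightarrow> complex) \<Rightarrow> complex" where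
  "val n d X g = (\<Sum>f\<in>Ix n {..<d}. \<Sum>u\<in>Ix n {..<d}. X f u * gprod {..<d} g f u)"

definition mf :: "nat \<Rightarrow> complex mat \<Rightarrow> nat \<Rightarrow> nat \<Rightarrow> complex" where
  "mf n M x y = (if x < n \<and> y < n then M $$ (x, y) else 0)"

lemma val_add: "val n d (\<lambda>f u. X f u + Y f u) g = val n d X g + val n d Y g"
  by (simp add: val_def distrib_right sum.distrib)

lemma val_scale: "val n d (\<lambda>f u. c * X f u) g = c * val n d X g"
  by (simp add: val_def sum_distrib_left mult.assoc)

lemma val_sum: "val n d (\<lambda>f u. \<Sum>a\<in>A. c a * X a f u) g = (\<Sum>a\<in>A. c a * val n d (X a) g)"
proof -
  have "val n d (\<lambda>f u. \<Sum>a\<in>A. c a * X a f u) g = (\<Sum>f\<in>Ix n {..<d}. \<Sum>u\<in>Ix n {..<d}. \<Sum>a\<in>A. c a * (X a f u * gprod {..<d} g f u))"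
    by (simp add: val_def sum_distrib_right mult.assoc)
  also have "\<dots> = (\<Sum>a\<in>A. \<Sum>f\<in>Ix n {..<d}. \<Sum>u\<in>Ix n {..<d}. c a * (X a f u * gprod {..<d} g f u))"
    by (rule sum_swap3[symmetric])
  finally show ?thesis by (simp add: val_def sum_distrib_left)
qed

lemma val_cong: "(\<And>f u. f \<in> Ix n {..<d} \<Longrightarrow> u \<in> Ix n {..<d} \<Longrightarrow> X f u = Y f u) \<Longrightarrow> val n d X g = val n d Y g"
  unfolding val_def by (intro sum.cong refl) auto

lemma val_scale_matrix: "val n d X (\<lambda>x y. c * g x y) = c ^ d * val n d X g"
  by (simp add: val_def gprod_def prod.distrib sum_distrib_left mult_ac)

lemma val_mult_matrix:
  "val n d X (\<lambda>x y. \<Sum>z<n. a x z * g z y) = val n d (\<lambda>w u. \<Sum>f\<in>Ix n {..<d}. X f u * gprod {..<d} a f w) g"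
proof -
  let ?I = "Ix n {..<d}"
  have m: "gprod {..<d} (\<lambda>x y. \<Sum>z<n. a x z * g z y) f u = (\<Sum>w\<in>?I. gprod {..<d} a f w * gprod {..<d} g w u)" for f u
    unfolding gprod_def prod.distrib[symmetric] using sum_Ix_prod[of "{..<d}" "\<lambda>k z. a (f k) z * g z (u k)"] by simp
  have "val n d X (\<lambda>x y. \<Sum>z<n. a x z * g z y) = (\<Sum>f\<in>?I. \<Sum>u\<in>?I. \<Sum>w\<in>?I. X f u * gprod {..<d} a f w * gprod {..<d} g w u)"
    by (simp add: val_def m sum_distrib_left mult.assoc)
  also have "\<dots> = (\<Sum>u\<in>?I. \<Sum>w\<in>?I. \<Sum>f\<in>?I. X f u * gprod {..<d} a f w * gprod {..<d} g w u)"
    by (rule sum_swap3)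
  also have "\<dots> = (\<Sum>w\<in>?I. \<Sum>u\<in>?I. \<Sum>f\<in>?I. X f u * gprod {..<d} a f w * gprod {..<d} g w u)" by (rule sum.swap)
  finally show ?thesis by (simp add: val_def sum_distrib_right)
qed

lemma val_mult_matrix_right:
  "val n d X (\<lambda>x y. \<Sum>z<n. g x z * a z y) = val n d (\<lambda>f w. \<Sum>u\<in>Ix n {..<d}. X f u * gprod {..<d} a w u) g"
proof -
  let ?I = "Ix n {..<d}"
  have m: "gprod {..<d} (\<lambda>x y. \<Sum>z<n. g x z * a z y) f u = (\<Sum>w\<in>?I. gprod {..<d} g f w * gprod {..<d} a w u)" for f u
    unfolding gprod_def prod.distrib[symmetric] using sum_Ix_prod[of "{..<d}" "\<lambda>k z. g (f k) z * a z (u k)"] by simp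
  have "val n d X (\<lambda>x y. \<Sum>z<n. g x z * a z y) = (\<Sum>f\<in>?I. \<Sum>u\<in>?I. \<Sum>w\<in>?I. X f u * gprod {..<d} a w u * gprod {..<d} g f w)"
    unfolding val_def m by (simp add: sum_distrib_left mult_ac)
  also have "\<dots> = (\<Sum>f\<in>?I. \<Sum>w\<in>?I. \<Sum>u\<in>?I. X f u * gprod {..<d} a w u * gprod {..<d} g f w)"
    by (rule sum.cong[OF refl], rule sum.swap)
  finally show ?thesis by (simp add: val_def sum_distrib_right)
qed

lemma mf_mult:
  "A \<in> carrier_mat n n \<Longrightarrow> M \<in> carrier_mat n n \<Longrightarrow> mf n (A * M) = (\<lambda>x y. \<Sum>z<n. mf n A x z * mf n M z y)"
  by (auto simp: mf_def fun_eq_iff scalar_prod_def atLeast0LessThan intro!: sum.cong)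

lemma mf_smult: "M \<in> carrier_mat n n \<Longrightarrow> mf n (c \<cdot>\<^sub>m M) = (\<lambda>x y. c * mf n M x y)"
  by (auto simp: mf_def fun_eq_iff)

lemma val_single:
  assumes "f0 \<in> Ix n {..<d}" "u0 \<in> Ix n {..<d}"
  shows "val n d (\<lambda>f u. if f = f0 \<and> u = u0 then 1 else 0) g = gprod {..<d} g f0 u0"
proof -
  have "val n d (\<lambda>f u. if f = f0 \<and> u = u0 then 1 else 0) g =
     (\<Sum>f\<in>Ix n {..<d}. if f = f0 then (\<Sum>u\<in>Ix n {..<d}. if u = u0 then gprod {..<d} g f u else 0) else 0)"
    unfolding val_def by (intro sum.cong refl) (auto intro!: sum.cong)
  also have "\<dots> = gprod {..<d} g f0 u0" using assms finite_Ix[of "{..<d}" n] by simp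
  finally show ?thesis .
qed

lemma gprod_Suc: "gprod {..<Suc d} g (f(d := i)) (u(d := j)) = g i j * gprod {..<d} g f u"
proof -
  have "gprod {..<d} g (f(d := i)) (u(d := j)) = gprod {..<d} g f u" by (rule gprod_cong) auto
  then show ?thesis by (simp add: gprod_def)
qed

lemma Ix_Suc_upd: "f \<in> Ix n {..<d} \<Longrightarrow> i < n \<Longrightarrow> f(d := i) \<in> Ix n {..<Suc d}"
  by (auto simp: Ix_def PiE_def Pi_def extensional_def less_Suc_eq)

lemma monom_is_gprod:
  "a \<in> exps n d \<Longrightarrow> \<exists>f\<in>Ix n {..<d}. \<exists>u\<in>Ix n {..<d}. \<forall>M. monom n a M = gprod {..<d} (mf n M) f u"
proof (induction d arbitrary: a)
  case 0
  then have "monom n a M = 1" for M by (simp add: exps_0 monom_def)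
  then show ?case by (simp add: Ix_empty gprod_def)
next
  case (Suc d)
  obtain i j a' where a': "i < n" "j < n" "a' \<in> exps n d" "a = exp_inc i j a'" using exps_Suc_cases[OF Suc.prems] .
  obtain f u where fu: "f \<in> Ix n {..<d}" "u \<in> Ix n {..<d}" "\<And>M. monom n a' M = gprod {..<d} (mf n M) f u"
    using Suc.IH[OF a'(3)] by blast
  have "monom n a M = gprod {..<Suc d} (mf n M) (f(d := i)) (u(d := j))" for M
    unfolding gprod_Suc a'(4) monom_exp_inc[OF a'(1,2)] using a' fu by (simp add: mf_def)
  then show ?case using Ix_Suc_upd[OF fu(1) a'(1)] Ix_Suc_upd[OF fu(2) a'(2)] by blast
qed

lemma gprod_is_monom:
  "f \<in> Ix n {..<d} \<Longrightarrow> u \<in> Ix n {..<d} \<Longrightarrow> \<exists>a\<in>exps n d. \<forall>M. gprod {..<d} (mf n M) f u = monom n a M"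
proof (induction d arbitrary: f u)
  case 0 then show ?case by (auto simp: exps_0 gprod_def monom_def)
next
  case (Suc d)
  define f' where "f' = restrict f {..<d}"
  define u' where "u' = restrict u {..<d}"
  have lt: "f k < n" "u k < n" if "k < Suc d" for k using Ix_lt[OF Suc.prems(1)] Ix_lt[OF Suc.prems(2)] that by auto
  have "f' \<in> Ix n {..<d}" "u' \<in> Ix n {..<d}" unfolding f'_def u'_def using lt by (auto intro!: restrict_Ix)
  then obtain a where a: "a \<in> exps n d" "\<And>M. gprod {..<d} (mf n M) f' u' = monom n a M" using Suc.IH by blast
  have "gprod {..<Suc d} (mf n M) f u = monom n (exp_inc (f d) (u d) a) M" for M
  proof -
    have "gprod {..<Suc d} (mf n M) f u = mf n M (f d) (u d) * gprod {..<d} (mf n M) f u" by (simp add: gprod_def)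
    also have "gprod {..<d} (mf n M) f u = gprod {..<d} (mf n M) f' u'"
      unfolding f'_def u'_def by (rule gprod_cong) auto
    also have "mf n M (f d) (u d) = M $$ (f d, u d)" using lt by (simp add: mf_def)
    finally show ?thesis using a lt by (simp add: monom_exp_inc)
  qed
  then show ?case using exp_inc_exps[OF lt(1)[of d] lt(2)[of d]] a(1) by auto
qed

text \<open>A monomial of degree d is a product of d entries, that is, a single entry of the d-th
  tensor power of the matrix.\<close>

lemma hompoly_eq_val: "hompoly n d = {(\<lambda>M. val n d X (mf n M)) | X. True}"
proof (intro equalityI subsetI)
  fix p assume "p \<in> hompoly n d"
  then obtain c where c: "p = (\<lambda>M. \<Sum>a\<in>exps n d. c a * monom n a M)" by (auto simp: hompoly_def)
  obtain F U where FU: "\<And>a. a \<in> exps n d \<Longrightarrow> F a \<in> Ix n {..<d} \<and> U a \<in> Ix n {..<d} \<and> (\<forall>M. monom n a M = gprod {..<d} (mf n M) (F a) (U a))"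
    using monom_is_gprod[of _ n d] by metis
  have "p M = val n d (\<lambda>f u. \<Sum>a\<in>exps n d. c a * (if f = F a \<and> u = U a then 1 else 0)) (mf n M)" for M
    unfolding val_sum c using FU by (intro sum.cong refl) (simp add: val_single)
  then show "p \<in> {(\<lambda>M. val n d X (mf n M)) | X. True}" by blast
next
  fix p assume "p \<in> {(\<lambda>M. val n d X (mf n M)) | X. True}"
  then obtain X where X: "p = (\<lambda>M. val n d X (mf n M))" by blast
  obtain A where A: "\<And>f u. f \<in> Ix n {..<d} \<Longrightarrow> u \<in> Ix n {..<d} \<Longrightarrow> A f u \<in> exps n d \<and> (\<forall>M. gprod {..<d} (mf n M) f u = monom n (A f u) M)"
    using gprod_is_monom[of _ n d] by metis
  let ?I = "Ix n {..<d}"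
  have fI: "finite ?I" by (simp add: finite_Ix)
  have "p M = (\<Sum>a\<in>exps n d. (\<Sum>f\<in>?I. \<Sum>u\<in>?I. if A f u = a then X f u else 0) * monom n a M)" for M
  proof -
    have "p M = (\<Sum>f\<in>?I. \<Sum>u\<in>?I. \<Sum>a\<in>exps n d. (if A f u = a then X f u else 0) * monom n a M)"
      unfolding X val_def
    proof (intro sum.cong refl)
      fix f u assume fu: "f \<in> ?I" "u \<in> ?I"
      have "(\<Sum>a\<in>exps n d. (if A f u = a then X f u else 0) * monom n a M) = (\<Sum>a\<in>exps n d. if A f u = a then X f u * monom n a M else 0)"
        by (intro sum.cong) auto
      then show "X f u * gprod {..<d} (mf n M) f u = (\<Sum>a\<in>exps n d. (if A f u = a then X f u else 0) * monom n a M)"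
        using A[OF fu] finite_exps by simp
    qed
    also have "\<dots> = (\<Sum>a\<in>exps n d. \<Sum>f\<in>?I. \<Sum>u\<in>?I. (if A f u = a then X f u else 0) * monom n a M)"
      by (rule sum_swap3[symmetric])
    finally show ?thesis by (simp add: sum_distrib_right)
  qed
  then have "p = (\<lambda>M. \<Sum>a\<in>exps n d. (\<Sum>f\<in>?I. \<Sum>u\<in>?I. if A f u = a then X f u else 0) * monom n a M)" by (rule ext)
  then show "p \<in> hompoly n d" unfolding hompoly_def by (intro CollectI exI conjI TrueI)
qed

section \<open>Insertions, multiples of the quadric and harmonic remainders\<close>

definition bitens :: "nat \<Rightarrow> 'k set \<Rightarrow> (('k \<Rightarrow> nat) \<Rightarrow> ('k \<Rightarrow> nat) \<Rightarrow> complex) \<Rightarrow> bool" where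
  "bitens n D X \<longleftrightarrow> (\<forall>u. tens n D (\<lambda>f. X f u)) \<and> (\<forall>f. tens n D (X f))"

text \<open>Makes an arbitrary coefficient function a tensor in both arguments without changing it
  on \<open>Ix n D\<close>, hence without changing the polynomial.\<close>

definition trim :: "nat \<Rightarrow> 'k set \<Rightarrow> (('k \<Rightarrow> nat) \<Rightarrow> ('k \<Rightarrow> nat) \<Rightarrow> complex) \<Rightarrow> ('k \<Rightarrow> nat) \<Rightarrow> ('k \<Rightarrow> nat) \<Rightarrow> complex" where
  "trim n D X f u = (if (\<forall>k\<in>D. f k < n \<and> u k < n) then X (restrict f D) (restrict u D) else 0)"

lemma restrict_id_Ix: "f \<in> Ix n D \<Longrightarrow> restrict f D = f"
  by (simp add: Ix_def PiE_def extensional_restrict)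

lemma trim_Ix: "f \<in> Ix n D \<Longrightarrow> u \<in> Ix n D \<Longrightarrow> trim n D X f u = X f u"
  by (simp add: trim_def restrict_id_Ix Ix_lt)

lemma bitens_trim: "bitens n D (trim n D X)"
  unfolding bitens_def tens_def
proof (intro conjI allI impI)
  fix u f f' :: "'a \<Rightarrow> nat" assume eq: "\<forall>k\<in>D. f k = f' k"
  then have r: "restrict f D = restrict f' D" by (auto simp: restrict_def fun_eq_iff)
  show "trim n D X f u = trim n D X f' u" "trim n D X u f = trim n D X u f'"
    using eq by (simp_all add: trim_def r cong: ball_cong)
next
  fix u f :: "'a \<Rightarrow> nat" assume "\<exists>k\<in>D. n \<le> f k"
  then show "trim n D X f u = 0" "trim n D X u f = 0" by (auto simp: trim_def not_less)
qed

lemma val_trim: "val n d (trim n {..<d} X) g = val n d X g"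
  by (rule val_cong) (simp add: trim_Ix)

lemma val_relabel:
  assumes "p permutes {..<d}"
  shows "val n d (\<lambda>f u. X (f \<circ> p) (u \<circ> p)) g = val n d X g"
proof -
  let ?I = "Ix n {..<d}"
  have bij: "bij_betw (\<lambda>f. f \<circ> p) ?I ?I" by (rule bij_betw_closed_ix[OF closed_ix_Ix assms]) simp
  have "gprod {..<d} g (f \<circ> p) (u \<circ> p) = gprod {..<d} g f u" for f u
    unfolding gprod_def using prod.permute[OF assms, of "\<lambda>k. g (f k) (u k)"] by simp
  then have "val n d (\<lambda>f u. X (f \<circ> p) (u \<circ> p)) g = (\<Sum>f\<in>?I. \<Sum>u\<in>?I. X (f \<circ> p) (u \<circ> p) * gprod {..<d} g (f \<circ> p) (u \<circ> p))"
    by (simp add: val_def)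
  also have "\<dots> = (\<Sum>f\<in>?I. \<Sum>u\<in>?I. X (f \<circ> p) u * gprod {..<d} g (f \<circ> p) u)"
  proof (rule sum.cong[OF refl])
    fix f
    show "(\<Sum>u\<in>?I. X (f \<circ> p) (u \<circ> p) * gprod {..<d} g (f \<circ> p) (u \<circ> p)) = (\<Sum>u\<in>?I. X (f \<circ> p) u * gprod {..<d} g (f \<circ> p) u)"
      by (rule sum.reindex_bij_betw[OF bij, of "\<lambda>u. X (f \<circ> p) u * gprod {..<d} g (f \<circ> p) u"])
  qed
  also have "\<dots> = val n d X g" unfolding val_def by (rule sum.reindex_bij_betw[OF bij, of "\<lambda>f. \<Sum>u\<in>?I. X f u * gprod {..<d} g f u"])
  finally show ?thesis .
qed

lemma val_transpose: "val n d (\<lambda>f u. X u f) g = val n d X (\<lambda>x y. g y x)"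
  unfolding val_def gprod_def by (rule sum.swap)

context bform
begin

text \<open>If g preserves b, an insertion in the left factor is carried through g to the right
  factor, where it becomes a contraction, and two slots disappear on each side. In this way a
  multiple of the quadric, whose value is 1 there, turns into a polynomial of degree two
  less.\<close>

lemma val_insertion:
  assumes g: "\<And>i j. i < n \<Longrightarrow> j < n \<Longrightarrow> (\<Sum>x<n. \<Sum>y<n. b x y * (g x i * g y j)) = b i j"
    and Y: "\<And>u. tens n {..<m} (\<lambda>f. Y f u)"
  shows "val n (Suc (Suc m)) (\<lambda>f u. b (f (Suc m)) (f m) * Y f u) g = val n m (\<lambda>f. ctr (Suc m) m (Y f)) g"
proof -
  let ?D = "{..<Suc (Suc m)}" and ?R = "{..<m}"
  have D: "?D = insert (Suc m) (insert m ?R)" by auto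
  have gp: "gprod ?D g (f(m := y, Suc m := x)) u = g x (u (Suc m)) * (g y (u m) * gprod ?R g f u)" for f u x y
  proof -
    have "gprod ?R g (f(m := y, Suc m := x)) u = gprod ?R g f u" by (rule gprod_cong) auto
    then show ?thesis unfolding D by (simp add: gprod_def)
  qed
  have Ye: "Y (f(m := y, Suc m := x)) u = Y f u" for f u x y by (rule tens_cong[OF Y]) auto
  have sI: "(\<Sum>f\<in>Ix n ?D. F f) = (\<Sum>x<n. \<Sum>y<n. \<Sum>f\<in>Ix n ?R. F (f(m := y, Suc m := x)))" for F :: "(nat \<Rightarrow> nat) \<Rightarrow> complex"
    unfolding D by (simp add: sum_Ix_insert)
  have "val n (Suc (Suc m)) (\<lambda>f u. b (f (Suc m)) (f m) * Y f u) g =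
     (\<Sum>u\<in>Ix n ?D. \<Sum>f\<in>Ix n ?D. b (f (Suc m)) (f m) * Y f u * gprod ?D g f u)"
    unfolding val_def by (rule sum.swap)
  also have "\<dots> = (\<Sum>u\<in>Ix n ?D. \<Sum>x<n. \<Sum>y<n. \<Sum>f\<in>Ix n ?R. b x y * (g x (u (Suc m)) * g y (u m)) * (Y f u * gprod ?R g f u))"
    unfolding sI[of "\<lambda>f. _ f * gprod ?D g f _"] gp Ye by (simp add: mult_ac)
  also have "\<dots> = (\<Sum>u\<in>Ix n ?D. \<Sum>f\<in>Ix n ?R. (\<Sum>x<n. \<Sum>y<n. b x y * (g x (u (Suc m)) * g y (u m))) * (Y f u * gprod ?R g f u))"
    unfolding sum_distrib_right by (rule sum.cong[OF refl], rule sum_swap3[symmetric])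
  \<comment> \<open>Here the invariance of b replaces the two factors of g by b at the slots of
    u.\<close>
  also have "\<dots> = (\<Sum>u\<in>Ix n ?D. \<Sum>f\<in>Ix n ?R. b (u (Suc m)) (u m) * (Y f u * gprod ?R g f u))"
    by (intro sum.cong refl) (simp add: g Ix_lt[of _ n ?D])
  also have "\<dots> = (\<Sum>x<n. \<Sum>y<n. \<Sum>u\<in>Ix n ?R. \<Sum>f\<in>Ix n ?R. b x y * (Y f (u(m := y, Suc m := x)) * gprod ?R g f u))"
  proof -
    have "gprod ?R g f (u(m := y, Suc m := x)) = gprod ?R g f u" for f u x y by (rule gprod_cong) auto
    then show ?thesis unfolding sI[of "\<lambda>u. \<Sum>f\<in>Ix n ?R. _ u f"] by simp
  qed
  also have "\<dots> = (\<Sum>u\<in>Ix n ?R. \<Sum>f\<in>Ix n ?R. \<Sum>x<n. \<Sum>y<n. b x y * (Y f (u(m := y, Suc m := x)) * gprod ?R g f u))"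
    by (rule sum_swap4[symmetric])
  also have "\<dots> = (\<Sum>f\<in>Ix n ?R. \<Sum>u\<in>Ix n ?R. \<Sum>x<n. \<Sum>y<n. b x y * (Y f (u(m := y, Suc m := x)) * gprod ?R g f u))"
    by (rule sum.swap)
  also have "\<dots> = val n m (\<lambda>f. ctr (Suc m) m (Y f)) g"
    unfolding val_def ctr_def by (simp add: sum_distrib_right mult.assoc fun_upd_twist[of m "Suc m"])
  finally show ?thesis .
qed

end

lemma fip_prod_swap: "fip (I \<times> I) (\<lambda>(f, u). X u f) (\<lambda>(f, u). Y u f) = fip (I \<times> I) (\<lambda>(f, u). X f u) (\<lambda>(f, u). Y f u)"
  unfolding fip_def by (rule sum.reindex_bij_witness[where i = prod.swap and j = prod.swap]) auto

lemma exists_perm_pair: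
  assumes "i \<in> D" "j \<in> D" "i \<noteq> j" "i0 \<in> D" "j0 \<in> D" "i0 \<noteq> j0"
  obtains q where "q permutes D" "q i = i0" "q j = j0"
proof -
  define s where "s = transpose i i0"
  define q where "q = transpose (s j) j0 \<circ> s"
  have "q permutes D" unfolding q_def s_def using assms
    by (intro permutes_compose permutes_swap_id) (auto simp: transpose_def)
  moreover have "q i = i0" "q j = j0" using assms by (auto simp: q_def s_def transpose_def)
  ultimately show ?thesis using that by blast
qed

context bform
begin

text \<open>Testing with the insertion of a contraction of X itself gives the squared norm of that
  contraction.\<close>

lemma harm_of_orthogonal:
  assumes D: "finite D" and X: "bitens n D X"
    and o: "\<And>i j Y. i \<in> D \<Longrightarrow> j \<in> D \<Longrightarrow> i \<noteq> j \<Longrightarrow> (\<And>u. tens n (D - {i, j}) (\<lambda>f. Y f u)) \<Longrightarrow> (\<And>f. tens n D (Y f)) \<Longrightarrow>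
       fip (Ix n D \<times> Ix n D) (\<lambda>(f, u). X f u) (\<lambda>(f, u). b (f i) (f j) * Y f u) = 0"
  shows "harm D (\<lambda>f. X f u)"
  unfolding harm_def
proof (intro ballI impI)
  fix i j assume ij: "i \<in> D" "j \<in> D" "i \<noteq> j"
  define R where "R = D - {i, j}"
  have R: "D = insert i (insert j R)" "i \<notin> R" "j \<notin> R" "finite R" using ij D by (auto simp: R_def)
  have X1: "tens n D (\<lambda>f. X f u)" and X2: "tens n D (X f)" for f u using X by (auto simp: bitens_def)
  define Y where "Y = (\<lambda>f u. ctr i j (\<lambda>f. X f u) f)"
  have Y1: "tens n R (\<lambda>f. Y f u)" for u unfolding Y_def using ctr_tens[OF X1[of u, unfolded R(1)] R(2,3)] .
  have Y2: "tens n D (Y f)" for f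
    unfolding Y_def ctr_def using X2 by (intro tens_sum tens_scale)
  have "0 = fip (Ix n D \<times> Ix n D) (\<lambda>(f, u). X f u) (\<lambda>(f, u). b (f i) (f j) * Y f u)"
    using o[OF ij Y1[unfolded R_def] Y2] by simp
  also have "\<dots> = (\<Sum>u\<in>Ix n D. fip (Ix n D) (\<lambda>f. X f u) (ins i j (\<lambda>f. Y f u)))"
    unfolding fip_def ins_def by (subst sum.swap) (simp add: sum.cartesian_product case_prod_unfold)
  also have "\<dots> = (\<Sum>u\<in>Ix n D. fip (Ix n R) (\<lambda>f. Y f u) (\<lambda>f. Y f u))"
    using fip_ctr[OF X1[unfolded R(1)] Y1 ij(3) R(2,3,4), folded R(1)] by (simp add: Y_def)
  also have "\<dots> = fip (Ix n D \<times> Ix n R) (\<lambda>(u, f). Y f u) (\<lambda>(u, f). Y f u)"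
    unfolding fip_def by (simp add: sum.cartesian_product case_prod_unfold)
  finally have "fip (Ix n D \<times> Ix n R) (\<lambda>(u, f). Y f u) (\<lambda>(u, f). Y f u) = 0" by simp
  then have z: "Y f u = 0" if "u \<in> Ix n D" "f \<in> Ix n R" for f u
    using fip_self_eq_0[of "Ix n D \<times> Ix n R" "\<lambda>(u, f). Y f u" "(u, f)"] that finite_Ix[OF D] finite_Ix[OF R(4)] by auto
  have "(\<lambda>f. Y f u) = (\<lambda>f. 0)" if "u \<in> Ix n D" for u
    using z that by (intro tens_eqI[OF Y1 tens_null]) auto
  then have "Y f = (\<lambda>u. 0)" for f by (intro tens_eqI[OF Y2 tens_null]) (auto dest: fun_cong)
  then show "ctr i j (\<lambda>f. X f u) = (\<lambda>f. 0)" by (simp add: Y_def fun_eq_iff)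
qed

definition linsertion :: "'k set \<Rightarrow> (('k \<Rightarrow> nat) \<Rightarrow> ('k \<Rightarrow> nat) \<Rightarrow> complex) \<Rightarrow> bool" where
  "linsertion D X \<longleftrightarrow> (\<exists>i\<in>D. \<exists>j\<in>D. \<exists>Y. i \<noteq> j \<and> (\<forall>u. tens n (D - {i, j}) (\<lambda>f. Y f u)) \<and> (\<forall>f. tens n D (Y f)) \<and>
     X = (\<lambda>f u. b (f i) (f j) * Y f u))"

lemma bitens_linsertion: assumes "linsertion D X" shows "bitens n D X"
proof -
  obtain i j Y where ij: "i \<in> D" "j \<in> D" "i \<noteq> j" and Y: "\<And>u. tens n (D - {i, j}) (\<lambda>f. Y f u)" "\<And>f. tens n D (Y f)"
    and X: "X = (\<lambda>f u. b (f i) (f j) * Y f u)" using assms unfolding linsertion_def by blast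
  have "D = insert i (insert j (D - {i, j}))" using ij by auto
  then have "tens n D (\<lambda>f. X f u)" for u using ins_tens[OF Y(1)[of u], of i j] unfolding X ins_def by simp
  moreover have "tens n D (X f)" for f unfolding X using Y(2) by (rule tens_scale)
  ultimately show ?thesis by (simp add: bitens_def)
qed

text \<open>Divisibility by the quadric, phrased on a set A where the quadric is 1. Subtraction of
  natural numbers truncates, hence the case distinction: in degrees 0 and 1 only the zero function
  on A qualifies.\<close>

definition reduces :: "nat \<Rightarrow> ((nat \<Rightarrow> nat) \<Rightarrow> (nat \<Rightarrow> nat) \<Rightarrow> complex) \<Rightarrow> (nat \<Rightarrow> nat \<Rightarrow> complex) set \<Rightarrow> bool" where
  "reduces d X A \<longleftrightarrow> (\<exists>Y. \<forall>g\<in>A. val n d X g = (if 2 \<le> d then val n (d - 2) Y g else 0))"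

lemma reduces_linsertion:
  assumes "linsertion {..<d} X"
    and A: "\<And>g i j. g \<in> A \<Longrightarrow> i < n \<Longrightarrow> j < n \<Longrightarrow> (\<Sum>x<n. \<Sum>y<n. b x y * (g x i * g y j)) = b i j"
  shows "reduces d X A"
proof -
  let ?D = "{..<d}"
  obtain i j Y where ij: "i \<in> ?D" "j \<in> ?D" "i \<noteq> j" and Y: "\<And>u. tens n (?D - {i, j}) (\<lambda>f. Y f u)" "\<And>f. tens n ?D (Y f)"
    and X: "X = (\<lambda>f u. b (f i) (f j) * Y f u)" using assms(1) unfolding linsertion_def by blast
  have "2 \<le> d" using ij by (cases "d = 0"; cases "d = 1") auto
  then obtain m where d: "d = Suc (Suc m)" by (metis add_2_eq_Suc le_Suc_ex)
  \<comment> \<open>Relabelling both factors simultaneously keeps the value and brings the inserted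
    pair to the last two slots, where \<open>val_insertion\<close> applies.\<close>
  obtain q where q: "q permutes ?D" "q i = Suc m" "q j = m"
    using exists_perm_pair[OF ij, of "Suc m" m] d by auto
  define Y' where "Y' = (\<lambda>f u. Y (f \<circ> q) (u \<circ> q))"
  have qm: "q k < m \<longleftrightarrow> k \<in> ?D - {i, j}" for k
  proof -
    have "q k \<in> ?D \<longleftrightarrow> k \<in> ?D" using permutes_in_image[OF q(1)] .
    moreover have "q k = Suc m \<longleftrightarrow> k = i" "q k = m \<longleftrightarrow> k = j"
      using permutes_inj[OF q(1)] q(2,3) by (metis injD)+
    ultimately show ?thesis using d by auto
  qed
  have "tens n {..<m} (\<lambda>f. Y' f u)" for u unfolding tens_def Y'_def
  proof (intro conjI allI impI)
    fix f f' :: "nat \<Rightarrow> nat" assume "\<forall>k\<in>{..<m}. f k = f' k"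
    then show "Y (f \<circ> q) (u \<circ> q) = Y (f' \<circ> q) (u \<circ> q)" using qm by (intro tens_cong[OF Y(1)]) auto
  next
    fix f :: "nat \<Rightarrow> nat" assume "\<exists>k\<in>{..<m}. n \<le> f k"
    then obtain k where k: "k < m" "n \<le> f k" by blast
    have "q (pinv q k) = k" by (rule permutes_inverses[OF q(1)])
    then show "Y (f \<circ> q) (u \<circ> q) = 0" using k qm[of "pinv q k"]
      by (intro tens_zero[OF Y(1), of "pinv q k"]) auto
  qed
  then have "val n d (\<lambda>f u. b (f (Suc m)) (f m) * Y' f u) g = val n m (\<lambda>f. ctr (Suc m) m (Y' f)) g" if "g \<in> A" for g
    unfolding d using A[OF that] by (intro val_insertion)
  moreover have "val n d X g = val n d (\<lambda>f u. b (f (Suc m)) (f m) * Y' f u) g" for g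
    using val_relabel[OF q(1), of n X g] unfolding X Y'_def by (simp add: q)
  ultimately show ?thesis unfolding reduces_def using d by (intro exI[of _ "\<lambda>f. ctr (Suc m) m (Y' f)"]) simp
qed

lemma reduces_add_scale:
  assumes "reduces d X A" "reduces d Y A" shows "reduces d (\<lambda>f u. X f u + c * Y f u) A"
proof -
  obtain X' Y' where X': "\<forall>g\<in>A. val n d X g = (if 2 \<le> d then val n (d - 2) X' g else 0)"
    and Y': "\<forall>g\<in>A. val n d Y g = (if 2 \<le> d then val n (d - 2) Y' g else 0)" using assms unfolding reduces_def by blast
  show ?thesis unfolding reduces_def
    by (intro exI[of _ "\<lambda>f u. X' f u + c * Y' f u"] ballI) (use X' Y' in \<open>simp add: val_add val_scale\<close>)
qed

end

context bgroup
begin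

text \<open>The mirror image, obtained by transposing X and g; transposed group elements preserve b
  as well, by \<open>g_inv'\<close>.\<close>

lemma reduces_rinsertion:
  assumes "linsertion {..<d} (\<lambda>f u. X u f)" shows "reduces d X Gr"
proof -
  have "reduces d (\<lambda>f u. X u f) ((\<lambda>g x y. g y x) ` Gr)"
    using assms by (rule reduces_linsertion) (auto simp: g_inv')
  then obtain Y where Y: "\<And>g. g \<in> Gr \<Longrightarrow> val n d (\<lambda>f u. X u f) (\<lambda>x y. g y x) = (if 2 \<le> d then val n (d - 2) Y (\<lambda>x y. g y x) else 0)"
    unfolding reduces_def by blast
  have "val n d X g = (if 2 \<le> d then val n (d - 2) (\<lambda>f u. Y u f) g else 0)" if "g \<in> Gr" for g
    using Y[OF that] unfolding val_transpose[of n d X] val_transpose[of n "d - 2" Y] by simp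
  then show ?thesis unfolding reduces_def by blast
qed

text \<open>Project X onto the span of all insertions in either factor. The remainder is orthogonal
  to all of them, hence harmonic in both factors, and averaging it over simultaneous permutations
  changes no value.\<close>

theorem val_decomposition:
  obtains X' where "HH {..<d} X'" "reduces d (\<lambda>f u. X f u - X' f u) Gr"
proof -
  let ?D = "{..<d}"
  have D: "finite ?D" by simp
  have fII: "finite (Ix n ?D \<times> Ix n ?D)" using finite_Ix[OF D] by blast
  define T where "T = trim n ?D X"
  have T: "bitens n ?D T" unfolding T_def by (rule bitens_trim)
  define W where "W = (\<lambda>Y (f, u). Y f u :: complex) ` {Y. linsertion ?D Y \<or> linsertion ?D (\<lambda>f u. Y u f)}"
  obtain w where w: "w \<in> fspan W" "\<And>v. v \<in> fspan W \<Longrightarrow> fip (Ix n ?D \<times> Ix n ?D) (\<lambda>x. (\<lambda>(f, u). T f u) x - w x) v = 0"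
    using orthogonal_decomposition[OF fII subsp_fspan[of W], of "\<lambda>(f, u). T f u"] by blast
  have w': "bitens n ?D (\<lambda>f u. w (f, u)) \<and> reduces d (\<lambda>f u. w (f, u)) Gr"
    using w(1)
  proof (induction rule: fspan_induct)
    case zero
    have "reduces d (\<lambda>f u. 0) Gr" unfolding reduces_def by (intro exI[of _ "\<lambda>f u. 0"]) (simp add: val_def)
    then show ?case by (simp add: bitens_def tens_null)
  next
    case (add c s w)
    obtain Y where Y: "linsertion ?D Y \<or> linsertion ?D (\<lambda>f u. Y u f)" "s = (\<lambda>(f, u). Y f u)" using add(1) unfolding W_def by auto
    have "bitens n ?D Y \<and> reduces d Y Gr"
      using Y(1)
    proof
      assume "linsertion ?D Y"
      then show ?thesis using bitens_linsertion reduces_linsertion g_inv by blast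
    next
      assume "linsertion ?D (\<lambda>f u. Y u f)"
      then show ?thesis using bitens_linsertion[of ?D "\<lambda>f u. Y u f"] reduces_rinsertion[of d Y] by (auto simp: bitens_def)
    qed
    then show ?case using add(2) reduces_add_scale[of d "\<lambda>f u. w (f, u)" Gr Y c] unfolding Y(2)
      by (auto simp: bitens_def intro!: tens_add tens_scale)
  qed
  define Z where "Z = (\<lambda>f u. T f u - w (f, u))"
  have Z: "bitens n ?D Z" using T w' by (auto simp: bitens_def Z_def intro: tens_diff)
  have Z': "bitens n ?D (\<lambda>f u. Z u f)" using Z by (auto simp: bitens_def)
  have ZW: "fip (Ix n ?D \<times> Ix n ?D) (\<lambda>(f, u). Z f u) (\<lambda>(f, u). Y f u) = 0" if "linsertion ?D Y \<or> linsertion ?D (\<lambda>f u. Y u f)" for Y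
  proof -
    have "(\<lambda>(f, u). Y f u) \<in> fspan W" unfolding W_def using that by (intro fspan_mem) blast
    from w(2)[OF this] show ?thesis by (simp add: Z_def case_prod_unfold)
  qed
  have h1: "harm ?D (\<lambda>f. Z f u)" for u
    by (rule harm_of_orthogonal[OF D Z], rule ZW) (auto simp: linsertion_def)
  have h2: "harm ?D (Z f)" for f
  proof (rule harm_of_orthogonal[OF D Z'])
    fix i j Y assume Y: "i \<in> ?D" "j \<in> ?D" "i \<noteq> j" "\<And>u. tens n (?D - {i, j}) (\<lambda>f. Y f u)" "\<And>f. tens n ?D (Y f)"
    have "linsertion ?D (\<lambda>f u. b (f i) (f j) * Y f u)" unfolding linsertion_def using Y by blast
    then have "fip (Ix n ?D \<times> Ix n ?D) (\<lambda>(f, u). Z f u) (\<lambda>(f, u). b (u i) (u j) * Y u f) = 0" by (intro ZW) simp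
    then show "fip (Ix n ?D \<times> Ix n ?D) (\<lambda>(f, u). Z u f) (\<lambda>(f, u). b (f i) (f j) * Y f u) = 0"
      using fip_prod_swap[of "Ix n ?D" Z "\<lambda>f u. b (u i) (u j) * Y u f"] by simp
  qed
  define P where "P = {p. p permutes ?D}"
  have P: "finite P" "card P > 0" unfolding P_def using finite_permutations[OF D]
    by (auto simp: card_gt_0_iff intro: permutes_id)
  define X' where "X' = (\<lambda>f u. \<Sum>p\<in>P. (1 / of_nat (card P)) * Z (f \<circ> p) (u \<circ> p))"
  have "HH ?D X'" unfolding HH_def
  proof (intro conjI allI impI)
    fix u
    have 1: "(\<lambda>f. X' f u) = (\<lambda>f. \<Sum>p\<in>P. (1 / of_nat (card P)) * pact p (\<lambda>f. Z f (u \<circ> p)) f)" by (simp add: X'_def pact_def)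
    have 2: "X' u = (\<lambda>v. \<Sum>p\<in>P. (1 / of_nat (card P)) * pact p (Z (u \<circ> p)) v)" by (simp add: X'_def pact_def)
    show "tens n ?D (\<lambda>f. X' f u)" unfolding 1 using Z by (intro tens_sum tens_scale tens_pact) (auto simp: bitens_def P_def)
    show "tens n ?D (X' u)" unfolding 2 using Z by (intro tens_sum tens_scale tens_pact) (auto simp: bitens_def P_def)
    show "harm ?D (\<lambda>f. X' f u)" unfolding 1 using h1 by (intro harm_sum harm_scale harm_pact) (auto simp: P_def)
    show "harm ?D (X' u)" unfolding 2 using h2 by (intro harm_sum harm_scale harm_pact) (auto simp: P_def)
  next
    fix q f u assume q: "q permutes ?D"
    have "X' (f \<circ> q) (u \<circ> q) = (\<Sum>p\<in>P. (1 / of_nat (card P)) * Z (f \<circ> (q \<circ> p)) (u \<circ> (q \<circ> p)))"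
      by (simp add: X'_def comp_assoc)
    also have "\<dots> = X' f u" unfolding X'_def
      by (rule sum.reindex_bij_witness[where i = "\<lambda>p. pinv q \<circ> p" and j = "\<lambda>p. q \<circ> p"])
        (auto simp: P_def permutes_compose[OF _ q] permutes_compose[OF _ permutes_inv[OF q]] comp_assoc[symmetric] permutes_inv_o[OF q])
    finally show "X' (f \<circ> q) (u \<circ> q) = X' f u" .
  qed
  moreover have "reduces d (\<lambda>f u. X f u - X' f u) Gr"
  proof -
    have e: "val n d (\<lambda>f u. X f u - X' f u) g = val n d (\<lambda>f u. w (f, u)) g" for g
    proof -
      have vX': "val n d X' g = val n d Z g"
      proof -
        have "val n d X' g = (\<Sum>p\<in>P. (1 / of_nat (card P)) * val n d (\<lambda>f u. Z (f \<circ> p) (u \<circ> p)) g)"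
          unfolding X'_def by (rule val_sum)
        also have "\<dots> = (\<Sum>p\<in>P. (1 / of_nat (card P)) * val n d Z g)"
          by (intro sum.cong refl) (simp add: P_def val_relabel)
        also have "\<dots> = val n d Z g" using P by auto
        finally show ?thesis .
      qed
      have "val n d (\<lambda>f u. X f u - X' f u) g = val n d X g - val n d X' g"
        using val_add[of n d X "\<lambda>f u. -1 * X' f u" g] val_scale[of n d "-1" X' g] by simp
      also have "val n d X g = val n d T g" unfolding T_def val_trim ..
      also have "val n d T g - val n d X' g = val n d (\<lambda>f u. w (f, u)) g"
        unfolding vX' using val_add[of n d Z "\<lambda>f u. w (f, u)" g] by (simp add: Z_def)
      finally show ?thesis .
    qed
    show ?thesis using w' unfolding reduces_def e by blast
  qed
  ultimately show ?thesis using that by blast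
qed

text \<open>Converse of \<open>reduces_linsertion\<close>. Inserting b in both factors of Y and
  dividing by n works, since \<open>val_insertion\<close> contracts the copy of b in the right
  factor and the closed loop has value n.\<close>

lemma exists_insertion:
  assumes n: "n > 0"
  obtains Y' where "\<And>u. tens n {..<m} (\<lambda>f. Y' f u)"
    "\<And>g. g \<in> Gr \<Longrightarrow> val n (Suc (Suc m)) (\<lambda>f u. b (f (Suc m)) (f m) * Y' f u) g = val n m Y g"
proof -
  define T where "T = trim n {..<m} Y"
  have T: "bitens n {..<m} T" unfolding T_def by (rule bitens_trim)
  define Y' where "Y' = (\<lambda>f u. (1 / of_nat n) * (b (u (Suc m)) (u m) * T f u))"
  have Y't: "tens n {..<m} (\<lambda>f. Y' f u)" for u
    unfolding Y'_def using T by (intro tens_scale) (auto simp: bitens_def)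
  have "ctr (Suc m) m (Y' f) u = T f u" for f u
  proof -
    have "T f (u(Suc m := x, m := y)) = T f u" for x y
      using T by (intro tens_cong[of n "{..<m}" "T f"]) (auto simp: bitens_def)
    then have "ctr (Suc m) m (Y' f) u = (1 / of_nat n) * (\<Sum>x<n. \<Sum>y<n. b x y * (b x y * T f u))"
      by (simp add: ctr_def Y'_def sum_distrib_left sum_divide_distrib)
    then show ?thesis unfolding b_contract0 using n by simp
  qed
  then have c: "(\<lambda>f. ctr (Suc m) m (Y' f)) = T" by (simp add: fun_eq_iff)
  have "val n (Suc (Suc m)) (\<lambda>f u. b (f (Suc m)) (f m) * Y' f u) g = val n m Y g" if g: "g \<in> Gr" for g
  proof -
    have "val n (Suc (Suc m)) (\<lambda>f u. b (f (Suc m)) (f m) * Y' f u) g = val n m T g"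
      unfolding c[symmetric] using g_inv[OF g] Y't by (intro val_insertion)
    then show ?thesis unfolding T_def val_trim .
  qed
  then show ?thesis using that Y't by blast
qed

text \<open>By \<open>exists_insertion\<close> the values of degree d - 2 are those of an insertion
  in degree d, which is the form required by \<open>HH_orthogonal_zero\<close>.\<close>

lemma val_HH_injective:
  assumes n: "n > 0" and X: "HH {..<d} X"
    and z: "\<And>g. g \<in> Gr \<Longrightarrow> (if 2 \<le> d then val n (d - 2) Y g else 0) + val n d X g = 0"
  shows "X f u = 0"
proof (cases "2 \<le> d")
  case False
  then show ?thesis using z by (intro HH_orthogonal_zero'[OF _ X]) (auto simp: val_def)
next
  case True
  then obtain m where d: "d = Suc (Suc m)" by (metis add_2_eq_Suc le_Suc_ex)
  obtain Y' where Y': "\<And>u. tens n {..<m} (\<lambda>f. Y' f u)"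
    "\<And>g. g \<in> Gr \<Longrightarrow> val n (Suc (Suc m)) (\<lambda>f u. b (f (Suc m)) (f m) * Y' f u) g = val n m Y g"
    by (rule exists_insertion[OF n]) (rule that)
  show ?thesis
  proof (rule HH_orthogonal_zero[OF _ X, of "Suc m" m Y'])
    have "{..<d} - {Suc m, m} = {..<m}" using d by auto
    then show "tens n ({..<d} - {Suc m, m}) (\<lambda>f. Y' f u)" for u using Y'(1) by simp
    fix g assume g: "g \<in> Gr"
    have "(\<Sum>f\<in>Ix n {..<d}. \<Sum>u\<in>Ix n {..<d}. (X f u + b (f (Suc m)) (f m) * Y' f u) * gprod {..<d} g f u) =
       val n d X g + val n d (\<lambda>f u. b (f (Suc m)) (f m) * Y' f u) g"
      unfolding val_add[symmetric] by (simp add: val_def)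
    then show "(\<Sum>f\<in>Ix n {..<d}. \<Sum>u\<in>Ix n {..<d}. (X f u + b (f (Suc m)) (f m) * Y' f u) * gprod {..<d} g f u) = 0"
      using z[OF g] Y'(2)[OF g] d by (simp add: add.commute)
  qed (use d in auto)
qed

section \<open>The action of pairs of group elements on coefficient tensors\<close>

definition act2 :: "'k set \<Rightarrow> (nat \<Rightarrow> nat \<Rightarrow> complex) \<Rightarrow> (nat \<Rightarrow> nat \<Rightarrow> complex) \<Rightarrow>
    (('k \<Rightarrow> nat) \<Rightarrow> ('k \<Rightarrow> nat) \<Rightarrow> complex) \<Rightarrow> ('k \<Rightarrow> nat) \<Rightarrow> ('k \<Rightarrow> nat) \<Rightarrow> complex" where
  "act2 D g h X f u = (\<Sum>v\<in>Ix n D. \<Sum>w\<in>Ix n D. gprod D g f v * gprod D h u w * X v w)"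

lemma act2_left: "(\<lambda>f. act2 D g h X f u) = gact n D g (\<lambda>v. \<Sum>w\<in>Ix n D. gprod D h u w * X v w)"
  by (simp add: act2_def gact_def sum_distrib_left mult.assoc fun_eq_iff)

lemma act2_right: "act2 D g h X f = (\<lambda>u. \<Sum>v\<in>Ix n D. gprod D g f v * gact n D h (X v) u)"
  by (simp add: act2_def gact_def sum_distrib_left mult.assoc fun_eq_iff)

lemma harm_gact:
  assumes "finite D" "g \<in> Gr" "harm D t" shows "harm D (gact n D g t)"
  unfolding harm_def
proof (intro ballI impI)
  fix i j assume ij: "i \<in> D" "j \<in> D" "i \<noteq> j"
  define R where "R = D - {i, j}"
  have R: "D = insert i (insert j R)" "i \<notin> R" "j \<notin> R" "finite R" using ij assms(1) by (auto simp: R_def)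
  have "ctr i j (gact n D g t) = gact n R g (ctr i j t)"
    using ctr_gact[OF ij(3) R(2,3,4) assms(2), of t] R(1) by simp
  also have "ctr i j t = (\<lambda>f. 0)" using assms(3) ij by (simp add: harm_def)
  finally show "ctr i j (gact n D g t) = (\<lambda>f. 0)" by (simp add: gact_def)
qed

lemma gprod_permute: "p permutes D \<Longrightarrow> gprod D g (f \<circ> p) (u \<circ> p) = gprod D g f u"
  unfolding gprod_def using prod.permute[of p D "\<lambda>k. g (f k) (u k)"] by simp

lemma act2_permute:
  assumes D: "finite D" and p: "p permutes D" and q: "q permutes D"
  shows "act2 D g h X (f \<circ> p) (u \<circ> q) = act2 D g h (\<lambda>f u. X (f \<circ> p) (u \<circ> q)) f u"
proof -
  let ?I = "Ix n D"
  have "act2 D g h X (f \<circ> p) (u \<circ> q) = (\<Sum>v\<in>?I. \<Sum>w\<in>?I. gprod D g (f \<circ> p) (v \<circ> p) * gprod D h (u \<circ> q) w * X (v \<circ> p) w)"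
    unfolding act2_def by (rule sum.reindex_bij_betw[OF bij_betw_closed_ix[OF closed_ix_Ix[OF D] p], symmetric])
  also have "\<dots> = (\<Sum>v\<in>?I. \<Sum>w\<in>?I. gprod D g (f \<circ> p) (v \<circ> p) * gprod D h (u \<circ> q) (w \<circ> q) * X (v \<circ> p) (w \<circ> q))"
  proof (rule sum.cong[OF refl])
    fix v
    show "(\<Sum>w\<in>?I. gprod D g (f \<circ> p) (v \<circ> p) * gprod D h (u \<circ> q) w * X (v \<circ> p) w) =
       (\<Sum>w\<in>?I. gprod D g (f \<circ> p) (v \<circ> p) * gprod D h (u \<circ> q) (w \<circ> q) * X (v \<circ> p) (w \<circ> q))"
      by (rule sum.reindex_bij_betw[OF bij_betw_closed_ix[OF closed_ix_Ix[OF D] q], symmetric])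
  qed
  finally show ?thesis by (simp add: act2_def gprod_permute[OF p] gprod_permute[OF q])
qed

lemma HH_act2:
  assumes D: "finite D" and gh: "g \<in> Gr" "h \<in> Gr" and X: "HH D X"
  shows "HH D (act2 D g h X)"
  unfolding HH_def
proof (intro conjI allI impI)
  fix u
  show "tens n D (\<lambda>f. act2 D g h X f u)" unfolding act2_left using D gh by (intro gact_tens')
  show "tens n D (act2 D g h X u)" unfolding act2_right using D gh by (intro tens_sum tens_scale gact_tens')
  show "harm D (\<lambda>f. act2 D g h X f u)" unfolding act2_left using D gh X
    by (intro harm_gact harm_sum harm_scale) (auto simp: HH_def)
  show "harm D (act2 D g h X u)" unfolding act2_right using D gh X
    by (intro harm_sum harm_scale harm_gact) (auto simp: HH_def)
next
  fix p f u assume p: "p permutes D"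
  have "(\<lambda>f u. X (f \<circ> p) (u \<circ> p)) = X" using X p by (simp add: HH_def fun_eq_iff)
  then show "act2 D g h X (f \<circ> p) (u \<circ> p) = act2 D g h X f u" unfolding act2_permute[OF D p p] by simp
qed

text \<open>The substitution of g^T N h for N acts on coefficients by g in the left and by h in the
  right factor. The transpose of g is what \<open>B_inv_m\<close> makes of the inverse in the action
  on matrices.\<close>

lemma val_act2:
  "val n d X (\<lambda>x y. \<Sum>z<n. g z x * (\<Sum>w<n. N z w * h w y)) = val n d (act2 {..<d} g h X) N"
proof -
  have 1: "gprod {..<d} (\<lambda>x z. g z x) f w = gprod {..<d} g w f" for f w by (simp add: gprod_def)
  have "(\<lambda>f w. \<Sum>u\<in>Ix n {..<d}. (\<Sum>v\<in>Ix n {..<d}. X v u * gprod {..<d} g f v) * gprod {..<d} h w u) = act2 {..<d} g h X"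
    unfolding act2_def by (intro ext) (subst sum.swap, simp add: sum_distrib_right sum_distrib_left mult_ac)
  then show ?thesis
    unfolding val_mult_matrix[where a = "\<lambda>x z. g z x"] val_mult_matrix_right[where a = h] 1 by simp
qed

end

section \<open>Weyl modules\<close>

lemma row_start_Suc: "r < length lam \<Longrightarrow> row_start lam (Suc r) = row_start lam r + lam ! r"
  by (simp add: row_start_def take_Suc_conv_app_nth)

lemma row_start_mono: "r \<le> s \<Longrightarrow> row_start lam r \<le> row_start lam s"
proof -
  assume "r \<le> s"
  then have "take s lam = take r lam @ take (s - r) (drop r lam)" by (metis le_add_diff_inverse take_add)
  then show ?thesis by (simp add: row_start_def)
qed

lemma row_start_length: "row_start lam (length lam) = sum_list lam"
  by (simp add: row_start_def)

text \<open>The least index skips rows of length zero: \<open>row_start\<close> does not grow there,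
  so an earlier row already satisfies the condition.\<close>

definition rowf :: "nat list \<Rightarrow> nat \<Rightarrow> nat" where
  "rowf lam x = (LEAST r. x < row_start lam (Suc r))"

definition colf :: "nat list \<Rightarrow> nat \<Rightarrow> nat" where
  "colf lam x = x - row_start lam (rowf lam x)"

lemma rowf_unique:
  assumes "r < length lam" "row_start lam r \<le> x" "x < row_start lam r + lam ! r"
  shows "rowf lam x = r"
  unfolding rowf_def
proof (rule Least_equality)
  show "x < row_start lam (Suc r)" using assms by (simp add: row_start_Suc)
  fix s assume "x < row_start lam (Suc s)"
  then show "r \<le> s" using assms(2) row_start_mono[of "Suc s" r lam] by (meson not_le not_less_eq_eq order_trans)
qed

lemma rowf_colf:
  assumes "x < sum_list lam"
  shows "rowf lam x < length lam" "x = row_start lam (rowf lam x) + colf lam x" "colf lam x < lam ! rowf lam x"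
proof -
  let ?r = "rowf lam x"
  have ne: "length lam \<noteq> 0" using assms by auto
  then have ex: "x < row_start lam (Suc (length lam - 1))" using assms by (simp add: row_start_length)
  have lt: "x < row_start lam (Suc ?r)" unfolding rowf_def by (rule LeastI[of "\<lambda>r. x < row_start lam (Suc r)", OF ex])
  have "?r \<le> length lam - 1" unfolding rowf_def by (rule Least_le) (rule ex)
  then show l: "?r < length lam" using ne by linarith
  have ge: "row_start lam ?r \<le> x"
  proof (cases ?r)
    case (Suc s)
    then have "\<not> x < row_start lam (Suc s)" unfolding rowf_def using not_less_Least[of s "\<lambda>r. x < row_start lam (Suc r)"] by simp
    then show ?thesis using Suc by simp
  qed (simp add: row_start_def)
  then show "x = row_start lam ?r + colf lam x" by (simp add: colf_def)
  then show "colf lam x < lam ! ?r" using lt unfolding row_start_Suc[OF l] by linarith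
qed

lemma rowf_colf_pos:
  assumes "r < length lam" "c < lam ! r"
  shows "row_start lam r + c < sum_list lam" "rowf lam (row_start lam r + c) = r" "colf lam (row_start lam r + c) = c"
proof -
  have "row_start lam r + c < row_start lam (Suc r)" using assms by (simp add: row_start_Suc)
  also have "\<dots> \<le> sum_list lam" using row_start_mono[of "Suc r" "length lam" lam] assms row_start_length[of lam] by simp
  finally show "row_start lam r + c < sum_list lam" .
  show r: "rowf lam (row_start lam r + c) = r" using assms by (intro rowf_unique) auto
  show "colf lam (row_start lam r + c) = c" unfolding colf_def r by simp
qed

lemma tableau_std:
  assumes "sorted_wrt (\<ge>) lam"
  shows "tableau {..<sum_list lam} (rowf lam) (colf lam)"
  unfolding tableau_def
proof (intro conjI ballI allI impI)
  show "inj_on (\<lambda>x. (rowf lam x, colf lam x)) {..<sum_list lam}"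
    by (rule inj_onI) (metis lessThan_iff prod.inject rowf_colf(2))
next
  fix x i assume x: "x \<in> {..<sum_list lam}" "i < rowf lam x"
  then have rx: "rowf lam x < length lam" "colf lam x < lam ! rowf lam x" using rowf_colf by auto
  have "lam ! i \<ge> lam ! rowf lam x" using assms x rx by (simp add: sorted_wrt_iff_nth_less)
  then have "i < length lam" "colf lam x < lam ! i" using rx x by auto
  from rowf_colf_pos[OF this] show "\<exists>y\<in>{..<sum_list lam}. colf lam y = colf lam x \<and> rowf lam y = i"
    by (intro bexI[of _ "row_start lam i + colf lam x"]) auto
next
  fix x j assume x: "x \<in> {..<sum_list lam}" "j < colf lam x"
  then have rx: "rowf lam x < length lam" "colf lam x < lam ! rowf lam x" using rowf_colf by auto
  then have "rowf lam x < length lam" "j < lam ! rowf lam x" using x by auto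
  from rowf_colf_pos[OF this] show "\<exists>y\<in>{..<sum_list lam}. rowf lam y = rowf lam x \<and> colf lam y = j"
    by (intro bexI[of _ "row_start lam (rowf lam x) + j"]) auto
qed

lemma row_set_eq: "r < length lam \<Longrightarrow> row_set lam r = {x\<in>{..<sum_list lam}. rowf lam x = r}"
proof (intro equalityI subsetI)
  fix x assume r: "r < length lam" and "x \<in> row_set lam r"
  then have x: "row_start lam r \<le> x" "x < row_start lam r + lam ! r" by (auto simp: row_set_def)
  from rowf_colf_pos[OF r, of "x - row_start lam r"] x show "x \<in> {x\<in>{..<sum_list lam}. rowf lam x = r}" by auto
next
  fix x assume "x \<in> {x\<in>{..<sum_list lam}. rowf lam x = r}"
  then show "x \<in> row_set lam r" using rowf_colf[of x lam] by (auto simp: row_set_def)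
qed

lemma col_set_eq: "col_set lam c = {x\<in>{..<sum_list lam}. colf lam x = c}"
proof (intro equalityI subsetI)
  fix x assume "x \<in> col_set lam c"
  then obtain r where "r < length lam" "c < lam ! r" "x = row_start lam r + c" by (auto simp: col_set_def)
  then show "x \<in> {x\<in>{..<sum_list lam}. colf lam x = c}" using rowf_colf_pos by auto
next
  fix x assume x: "x \<in> {x\<in>{..<sum_list lam}. colf lam x = c}"
  then show "x \<in> col_set lam c" unfolding col_set_def using rowf_colf[of x lam]
    by (intro CollectI exI[of _ "rowf lam x"]) auto
qed

text \<open>Links the setwise stabilizers in the definitions of row and column group with
  \<open>stab\<close>. I is any set of labels that contains the occurring ones: the row numbers of
  the list, or UNIV for columns.\<close>

lemma stab_fibres:
  assumes "p permutes D"
  shows "(\<forall>i\<in>I. p ` {x\<in>D. r x = i} = {x\<in>D. r x = i}) \<and> r ` D \<subseteq> I \<longleftrightarrow> p \<in> stab D r \<and> r ` D \<subseteq> I"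
proof (intro iffI conjI ballI; (elim conjE)?)
  assume h: "\<forall>i\<in>I. p ` {x\<in>D. r x = i} = {x\<in>D. r x = i}" "r ` D \<subseteq> I"
  show "p \<in> stab D r" unfolding stab_def
  proof (intro CollectI conjI ballI assms)
    fix x assume x: "x \<in> D"
    then have "p x \<in> p ` {y\<in>D. r y = r x}" by auto
    then show "r (p x) = r x" using h x by auto
  qed
next
  fix i assume h: "p \<in> stab D r" and "i \<in> I"
  show "p ` {x\<in>D. r x = i} = {x\<in>D. r x = i}"
  proof (intro equalityI subsetI)
    fix y assume "y \<in> p ` {x\<in>D. r x = i}"
    then show "y \<in> {x\<in>D. r x = i}" using h assms by (auto simp: stab_def permutes_in_image)
  next
    fix y assume y: "y \<in> {x\<in>D. r x = i}"
    have "pinv p \<in> stab D r" using h by (rule stab_inv)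
    then have "pinv p y \<in> {x\<in>D. r x = i}" using y permutes_in_image[OF permutes_inv[OF assms]] by (auto simp: stab_def)
    then show "y \<in> p ` {x\<in>D. r x = i}" using permutes_inverses(1)[OF assms, of y] by (metis imageI)
  qed
qed auto

lemma row_group_eq: "row_group lam = stab {..<sum_list lam} (rowf lam)"
proof -
  have sub: "rowf lam ` {..<sum_list lam} \<subseteq> {..<length lam}" using rowf_colf(1) by auto
  have "p \<in> row_group lam \<longleftrightarrow> p \<in> stab {..<sum_list lam} (rowf lam)" for p
  proof (cases "p permutes {..<sum_list lam}")
    case True
    have "p \<in> row_group lam \<longleftrightarrow> (\<forall>i\<in>{..<length lam}. p ` {x\<in>{..<sum_list lam}. rowf lam x = i} = {x\<in>{..<sum_list lam}. rowf lam x = i})"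
      unfolding row_group_def using True by (auto simp: row_set_eq)
    then show ?thesis using stab_fibres[OF True, of "{..<length lam}" "rowf lam"] sub by blast
  qed (auto simp: row_group_def stab_def)
  then show ?thesis by blast
qed

lemma col_group_eq: "col_group lam = stab {..<sum_list lam} (colf lam)"
proof -
  have "p \<in> col_group lam \<longleftrightarrow> p \<in> stab {..<sum_list lam} (colf lam)" for p
  proof (cases "p permutes {..<sum_list lam}")
    case True
    show ?thesis using stab_fibres[OF True, of UNIV "colf lam"] True unfolding col_group_def col_set_eq by simp
  qed (auto simp: col_group_def stab_def)
  then show ?thesis by blast
qed

lemma card_row_std: "card {x\<in>{..<sum_list lam}. rowf lam x = i} = (if i < length lam then lam ! i else 0)"
proof (cases "i < length lam")
  case True
  then have "{x\<in>{..<sum_list lam}. rowf lam x = i} = row_set lam i" by (simp add: row_set_eq)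
  then show ?thesis using True by (simp add: row_set_def)
next
  case False
  then have "{x\<in>{..<sum_list lam}. rowf lam x = i} = {}" using rowf_colf(1) by fastforce
  then have "card {x\<in>{..<sum_list lam}. rowf lam x = i} = 0" by (simp only: card.empty)
  then show ?thesis using False by simp
qed

lemma list_eq_of_card_rows:
  assumes "length lam = length mu" "sum_list lam = sum_list mu"
    "\<And>i. card {x\<in>{..<sum_list lam}. rowf lam x = i} = card {x\<in>{..<sum_list lam}. rowf mu x = i}"
  shows "lam = mu"
proof (rule nth_equalityI)
  fix i assume "i < length lam"
  then show "lam ! i = mu ! i" using assms(3)[of i] card_row_std[of lam i] card_row_std[of mu i] assms(1,2) by simp
qed (fact assms(1))

text \<open>The given definitions index tensors by words of length d, the argument uses functions on
  slots; \<open>lift\<close> and \<open>lower\<close> pass between the two.\<close>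

definition lift :: "nat \<Rightarrow> (nat list \<Rightarrow> complex) \<Rightarrow> (nat \<Rightarrow> nat) \<Rightarrow> complex" where
  "lift d T f = T (map f [0..<d])"

definition lower :: "nat \<Rightarrow> ((nat \<Rightarrow> nat) \<Rightarrow> complex) \<Rightarrow> nat list \<Rightarrow> complex" where
  "lower d t w = (if length w = d then t ((!) w) else 0)"

lemma lift_lower: "tens n {..<d} t \<Longrightarrow> lift d (lower d t) = t"
  by (intro ext) (auto simp: lift_def lower_def intro: tens_cong)

lemma tens_lift: "T \<in> tensors n d \<Longrightarrow> tens n {..<d} (lift d T)"
proof -
  assume T: "T \<in> tensors n d"
  have "T (map f [0..<d]) = T (map g [0..<d])" if "\<forall>k\<in>{..<d}. f k = g k" for f g
  proof -
    have "map f [0..<d] = map g [0..<d]" using that by auto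
    then show ?thesis by (rule arg_cong)
  qed
  moreover have "T (map f [0..<d]) = 0" if "k \<in> {..<d}" "n \<le> f k" for f k
  proof -
    have "map f [0..<d] \<notin> idx n d" using that by (force simp: idx_def)
    then show ?thesis using T by (simp add: tensors_def)
  qed
  ultimately show ?thesis unfolding tens_def lift_def by blast
qed

lemma lower_tensors: assumes t: "tens n {..<d} t" shows "lower d t \<in> tensors n d"
  unfolding tensors_def
proof (intro CollectI allI impI)
  fix w assume w: "w \<notin> idx n d"
  show "lower d t w = 0"
  proof (cases "length w = d")
    case True
    then obtain k where "k < d" "n \<le> w ! k" using w by (auto simp: idx_def in_set_conv_nth not_less)
    then show ?thesis using True tens_zero[OF t, of k "(!) w"] by (simp add: lower_def)
  qed (simp add: lower_def)
qed

lemma young_sym_eq: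
  assumes "sum_list lam = d"
  shows "young_sym lam T = lower d (yng {..<d} (rowf lam) (colf lam) (lift d T))"
proof
  fix w
  show "young_sym lam T w = lower d (yng {..<d} (rowf lam) (colf lam) (lift d T)) w"
  proof (cases "length w = d")
    case True
    then show ?thesis using assms
      by (simp add: young_sym_def row_group_eq col_group_eq permT_def lower_def yng_def symz_def asymz_def lift_def comp_def)
  next
    case False
    then show ?thesis using assms by (simp add: young_sym_def permT_def lower_def)
  qed
qed

lemma sum_idx: "(\<Sum>w\<in>idx n d. F w) = (\<Sum>f\<in>Ix n {..<d}. F (map f [0..<d]))"
proof (rule sum.reindex_bij_witness[where i = "\<lambda>f. map f [0..<d]" and j = "\<lambda>w. restrict ((!) w) {..<d}"])
  fix w assume w: "w \<in> idx n d"
  show r: "map (restrict ((!) w) {..<d}) [0..<d] = w" using w by (auto simp: idx_def intro: nth_equalityI)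
  show "restrict ((!) w) {..<d} \<in> Ix n {..<d}" using w by (intro restrict_Ix) (auto simp: idx_def)
  show "F (map (restrict ((!) w) {..<d}) [0..<d]) = F w" unfolding r ..
next
  fix f assume f: "f \<in> Ix n {..<d}"
  show "restrict ((!) (map f [0..<d])) {..<d} = f"
    using f by (auto simp: Ix_def PiE_def extensional_def restrict_def fun_eq_iff)
  show "map f [0..<d] \<in> idx n d" using f by (auto simp: idx_def Ix_lt)
qed

context bform
begin

text \<open>Tracelessness is stated for i < j only; the other order follows from the symmetry of b
  up to the sign e.\<close>

lemma traceless_iff_harm:
  assumes B: "b = mf n B" "dim_row B = n" and T: "T \<in> tensors n d"
  shows "traceless B d T \<longleftrightarrow> harm {..<d} (lift d T)"
proof -
  have c: "ctr i j (lift d T) f = (\<Sum>x<n. \<Sum>y<n. B $$ (x, y) * T ((map f [0..<d])[i := x, j := y]))" if "i < d" "j < d" for i j f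
  proof -
    have "map (f(i := x, j := y)) [0..<d] = (map f [0..<d])[i := x, j := y]" for x y
      using that by (intro nth_equalityI) (auto simp: nth_list_update)
    then show ?thesis unfolding ctr_def lift_def by (simp add: B mf_def)
  qed
  show ?thesis
  proof
    assume t: "traceless B d T"
    have z: "ctr i j (lift d T) f = 0" if "i < j" "j < d" for i j f
      using t that unfolding c[OF less_trans[OF that] that(2)] traceless_def by (simp add: B)
    show "harm {..<d} (lift d T)" unfolding harm_def
    proof (intro ballI impI ext)
      fix i j f assume ij: "i \<in> {..<d}" "j \<in> {..<d}" "i \<noteq> j"
      show "ctr i j (lift d T) f = 0"
      proof (cases "i < j")
        case False
        then show ?thesis using z[of j i f] ctr_commute[of j i "lift d T" f] ij by simp
      qed (use z ij in auto)
    qed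
  next
    assume h: "harm {..<d} (lift d T)"
    show "traceless B d T" unfolding traceless_def
    proof (intro allI impI)
      fix i j :: nat and w :: "nat list" assume a: "i < j \<and> j < d \<and> length w = d"
      have "map ((!) w) [0..<d] = w" using a map_nth by blast
      then have "ctr i j (lift d T) ((!) w) = (\<Sum>x<n. \<Sum>y<n. B $$ (x, y) * T (w[i := x, j := y]))" using c[of i j "(!) w"] a by simp
      moreover have "ctr i j (lift d T) = (\<lambda>f. 0)" using h a by (simp add: harm_def)
      ultimately show "(\<Sum>a<dim_row B. \<Sum>c<dim_row B. B $$ (a, c) * T (w[i := a, j := c])) = 0" by (simp add: B)
    qed
  qed
qed

lemma tens_yng: assumes "tens n D t" shows "tens n D (yng D r c t)"
  unfolding yng_def symz_alt asymz_alt using assms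
  by (intro tens_sum tens_scale tens_pact) (auto dest: stab_permutes)

lemma harm_yng: "harm D t \<Longrightarrow> harm D (yng D r c t)"
  unfolding yng_def by (intro harm_symz harm_asymz)

lemma weyl_module_eq:
  assumes B: "b = mf n B" "dim_row B = n" and d: "sum_list lam = d"
  shows "weyl_module B lam = {lower d (yng {..<d} (rowf lam) (colf lam) t) | t. tens n {..<d} t \<and> harm {..<d} t}"
proof (intro equalityI subsetI)
  fix S assume "S \<in> weyl_module B lam"
  then obtain T where T: "T \<in> tensors n d" "traceless B d T" "S = young_sym lam T"
    unfolding weyl_module_def using B d by blast
  then show "S \<in> {lower d (yng {..<d} (rowf lam) (colf lam) t) | t. tens n {..<d} t \<and> harm {..<d} t}"
    using traceless_iff_harm[OF B T(1)] tens_lift[OF T(1)] young_sym_eq[OF d] by blast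
next
  fix S assume "S \<in> {lower d (yng {..<d} (rowf lam) (colf lam) t) | t. tens n {..<d} t \<and> harm {..<d} t}"
  then obtain t where t: "tens n {..<d} t" "harm {..<d} t" "S = lower d (yng {..<d} (rowf lam) (colf lam) t)" by blast
  have "S = young_sym lam (lower d t)" unfolding young_sym_eq[OF d] lift_lower[OF t(1)] t(3) ..
  moreover have "traceless B d (lower d t)"
    using traceless_iff_harm[OF B lower_tensors[OF t(1)]] lift_lower[OF t(1)] t(2) by simp
  ultimately show "S \<in> weyl_module B lam" unfolding weyl_module_def using B d lower_tensors[OF t(1)] by blast
qed

text \<open>The projections of the unit vectors to the harmonic tensors. Used in both factors, they
  write an element of \<open>HH\<close> as a sum of products of harmonic tensors.\<close>

lemma harmonic_projection:
  assumes D: "finite D"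
  obtains \<pi> where "\<And>v. tens n D (\<pi> v)" "\<And>v. harm D (\<pi> v)"
    "\<And>t f. tens n D t \<Longrightarrow> harm D t \<Longrightarrow> t f = (\<Sum>v\<in>Ix n D. t v * \<pi> v f)"
proof -
  define U where "U = {t. tens n D t \<and> harm D t}"
  have U: "subsp U" unfolding subsp_def U_def
    by (auto simp: tens_null tens_add tens_scale harm_add harm_scale) (simp add: harm_def ctr_def)
  have fI: "finite (Ix n D)" using D by (rule finite_Ix)
  have "\<forall>v. \<exists>u. u \<in> U \<and> (\<forall>a\<in>U. fip (Ix n D) (\<lambda>f. (if f = v then 1 else 0) - u f) a = 0)"
  proof
    fix v
    show "\<exists>u. u \<in> U \<and> (\<forall>a\<in>U. fip (Ix n D) (\<lambda>f. (if f = v then 1 else 0) - u f) a = 0)"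
      using orthogonal_decomposition[OF fI U, of "\<lambda>f. if f = v then 1 else 0"] by blast
  qed
  then obtain \<pi> where \<pi>: "\<And>v. \<pi> v \<in> U" "\<And>v a. a \<in> U \<Longrightarrow> fip (Ix n D) (\<lambda>f. (if f = v then 1 else 0) - \<pi> v f) a = 0"
    by metis
  have "t = (\<lambda>f. \<Sum>v\<in>Ix n D. t v * \<pi> v f)" if t: "t \<in> U" for t
  proof (rule tens_eqI[of n D])
    show "tens n D t" using t by (simp add: U_def)
    have s: "(\<lambda>f. \<Sum>v\<in>Ix n D. t v * \<pi> v f) \<in> U" by (rule subsp_sum[OF U \<pi>(1)])
    then show "tens n D (\<lambda>f. \<Sum>v\<in>Ix n D. t v * \<pi> v f)" by (simp add: U_def)
    fix f assume f: "f \<in> Ix n D"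
    have o: "fip (Ix n D) (\<lambda>f. t f - (\<Sum>v\<in>Ix n D. t v * \<pi> v f)) a = 0" if a: "a \<in> U" for a
    proof -
      have "fip (Ix n D) (\<lambda>f. t f - (\<Sum>v\<in>Ix n D. t v * \<pi> v f)) a = fip (Ix n D) (\<lambda>f. \<Sum>v\<in>Ix n D. t v * ((if f = v then 1 else 0) - \<pi> v f)) a"
        unfolding fip_def
      proof (rule sum.cong[OF refl])
        fix f assume f: "f \<in> Ix n D"
        have "(\<Sum>v\<in>Ix n D. t v * (if f = v then 1 else 0)) = (\<Sum>v\<in>Ix n D. if f = v then t v else 0)"
          by (rule sum.cong) auto
        then have "t f = (\<Sum>v\<in>Ix n D. t v * (if f = v then 1 else 0))" using f fI by simp
        then show "(t f - (\<Sum>v\<in>Ix n D. t v * \<pi> v f)) * cnj (a f) = (\<Sum>v\<in>Ix n D. t v * ((if f = v then 1 else 0) - \<pi> v f)) * cnj (a f)"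
          by (simp add: right_diff_distrib sum_subtractf)
      qed
      then show ?thesis unfolding fip_sum_left using \<pi>(2)[OF a] by simp
    qed
    show "t f = (\<Sum>v\<in>Ix n D. t v * \<pi> v f)"
      by (rule fip_eq_zero_of_diff[OF fI U t s _ o f]) (simp add: fip_def)
  qed
  then show ?thesis using that[of \<pi>] \<pi>(1) unfolding U_def by (metis (mono_tags, lifting) mem_Collect_eq)
qed

end

section \<open>Conjugate tableaux and lists of row lengths\<close>

lemma stab_cong: "(\<And>x. x \<in> D \<Longrightarrow> r x = r' x) \<Longrightarrow> stab D r = stab D r'"
proof -
  assume e: "\<And>x. x \<in> D \<Longrightarrow> r x = r' x"
  have "r (p x) = r x \<longleftrightarrow> r' (p x) = r' x" if "p permutes D" "x \<in> D" for p x
    using e that permutes_in_image[OF that(1)] by simp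
  then show ?thesis unfolding stab_def by blast
qed

lemma bij_betw_stab_conj:
  assumes "p permutes D"
  shows "bij_betw (\<lambda>q. p \<circ> q \<circ> pinv p) (stab D r) (stab D (r \<circ> pinv p))"
proof (rule bij_betwI[where g = "\<lambda>q. pinv p \<circ> q \<circ> p"])
  note ip = permutes_inv[OF assms]
  show "(\<lambda>q. p \<circ> q \<circ> pinv p) \<in> stab D r \<rightarrow> stab D (r \<circ> pinv p)"
  proof
    fix q assume q: "q \<in> stab D r"
    have "r (pinv p (p (q (pinv p x)))) = r (pinv p x)" if "x \<in> D" for x
      using q that permutes_in_image[OF ip] by (simp add: permutes_inverses[OF assms] stab_def)
    then show "p \<circ> q \<circ> pinv p \<in> stab D (r \<circ> pinv p)"
      using permutes_compose[OF permutes_compose[OF ip stab_permutes[OF q]] assms] by (simp add: stab_def comp_assoc)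
  qed
  show "(\<lambda>q. pinv p \<circ> q \<circ> p) \<in> stab D (r \<circ> pinv p) \<rightarrow> stab D r"
  proof
    fix q assume q: "q \<in> stab D (r \<circ> pinv p)"
    have "r (pinv p (q (p x))) = r x" if "x \<in> D" for x
    proof -
      have "p x \<in> D" using that permutes_in_image[OF assms] by simp
      then have "(r \<circ> pinv p) (q (p x)) = (r \<circ> pinv p) (p x)" using q unfolding stab_def by blast
      then show ?thesis by (simp add: permutes_inverses[OF assms])
    qed
    then show "pinv p \<circ> q \<circ> p \<in> stab D r"
      using permutes_compose[OF permutes_compose[OF assms stab_permutes[OF q]] ip] by (simp add: stab_def comp_assoc)
  qed
  show "pinv p \<circ> (p \<circ> q \<circ> pinv p) \<circ> p = q" for q
    by (simp add: fun_eq_iff permutes_inverses[OF assms])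
  show "p \<circ> (pinv p \<circ> q \<circ> p) \<circ> pinv p = q" for q
    by (simp add: fun_eq_iff permutes_inverses[OF assms])
qed

lemma symz_conj:
  assumes "p permutes D"
  shows "symz D (r \<circ> pinv p) (pact p t) = pact p (symz D r t)"
proof
  fix f
  have "symz D (r \<circ> pinv p) (pact p t) f = (\<Sum>q\<in>stab D r. t (f \<circ> (p \<circ> q \<circ> pinv p) \<circ> p))"
    unfolding symz_def pact_def
    by (rule sum.reindex_bij_betw[OF bij_betw_stab_conj[OF assms], of "\<lambda>q. t (f \<circ> q \<circ> p)", symmetric])
  also have "\<dots> = pact p (symz D r t) f"
    by (simp add: symz_def pact_def comp_assoc permutes_inv_o[OF assms])
  finally show "symz D (r \<circ> pinv p) (pact p t) f = pact p (symz D r t) f" .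
qed

lemma asymz_conj:
  assumes "p permutes D" "finite D"
  shows "asymz D (r \<circ> pinv p) (pact p t) = pact p (asymz D r t)"
proof
  fix f
  have perm: "permutation p" "permutation (pinv p)"
    using permutes_imp_permutation[OF assms(2,1)] permutes_imp_permutation[OF assms(2) permutes_inv[OF assms(1)]] by auto
  have sg: "sign (p \<circ> q \<circ> pinv p) = sign q" if "q \<in> stab D r" for q
  proof -
    have "permutation q" using permutes_imp_permutation[OF assms(2) stab_permutes[OF that]] .
    then show ?thesis using perm sign_inverse[OF perm(1)]
      by (simp add: sign_compose permutation_compose mult.commute[of "sign p"] mult.assoc)
  qed
  have "asymz D (r \<circ> pinv p) (pact p t) f = (\<Sum>q\<in>stab D r. of_int (sign (p \<circ> q \<circ> pinv p)) * t (f \<circ> (p \<circ> q \<circ> pinv p) \<circ> p))"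
    unfolding asymz_def pact_def
    by (rule sum.reindex_bij_betw[OF bij_betw_stab_conj[OF assms(1)], of "\<lambda>q. of_int (sign q) * t (f \<circ> q \<circ> p)", symmetric])
  also have "\<dots> = (\<Sum>q\<in>stab D r. of_int (sign q) * t (f \<circ> p \<circ> q))"
  proof (intro sum.cong refl)
    fix q assume "q \<in> stab D r"
    have "f \<circ> (p \<circ> q \<circ> pinv p) \<circ> p = f \<circ> p \<circ> q" by (simp add: comp_assoc permutes_inv_o[OF assms(1)])
    then show "of_int (sign (p \<circ> q \<circ> pinv p)) * t (f \<circ> (p \<circ> q \<circ> pinv p) \<circ> p) = of_int (sign q) * t (f \<circ> p \<circ> q)"
      using sg[OF \<open>q \<in> stab D r\<close>] by (simp only:)
  qed
  also have "\<dots> = pact p (asymz D r t) f" by (simp add: asymz_def pact_def)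
  finally show "asymz D (r \<circ> pinv p) (pact p t) f = pact p (asymz D r t) f" .
qed

lemma symz_cong_col: "(\<And>x. x \<in> D \<Longrightarrow> r x = r' x) \<Longrightarrow> symz D r = symz D r'"
  by (simp add: symz_def[abs_def] stab_cong[of D r r'])

lemma asymz_cong_col: "(\<And>x. x \<in> D \<Longrightarrow> r x = r' x) \<Longrightarrow> asymz D r = asymz D r'"
  by (simp add: asymz_def[abs_def] stab_cong[of D r r'])

lemma tens_symz: "tens n D t \<Longrightarrow> tens n D (symz D r t)"
  unfolding symz_alt by (intro tens_sum tens_scale tens_pact) (auto dest: stab_permutes)

lemma tens_asymz: "tens n D t \<Longrightarrow> tens n D (asymz D r t)"
  unfolding asymz_alt by (intro tens_sum tens_scale tens_pact) (auto dest: stab_permutes)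

lemma sum_pair: "(\<Sum>p\<in>R. \<Sum>q\<in>C. F p q) = (\<Sum>a\<in>R \<times> C. F (fst a) (snd a))"
  by (simp add: sum.cartesian_product case_prod_unfold)

text \<open>Lists of fixed length L, padded by zeros, as in \<open>LamO\<close> and
  \<open>LamSp\<close>. Rows beyond L would be lost, so the first column has to be bounded by L
  before the list is used.\<close>

definition shape_list :: "nat \<Rightarrow> 'k set \<Rightarrow> ('k \<Rightarrow> nat) \<Rightarrow> nat list" where
  "shape_list L D r = map (\<lambda>i. card {x\<in>D. r x = i}) [0..<L]"

lemma shape_list_props:
  assumes D: "finite D" and T: "tableau D r c" and L: "card {x\<in>D. c x = 0} \<le> L"
  shows "length (shape_list L D r) = L" "sorted_wrt (\<ge>) (shape_list L D r)" "sum_list (shape_list L D r) = card D"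
    "\<And>i. i < L \<Longrightarrow> shape_list L D r ! i > j \<longleftrightarrow> i < card {x\<in>D. c x = j}"
    "\<And>x. x \<in> D \<Longrightarrow> r x < L"
proof -
  have rc: "j < card {x\<in>D. r x = i} \<longleftrightarrow> i < card {x\<in>D. c x = j}" for i j
    using tableau_row[OF D T, of i j] tableau_col[OF D T, of i j] by simp
  show "length (shape_list L D r) = L" by (simp add: shape_list_def)
  show "shape_list L D r ! i > j \<longleftrightarrow> i < card {x\<in>D. c x = j}" if "i < L" for i using that by (simp add: shape_list_def rc)
  show lt: "r x < L" if "x \<in> D" for x
  proof -
    have "0 < card {y\<in>D. r y = r x}" using that D by (auto simp: card_gt_0_iff)
    then show ?thesis using rc[of 0 "r x"] L by simp
  qed
  show "sorted_wrt (\<ge>) (shape_list L D r)" unfolding sorted_wrt_iff_nth_less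
  proof (intro allI impI)
    fix i j assume ij: "i < j" "j < length (shape_list L D r)"
    have "card {x\<in>D. r x = j} \<le> card {x\<in>D. r x = i}"
    proof (rule ccontr)
      assume "\<not> ?thesis"
      then have "card {x\<in>D. r x = i} < card {x\<in>D. r x = j}" by simp
      then show False using rc[of "card {x\<in>D. r x = i}" j] rc[of "card {x\<in>D. r x = i}" i] ij by simp
    qed
    then show "shape_list L D r ! i \<ge> shape_list L D r ! j" using ij by (simp add: shape_list_def)
  qed
  have "sum_list (shape_list L D r) = (\<Sum>i<L. card {x\<in>D. r x = i})"
    by (simp add: shape_list_def interv_sum_list_conv_sum_set_nat atLeast0LessThan)
  also have "\<dots> = (\<Sum>i<L. \<Sum>x\<in>{x\<in>D. r x = i}. 1)" by simp
  also have "\<dots> = (\<Sum>x\<in>D. 1)" using D lt by (intro sum.group) auto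
  finally show "sum_list (shape_list L D r) = card D" by simp
qed

section \<open>Young symmetrizers on the harmonic elements\<close>

locale bweyl = bgroup +
  fixes B :: "complex mat" and L :: nat and \<Lambda> :: "nat list set"
  assumes bB: "b = mf n B" and dimB: "dim_row B = n"
    and Lam_props: "lam \<in> \<Lambda> \<Longrightarrow> length lam = L \<and> sorted_wrt (\<ge>) lam"
    and Lam_shape: "e = 1 \<and> L = n \<and> \<Lambda> = LamO n \<or> e = -1 \<and> L = n div 2 \<and> \<Lambda> = LamSp (n div 2)"
begin

text \<open>y is antisymmetric in every column, so the vanishing results bound the first two columns
  together by n, or the first one by n/2. The numbers of rows longer than 0 and longer than 1 are
  the lengths of these columns.\<close>

lemma shape_in_Lambda:
  fixes D :: "nat set"
  assumes D: "finite D" and T: "tableau D r c" and y: "tens n D y" "harm D y" "csym (-1) D c y" "y \<noteq> (\<lambda>f. 0)"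
  shows "card {x\<in>D. c x = 0} \<le> L" "shape_list L D r \<in> \<Lambda>"
proof -
  let ?C = "\<lambda>j. {x\<in>D. c x = j}"
  have a: "antis (?C j) y" for j using y(3) unfolding csym_def by auto
  from Lam_shape have "card (?C 0) \<le> L \<and> shape_list L D r \<in> \<Lambda>"
  proof (elim disjE conjE)
    assume e: "e = 1" "L = n" "\<Lambda> = LamO n"
    have le: "card (?C 0) + card (?C 1) \<le> n"
    proof (rule ccontr)
      assume "\<not> ?thesis"
      then have "y = (\<lambda>f. 0)" by (intro harm_antis_two_columns[OF D y(1,2), of "?C 0" "?C 1"] a) auto
      then show False using y(4) by simp
    qed
    then have c0: "card (?C 0) \<le> L" using e by simp
    note sp = shape_list_props[OF D T c0]
    have "{i. i < n \<and> shape_list L D r ! i > j} = {..<card (?C j)}" if "card (?C j) \<le> n" for j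
      using sp(4)[of _ j] e that by auto
    then have "shape_list L D r \<in> LamO n" using le sp(1,2) e unfolding LamO_def by simp
    then show ?thesis using c0 e by simp
  next
    assume e: "e = -1" "L = n div 2" "\<Lambda> = LamSp (n div 2)"
    have "2 * card (?C 0) \<le> n"
    proof (rule ccontr)
      assume "\<not> ?thesis"
      then have "y = (\<lambda>f. 0)" using e by (intro harm_antis_column[OF D y(1,2), of "?C 0"] a) auto
      then show False using y(4) by simp
    qed
    then have c0: "card (?C 0) \<le> L" using e by simp
    note sp = shape_list_props[OF D T c0]
    show ?thesis using c0 sp(1,2) e unfolding LamSp_def by simp
  qed
  then show "card (?C 0) \<le> L" "shape_list L D r \<in> \<Lambda>" by auto
qed

definition yng2 :: "nat list \<Rightarrow> ((nat \<Rightarrow> nat) \<Rightarrow> (nat \<Rightarrow> nat) \<Rightarrow> complex) \<Rightarrow> (nat \<Rightarrow> nat) \<Rightarrow> (nat \<Rightarrow> nat) \<Rightarrow> complex" where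
  "yng2 lam X f u = yng {..<sum_list lam} (rowf lam) (colf lam) (\<lambda>f. yng {..<sum_list lam} (rowf lam) (colf lam) (X f) u) f"

definition lower2 :: "nat \<Rightarrow> ((nat \<Rightarrow> nat) \<Rightarrow> (nat \<Rightarrow> nat) \<Rightarrow> complex) \<Rightarrow> nat list \<times> nat list \<Rightarrow> complex" where
  "lower2 d X = (\<lambda>(w, w'). if length w = d \<and> length w' = d then X ((!) w) ((!) w') else 0)"

definition Lamd :: "nat \<Rightarrow> nat list set" where
  "Lamd d = {lam \<in> \<Lambda>. sum_list lam = d}"

lemma finite_Lamd: "finite (Lamd d)"
proof -
  have "Lamd d \<subseteq> {xs. set xs \<subseteq> {..d} \<and> length xs = L}"
    using Lam_props member_le_sum_list by (fastforce simp: Lamd_def)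
  then show ?thesis using finite_lists_length_eq[of "{..d}" L] finite_subset by blast
qed

lemma std_tableau: "lam \<in> Lamd d \<Longrightarrow> tableau {..<d} (rowf lam) (colf lam)"
  using tableau_std[of lam] Lam_props by (auto simp: Lamd_def)

lemma yng2_sum:
  "yng2 lam (\<lambda>f u. \<Sum>a\<in>A. k a * (s a f * t a u)) f u =
     (\<Sum>a\<in>A. k a * (yng {..<sum_list lam} (rowf lam) (colf lam) (s a) f * yng {..<sum_list lam} (rowf lam) (colf lam) (t a) u))"
proof -
  let ?y = "yng {..<sum_list lam} (rowf lam) (colf lam)"
  have 1: "?y (\<lambda>u. \<Sum>a\<in>A. k a * (s a f * t a u)) u = (\<Sum>a\<in>A. (k a * ?y (t a) u) * s a f)" for f
  proof -
    have "?y (\<lambda>u. \<Sum>a\<in>A. k a * (s a f * t a u)) u = ?y (\<lambda>u. \<Sum>a\<in>A. (k a * s a f) * t a u) u" by (simp add: mult.assoc)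
    also have "\<dots> = (\<Sum>a\<in>A. (k a * s a f) * ?y (t a) u)" unfolding yng_sum ..
    finally show ?thesis by (simp add: mult_ac)
  qed
  show ?thesis unfolding yng2_def 1 unfolding yng_sum by (simp add: mult_ac)
qed

lemma yng2_add_scale: "yng2 lam (\<lambda>f u. X f u + c * Y f u) f u = yng2 lam X f u + c * yng2 lam Y f u"
  by (simp add: yng2_def yng_def symz_def asymz_def distrib_left sum.distrib sum_distrib_left mult.left_commute)

lemma yng2_sum':
  "yng2 lam (\<lambda>f u. \<Sum>a\<in>A. X a f u) f u = (\<Sum>a\<in>A. yng2 lam (X a) f u)"
proof (induction A rule: infinite_finite_induct)
  case (insert a A)
  then show ?case using yng2_add_scale[of lam "X a" 1 "\<lambda>f u. \<Sum>a\<in>A. X a f u" f u] by simp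
qed (simp_all add: yng2_def yng_def symz_def asymz_def)

lemma HH_expand:
  assumes D: "finite D" and X: "HH D X"
  obtains \<pi> where "\<And>v. tens n D (\<pi> v)" "\<And>v. harm D (\<pi> v)"
    "X = (\<lambda>f u. \<Sum>(v, w)\<in>Ix n D \<times> Ix n D. X v w * (\<pi> v f * \<pi> w u))"
proof -
  obtain \<pi> where \<pi>: "\<And>v. tens n D (\<pi> v)" "\<And>v. harm D (\<pi> v)"
    "\<And>t f. tens n D t \<Longrightarrow> harm D t \<Longrightarrow> t f = (\<Sum>v\<in>Ix n D. t v * \<pi> v f)"
    by (rule harmonic_projection[OF D]) (rule that)
  have "X f u = (\<Sum>(v, w)\<in>Ix n D \<times> Ix n D. X v w * (\<pi> v f * \<pi> w u))" for f u
  proof -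
    have "X f u = (\<Sum>v\<in>Ix n D. X v u * \<pi> v f)" using \<pi>(3)[of "\<lambda>f. X f u" f] X by (simp add: HH_def)
    also have "\<dots> = (\<Sum>v\<in>Ix n D. (\<Sum>w\<in>Ix n D. X v w * \<pi> w u) * \<pi> v f)"
    proof (rule sum.cong[OF refl])
      fix v
      have "X v u = (\<Sum>w\<in>Ix n D. X v w * \<pi> w u)" using \<pi>(3)[of "X v" u] X by (simp add: HH_def)
      then show "X v u * \<pi> v f = (\<Sum>w\<in>Ix n D. X v w * \<pi> w u) * \<pi> v f" by simp
    qed
    also have "\<dots> = (\<Sum>(v, w)\<in>Ix n D \<times> Ix n D. X v w * (\<pi> v f * \<pi> w u))"
      unfolding sum_distrib_right sum.cartesian_product by (rule sum.cong) (auto simp: mult_ac)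
    finally show ?thesis .
  qed
  then have "X = (\<lambda>f u. \<Sum>(v, w)\<in>Ix n D \<times> Ix n D. X v w * (\<pi> v f * \<pi> w u))" by (intro ext)
  then show ?thesis by (rule that[of \<pi>, OF \<pi>(1,2)])
qed

lemma tensor_sq_eq:
  assumes "sum_list lam = d"
  shows "tensor_sq (weyl_module B lam) = fspan {lower2 d (\<lambda>f u. yng {..<d} (rowf lam) (colf lam) s f * yng {..<d} (rowf lam) (colf lam) t u) | s t.
     tens n {..<d} s \<and> harm {..<d} s \<and> tens n {..<d} t \<and> harm {..<d} t}"
proof -
  have 1: "(\<lambda>(a, c). lower d x a * lower d y c) = lower2 d (\<lambda>f u. x f * y u)" for x y
    by (auto simp: lower_def lower2_def fun_eq_iff)
  have "{(\<lambda>(a, c). S a * T c) | S T. S \<in> weyl_module B lam \<and> T \<in> weyl_module B lam} =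
     {lower2 d (\<lambda>f u. yng {..<d} (rowf lam) (colf lam) s f * yng {..<d} (rowf lam) (colf lam) t u) | s t.
     tens n {..<d} s \<and> harm {..<d} s \<and> tens n {..<d} t \<and> harm {..<d} t}"
    unfolding weyl_module_eq[OF bB dimB assms] 1[symmetric] by blast
  then show ?thesis unfolding tensor_sq_def by simp
qed

lemma yng2_in_tensor_sq:
  assumes d: "sum_list lam = d" and X: "HH {..<d} X"
  shows "lower2 d (yng2 lam X) \<in> tensor_sq (weyl_module B lam)"
proof -
  obtain \<pi> where \<pi>: "\<And>v. tens n {..<d} (\<pi> v)" "\<And>v. harm {..<d} (\<pi> v)"
    "X = (\<lambda>f u. \<Sum>(v, w)\<in>Ix n {..<d} \<times> Ix n {..<d}. X v w * (\<pi> v f * \<pi> w u))"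
    by (rule HH_expand[OF _ X]) (simp, rule that)
  let ?y = "yng {..<d} (rowf lam) (colf lam)" and ?I = "Ix n {..<d} \<times> Ix n {..<d}"
  have "yng2 lam X f u = (\<Sum>a\<in>?I. X (fst a) (snd a) * (?y (\<pi> (fst a)) f * ?y (\<pi> (snd a)) u))" for f u
    by (subst \<pi>(3)) (simp add: case_prod_unfold yng2_sum d)
  then have "lower2 d (yng2 lam X) = (\<lambda>x. \<Sum>a\<in>?I. X (fst a) (snd a) * lower2 d (\<lambda>f u. ?y (\<pi> (fst a)) f * ?y (\<pi> (snd a)) u) x)"
    by (auto simp: lower2_def fun_eq_iff)
  moreover have "\<dots> \<in> tensor_sq (weyl_module B lam)"
    unfolding tensor_sq_eq[OF d] by (intro subsp_sum[OF subsp_fspan] fspan_mem) (use \<pi>(1,2) in blast)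
  ultimately show ?thesis by simp
qed

text \<open>The simultaneous invariance of X lets the symmetrizer c on the second factor act on the
  first instead, through inverse permutations and therefore in the opposite order. So c on both
  factors is c c* on the first, a form to which positivity applies.\<close>

lemma yng2_diagonal:
  assumes d: "sum_list lam = d" and X: "HH {..<d} X"
  shows "yng2 lam X f u = symz {..<d} (rowf lam) (asymz {..<d} (colf lam) (asymz {..<d} (colf lam) (symz {..<d} (rowf lam) (\<lambda>f. X f u)))) f"
proof -
  let ?D = "{..<d}" and ?R = "stab {..<d} (rowf lam)" and ?C = "stab {..<d} (colf lam)"
  have "yng ?D (rowf lam) (colf lam) (X f) u = asymz ?D (colf lam) (symz ?D (rowf lam) (\<lambda>f. X f u)) f" for f
  proof -
    have "yng ?D (rowf lam) (colf lam) (X f) u = (\<Sum>p\<in>?R. \<Sum>q\<in>?C. of_int (sign q) * X f (u \<circ> p \<circ> q))"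
      by (simp add: yng_def symz_def asymz_def)
    also have "\<dots> = (\<Sum>p\<in>?R. \<Sum>q\<in>?C. of_int (sign (pinv q)) * X (f \<circ> pinv q \<circ> pinv p) u)"
    proof (intro sum.cong refl)
      fix p q assume pq: "p \<in> ?R" "q \<in> ?C"
      note p = stab_permutes[OF pq(1)] and q = stab_permutes[OF pq(2)]
      have "sign (pinv q) = sign q" using permutes_imp_permutation[OF _ q] by (intro sign_inverse) simp
      moreover have "X (f \<circ> pinv q \<circ> pinv p) u = X (f \<circ> pinv q \<circ> pinv p \<circ> (p \<circ> q)) (u \<circ> (p \<circ> q))"
        using X permutes_compose[OF q p] unfolding HH_def by metis
      moreover have "f \<circ> pinv q \<circ> pinv p \<circ> (p \<circ> q) = f"
        by (simp add: fun_eq_iff permutes_inverses[OF p] permutes_inverses[OF q])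
      ultimately show "of_int (sign q) * X f (u \<circ> p \<circ> q) = of_int (sign (pinv q)) * X (f \<circ> pinv q \<circ> pinv p) u"
        by (simp add: comp_assoc)
    qed
    also have "\<dots> = (\<Sum>p\<in>?R. \<Sum>q\<in>?C. of_int (sign q) * X (f \<circ> q \<circ> pinv p) u)"
    proof (rule sum.cong[OF refl])
      fix p
      show "(\<Sum>q\<in>?C. of_int (sign (pinv q)) * X (f \<circ> pinv q \<circ> pinv p) u) = (\<Sum>q\<in>?C. of_int (sign q) * X (f \<circ> q \<circ> pinv p) u)"
        by (rule sum.reindex_bij_betw[OF bij_betw_stab_inv, of "\<lambda>q. of_int (sign q) * X (f \<circ> q \<circ> pinv p) u"])
    qed
    also have "\<dots> = (\<Sum>p\<in>?R. \<Sum>q\<in>?C. of_int (sign q) * X (f \<circ> q \<circ> p) u)"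
      by (rule sum.reindex_bij_betw[OF bij_betw_stab_inv, of "\<lambda>p. \<Sum>q\<in>?C. of_int (sign q) * X (f \<circ> q \<circ> p) u"])
    also have "\<dots> = (\<Sum>q\<in>?C. \<Sum>p\<in>?R. of_int (sign q) * X (f \<circ> q \<circ> p) u)" by (rule sum.swap)
    also have "\<dots> = asymz ?D (colf lam) (symz ?D (rowf lam) (\<lambda>f. X f u)) f"
      by (simp add: symz_def asymz_def sum_distrib_left)
    finally show ?thesis .
  qed
  then show ?thesis unfolding yng2_def d by (simp add: yng_def)
qed

text \<open>A slice of X at a fixed second index is a nonzero harmonic tensor, which some tableau
  does not annihilate, and the shape of that tableau is admissible. Relabelling the slots gives the
  row-by-row tableau and another slice of X. Nonvanishing then passes from c* to c c*, hence to
  \<open>yng2\<close>.\<close>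

lemma HH_nonzero_component:
  assumes X: "HH {..<d} X" and nz: "X f0 u0 \<noteq> 0"
  obtains lam where "lam \<in> Lamd d" "lower2 d (yng2 lam X) \<noteq> (\<lambda>x. 0)"
proof -
  let ?D = "{..<d}"
  have D: "finite ?D" by simp
  define t where "t = (\<lambda>f. X f u0)"
  have t: "tens n ?D t" "harm ?D t" "t \<noteq> (\<lambda>f. 0)" using X nz by (auto simp: t_def HH_def fun_eq_iff)
  obtain r c p where T: "tableau ?D r c" and p: "p permutes ?D" and y0: "asymz ?D c (symz ?D r (pact p t)) \<noteq> (\<lambda>f. 0)"
    using exists_nonvanishing_tableau[OF D t(3)] by blast
  define y where "y = asymz ?D c (symz ?D r (pact p t))"
  have tp: "tens n ?D (pact p t)" "harm ?D (pact p t)" using t p by (auto intro: tens_pact harm_pact)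
  have y: "tens n ?D y" "harm ?D y" "csym (-1) ?D c y" "y \<noteq> (\<lambda>f. 0)"
    unfolding y_def using tp y0 D
    by (auto intro!: harm_asymz harm_symz csym_asymz tens_asymz tens_symz)
  define lam where "lam = shape_list L ?D r"
  have c0: "card {x\<in>?D. c x = 0} \<le> L" and lam: "lam \<in> \<Lambda>" using shape_in_Lambda[OF D T y] by (auto simp: lam_def)
  note sp = shape_list_props[OF D T c0]
  have d: "sum_list lam = d" using sp(3) by (simp add: lam_def)
  have lamd: "lam \<in> Lamd d" using lam d by (simp add: Lamd_def)
  have cards: "card {x\<in>?D. rowf lam x = i} = card {x\<in>?D. r x = i}" for i
  proof (cases "i < L")
    case True
    then show ?thesis using card_row_std[of lam i] d sp(1) by (simp add: lam_def shape_list_def)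
  next
    case False
    then have "{x\<in>?D. r x = i} = {}" using sp(5) by auto
    then have c: "card {x\<in>?D. r x = i} = 0" by (simp only: card.empty)
    have "length lam = L" using sp(1) by (simp add: lam_def)
    then show ?thesis using False by (simp only: card_row_std[of lam i, unfolded d] c if_False)
  qed
  \<comment> \<open>q carries the row-by-row tableau of the definitions to the tableau that was
    found.\<close>
  obtain q where q: "q permutes ?D" "\<And>x. x \<in> ?D \<Longrightarrow> r (q x) = rowf lam x" "\<And>x. x \<in> ?D \<Longrightarrow> c (q x) = colf lam x"
    by (rule tableau_transfer[OF D std_tableau[OF lamd] T cards]) (rule that)
  note iq = permutes_inv[OF q(1)]
  have req: "symz ?D r = symz ?D (rowf lam \<circ> pinv q)"
  proof (rule symz_cong_col)
    fix x assume "x \<in> ?D"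
    then have "pinv q x \<in> ?D" using permutes_in_image[OF iq] by blast
    from q(2)[OF this] show "r x = (rowf lam \<circ> pinv q) x" by (simp add: permutes_inverses[OF q(1)])
  qed
  have ceq: "asymz ?D c = asymz ?D (colf lam \<circ> pinv q)"
  proof (rule asymz_cong_col)
    fix x assume "x \<in> ?D"
    then have "pinv q x \<in> ?D" using permutes_in_image[OF iq] by blast
    from q(3)[OF this] show "c x = (colf lam \<circ> pinv q) x" by (simp add: permutes_inverses[OF q(1)])
  qed
  define s where "s = pinv q \<circ> p"
  have s: "s permutes ?D" unfolding s_def using p iq by (rule permutes_compose)
  have e: "pact p t = pact q (pact s t)" by (simp add: s_def comp_assoc[symmetric] permutes_inv_o[OF q(1)])
  have "y = pact q (asymz ?D (colf lam) (symz ?D (rowf lam) (pact s t)))"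
    unfolding y_def req ceq e symz_conj[OF q(1)] asymz_conj[OF q(1) D] ..
  then have nz1: "asymz ?D (colf lam) (symz ?D (rowf lam) (pact s t)) \<noteq> (\<lambda>f. 0)"
    using y(4) by (auto simp: pact_def)
  \<comment> \<open>A permutation of the first index of X can be undone in the second one: the
    permuted slice is the slice at u1.\<close>
  define u1 where "u1 = u0 \<circ> pinv s"
  have st: "pact s t = (\<lambda>f. X f u1)"
  proof
    fix f
    have "X f u1 = X (f \<circ> s) (u1 \<circ> s)" using X s unfolding HH_def by metis
    then show "pact s t f = X f u1" by (simp add: pact_def t_def u1_def comp_assoc permutes_inv_o[OF s])
  qed
  have "\<exists>f\<in>Ix n ?D. yng2 lam X f u1 \<noteq> 0"
  proof (rule ccontr)
    assume "\<not> ?thesis"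
    then have z: "symz ?D (rowf lam) (asymz ?D (colf lam) (asymz ?D (colf lam) (symz ?D (rowf lam) (pact s t)))) f = 0" if "f \<in> Ix n ?D" for f
      using that yng2_diagonal[OF d X, of f u1] unfolding st by metis
    have "asymz ?D (colf lam) (symz ?D (rowf lam) (pact s t)) f = 0" if "f \<in> Ix n ?D" for f
      using asymz_symz_zero[OF closed_ix_Ix[OF D] D z that] .
    moreover have "tens n ?D (asymz ?D (colf lam) (symz ?D (rowf lam) (pact s t)))"
      using tens_pact[OF t(1) s] by (intro tens_asymz tens_symz)
    ultimately have "asymz ?D (colf lam) (symz ?D (rowf lam) (pact s t)) = (\<lambda>f. 0)" by (intro tens_eqI[OF _ tens_null]) auto
    then show False using nz1 by simp
  qed
  then obtain f1 where f1: "yng2 lam X f1 u1 \<noteq> 0" by blast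
  have t1: "tens n ?D (\<lambda>f. yng2 lam X f u)" for u
    unfolding yng2_diagonal[OF d X] using X
    by (intro tens_asymz tens_symz) (simp add: HH_def)
  have t2: "tens n ?D (yng2 lam X f)" for f
  proof -
    have "yng2 lam X f = (\<lambda>u. \<Sum>p\<in>stab ?D (rowf lam). \<Sum>q\<in>stab ?D (colf lam). of_int (sign q) * yng ?D (rowf lam) (colf lam) (X (f \<circ> p \<circ> q)) u)"
      unfolding yng2_def d by (simp add: yng_def[of _ _ _ "\<lambda>f. yng _ _ _ (X f) _"] symz_def asymz_def)
    then show ?thesis using X by (auto simp: HH_def intro!: tens_sum tens_scale tens_yng)
  qed
  have "lower2 d (yng2 lam X) (map f1 [0..<d], map u1 [0..<d]) = yng2 lam X f1 u1"
  proof -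
    have "yng2 lam X ((!) (map f1 [0..<d])) ((!) (map u1 [0..<d])) = yng2 lam X f1 ((!) (map u1 [0..<d]))"
      by (rule tens_cong[OF t1]) auto
    also have "\<dots> = yng2 lam X f1 u1" by (rule tens_cong[OF t2]) auto
    finally show ?thesis by (simp add: lower2_def)
  qed
  then have "lower2 d (yng2 lam X) \<noteq> (\<lambda>x. 0)" using f1 by (metis)
  then show ?thesis using that[OF lamd] by blast
qed

lemma HH_add_scale: "HH D X \<Longrightarrow> HH D Y \<Longrightarrow> HH D (\<lambda>f u. X f u + c * Y f u)"
  unfolding HH_def by (auto intro!: tens_add tens_scale harm_add harm_scale)

lemma HH_zero: "HH D (\<lambda>f u. 0)"
  by (simp add: HH_def tens_null harm_def ctr_def)

lemma HH_sum: "(\<And>a. a \<in> A \<Longrightarrow> HH D (X a)) \<Longrightarrow> HH D (\<lambda>f u. \<Sum>a\<in>A. X a f u)"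
proof (induction A rule: infinite_finite_induct)
  case (insert a A)
  then have "HH D (\<lambda>f u. X a f u + 1 * (\<Sum>a\<in>A. X a f u))" by (intro HH_add_scale) auto
  then show ?case using insert by simp
qed (simp_all add: HH_zero)

text \<open>Summing p (c s) times p (c t) over all p gives an invariant element. Applying c to both
  factors multiplies the p-th term by the square of \<open>\<kappa> p\<close>, where c p c =
  \<open>\<kappa> p\<close> c. The total factor K is a sum of squares of integers in which
  \<open>\<kappa> id\<close> is not zero, so one can divide by it. Symmetrizers of other shapes
  annihilate every term.\<close>

lemma HH_preimage_single:
  assumes lam: "lam \<in> Lamd d" and s: "tens n {..<d} s" "harm {..<d} s" and t: "tens n {..<d} t" "harm {..<d} t"
  obtains X where "HH {..<d} X" "\<And>f u. yng2 lam X f u = yng {..<d} (rowf lam) (colf lam) s f * yng {..<d} (rowf lam) (colf lam) t u"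
    "\<And>mu f u. mu \<in> Lamd d \<Longrightarrow> mu \<noteq> lam \<Longrightarrow> yng2 mu X f u = 0"
proof -
  let ?D = "{..<d}" and ?y = "\<lambda>lam. yng {..<d} (rowf lam) (colf lam)"
  have D: "finite ?D" by simp
  define P where "P = {p. p permutes ?D}"
  have fP: "finite P" unfolding P_def using finite_permutations[OF D] .
  have "\<exists>e::int. \<forall>x :: (nat \<Rightarrow> nat) \<Rightarrow> complex. ?y lam (pact p (?y lam x)) = (\<lambda>f. of_int e * ?y lam x f)" if "p \<in> P" for p
    using yng_pact_yng[OF D std_tableau[OF lam], of p] that unfolding P_def by (metis mem_Collect_eq)
  then obtain \<kappa> :: "(nat \<Rightarrow> nat) \<Rightarrow> int" where \<kappa>: "\<And>p (x :: (nat \<Rightarrow> nat) \<Rightarrow> complex). p \<in> P \<Longrightarrow> ?y lam (pact p (?y lam x)) = (\<lambda>f. of_int (\<kappa> p) * ?y lam x f)"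
    by metis
  have idP: "id \<in> P" by (simp add: P_def)
  have "\<kappa> id \<noteq> 0"
  proof
    assume z: "\<kappa> id = 0"
    obtain x :: "(nat \<Rightarrow> nat) \<Rightarrow> complex" where "?y lam (?y lam x) \<noteq> (\<lambda>f. 0)"
      using yng_yng_nonzero[OF D std_tableau[OF lam]] by blast
    then show False using \<kappa>[OF idP, of x] z by simp
  qed
  then have "(\<Sum>p\<in>P. \<kappa> p * \<kappa> p) > 0"
    using fP idP by (intro sum_pos2[of _ id]) (auto simp: zero_less_mult_iff)
  define K where "K = (of_int (\<Sum>p\<in>P. \<kappa> p * \<kappa> p) :: complex)"
  have K: "K \<noteq> 0" unfolding K_def using \<open>(\<Sum>p\<in>P. \<kappa> p * \<kappa> p) > 0\<close> by (metis less_irrefl of_int_eq_0_iff)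
  define X where "X = (\<lambda>f u. \<Sum>p\<in>P. (1 / K) * (pact p (?y lam s) f * pact p (?y lam t) u))"
  have yX: "yng2 mu X f u = (\<Sum>p\<in>P. (1 / K) * (?y mu (pact p (?y lam s)) f * ?y mu (pact p (?y lam t)) u))" if "mu \<in> Lamd d" for mu f u
    using that unfolding X_def yng2_sum by (simp add: Lamd_def)
  have "HH ?D X" unfolding HH_def
  proof (intro conjI allI impI)
    fix v
    have ps: "tens n ?D (pact p (?y lam s))" "harm ?D (pact p (?y lam s))" "tens n ?D (pact p (?y lam t))" "harm ?D (pact p (?y lam t))" if "p \<in> P" for p
      using that s t by (auto simp: P_def intro!: tens_pact harm_pact tens_yng harm_yng)
    have 1: "(\<lambda>f. X f v) = (\<lambda>f. \<Sum>p\<in>P. ((1 / K) * pact p (?y lam t) v) * pact p (?y lam s) f)" by (simp add: X_def mult_ac)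
    have 2: "X v = (\<lambda>u. \<Sum>p\<in>P. ((1 / K) * pact p (?y lam s) v) * pact p (?y lam t) u)" by (simp add: X_def mult_ac)
    show "tens n ?D (\<lambda>f. X f v)" unfolding 1 by (intro tens_sum tens_scale ps)
    show "tens n ?D (X v)" unfolding 2 by (intro tens_sum tens_scale ps)
    show "harm ?D (\<lambda>f. X f v)" unfolding 1 by (intro harm_sum harm_scale ps)
    show "harm ?D (X v)" unfolding 2 by (intro harm_sum harm_scale ps)
  next
    fix q f u assume q: "q permutes ?D"
    have "X (f \<circ> q) (u \<circ> q) = (\<Sum>p\<in>P. (1 / K) * (pact (q \<circ> p) (?y lam s) f * pact (q \<circ> p) (?y lam t) u))"
      by (simp add: X_def pact_def comp_assoc)
    also have "\<dots> = X f u" unfolding X_def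
      by (rule sum.reindex_bij_witness[where i = "\<lambda>p. pinv q \<circ> p" and j = "\<lambda>p. q \<circ> p"])
        (auto simp: P_def permutes_compose[OF _ q] permutes_compose[OF _ permutes_inv[OF q]] comp_assoc[symmetric] permutes_inv_o[OF q])
    finally show "X (f \<circ> q) (u \<circ> q) = X f u" .
  qed
  moreover have "yng2 lam X f u = ?y lam s f * ?y lam t u" for f u
  proof -
    have "yng2 lam X f u = (\<Sum>p\<in>P. (1 / K) * (of_int (\<kappa> p * \<kappa> p) * (?y lam s f * ?y lam t u)))"
      unfolding yX[OF lam] by (intro sum.cong refl) (simp add: \<kappa> mult_ac)
    also have "\<dots> = (1 / K) * (K * (?y lam s f * ?y lam t u))"
      unfolding K_def of_int_sum sum_distrib_right sum_distrib_left ..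
    finally show ?thesis using K by simp
  qed
  moreover have "yng2 mu X f u = 0" if mu: "mu \<in> Lamd d" "mu \<noteq> lam" for mu f u
  proof -
    have "length lam = length mu" "sum_list lam = d" "sum_list mu = d" using lam mu Lam_props by (auto simp: Lamd_def)
    then obtain i where "card {x\<in>?D. rowf lam x = i} \<noteq> card {x\<in>?D. rowf mu x = i}"
      using list_eq_of_card_rows[of lam mu] mu(2) by auto
    then have "?y mu (pact p (?y lam x)) = (\<lambda>f. 0)" if "p \<in> P" for p and x :: "(nat \<Rightarrow> nat) \<Rightarrow> complex"
      using that by (intro yng_pact_yng_other[OF D std_tableau[OF lam] std_tableau[OF mu(1)]]) (auto simp: P_def)
    then show ?thesis unfolding yX[OF mu(1)] by simp
  qed
  ultimately show ?thesis using that by blast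
qed

lemma HH_preimage_component:
  assumes lam: "lam \<in> Lamd d" and Z: "Z \<in> tensor_sq (weyl_module B lam)"
  shows "\<exists>X. HH {..<d} X \<and> lower2 d (yng2 lam X) = Z \<and> (\<forall>mu\<in>Lamd d. mu \<noteq> lam \<longrightarrow> lower2 d (yng2 mu X) = (\<lambda>x. 0))"
proof -
  have d: "sum_list lam = d" using lam by (simp add: Lamd_def)
  show ?thesis using Z unfolding tensor_sq_eq[OF d]
  proof (induction rule: fspan_induct)
    case zero
    have "yng2 mu (\<lambda>f u. 0) = (\<lambda>f u. 0)" for mu by (simp add: yng2_def yng_def symz_def asymz_def fun_eq_iff)
    then show ?case by (intro exI[of _ "\<lambda>f u. 0"]) (auto simp: HH_zero lower2_def)
  next
    case (add c S Z)
    obtain X where X: "HH {..<d} X" "lower2 d (yng2 lam X) = Z" "\<forall>mu\<in>Lamd d. mu \<noteq> lam \<longrightarrow> lower2 d (yng2 mu X) = (\<lambda>x. 0)"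
      using add(2) by blast
    obtain s t where st: "tens n {..<d} s" "harm {..<d} s" "tens n {..<d} t" "harm {..<d} t"
      and S: "S = lower2 d (\<lambda>f u. yng {..<d} (rowf lam) (colf lam) s f * yng {..<d} (rowf lam) (colf lam) t u)"
      using add(1) by blast
    obtain Y where Y: "HH {..<d} Y" "\<And>f u. yng2 lam Y f u = yng {..<d} (rowf lam) (colf lam) s f * yng {..<d} (rowf lam) (colf lam) t u"
      "\<And>mu f u. mu \<in> Lamd d \<Longrightarrow> mu \<noteq> lam \<Longrightarrow> yng2 mu Y f u = 0"
      by (rule HH_preimage_single[OF lam st]) (rule that)
    have lin: "lower2 d (yng2 mu (\<lambda>f u. X f u + c * Y f u)) = (\<lambda>x. lower2 d (yng2 mu X) x + c * lower2 d (yng2 mu Y) x)" for mu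
      by (auto simp: lower2_def fun_eq_iff yng2_add_scale)
    have "lower2 d (yng2 lam Y) = S" unfolding S by (auto simp: lower2_def Y(2) fun_eq_iff)
    moreover have "lower2 d (yng2 mu Y) = (\<lambda>x. 0)" if "mu \<in> Lamd d" "mu \<noteq> lam" for mu
      using Y(3)[OF that] by (auto simp: lower2_def)
    ultimately show ?case using X HH_add_scale[OF X(1) Y(1), of c]
      by (intro exI[of _ "\<lambda>f u. X f u + c * Y f u"]) (simp add: lin)
  qed
qed

definition chi :: "nat \<Rightarrow> ((nat \<Rightarrow> nat) \<Rightarrow> (nat \<Rightarrow> nat) \<Rightarrow> complex) \<Rightarrow> nat list \<times> nat list \<times> nat list \<Rightarrow> complex" where
  "chi d X = (\<lambda>(lam, x). if lam \<in> Lamd d then lower2 d (yng2 lam X) x else 0)"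

lemma chi_add_scale: "chi d (\<lambda>f u. X f u + c * Y f u) = (\<lambda>x. chi d X x + c * chi d Y x)"
  by (auto simp: chi_def lower2_def fun_eq_iff yng2_add_scale)

theorem chi_bij:
  "bij_betw (chi d) {X. HH {..<d} X} (idx_dsum (Lamd d) (\<lambda>lam. tensor_sq (weyl_module B lam)))"
  unfolding bij_betw_def
proof
  show "inj_on (chi d) {X. HH {..<d} X}"
  proof (rule inj_onI, rule ccontr)
    fix X Y assume XY: "X \<in> {X. HH {..<d} X}" "Y \<in> {X. HH {..<d} X}" "chi d X = chi d Y" "X \<noteq> Y"
    define Z where "Z = (\<lambda>f u. X f u + (-1) * Y f u)"
    have Z: "HH {..<d} Z" unfolding Z_def using XY by (intro HH_add_scale) auto
    obtain f u where "Z f u \<noteq> 0" using XY(4) by (force simp: Z_def fun_eq_iff)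
    then obtain lam where lam: "lam \<in> Lamd d" "lower2 d (yng2 lam Z) \<noteq> (\<lambda>x. 0)" using HH_nonzero_component[OF Z] by blast
    have "chi d Z = (\<lambda>x. 0)" unfolding Z_def chi_add_scale XY(3) by simp
    then have "chi d Z (lam, x) = 0" for x by simp
    then have "lower2 d (yng2 lam Z) x = 0" for x using lam(1) by (simp add: chi_def)
    then show False using lam(2) by (simp add: fun_eq_iff)
  qed
  show "chi d ` {X. HH {..<d} X} = idx_dsum (Lamd d) (\<lambda>lam. tensor_sq (weyl_module B lam))"
  proof (intro equalityI subsetI)
    fix Y assume "Y \<in> chi d ` {X. HH {..<d} X}"
    then obtain X where X: "HH {..<d} X" "Y = chi d X" by blast
    have "(\<lambda>p. Y (lam, p)) \<in> tensor_sq (weyl_module B lam)" if "lam \<in> Lamd d" for lam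
      using yng2_in_tensor_sq[OF _ X(1), of lam] that unfolding X(2) chi_def by (simp add: Lamd_def)
    then show "Y \<in> idx_dsum (Lamd d) (\<lambda>lam. tensor_sq (weyl_module B lam))"
      unfolding idx_dsum_def by (auto simp: X(2) chi_def)
  next
    fix Y assume Y: "Y \<in> idx_dsum (Lamd d) (\<lambda>lam. tensor_sq (weyl_module B lam))"
    have "\<forall>lam\<in>Lamd d. \<exists>X. HH {..<d} X \<and> lower2 d (yng2 lam X) = (\<lambda>p. Y (lam, p)) \<and> (\<forall>mu\<in>Lamd d. mu \<noteq> lam \<longrightarrow> lower2 d (yng2 mu X) = (\<lambda>x. 0))"
      using Y HH_preimage_component by (simp add: idx_dsum_def)
    then obtain F where F: "\<And>lam. lam \<in> Lamd d \<Longrightarrow> HH {..<d} (F lam)" "\<And>lam. lam \<in> Lamd d \<Longrightarrow> lower2 d (yng2 lam (F lam)) = (\<lambda>p. Y (lam, p))"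
      "\<And>lam mu. lam \<in> Lamd d \<Longrightarrow> mu \<in> Lamd d \<Longrightarrow> mu \<noteq> lam \<Longrightarrow> lower2 d (yng2 mu (F lam)) = (\<lambda>x. 0)"
      by metis
    define X where "X = (\<lambda>f u. \<Sum>lam\<in>Lamd d. F lam f u)"
    have "HH {..<d} X" unfolding X_def using F(1) by (rule HH_sum)
    moreover have "chi d X = Y"
    proof
      fix x :: "nat list \<times> nat list \<times> nat list"
      obtain mu y where x: "x = (mu, y)" by (cases x)
      show "chi d X x = Y x"
      proof (cases "mu \<in> Lamd d")
        case False then show ?thesis using Y by (cases y) (simp add: x chi_def idx_dsum_def)
      next
        case True
        have "lower2 d (yng2 mu X) y = (\<Sum>lam\<in>Lamd d. lower2 d (yng2 mu (F lam)) y)"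
          unfolding X_def by (auto simp: lower2_def yng2_sum' case_prod_unfold)
        also have "\<dots> = (\<Sum>lam\<in>Lamd d. if lam = mu then Y (mu, y) else 0)"
          using True F(2,3) by (intro sum.cong refl) auto
        also have "\<dots> = Y (mu, y)" using True finite_Lamd by simp
        finally show ?thesis using True by (simp add: x chi_def)
      qed
    qed
    ultimately show "Y \<in> chi d ` {X. HH {..<d} X}" by blast
  qed
qed

lemma lower2_act2:
  assumes X: "bitens n {..<d} X"
  shows "lower2 d (act2 {..<d} (mf n g) (mf n h) X) = pair_act n d (g, h) (lower2 d X)"
proof
  fix x :: "nat list \<times> nat list"
  obtain w w' where x: "x = (w, w')" by (cases x)
  have X': "X ((!) (map v [0..<d])) ((!) (map v' [0..<d])) = X v v'" for v v'
  proof -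
    have "X ((!) (map v [0..<d])) ((!) (map v' [0..<d])) = X v ((!) (map v' [0..<d]))"
      using X by (intro tens_cong[of n "{..<d}" "\<lambda>f. X f _"]) (auto simp: bitens_def)
    also have "\<dots> = X v v'" using X by (intro tens_cong[of n "{..<d}" "X v"]) (auto simp: bitens_def)
    finally show ?thesis .
  qed
  have gp: "gprod {..<d} (mf n m) ((!) y) v = (\<Prod>k<d. m $$ (y ! k, map v [0..<d] ! k))" if "y \<in> idx n d" "v \<in> Ix n {..<d}" for y v m
    unfolding gprod_def using that Ix_lt[OF that(2)] by (intro prod.cong refl) (auto simp: mf_def idx_def)
  have gz: "gprod {..<d} (mf n m) ((!) y) v = 0" if y: "y \<notin> idx n d" "length y = d" for y v m
  proof -
    obtain k where "k < d" "n \<le> y ! k" using y by (auto simp: idx_def in_set_conv_nth not_less)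
    then show ?thesis unfolding gprod_def by (auto intro!: prod_zero bexI[of _ k] simp: mf_def)
  qed
  show "lower2 d (act2 {..<d} (mf n g) (mf n h) X) x = pair_act n d (g, h) (lower2 d X) x"
  proof (cases "w \<in> idx n d \<and> w' \<in> idx n d")
    case True
    then have l: "length w = d" "length w' = d" by (auto simp: idx_def)
    show ?thesis unfolding x pair_act_def sum_idx using True l
      by (auto simp: lower2_def act2_def X' gp intro!: sum.cong)
  next
    case False
    have "act2 {..<d} (mf n g) (mf n h) X ((!) w) ((!) w') = 0" if l: "length w = d" "length w' = d"
    proof -
      have "gprod {..<d} (mf n g) ((!) w) v * gprod {..<d} (mf n h) ((!) w') v' = 0" for v v'
        using False gz[OF _ l(1), of g v] gz[OF _ l(2), of h v'] by auto
      then show ?thesis unfolding act2_def by (simp only: mult_zero_left sum.neutral_const)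
    qed
    then show ?thesis using False by (auto simp: x pair_act_def lower2_def)
  qed
qed

text \<open>The group changes the values in the slots, the symmetrizers change the
  positions.\<close>

lemma yng2_act2: 
  assumes d: "sum_list lam = d"
  shows "yng2 lam (act2 {..<d} g h X) f u = act2 {..<d} g h (yng2 lam X) f u"
proof -
  let ?D = "{..<d}" and ?R = "stab {..<d} (rowf lam)" and ?C = "stab {..<d} (colf lam)"
  define A where "A = (?R \<times> ?C) \<times> (?R \<times> ?C)"
  define l where "l = (\<lambda>a :: ((nat \<Rightarrow> nat) \<times> (nat \<Rightarrow> nat)) \<times> (nat \<Rightarrow> nat) \<times> (nat \<Rightarrow> nat). fst (fst a) \<circ> snd (fst a))"
  define m where "m = (\<lambda>a :: ((nat \<Rightarrow> nat) \<times> (nat \<Rightarrow> nat)) \<times> (nat \<Rightarrow> nat) \<times> (nat \<Rightarrow> nat). fst (snd a) \<circ> snd (snd a))"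
  define s where "s = (\<lambda>a :: ((nat \<Rightarrow> nat) \<times> (nat \<Rightarrow> nat)) \<times> (nat \<Rightarrow> nat) \<times> (nat \<Rightarrow> nat). (of_int (sign (snd (fst a))) * of_int (sign (snd (snd a))) :: complex))"
  have y: "yng2 lam Y f u = (\<Sum>a\<in>A. s a * Y (f \<circ> l a) (u \<circ> m a))" for Y f u
  proof -
    have "yng2 lam Y f u = (\<Sum>p\<in>?R. \<Sum>q\<in>?C. \<Sum>p'\<in>?R. \<Sum>q'\<in>?C. of_int (sign q) * (of_int (sign q') * Y (f \<circ> (p \<circ> q)) (u \<circ> (p' \<circ> q'))))"
      unfolding yng2_def d by (simp add: yng_def symz_def asymz_def sum_distrib_left comp_assoc)
    also have "\<dots> = (\<Sum>p\<in>?R. \<Sum>q\<in>?C. \<Sum>c\<in>?R \<times> ?C. of_int (sign q) * (of_int (sign (snd c)) * Y (f \<circ> (p \<circ> q)) (u \<circ> (fst c \<circ> snd c))))"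
      by (intro sum.cong refl sum_pair)
    also have "\<dots> = (\<Sum>a\<in>?R \<times> ?C. \<Sum>c\<in>?R \<times> ?C. of_int (sign (snd a)) * (of_int (sign (snd c)) * Y (f \<circ> (fst a \<circ> snd a)) (u \<circ> (fst c \<circ> snd c))))"
      by (rule sum_pair)
    also have "\<dots> = (\<Sum>a\<in>A. s a * Y (f \<circ> l a) (u \<circ> m a))"
      unfolding A_def by (subst sum_pair) (simp add: s_def l_def m_def mult.assoc)
    finally show ?thesis .
  qed
  have lm: "l a permutes ?D" "m a permutes ?D" if "a \<in> A" for a
    using that by (auto simp: A_def l_def m_def intro!: permutes_compose dest: stab_permutes)
  have "yng2 lam (act2 ?D g h X) f u = (\<Sum>a\<in>A. s a * act2 ?D g h (\<lambda>f u. X (f \<circ> l a) (u \<circ> m a)) f u)"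
    unfolding y by (intro sum.cong refl) (simp add: act2_permute lm)
  also have "\<dots> = (\<Sum>a\<in>A. \<Sum>v\<in>Ix n ?D. \<Sum>w\<in>Ix n ?D. gprod ?D g f v * gprod ?D h u w * (s a * X (v \<circ> l a) (w \<circ> m a)))"
    by (simp add: act2_def sum_distrib_left mult_ac)
  also have "\<dots> = (\<Sum>v\<in>Ix n ?D. \<Sum>w\<in>Ix n ?D. \<Sum>a\<in>A. gprod ?D g f v * gprod ?D h u w * (s a * X (v \<circ> l a) (w \<circ> m a)))"
    by (rule sum_swap3)
  also have "\<dots> = act2 ?D g h (yng2 lam X) f u"
    unfolding act2_def y[abs_def] by (simp add: sum_distrib_left)
  finally show ?thesis .
qed

lemma bitens_yng2:
  assumes d: "sum_list lam = d" and X: "bitens n {..<d} X" shows "bitens n {..<d} (yng2 lam X)"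
  unfolding bitens_def
proof (intro conjI allI)
  let ?D = "{..<d}"
  fix v
  have "(\<lambda>f. yng2 lam X f v) = yng ?D (rowf lam) (colf lam) (\<lambda>f. yng ?D (rowf lam) (colf lam) (X f) v)"
    by (simp add: yng2_def d)
  moreover have "tens n ?D (\<lambda>f. yng ?D (rowf lam) (colf lam) (X f) v)"
    using X by (auto simp: yng_def symz_def asymz_def bitens_def intro!: tens_sum tens_scale)
  ultimately show "tens n ?D (\<lambda>f. yng2 lam X f v)" by (simp add: tens_yng)
  have "yng2 lam X v = (\<lambda>u. \<Sum>p\<in>stab ?D (rowf lam). \<Sum>q\<in>stab ?D (colf lam). of_int (sign q) * yng ?D (rowf lam) (colf lam) (X (v \<circ> p \<circ> q)) u)"
    unfolding yng2_def d by (simp add: yng_def[of _ _ _ "\<lambda>f. yng _ _ _ (X f) _"] symz_def asymz_def)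
  then show "tens n ?D (yng2 lam X v)" using X by (auto simp: bitens_def intro!: tens_sum tens_scale tens_yng)
qed

lemma chi_act2:
  assumes X: "HH {..<d} X"
  shows "chi d (act2 {..<d} (mf n g) (mf n h) X) = idx_act (\<lambda>lam. pair_act n (sum_list lam)) (g, h) (chi d X)"
proof
  fix x :: "nat list \<times> nat list \<times> nat list"
  obtain lam y where x: "x = (lam, y)" by (cases x)
  have bX: "bitens n {..<d} X" using X by (simp add: HH_def bitens_def)
  show "chi d (act2 {..<d} (mf n g) (mf n h) X) x = idx_act (\<lambda>lam. pair_act n (sum_list lam)) (g, h) (chi d X) x"
  proof (cases "lam \<in> Lamd d")
    case True
    then have d: "sum_list lam = d" by (simp add: Lamd_def)
    have "yng2 lam (act2 {..<d} (mf n g) (mf n h) X) = act2 {..<d} (mf n g) (mf n h) (yng2 lam X)"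
      by (intro ext yng2_act2 d)
    then have "chi d (act2 {..<d} (mf n g) (mf n h) X) x = pair_act n d (g, h) (lower2 d (yng2 lam X)) y"
      using True lower2_act2[OF bitens_yng2[OF d bX]] by (simp add: x chi_def)
    moreover have "(\<lambda>q. chi d X (lam, q)) = lower2 d (yng2 lam X)" using True by (simp add: chi_def)
    ultimately show ?thesis by (simp add: idx_act_def x d)
  next
    case False
    then show ?thesis by (simp add: idx_act_def x chi_def pair_act_def case_prod_unfold)
  qed
qed

end

section \<open>Orthogonal and symplectic groups\<close>

locale real_form =
  fixes n :: nat and B :: "complex mat" and e :: complex
  assumes B_carrier: "B \<in> carrier_mat n n"
    and B_real: "x < n \<Longrightarrow> y < n \<Longrightarrow> cnj (B $$ (x, y)) = B $$ (x, y)"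
    and B_sym: "x < n \<Longrightarrow> y < n \<Longrightarrow> B $$ (y, x) = e * B $$ (x, y)"
    and e_one: "e * e = 1"
    and B_orth: "x < n \<Longrightarrow> y < n \<Longrightarrow> (\<Sum>c<n. B $$ (x, c) * B $$ (y, c)) = (if x = y then 1 else 0)"
begin

definition isom :: "complex mat set" where
  "isom = {M \<in> carrier_mat n n. transpose_mat M * B * M = B}"

sublocale bform n "mf n B" e
proof
  show "mf n B x y = 0" if "\<not> (x < n \<and> y < n)" for x y using that by (auto simp: mf_def)
  show "cnj (mf n B x y) = mf n B x y" for x y by (simp add: mf_def B_real)
  show "mf n B y x = e * mf n B x y" for x y by (simp add: mf_def B_sym[of x y])
  show "e * e = 1" by (rule e_one)
  show "(\<Sum>c<n. mf n B x c * mf n B y c) = (if x = y then 1 else 0)" if "x < n" "y < n" for x y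
    using B_orth[OF that] that by (simp add: mf_def)
qed

lemma BBT: "B * transpose_mat B = 1\<^sub>m n"
  using B_carrier B_orth by (intro eq_matI) (auto simp: scalar_prod_def atLeast0LessThan)

lemma BTB: "transpose_mat B * B = 1\<^sub>m n"
  using mat_mult_left_right_inverse[OF _ _ BBT] B_carrier by simp

lemma isom_carrier: "M \<in> isom \<Longrightarrow> M \<in> carrier_mat n n"
  by (simp add: isom_def)

lemma isom_mult: assumes "M \<in> isom" "N \<in> isom" shows "M * N \<in> isom"
proof -
  note c = isom_carrier[OF assms(1)] isom_carrier[OF assms(2)] B_carrier
  have "transpose_mat (M * N) * B * (M * N) = transpose_mat N * (transpose_mat M * B * M) * N"
  proof -
    have "transpose_mat (M * N) * B * (M * N) = transpose_mat N * transpose_mat M * B * (M * N)"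
      using c by (simp add: transpose_mult[OF c(1,2)])
    also have "\<dots> = transpose_mat N * transpose_mat M * B * M * N"
      using c by (simp add: assoc_mult_mat[of _ n n _ n _ n])
    also have "\<dots> = transpose_mat N * (transpose_mat M * B * M) * N"
      using c by (simp add: assoc_mult_mat[of _ n n _ n _ n])
    finally show ?thesis .
  qed
  then show ?thesis using assms c by (simp add: isom_def)
qed

text \<open>The explicit inverse of an isometry, obtained from M^T B M = B and B^T B = 1.\<close>

definition adjm :: "complex mat \<Rightarrow> complex mat" where
  "adjm M = transpose_mat B * transpose_mat M * B"

lemma adjm_inverse:
  assumes "M \<in> isom"
  shows "adjm M \<in> carrier_mat n n" "adjm M * M = 1\<^sub>m n" "M * adjm M = 1\<^sub>m n"
proof -
  note c = isom_carrier[OF assms] B_carrier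
  show a: "adjm M \<in> carrier_mat n n" using c by (simp add: adjm_def)
  have "adjm M * M = transpose_mat B * (transpose_mat M * B * M)"
    using c by (simp add: adjm_def assoc_mult_mat[of _ n n _ n _ n])
  then show l: "adjm M * M = 1\<^sub>m n" using assms BTB by (simp add: isom_def)
  show "M * adjm M = 1\<^sub>m n" by (rule mat_mult_left_right_inverse[OF a c(1) l])
qed

lemma isom_transpose: assumes "M \<in> isom" shows "transpose_mat M \<in> isom"
proof -
  note c = isom_carrier[OF assms] B_carrier
  have "M * transpose_mat B * transpose_mat M * B = 1\<^sub>m n"
    using adjm_inverse(3)[OF assms] c by (simp add: adjm_def assoc_mult_mat[of _ n n _ n _ n])
  then have "M * transpose_mat B * transpose_mat M * B * transpose_mat B = transpose_mat B" using c by simp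
  then have "M * transpose_mat B * transpose_mat M * (B * transpose_mat B) = transpose_mat B"
    using c by (simp add: assoc_mult_mat[of _ n n _ n _ n])
  then have "M * transpose_mat B * transpose_mat M = transpose_mat B" unfolding BBT using c by simp
  then have "transpose_mat (M * transpose_mat B * transpose_mat M) = B" by simp
  moreover have "transpose_mat (M * transpose_mat B * transpose_mat M) = M * (B * transpose_mat M)"
    using c by (simp add: transpose_mult[of _ n n _ n])
  ultimately have "M * B * transpose_mat M = B" using c by (simp add: assoc_mult_mat[of _ n n _ n _ n])
  then show ?thesis using c by (simp add: isom_def)
qed

lemma B_isom: "B \<in> isom"
  using B_carrier BTB by (simp add: isom_def)

lemma adjm_isom: "M \<in> isom \<Longrightarrow> adjm M \<in> isom"
  unfolding adjm_def by (intro isom_mult isom_transpose B_isom)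

lemma one_isom: "1\<^sub>m n \<in> isom"
  using B_carrier by (simp add: isom_def)

text \<open>\<open>inv_m\<close> is chosen by SOME; uniqueness of inverses identifies it.\<close>

lemma inv_m_isom: assumes "M \<in> isom" shows "inv_m M = adjm M"
proof -
  note c = isom_carrier[OF assms]
  let ?P = "\<lambda>h. h \<in> carrier_mat (dim_row M) (dim_row M) \<and> M * h = 1\<^sub>m (dim_row M) \<and> h * M = 1\<^sub>m (dim_row M)"
  have "?P (adjm M)" using adjm_inverse[OF assms] c by simp
  then have P: "?P (inv_m M)" unfolding inv_m_def by (rule someI)
  then have i: "inv_m M \<in> carrier_mat n n" "inv_m M * M = 1\<^sub>m n" using c by auto
  have "inv_m M = inv_m M * (M * adjm M)" using adjm_inverse(3)[OF assms] i by simp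
  also have "\<dots> = adjm M" using i c adjm_inverse(1)[OF assms] by (simp add: assoc_mult_mat[of _ n n _ n _ n, symmetric])
  finally show ?thesis .
qed

text \<open>The reason for evaluating polynomials at B M: the inverse of g in the action on
  functions turns into a transpose, so that g acts linearly on the coefficients.\<close>

lemma B_inv_m: assumes "M \<in> isom" shows "B * inv_m M = transpose_mat M * B"
proof -
  note c = isom_carrier[OF assms] B_carrier
  have "B * adjm M = (B * transpose_mat B) * (transpose_mat M * B)"
    using c by (simp add: adjm_def assoc_mult_mat[of _ n n _ n _ n])
  then show ?thesis unfolding inv_m_isom[OF assms] BBT using c by simp
qed

lemma form_entries:
  assumes "M \<in> carrier_mat n n" "i < n" "j < n"
  shows "(transpose_mat M * B * M) $$ (i, j) = (\<Sum>x<n. \<Sum>y<n. mf n B x y * (mf n M x i * mf n M y j))"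
proof -
  have "(transpose_mat M * B * M) $$ (i, j) = (\<Sum>y<n. (\<Sum>x<n. M $$ (x, i) * B $$ (x, y)) * M $$ (y, j))"
    using assms B_carrier by (simp add: scalar_prod_def atLeast0LessThan del: assoc_mult_mat)
  also have "\<dots> = (\<Sum>y<n. \<Sum>x<n. mf n B x y * (mf n M x i * mf n M y j))"
    using assms by (auto simp: mf_def sum_distrib_left sum_distrib_right mult_ac intro!: sum.cong)
  also have "\<dots> = (\<Sum>x<n. \<Sum>y<n. mf n B x y * (mf n M x i * mf n M y j))" by (rule sum.swap)
  finally show ?thesis .
qed

lemma isom_iff:
  assumes "M \<in> carrier_mat n n"
  shows "M \<in> isom \<longleftrightarrow> (\<forall>i<n. \<forall>j<n. (\<Sum>x<n. \<Sum>y<n. mf n B x y * (mf n M x i * mf n M y j)) = mf n B i j)"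
proof
  assume "M \<in> isom"
  then have "transpose_mat M * B * M = B" by (simp add: isom_def)
  then show "\<forall>i<n. \<forall>j<n. (\<Sum>x<n. \<Sum>y<n. mf n B x y * (mf n M x i * mf n M y j)) = mf n B i j"
    using form_entries[OF assms] by (simp add: mf_def[of n B i j for i j])
next
  assume h: "\<forall>i<n. \<forall>j<n. (\<Sum>x<n. \<Sum>y<n. mf n B x y * (mf n M x i * mf n M y j)) = mf n B i j"
  have "transpose_mat M * B * M = B"
  proof (rule eq_matI)
    fix i j assume "i < dim_row B" "j < dim_col B"
    then have ij: "i < n" "j < n" using B_carrier by auto
    have "(transpose_mat M * B * M) $$ (i, j) = mf n B i j" unfolding form_entries[OF assms ij] using h ij by blast
    then show "(transpose_mat M * B * M) $$ (i, j) = B $$ (i, j)" using ij by (simp add: mf_def)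
  qed (use assms B_carrier in auto)
  then show "M \<in> isom" using assms by (simp add: isom_def)
qed

lemma mf_mat: "(\<And>x y. \<not> (x < n \<and> y < n) \<Longrightarrow> g x y = 0) \<Longrightarrow> mf n (mat n n (\<lambda>(x, y). g x y)) = g"
  by (auto simp: mf_def fun_eq_iff)

lemma mem_mf_isom:
  assumes "\<And>x y. \<not> (x < n \<and> y < n) \<Longrightarrow> g x y = 0"
    "\<And>i j. i < n \<Longrightarrow> j < n \<Longrightarrow> (\<Sum>x<n. \<Sum>y<n. mf n B x y * (g x i * g y j)) = mf n B i j"
  shows "g \<in> mf n ` isom"
proof -
  let ?M = "mat n n (\<lambda>(x, y). g x y)"
  have g: "mf n ?M = g" by (rule mf_mat[OF assms(1)])
  have "?M \<in> isom" by (subst isom_iff) (simp_all add: g assms(2))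
  then have "mf n ?M \<in> mf n ` isom" by (rule imageI)
  then show ?thesis by (simp only: g)
qed

lemma mf_transpose: "M \<in> carrier_mat n n \<Longrightarrow> mf n (transpose_mat M) = (\<lambda>x y. mf n M y x)"
  by (auto simp: mf_def fun_eq_iff)

lemma mf_isom_inv:
  assumes "g \<in> mf n ` isom" "i < n" "j < n"
  shows "(\<Sum>x<n. \<Sum>y<n. mf n B x y * (g x i * g y j)) = mf n B i j"
    "(\<Sum>x<n. \<Sum>y<n. mf n B x y * (g i x * g j y)) = mf n B i j"
proof -
  obtain M where M: "M \<in> isom" "g = mf n M" using assms(1) by blast
  note c = isom_carrier[OF M(1)]
  show "(\<Sum>x<n. \<Sum>y<n. mf n B x y * (g x i * g y j)) = mf n B i j"
    using isom_iff[OF c] M assms by blast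
  have t: "transpose_mat M \<in> carrier_mat n n" using c by simp
  from isom_transpose[OF M(1)] show "(\<Sum>x<n. \<Sum>y<n. mf n B x y * (g i x * g j y)) = mf n B i j"
    unfolding isom_iff[OF t] mf_transpose[OF c] M(2) using assms by blast
qed

lemma bgroup_isom:
  assumes lie: "\<And>p q. p < n \<Longrightarrow> q < n \<Longrightarrow> \<exists>(m::nat) w \<gamma> D.
       (\<forall>r<m. (\<forall>s::complex. \<gamma> r s \<in> mf n ` isom) \<and> (\<forall>i<n. \<forall>j<n. \<gamma> r 0 i j = (if i = j then 1 else 0)) \<and>
          (\<forall>i<n. \<forall>j<n. ((\<lambda>s. \<gamma> r s i j) has_field_derivative D r i j) (at 0))) \<and>
       (\<forall>i<n. \<forall>j<n. (\<Sum>r<m. w r * D r i j) = (if q = j then mf n B p i else 0) - e * (if p = j then mf n B q i else 0))"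
    and refl: "e = 1 \<Longrightarrow> 0 < n \<Longrightarrow> (\<lambda>x y. if x = y \<and> x < n then (if x = 0 then -1 else 1) else 0) \<in> mf n ` isom"
  shows "bgroup n (mf n B) e (mf n ` isom)"
proof
  fix g assume g: "g \<in> mf n ` isom"
  then obtain M where M: "M \<in> isom" "g = mf n M" by blast
  show "g x y = 0" if "\<not> (x < n \<and> y < n)" for x y using that by (auto simp: M(2) mf_def)
  show "(\<Sum>x<n. \<Sum>y<n. mf n B x y * (g x i * g y j)) = mf n B i j" if "i < n" "j < n" for i j
    using mf_isom_inv(1)[OF g that] .
  show i2: "(\<Sum>x<n. \<Sum>y<n. mf n B x y * (g i x * g j y)) = mf n B i j" if "i < n" "j < n" for i j
    using mf_isom_inv(2)[OF g that] .
  show "(\<lambda>x y. \<Sum>z<n. g x z * h z y) \<in> mf n ` isom" if h: "h \<in> mf n ` isom" for h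
  proof -
    obtain N where N: "N \<in> isom" "h = mf n N" using h by blast
    have "mf n (M * N) = (\<lambda>x y. \<Sum>z<n. g x z * h z y)"
      unfolding M(2) N(2) using isom_carrier M(1) N(1) by (intro mf_mult) auto
    then show ?thesis using isom_mult[OF M(1) N(1)] by (metis image_eqI)
  qed
  show "(\<lambda>x y. cnj (g y x)) \<in> mf n ` isom"
  proof (rule mem_mf_isom)
    show "cnj (g y x) = 0" if "\<not> (x < n \<and> y < n)" for x y using that by (auto simp: M(2) mf_def)
    fix i j assume ij: "i < n" "j < n"
    have "(\<Sum>x<n. \<Sum>y<n. mf n B x y * (cnj (g i x) * cnj (g j y))) = cnj (\<Sum>x<n. \<Sum>y<n. mf n B x y * (g i x * g j y))"
      by (simp add: b_real)
    then show "(\<Sum>x<n. \<Sum>y<n. mf n B x y * (cnj (g i x) * cnj (g j y))) = mf n B i j"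
      unfolding i2[OF ij] b_real .
  qed
next
  have "mf n (1\<^sub>m n) = (\<lambda>x y. if x = y \<and> x < n then 1 else 0)" by (auto simp: mf_def fun_eq_iff)
  then show "(\<lambda>x y. if x = y \<and> x < n then 1 else 0) \<in> mf n ` isom" using one_isom by (metis image_eqI)
qed (fact lie, fact refl)

end

section \<open>The standard symmetric form and rotations\<close>

lemma real_form_one: "real_form n (1\<^sub>m n) 1"
proof
  fix x y assume xy: "x < n" "y < n"
  have "(\<Sum>c<n. 1\<^sub>m n $$ (x, c) * 1\<^sub>m n $$ (y, c)) = (\<Sum>c<n. if c = x then (if x = y then 1 else 0) else (0::complex))"
    using xy by (intro sum.cong) auto
  then show "(\<Sum>c<n. 1\<^sub>m n $$ (x, c) * 1\<^sub>m n $$ (y, c)) = (if x = y then 1 else (0::complex))" using xy by simp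
qed auto

text \<open>The Lie algebra element for p and q is E_pq - E_qp, the velocity of the rotation in the
  plane of p and q by a complex angle. For p = q it is zero, and the empty family of curves
  serves.\<close>

lemma bgroup_orth: "bgroup n (mf n (1\<^sub>m n)) 1 (mf n ` orth n)"
proof -
  interpret real_form n "1\<^sub>m n" 1 by (rule real_form_one)
  have o: "orth n = isom" unfolding orth_def isom_def by auto
  have mfd: "mf n (1\<^sub>m n) x y = (if x = y \<and> x < n then 1 else 0)" for x y by (auto simp: mf_def)
  have form: "(\<Sum>x<n. \<Sum>y<n. mf n (1\<^sub>m n) x y * (g x i * g y j)) = (\<Sum>x<n. g x i * g x j)" for g i j
  proof (rule sum.cong[OF refl])
    fix x assume "x \<in> {..<n}"
    then have "(\<Sum>y<n. mf n (1\<^sub>m n) x y * (g x i * g y j)) = (\<Sum>y<n. if y = x then g x i * g y j else 0)"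
      by (intro sum.cong) (auto simp: mfd)
    then show "(\<Sum>y<n. mf n (1\<^sub>m n) x y * (g x i * g y j)) = g x i * g x j" using \<open>x \<in> {..<n}\<close> by simp
  qed
  show ?thesis unfolding o
  proof (rule bgroup_isom)
    fix p q assume pq: "p < n" "q < n"
    show "\<exists>(m::nat) w \<gamma> D.
       (\<forall>r<m. (\<forall>s::complex. \<gamma> r s \<in> mf n ` isom) \<and> (\<forall>i<n. \<forall>j<n. \<gamma> r 0 i j = (if i = j then 1 else 0)) \<and>
          (\<forall>i<n. \<forall>j<n. ((\<lambda>s. \<gamma> r s i j) has_field_derivative D r i j) (at 0))) \<and>
       (\<forall>i<n. \<forall>j<n. (\<Sum>r<m. w r * D r i j) = (if q = j then mf n (1\<^sub>m n) p i else 0) - 1 * (if p = j then mf n (1\<^sub>m n) q i else 0))"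
    proof (cases "p = q")
      case True
      then show ?thesis by (intro exI[of _ 0]) simp
    next
      case ne: False
      \<comment> \<open>A and C are rows p and q of the rotation matrix.\<close>
      define A where "A = (\<lambda>(s::complex) i. if i = p then cos s else if i = q then sin s else 0)"
      define C where "C = (\<lambda>(s::complex) i. if i = p then - sin s else if i = q then cos s else 0)"
      define \<gamma> where "\<gamma> = (\<lambda>(s::complex) x i. if x < n \<and> i < n then
         (if x = p then A s i else 0) + (if x = q then C s i else 0) + (if x = i \<and> i \<noteq> p \<and> i \<noteq> q then 1 else 0) else 0)"
      define D where "D = (\<lambda>x i. if x = p \<and> i = q then 1 else if x = q \<and> i = p then -1 else (0::complex))"
      have "\<gamma> s \<in> mf n ` isom" for s
      proof (rule mem_mf_isom)
        show "\<gamma> s x y = 0" if "\<not> (x < n \<and> y < n)" for x y using that by (auto simp: \<gamma>_def)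
        fix i j assume ij: "i < n" "j < n"
        have "(\<Sum>x<n. \<gamma> s x i * \<gamma> s x j) = (\<Sum>x<n. (if x = p then A s i * A s j else 0) + (if x = q then C s i * C s j else 0)
            + (if x = i then (if i = j \<and> i \<noteq> p \<and> i \<noteq> q then 1 else 0) else 0))"
          using ij ne by (intro sum.cong refl) (auto simp: \<gamma>_def A_def C_def)
        also have "\<dots> = A s i * A s j + C s i * C s j + (if i = j \<and> i \<noteq> p \<and> i \<noteq> q then 1 else 0)"
          using ij pq by (simp add: sum.distrib)
        also have "\<dots> = (if i = j then 1 else 0)"
          using ne sin_cos_squared_add[of s] by (auto simp: A_def C_def power2_eq_square add.commute)
        finally show "(\<Sum>x<n. \<Sum>y<n. mf n (1\<^sub>m n) x y * (\<gamma> s x i * \<gamma> s y j)) = mf n (1\<^sub>m n) i j"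
          unfolding form using ij by (simp add: mfd)
      qed
      moreover have "\<gamma> 0 i j = (if i = j then 1 else 0)" if "i < n" "j < n" for i j
        using that ne by (auto simp: \<gamma>_def A_def C_def)
      moreover have "((\<lambda>s. \<gamma> s i j) has_field_derivative D i j) (at 0)" if ij: "i < n" "j < n" for i j
      proof -
        have dc: "(cos has_field_derivative (0::complex)) (at 0)" using DERIV_cos[of "0::complex"] by simp
        have ds: "(sin has_field_derivative (1::complex)) (at 0)" using DERIV_sin[of "0::complex"] by simp
        have dm: "((\<lambda>s. - sin s) has_field_derivative (-1::complex)) (at 0)" using DERIV_minus[OF ds] by simp
        consider "i = p \<and> j = p \<or> i = q \<and> j = q" | "i = p \<and> j = q" | "i = q \<and> j = p" | "\<not> (i \<in> {p, q} \<and> j \<in> {p, q})" by blast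
        then show ?thesis
        proof cases
          case 1
          then have "(\<lambda>s. \<gamma> s i j) = cos" "D i j = 0" using ij ne by (auto simp: \<gamma>_def A_def C_def D_def)
          then show ?thesis using dc by simp
        next
          case 2
          then have "(\<lambda>s. \<gamma> s i j) = sin" "D i j = 1" using ij ne by (auto simp: \<gamma>_def A_def C_def D_def)
          then show ?thesis using ds by simp
        next
          case 3
          then have "(\<lambda>s. \<gamma> s i j) = (\<lambda>s. - sin s)" "D i j = -1" using ij ne by (auto simp: \<gamma>_def A_def C_def D_def)
          then show ?thesis using dm by simp
        next
          case 4
          then have "(\<lambda>s. \<gamma> s i j) = (\<lambda>s. if i = j then 1 else 0)" "D i j = 0" using ij ne by (auto simp: \<gamma>_def A_def C_def D_def)
          then show ?thesis by simp
        qed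
      qed
      moreover have "D i j = (if q = j then mf n (1\<^sub>m n) p i else 0) - 1 * (if p = j then mf n (1\<^sub>m n) q i else 0)" if "i < n" "j < n" for i j
        using that ne pq by (auto simp: D_def mfd)
      ultimately show ?thesis
        by (intro exI[of _ 1] exI[of _ "\<lambda>_. 1"] exI[of _ "\<lambda>_. \<gamma>"] exI[of _ "\<lambda>_. D"]) simp
    qed
  next
    assume n: "0 < n"
    show "(\<lambda>x y. if x = y \<and> x < n then (if x = 0 then -1 else 1) else (0::complex)) \<in> mf n ` isom"
    proof (rule mem_mf_isom)
      fix i j assume ij: "i < n" "j < n"
      let ?g = "\<lambda>x y. if x = y \<and> x < n then (if x = 0 then -1 else 1) else (0::complex)"
      have "(\<Sum>x<n. ?g x i * ?g x j) = (\<Sum>x<n. if x = i then (if i = j then 1 else 0) else 0)"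
        using ij by (intro sum.cong) auto
      then show "(\<Sum>x<n. \<Sum>y<n. mf n (1\<^sub>m n) x y * (?g x i * ?g y j)) = mf n (1\<^sub>m n) i j"
        unfolding form[of ?g i j] using ij by (simp add: mfd)
    qed auto
  qed
qed

section \<open>The standard symplectic form and transvections\<close>

definition partner :: "nat \<Rightarrow> nat" where
  "partner x = (if even x then x + 1 else x - 1)"

lemma Jmat_partner: "x < n \<Longrightarrow> c < n \<Longrightarrow> Jmat n $$ (x, c) = (if c = partner x then (if even x then 1 else -1) else 0)"
  by (auto simp: Jmat_def partner_def; presburger)

lemma partner_partner [simp]: "partner (partner x) = x"
  by (auto simp: partner_def)

lemma partner_lt: "even n \<Longrightarrow> x < n \<Longrightarrow> partner x < n"
  by (auto simp: partner_def elim!: evenE)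

lemma even_partner: "even (partner x) \<longleftrightarrow> odd x"
  by (auto simp: partner_def)

lemma real_form_Jmat: assumes "even n" shows "real_form n (Jmat n) (-1)"
proof
  show "Jmat n \<in> carrier_mat n n" by (simp add: Jmat_def)
  fix x y assume xy: "x < n" "y < n"
  show "cnj (Jmat n $$ (x, y)) = Jmat n $$ (x, y)" using xy by (simp add: Jmat_partner)
  have "x = partner y \<longleftrightarrow> y = partner x" by (metis partner_partner)
  then show "Jmat n $$ (y, x) = -1 * Jmat n $$ (x, y)" using xy even_partner by (auto simp: Jmat_partner)
  have "(\<Sum>c<n. Jmat n $$ (x, c) * Jmat n $$ (y, c)) = (\<Sum>c<n. if c = partner x then (if x = y then 1 else 0) else 0)"
    using xy by (intro sum.cong refl) (auto simp: Jmat_partner dest: arg_cong[where f = partner])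
  then show "(\<Sum>c<n. Jmat n $$ (x, c) * Jmat n $$ (y, c)) = (if x = y then 1 else 0)"
    using partner_lt[OF assms xy(1)] by simp
qed simp

text \<open>The matrices \<open>tv v s\<close> are transvections. They preserve J for every s: the
  terms linear in s cancel by \<open>b1\<close> and \<open>b2\<close>, and the quadratic one
  vanishes by \<open>b3\<close> since J is alternating. Their velocity is quadratic in v, so
  polarization over e_p + e_q, e_p and e_q with weights 1, -1, -1 yields the element for p and
  q.\<close>

lemma bgroup_symp: assumes "even n" shows "bgroup n (mf n (Jmat n)) (-1) (mf n ` symp n)"
proof -
  interpret real_form n "Jmat n" "-1" by (rule real_form_Jmat[OF assms])
  have o: "symp n = isom" unfolding symp_def isom_def ..
  let ?b = "mf n (Jmat n)"
  define \<beta> where "\<beta> = (\<lambda>v x. \<Sum>z<n. v z * ?b z x)"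
  define tv where "tv = (\<lambda>v (s::complex) x y. if x < n \<and> y < n then (if x = y then 1 else 0) + s * (\<beta> v x * v y) else 0)"
  have b1: "(\<Sum>x<n. ?b x j * \<beta> v x) = - v j" if j: "j < n" for v j
  proof -
    have "(\<Sum>x<n. ?b x j * \<beta> v x) = (\<Sum>x<n. \<Sum>z<n. ?b x j * (v z * ?b z x))" by (simp add: \<beta>_def sum_distrib_left)
    also have "\<dots> = (\<Sum>z<n. \<Sum>x<n. ?b x j * (v z * ?b z x))" by (rule sum.swap)
    also have "\<dots> = (\<Sum>z<n. - v z * (\<Sum>x<n. ?b z x * ?b j x))"
    proof (rule sum.cong[OF refl])
      fix z
      have "?b x j * (v z * ?b z x) = - v z * (?b z x * ?b j x)" for x using b_sym[of x j] by (simp add: mult_ac)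
      then show "(\<Sum>x<n. ?b x j * (v z * ?b z x)) = - v z * (\<Sum>x<n. ?b z x * ?b j x)" by (simp add: sum_distrib_left)
    qed
    also have "\<dots> = (\<Sum>z<n. if z = j then - v z else 0)" using j by (intro sum.cong refl) (auto simp: b_orth)
    finally show ?thesis using j by simp
  qed
  have b2: "(\<Sum>y<n. ?b i y * \<beta> v y) = v i" if i: "i < n" for v i
  proof -
    have "(\<Sum>y<n. ?b i y * \<beta> v y) = (\<Sum>y<n. - (?b y i * \<beta> v y))"
      using b_sym[of i] by (intro sum.cong refl) simp
    then show ?thesis using b1[OF i, of v] by (simp add: sum_negf)
  qed
  have b3: "(\<Sum>x<n. \<Sum>y<n. ?b x y * (\<beta> v x * \<beta> v y)) = 0" for v
  proof -
    have "(\<Sum>x<n. \<Sum>y<n. ?b x y * (\<beta> v x * \<beta> v y)) = (\<Sum>y<n. \<Sum>x<n. ?b x y * (\<beta> v x * \<beta> v y))" by (rule sum.swap)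
    also have "\<dots> = (\<Sum>y<n. \<Sum>x<n. - (?b y x * (\<beta> v y * \<beta> v x)))"
    proof (intro sum.cong refl)
      fix x y show "?b x y * (\<beta> v x * \<beta> v y) = - (?b y x * (\<beta> v y * \<beta> v x))" using b_sym[of x y] by (simp add: mult_ac)
    qed
    also have "\<dots> = - (\<Sum>x<n. \<Sum>y<n. ?b x y * (\<beta> v x * \<beta> v y))" by (simp add: sum_negf)
    finally show ?thesis by simp
  qed
  have tv: "tv v s \<in> mf n ` isom" for v s
  proof (rule mem_mf_isom)
    show "tv v s x y = 0" if "\<not> (x < n \<and> y < n)" for x y using that by (auto simp: tv_def)
    fix i j assume ij: "i < n" "j < n"
    have "(\<Sum>x<n. \<Sum>y<n. ?b x y * (tv v s x i * tv v s y j)) =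
       (\<Sum>x<n. \<Sum>y<n. (if x = i then (if y = j then ?b x y else 0) else 0) + (if x = i then s * v j * (?b x y * \<beta> v y) else 0)
         + (if y = j then s * v i * (?b x y * \<beta> v x) else 0) + s * s * v i * v j * (?b x y * (\<beta> v x * \<beta> v y)))"
      using ij by (intro sum.cong refl) (auto simp: tv_def algebra_simps)
    also have "\<dots> = ?b i j + s * v j * (\<Sum>y<n. ?b i y * \<beta> v y) + s * v i * (\<Sum>x<n. ?b x j * \<beta> v x)
         + s * s * v i * v j * (\<Sum>x<n. \<Sum>y<n. ?b x y * (\<beta> v x * \<beta> v y))"
    proof -
      have "(\<Sum>x<n. \<Sum>y<n. if x = i then s * v j * (?b x y * \<beta> v y) else 0) = s * v j * (\<Sum>y<n. ?b i y * \<beta> v y)"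
        using ij by (subst sum.swap) (simp add: sum_distrib_left)
      moreover have "(\<Sum>x<n. \<Sum>y<n. if y = j then s * v i * (?b x y * \<beta> v x) else 0) = s * v i * (\<Sum>x<n. ?b x j * \<beta> v x)"
        using ij by (simp add: sum_distrib_left)
      moreover have "(\<Sum>x<n. \<Sum>y<n. if x = i then (if y = j then ?b x y else 0) else 0) = ?b i j"
        using ij by (subst sum.swap) simp
      moreover have "(\<Sum>x<n. \<Sum>y<n. s * s * v i * v j * (?b x y * (\<beta> v x * \<beta> v y))) = s * s * v i * v j * (\<Sum>x<n. \<Sum>y<n. ?b x y * (\<beta> v x * \<beta> v y))"
        by (simp only: sum_distrib_left)
      ultimately show ?thesis by (simp only: sum.distrib)
    qed
    also have "\<dots> = ?b i j" unfolding b1[OF ij(2)] b2[OF ij(1)] b3 by simp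
    finally show "(\<Sum>x<n. \<Sum>y<n. ?b x y * (tv v s x i * tv v s y j)) = ?b i j" .
  qed
  show ?thesis unfolding o
  proof (rule bgroup_isom)
    fix p q assume pq: "p < n" "q < n"
    define u where "u = (\<lambda>(r::nat) x. if r = 0 then (if x = p then 1 else 0) + (if x = q then 1 else 0)
      else if r = 1 then (if x = p then 1 else 0) else (if x = q then 1 else (0::complex)))"
    define w where "w = (\<lambda>r::nat. if r = 0 then 1 else (-1::complex))"
    define D where "D = (\<lambda>r x y. \<beta> (u r) x * u r y)"
    have ub: "\<beta> (u 0) x = ?b p x + ?b q x" "\<beta> (u 1) x = ?b p x" "\<beta> (u 2) x = ?b q x" for x
    proof -
      have "\<beta> (u 0) x = (\<Sum>z<n. (if z = p then ?b z x else 0) + (if z = q then ?b z x else 0))"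
        unfolding \<beta>_def by (intro sum.cong) (auto simp: u_def)
      then show "\<beta> (u 0) x = ?b p x + ?b q x" using pq by (simp add: sum.distrib)
      have "\<beta> (u 1) x = (\<Sum>z<n. if z = p then ?b z x else 0)" unfolding \<beta>_def by (intro sum.cong) (auto simp: u_def)
      then show "\<beta> (u 1) x = ?b p x" using pq by simp
      have "\<beta> (u 2) x = (\<Sum>z<n. if z = q then ?b z x else 0)" unfolding \<beta>_def by (intro sum.cong) (auto simp: u_def)
      then show "\<beta> (u 2) x = ?b q x" using pq by simp
    qed
    have "((\<lambda>s. tv (u r) s i j) has_field_derivative D r i j) (at 0)" if "i < n" "j < n" for r i j
    proof -
      have "((\<lambda>s. (if i = j then 1 else 0) + s * (\<beta> (u r) i * u r j)) has_field_derivative 0 + 1 * (\<beta> (u r) i * u r j)) (at 0)"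
        by (intro DERIV_add DERIV_const DERIV_cmult_right DERIV_ident)
      then show ?thesis using that by (simp add: tv_def D_def)
    qed
    moreover have "(\<Sum>r<3. w r * D r i j) = (if q = j then ?b p i else 0) - -1 * (if p = j then ?b q i else 0)" for i j
    proof -
      have "(\<Sum>r<3. w r * D r i j) = D 0 i j - D 1 i j - D 2 i j" by (simp add: numeral_3_eq_3 numeral_2_eq_2 w_def)
      then show ?thesis unfolding D_def ub by (auto simp: u_def algebra_simps)
    qed
    moreover have "tv (u r) 0 i j = (if i = j then 1 else 0)" if "i < n" "j < n" for r i j using that by (simp add: tv_def)
    ultimately show "\<exists>(m::nat) w \<gamma> D.
       (\<forall>r<m. (\<forall>s::complex. \<gamma> r s \<in> mf n ` isom) \<and> (\<forall>i<n. \<forall>j<n. \<gamma> r 0 i j = (if i = j then 1 else 0)) \<and>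
          (\<forall>i<n. \<forall>j<n. ((\<lambda>s. \<gamma> r s i j) has_field_derivative D r i j) (at 0))) \<and>
       (\<forall>i<n. \<forall>j<n. (\<Sum>r<m. w r * D r i j) = (if q = j then ?b p i else 0) - -1 * (if p = j then ?b q i else 0))"
      using tv by (intro exI[of _ 3] exI[of _ w] exI[of _ "\<lambda>r. tv (u r)"] exI[of _ D]) simp
  qed simp
qed

section \<open>The coordinate ring of the cone\<close>

text \<open>Both modules are reached from a third space U of coefficient tensors, or of pairs of a
  function and such a tensor. Its operations are not the pointwise ones of \<open>gmod_iso\<close>,
  so they are parameters.\<close>

lemma gmod_iso_via:
  fixes U :: "'u set" and add :: "'u \<Rightarrow> 'u \<Rightarrow> 'u" and scl :: "complex \<Rightarrow> 'u \<Rightarrow> 'u" and act :: "'g \<Rightarrow> 'u \<Rightarrow> 'u"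
  assumes \<psi>: "bij_betw \<psi> U V" and \<chi>: "bij_betw \<chi> U W"
    and U: "\<And>u v. u \<in> U \<Longrightarrow> v \<in> U \<Longrightarrow> add u v \<in> U" "\<And>c u. u \<in> U \<Longrightarrow> scl c u \<in> U" "\<And>\<gamma> u. \<gamma> \<in> \<Gamma> \<Longrightarrow> u \<in> U \<Longrightarrow> act \<gamma> u \<in> U"
    and \<psi>l: "\<And>u v. u \<in> U \<Longrightarrow> v \<in> U \<Longrightarrow> \<psi> (add u v) = (\<lambda>x. \<psi> u x + \<psi> v x)" "\<And>c u. u \<in> U \<Longrightarrow> \<psi> (scl c u) = (\<lambda>x. c * \<psi> u x)"
      "\<And>\<gamma> u. \<gamma> \<in> \<Gamma> \<Longrightarrow> u \<in> U \<Longrightarrow> \<psi> (act \<gamma> u) = \<alpha> \<gamma> (\<psi> u)"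
    and \<chi>l: "\<And>u v. u \<in> U \<Longrightarrow> v \<in> U \<Longrightarrow> \<chi> (add u v) = (\<lambda>x. \<chi> u x + \<chi> v x)" "\<And>c u. u \<in> U \<Longrightarrow> \<chi> (scl c u) = (\<lambda>x. c * \<chi> u x)"
      "\<And>\<gamma> u. \<gamma> \<in> \<Gamma> \<Longrightarrow> u \<in> U \<Longrightarrow> \<chi> (act \<gamma> u) = \<beta> \<gamma> (\<chi> u)"
  shows "gmod_iso \<Gamma> V \<alpha> W \<beta>"
proof -
  define \<phi> where "\<phi> = \<chi> \<circ> inv_into U \<psi>"
  have \<phi>: "\<phi> (\<psi> u) = \<chi> u" if "u \<in> U" for u
    using that \<psi> by (simp add: \<phi>_def bij_betw_inv_into_left)
  have V: "\<exists>u\<in>U. v = \<psi> u" if "v \<in> V" for v using that \<psi> by (auto simp: bij_betw_def)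
  have "bij_betw \<phi> V W" unfolding \<phi>_def using bij_betw_inv_into[OF \<psi>] \<chi> by (rule bij_betw_trans)
  moreover have "\<phi> (\<lambda>x. u x + v x) = (\<lambda>y. \<phi> u y + \<phi> v y)" if uv: "u \<in> V" "v \<in> V" for u v
  proof -
    obtain u' v' where "u' \<in> U" "v' \<in> U" "u = \<psi> u'" "v = \<psi> v'" using V uv by metis
    then show ?thesis using U(1) by (simp add: \<psi>l(1)[symmetric] \<phi> \<chi>l(1))
  qed
  moreover have "\<phi> (\<lambda>x. c * u x) = (\<lambda>y. c * \<phi> u y)" if u: "u \<in> V" for c u
  proof -
    obtain u' where "u' \<in> U" "u = \<psi> u'" using V[OF u] by blast
    then show ?thesis using U(2) by (simp add: \<psi>l(2)[symmetric] \<phi> \<chi>l(2))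
  qed
  moreover have "\<phi> (\<alpha> \<gamma> u) = \<beta> \<gamma> (\<phi> u)" if g: "\<gamma> \<in> \<Gamma>" and u: "u \<in> V" for \<gamma> u
  proof -
    obtain u' where "u' \<in> U" "u = \<psi> u'" using V[OF u] by blast
    then show ?thesis using U(3) g by (simp add: \<psi>l(3)[symmetric] \<phi> \<chi>l(3))
  qed
  ultimately show ?thesis unfolding gmod_iso_def by blast
qed

lemma gmod_iso_trans:
  assumes "gmod_iso \<Gamma> V \<alpha> W \<beta>" "gmod_iso \<Gamma> W \<beta> Z \<delta>"
  shows "gmod_iso \<Gamma> V \<alpha> Z \<delta>"
proof -
  obtain \<phi> where \<phi>: "bij_betw \<phi> V W" "\<And>u v. u \<in> V \<Longrightarrow> v \<in> V \<Longrightarrow> \<phi> (\<lambda>x. u x + v x) = (\<lambda>y. \<phi> u y + \<phi> v y)"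
    "\<And>c u. u \<in> V \<Longrightarrow> \<phi> (\<lambda>x. c * u x) = (\<lambda>y. c * \<phi> u y)" "\<And>\<gamma> u. \<gamma> \<in> \<Gamma> \<Longrightarrow> u \<in> V \<Longrightarrow> \<phi> (\<alpha> \<gamma> u) = \<beta> \<gamma> (\<phi> u)"
    using assms(1) unfolding gmod_iso_def by blast
  obtain \<phi>' where \<phi>': "bij_betw \<phi>' W Z" "\<And>u v. u \<in> W \<Longrightarrow> v \<in> W \<Longrightarrow> \<phi>' (\<lambda>x. u x + v x) = (\<lambda>y. \<phi>' u y + \<phi>' v y)"
    "\<And>c u. u \<in> W \<Longrightarrow> \<phi>' (\<lambda>x. c * u x) = (\<lambda>y. c * \<phi>' u y)" "\<And>\<gamma> u. \<gamma> \<in> \<Gamma> \<Longrightarrow> u \<in> W \<Longrightarrow> \<phi>' (\<beta> \<gamma> u) = \<delta> \<gamma> (\<phi>' u)"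
    using assms(2) unfolding gmod_iso_def by blast
  have W: "\<phi> u \<in> W" if "u \<in> V" for u using \<phi>(1) that by (rule bij_betwE[rule_format])
  show ?thesis unfolding gmod_iso_def
    by (intro exI[of _ "\<phi>' \<circ> \<phi>"] conjI bij_betw_trans[OF \<phi>(1) \<phi>'(1)]) (auto simp: \<phi> \<phi>' W)
qed

lemma sum_index_0: "(0, lam) \<in> sum_index \<Lambda> d \<longleftrightarrow> lam \<in> \<Lambda> \<and> sum_list lam = d"
  by (simp add: sum_index_def)

lemma sum_index_Suc: "(Suc k, lam) \<in> sum_index \<Lambda> (Suc (Suc d)) \<longleftrightarrow> (k, lam) \<in> sum_index \<Lambda> d"
  by (auto simp: sum_index_def)

lemma gmod_iso_reindex:
  fixes h :: "'i \<Rightarrow> 'j" and F :: "'i \<Rightarrow> ('p \<Rightarrow> complex) set"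
  assumes inj: "inj_on h I" and J: "J = h ` I" and F: "\<And>i. i \<in> I \<Longrightarrow> F' (h i) = F i" and A: "\<And>i. i \<in> I \<Longrightarrow> A' (h i) = A i"
    and A0: "\<And>i \<gamma> p. A i \<gamma> (\<lambda>q. 0) p = 0" "\<And>j \<gamma> p. A' j \<gamma> (\<lambda>q. 0) p = 0"
  shows "gmod_iso \<Gamma> (idx_dsum I F) (idx_act A) (idx_dsum J F') (idx_act A')"
proof -
  define \<phi> where "\<phi> = (\<lambda>X (j, p::'p). if j \<in> J then X (inv_into I h j, p) else (0::complex))"
  define \<theta> where "\<theta> = (\<lambda>Y (i, p::'p). if i \<in> I then Y (h i, p) else (0::complex))"
  have hi: "inv_into I h (h i) = i" if "i \<in> I" for i using inj that by simp
  have ih: "h (inv_into I h j) = j" "inv_into I h j \<in> I" if "j \<in> J" for j using that J by (auto intro: f_inv_into_f inv_into_into)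
  have "bij_betw \<phi> (idx_dsum I F) (idx_dsum J F')"
  proof (rule bij_betwI[where g = \<theta>])
    show "\<phi> \<in> idx_dsum I F \<rightarrow> idx_dsum J F'"
    proof
      fix X assume X: "X \<in> idx_dsum I F"
      have "(\<lambda>p. \<phi> X (j, p)) \<in> F' j" if "j \<in> J" for j
        using X ih[OF that] F[of "inv_into I h j"] that by (auto simp: \<phi>_def idx_dsum_def)
      then show "\<phi> X \<in> idx_dsum J F'" by (auto simp: idx_dsum_def \<phi>_def)
    qed
    show "\<theta> \<in> idx_dsum J F' \<rightarrow> idx_dsum I F"
    proof
      fix Y assume Y: "Y \<in> idx_dsum J F'"
      have "(\<lambda>p. \<theta> Y (i, p)) \<in> F i" if "i \<in> I" for i
        using Y F[OF that] that J by (auto simp: \<theta>_def idx_dsum_def)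
      then show "\<theta> Y \<in> idx_dsum I F" by (auto simp: idx_dsum_def \<theta>_def)
    qed
    show "\<theta> (\<phi> X) = X" if "X \<in> idx_dsum I F" for X
      using that J hi by (auto simp: \<theta>_def \<phi>_def idx_dsum_def fun_eq_iff)
    show "\<phi> (\<theta> Y) = Y" if "Y \<in> idx_dsum J F'" for Y
      using that ih by (auto simp: \<theta>_def \<phi>_def idx_dsum_def fun_eq_iff)
  qed
  moreover have "\<phi> (idx_act A \<gamma> X) = idx_act A' \<gamma> (\<phi> X)" for \<gamma> X
  proof
    fix x :: "'j \<times> 'p"
    obtain j p where x: "x = (j, p)" by (cases x)
    have "A (inv_into I h j) = A' j" if "j \<in> J" using A[OF ih(2)[OF that]] ih(1)[OF that] by simp
    then show "\<phi> (idx_act A \<gamma> X) x = idx_act A' \<gamma> (\<phi> X) x"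
      using A0(2)[of j \<gamma> p] by (simp add: x \<phi>_def idx_act_def)
  qed
  moreover have "\<phi> (\<lambda>x. u x + v x) = (\<lambda>y. \<phi> u y + \<phi> v y)" for u v by (auto simp: \<phi>_def fun_eq_iff)
  moreover have "\<phi> (\<lambda>x. c * u x) = (\<lambda>y. c * \<phi> u y)" for c u by (auto simp: \<phi>_def fun_eq_iff)
  ultimately show ?thesis unfolding gmod_iso_def by blast
qed

text \<open>The summands with k = 0 are the new ones, of size d + 2. All others are those for d with
  k shifted by one, since d + 2 - 2 (k + 1) = d - 2 k.\<close>

lemma gmod_iso_sum_index_step:
  assumes "gmod_iso \<Gamma> V \<alpha> (idx_dsum (sum_index \<Lambda> d) (\<lambda>(k, lam). F lam)) (idx_act (\<lambda>(k, lam). A lam))"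
  shows "gmod_iso \<Gamma> (sum_carrier V (idx_dsum {lam \<in> \<Lambda>. sum_list lam = Suc (Suc d)} F)) (sum_act \<alpha> (idx_act A))
     (idx_dsum (sum_index \<Lambda> (Suc (Suc d))) (\<lambda>(k, lam). F lam)) (idx_act (\<lambda>(k, lam). A lam))"
proof -
  let ?V' = "idx_dsum (sum_index \<Lambda> d) (\<lambda>(k, lam). F lam)" and ?I = "{lam \<in> \<Lambda>. sum_list lam = Suc (Suc d)}"
  let ?Z = "idx_dsum (sum_index \<Lambda> (Suc (Suc d))) (\<lambda>(k, lam). F lam)"
  obtain \<phi> where \<phi>: "bij_betw \<phi> V ?V'" "\<And>u v. u \<in> V \<Longrightarrow> v \<in> V \<Longrightarrow> \<phi> (\<lambda>x. u x + v x) = (\<lambda>y. \<phi> u y + \<phi> v y)"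
    "\<And>c u. u \<in> V \<Longrightarrow> \<phi> (\<lambda>x. c * u x) = (\<lambda>y. c * \<phi> u y)"
    "\<And>\<gamma> u. \<gamma> \<in> \<Gamma> \<Longrightarrow> u \<in> V \<Longrightarrow> \<phi> (\<alpha> \<gamma> u) = idx_act (\<lambda>(k, lam). A lam) \<gamma> (\<phi> u)"
    using assms unfolding gmod_iso_def by blast
  define \<Phi> where "\<Phi> = (\<lambda>X ((k, lam), p). case k of 0 \<Rightarrow> (X \<circ> Inr) (lam, p) | Suc k' \<Rightarrow> \<phi> (X \<circ> Inl) ((k', lam), p))"
  define \<Theta> where "\<Theta> = (\<lambda>Y. case_sum (inv_into V \<phi> (\<lambda>((k, lam), p). Y ((Suc k, lam), p))) (\<lambda>(lam, p). Y ((0::nat, lam), p)))"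
  have \<Phi>0: "\<Phi> X ((0, lam), p) = (X \<circ> Inr) (lam, p)" and \<Phi>S: "\<Phi> X ((Suc k, lam), p) = \<phi> (X \<circ> Inl) ((k, lam), p)" for X k lam p
    by (simp_all add: \<Phi>_def)
  have eqI: "Y = Y'" if "\<And>lam p. Y ((0, lam), p) = Y' ((0, lam), p)" "\<And>k lam p. Y ((Suc k, lam), p) = Y' ((Suc k, lam), p)"
    for Y Y' :: "(nat \<times> nat list) \<times> 'c \<Rightarrow> complex"
  proof
    fix x :: "(nat \<times> nat list) \<times> 'c"
    obtain k lam p where x: "x = ((k, lam), p)" by (cases x) auto
    show "Y x = Y' x" using that by (cases k) (auto simp: x)
  qed
  have in1: "\<Phi> X \<in> ?Z" if X: "X \<in> sum_carrier V (idx_dsum ?I F)" for X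
  proof -
    have 1: "X \<circ> Inr \<in> idx_dsum ?I F" "\<phi> (X \<circ> Inl) \<in> ?V'" using X bij_betwE[OF \<phi>(1)] by (auto simp: sum_carrier_def)
    show ?thesis unfolding idx_dsum_def
    proof (intro CollectI conjI ballI allI impI)
      fix i assume i: "i \<in> sum_index \<Lambda> (Suc (Suc d))"
      obtain k lam where [simp]: "i = (k, lam)" by (cases i)
      show "(\<lambda>p. \<Phi> X (i, p)) \<in> (case i of (k, lam) \<Rightarrow> F lam)"
      proof (cases k)
        case 0
        then have "lam \<in> ?I" using i by (simp add: sum_index_0)
        then have "(\<lambda>p. (X \<circ> Inr) (lam, p)) \<in> F lam" using 1(1) unfolding idx_dsum_def by blast
        then show ?thesis using 0 by (simp add: \<Phi>0)
      next
        case (Suc k')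
        then have "(k', lam) \<in> sum_index \<Lambda> d" using i by (simp add: sum_index_Suc)
        then have "(\<lambda>p. \<phi> (X \<circ> Inl) ((k', lam), p)) \<in> F lam" using 1(2) unfolding idx_dsum_def by blast
        then show ?thesis using Suc by (simp add: \<Phi>S)
      qed
    next
      fix i p assume i: "i \<notin> sum_index \<Lambda> (Suc (Suc d))"
      obtain k lam where [simp]: "i = (k, lam)" by (cases i)
      show "\<Phi> X (i, p) = 0"
      proof (cases k)
        case 0
        then have "lam \<notin> ?I" using i by (simp add: sum_index_0)
        then have "(X \<circ> Inr) (lam, p) = 0" using 1(1) unfolding idx_dsum_def by blast
        then show ?thesis using 0 by (simp add: \<Phi>0)
      next
        case (Suc k')
        then have "(k', lam) \<notin> sum_index \<Lambda> d" using i by (simp add: sum_index_Suc)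
        then have "\<phi> (X \<circ> Inl) ((k', lam), p) = 0" using 1(2) unfolding idx_dsum_def by blast
        then show ?thesis using Suc by (simp add: \<Phi>S)
      qed
    qed
  qed
  have shift: "(\<lambda>((k, lam), p). Y ((Suc k, lam), p)) \<in> ?V'" and zero: "(\<lambda>(lam, p). Y ((0, lam), p)) \<in> idx_dsum ?I F" if Y: "Y \<in> ?Z" for Y
  proof -
    have Y1: "(\<lambda>p. Y ((k, lam), p)) \<in> F lam" if "(k, lam) \<in> sum_index \<Lambda> (Suc (Suc d))" for k lam
      using Y that unfolding idx_dsum_def by fastforce
    have Y2: "Y ((k, lam), p) = 0" if "(k, lam) \<notin> sum_index \<Lambda> (Suc (Suc d))" for k lam p
      using Y that unfolding idx_dsum_def by blast
    show "(\<lambda>((k, lam), p). Y ((Suc k, lam), p)) \<in> ?V'" unfolding idx_dsum_def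
      using Y1[OF sum_index_Suc[THEN iffD2]] Y2 sum_index_Suc by fastforce
    show "(\<lambda>(lam, p). Y ((0, lam), p)) \<in> idx_dsum ?I F" unfolding idx_dsum_def
      using Y1[of 0] Y2[of 0] by (simp add: sum_index_0)
  qed
  have "bij_betw \<Phi> (sum_carrier V (idx_dsum ?I F)) ?Z"
  proof (rule bij_betwI[where g = \<Theta>])
    show "\<Phi> \<in> sum_carrier V (idx_dsum ?I F) \<rightarrow> ?Z" using in1 by blast
    have Vin: "inv_into V \<phi> Y \<in> V" "\<phi> (inv_into V \<phi> Y) = Y" if "Y \<in> ?V'" for Y
      using \<phi>(1) that by (auto simp: bij_betw_def inv_into_into f_inv_into_f)
    have TI: "\<Theta> Y \<circ> Inl = inv_into V \<phi> (\<lambda>((k, lam), p). Y ((Suc k, lam), p))" "\<Theta> Y \<circ> Inr = (\<lambda>(lam, p). Y ((0, lam), p))" for Y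
      by (auto simp: \<Theta>_def)
    show "\<Theta> \<in> ?Z \<rightarrow> sum_carrier V (idx_dsum ?I F)"
      unfolding sum_carrier_def using Vin(1)[OF shift] zero by (auto simp: TI)
    show "\<Phi> (\<Theta> Y) = Y" if "Y \<in> ?Z" for Y
      by (rule eqI) (simp_all only: \<Phi>0 \<Phi>S TI Vin(2)[OF shift[OF that]] prod.case)
    show "\<Theta> (\<Phi> X) = X" if X: "X \<in> sum_carrier V (idx_dsum ?I F)" for X
    proof -
      have XV: "X \<circ> Inl \<in> V" using X by (simp add: sum_carrier_def)
      have "(\<lambda>((k, lam), p). \<Phi> X ((Suc k, lam), p)) = \<phi> (X \<circ> Inl)" by (auto simp: \<Phi>S fun_eq_iff)
      then have l: "\<Theta> (\<Phi> X) \<circ> Inl = X \<circ> Inl" unfolding TI using \<phi>(1) XV by (simp add: bij_betw_inv_into_left)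
      have r: "\<Theta> (\<Phi> X) \<circ> Inr = X \<circ> Inr" unfolding TI by (auto simp: \<Phi>0 fun_eq_iff)
      show ?thesis
      proof
        fix z show "\<Theta> (\<Phi> X) z = X z" using fun_cong[OF l] fun_cong[OF r] by (cases z) auto
      qed
    qed
  qed
  moreover have "\<Phi> (\<lambda>x. u x + v x) = (\<lambda>y. \<Phi> u y + \<Phi> v y)" if "u \<in> sum_carrier V (idx_dsum ?I F)" "v \<in> sum_carrier V (idx_dsum ?I F)" for u v
  proof -
    have "(\<lambda>x. u x + v x) \<circ> Inl = (\<lambda>x. (u \<circ> Inl) x + (v \<circ> Inl) x)" by auto
    moreover have "u \<circ> Inl \<in> V" "v \<circ> Inl \<in> V" using that by (auto simp: sum_carrier_def)
    ultimately have "\<phi> ((\<lambda>x. u x + v x) \<circ> Inl) = (\<lambda>y. \<phi> (u \<circ> Inl) y + \<phi> (v \<circ> Inl) y)" by (simp only: \<phi>(2))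
    then show ?thesis by (intro eqI) (simp_all only: \<Phi>0 \<Phi>S, simp)
  qed
  moreover have "\<Phi> (\<lambda>x. c * u x) = (\<lambda>y. c * \<Phi> u y)" if "u \<in> sum_carrier V (idx_dsum ?I F)" for c u
  proof -
    have "(\<lambda>x. c * u x) \<circ> Inl = (\<lambda>x. c * (u \<circ> Inl) x)" by auto
    moreover have "u \<circ> Inl \<in> V" using that by (auto simp: sum_carrier_def)
    ultimately have "\<phi> ((\<lambda>x. c * u x) \<circ> Inl) = (\<lambda>y. c * \<phi> (u \<circ> Inl) y)" by (simp only: \<phi>(3))
    then show ?thesis by (intro eqI) (simp_all only: \<Phi>0 \<Phi>S, simp)
  qed
  moreover have "\<Phi> (sum_act \<alpha> (idx_act A) \<gamma> u) = idx_act (\<lambda>(k, lam). A lam) \<gamma> (\<Phi> u)"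
    if g: "\<gamma> \<in> \<Gamma>" and u: "u \<in> sum_carrier V (idx_dsum ?I F)" for \<gamma> u
  proof -
    have l: "sum_act \<alpha> (idx_act A) \<gamma> u \<circ> Inl = \<alpha> \<gamma> (u \<circ> Inl)" by (auto simp: sum_act_def)
    have r: "sum_act \<alpha> (idx_act A) \<gamma> u \<circ> Inr = idx_act A \<gamma> (u \<circ> Inr)" by (auto simp: sum_act_def)
    have "u \<circ> Inl \<in> V" using u by (auto simp: sum_carrier_def)
    then have a: "\<phi> (sum_act \<alpha> (idx_act A) \<gamma> u \<circ> Inl) = idx_act (\<lambda>(k, lam). A lam) \<gamma> (\<phi> (u \<circ> Inl))" unfolding l using \<phi>(4) g by blast
    show ?thesis
      by (rule eqI) (simp_all only: \<Phi>0 \<Phi>S a r, simp_all add: idx_act_def \<Phi>0 \<Phi>S)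
  qed
  ultimately show ?thesis unfolding gmod_iso_def by blast
qed

section \<open>Functions on the cone and their restriction to the group\<close>

lemma val_diff: "val n d (\<lambda>f u. X f u - Y f u) g = val n d X g - val n d Y g"
  by (simp add: val_def left_diff_distrib sum_subtractf)

locale cone_setup = real_form n B e + bweyl n "mf n B" e "mf n ` isom" B L \<Lambda>
  for n :: nat and B :: "complex mat" and e :: complex and L :: nat and \<Lambda> :: "nat list set" +
  assumes n_pos: "0 < n"
begin

lemma cone_carrier: "M \<in> cone isom \<Longrightarrow> M \<in> carrier_mat n n"
  by (auto simp: cone_def isom_def)

lemma smult_cone: "M \<in> isom \<Longrightarrow> c \<cdot>\<^sub>m M \<in> cone isom"
  by (auto simp: cone_def)

lemma isom_cone: "M \<in> isom \<Longrightarrow> M \<in> cone isom"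
proof -
  assume M: "M \<in> isom"
  have "1 \<cdot>\<^sub>m M = M" by (intro eq_matI) auto
  then show ?thesis using smult_cone[OF M, of 1] by simp
qed

text \<open>Lets functions on the cone be compared on the group alone (\<open>homog_eqI\<close>).
  The vertex c = 0 is included; in degree 0 this uses 0^0 = 1.\<close>

definition homog :: "nat \<Rightarrow> (complex mat \<Rightarrow> complex) \<Rightarrow> bool" where
  "homog d F \<longleftrightarrow> (\<forall>M. M \<notin> cone isom \<longrightarrow> F M = 0) \<and> (\<forall>c. \<forall>M\<in>isom. F (c \<cdot>\<^sub>m M) = c ^ d * F M)"

lemma homog_eqI:
  assumes "homog d F" "homog d F'" "\<And>M. M \<in> isom \<Longrightarrow> F M = F' M" shows "F = F'"
proof
  fix M
  show "F M = F' M"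
  proof (cases "M \<in> cone isom")
    case True
    then obtain c N where "M = c \<cdot>\<^sub>m N" "N \<in> isom" by (auto simp: cone_def)
    then show ?thesis using assms by (simp add: homog_def)
  qed (use assms in \<open>simp add: homog_def\<close>)
qed

definition cval :: "nat \<Rightarrow> ((nat \<Rightarrow> nat) \<Rightarrow> (nat \<Rightarrow> nat) \<Rightarrow> complex) \<Rightarrow> complex mat \<Rightarrow> complex" where
  "cval d X M = (if M \<in> cone isom then val n d X (mf n (B * M)) else 0)"

lemma cval_isom: "M \<in> isom \<Longrightarrow> cval d X M = val n d X (mf n (B * M))"
  by (simp add: cval_def isom_cone)

lemma homog_cval: "homog d (cval d X)"
  unfolding homog_def
proof (intro conjI allI ballI impI)
  fix c M assume M: "M \<in> isom"
  note c = isom_carrier[OF M]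
  have "B * (c \<cdot>\<^sub>m M) = c \<cdot>\<^sub>m (B * M)" using c B_carrier by (simp add: mult_smult_distrib[of _ n n _ n])
  then have "mf n (B * (c \<cdot>\<^sub>m M)) = (\<lambda>x y. c * mf n (B * M) x y)" using c B_carrier by (simp add: mf_smult)
  then show "cval d X (c \<cdot>\<^sub>m M) = c ^ d * cval d X M"
    using M by (simp add: cval_def smult_cone isom_cone val_scale_matrix)
qed (simp add: cval_def)

text \<open>B is invertible, so the linear substitution of B M for M maps the homogeneous
  polynomials of degree d onto themselves.\<close>

lemma coord_eq: "coord n isom d = range (cval d)"
proof (intro equalityI subsetI)
  fix F assume "F \<in> coord n isom d"
  then obtain X where F: "F = (\<lambda>M. if M \<in> cone isom then val n d X (mf n M) else 0)"
    unfolding coord_def hompoly_eq_val by auto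
  define X' where "X' = (\<lambda>w u. \<Sum>f\<in>Ix n {..<d}. X f u * gprod {..<d} (mf n (transpose_mat B)) f w)"
  have "F = cval d X'"
  proof
    fix M
    show "F M = cval d X' M"
    proof (cases "M \<in> cone isom")
      case True
      note c = cone_carrier[OF True]
      have "transpose_mat B * (B * M) = M"
        using c B_carrier BTB by (simp add: assoc_mult_mat[of _ n n _ n _ n, symmetric])
      then have "mf n M = (\<lambda>x y. \<Sum>z<n. mf n (transpose_mat B) x z * mf n (B * M) z y)"
        using mf_mult[of "transpose_mat B" n "B * M"] c B_carrier by simp
      then have "val n d X (mf n M) = val n d X' (mf n (B * M))" unfolding X'_def by (simp add: val_mult_matrix)
      then show ?thesis using True by (simp add: F cval_def)
    qed (simp add: F cval_def)
  qed
  then show "F \<in> range (cval d)" by simp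
next
  fix F assume "F \<in> range (cval d)"
  then obtain X where F: "F = cval d X" by blast
  define X' where "X' = (\<lambda>w u. \<Sum>f\<in>Ix n {..<d}. X f u * gprod {..<d} (mf n B) f w)"
  have "val n d X (mf n (B * M)) = val n d X' (mf n M)" if "M \<in> cone isom" for M
    using mf_mult[OF B_carrier cone_carrier[OF that]] unfolding X'_def by (simp add: val_mult_matrix)
  then have "F = (\<lambda>M. if M \<in> cone isom then val n d X' (mf n M) else 0)" by (auto simp: F cval_def)
  then show "F \<in> coord n isom d" unfolding coord_def hompoly_eq_val
    by (intro CollectI exI[of _ "\<lambda>M. val n d X' (mf n M)"]) auto
qed

lemma range_mf_B: "g \<in> mf n ` isom \<Longrightarrow> \<exists>M\<in>isom. g = mf n (B * M)"
proof -
  assume "g \<in> mf n ` isom"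
  then obtain N where N: "N \<in> isom" "g = mf n N" by blast
  note c = isom_carrier[OF N(1)]
  have "B * (transpose_mat B * N) = N"
    using c B_carrier BBT by (simp add: assoc_mult_mat[of _ n n _ n _ n, symmetric])
  then show ?thesis using N isom_mult[OF isom_transpose[OF B_isom] N(1)] by metis
qed

lemma mf_B: "M \<in> isom \<Longrightarrow> mf n (B * M) \<in> mf n ` isom"
  using isom_mult[OF B_isom] by blast

lemma conj_isom: "g \<in> isom \<Longrightarrow> h \<in> isom \<Longrightarrow> M \<in> isom \<Longrightarrow> inv_m g * M * h \<in> isom"
  by (intro isom_mult) (auto simp: inv_m_isom adjm_isom)

lemma homog_act:
  assumes F: "homog d F" and g: "g \<in> isom" and h: "h \<in> isom"
  shows "homog d (coord_act n (g, h) F)"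
  unfolding homog_def
proof (intro conjI allI impI ballI)
  note gc = isom_carrier[OF g] and hc = isom_carrier[OF h]
  have ic: "inv_m g \<in> carrier_mat n n" using isom_carrier[OF adjm_isom[OF g]] inv_m_isom[OF g] by simp
  fix M assume M: "M \<notin> cone isom"
  show "coord_act n (g, h) F M = 0"
  proof (cases "M \<in> carrier_mat n n")
    case c: True
    \<comment> \<open>Otherwise the inverse motion would put M on the cone.\<close>
    have "inv_m g * M * h \<notin> cone isom"
    proof
      assume "inv_m g * M * h \<in> cone isom"
      then obtain k N where N: "inv_m g * M * h = k \<cdot>\<^sub>m N" "N \<in> isom" by (auto simp: cone_def)
      note Nc = isom_carrier[OF N(2)] and ac = isom_carrier[OF adjm_isom[OF h]]
      have "g * (inv_m g * M * h) * adjm h = (g * inv_m g) * M * (h * adjm h)"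
        using gc hc ic c ac by (simp add: assoc_mult_mat[of _ n n _ n _ n])
      also have "\<dots> = M" using c adjm_inverse[OF g] adjm_inverse[OF h] by (simp add: inv_m_isom[OF g])
      finally have "M = g * (k \<cdot>\<^sub>m N) * adjm h" unfolding N(1) by simp
      also have "\<dots> = k \<cdot>\<^sub>m (g * N * adjm h)"
        using gc Nc ac by (simp add: mult_smult_distrib[of _ n n _ n] mult_smult_assoc_mat[of _ n n _ n])
      finally have "M \<in> cone isom" using smult_cone[OF isom_mult[OF isom_mult[OF g N(2)] adjm_isom[OF h]]] by simp
      then show False using M by simp
    qed
    then show ?thesis using F c by (simp add: coord_act_def homog_def)
  qed (simp add: coord_act_def)
next
  note gc = isom_carrier[OF g] and hc = isom_carrier[OF h]
  have ic: "inv_m g \<in> carrier_mat n n" using isom_carrier[OF adjm_isom[OF g]] inv_m_isom[OF g] by simp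
  fix k M assume M: "M \<in> isom"
  note c = isom_carrier[OF M]
  have "inv_m g * (k \<cdot>\<^sub>m M) * h = k \<cdot>\<^sub>m (inv_m g * M * h)"
    using ic c hc by (simp add: mult_smult_distrib[of _ n n _ n] mult_smult_assoc_mat[of _ n n _ n])
  then show "coord_act n (g, h) F (k \<cdot>\<^sub>m M) = k ^ d * coord_act n (g, h) F M"
    using c conj_isom[OF g h M] F by (simp add: coord_act_def homog_def)
qed

lemma coord_act_isom: "M \<in> isom \<Longrightarrow> coord_act n (g, h) F M = F (inv_m g * M * h)"
  by (simp add: coord_act_def isom_carrier)

lemma cval_act:
  assumes g: "g \<in> isom" and h: "h \<in> isom"
  shows "cval d (act2 {..<d} (mf n g) (mf n h) X) = coord_act n (g, h) (cval d X)"
proof (rule homog_eqI[OF homog_cval homog_act[OF homog_cval g h]])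
  fix M assume M: "M \<in> isom"
  note c = isom_carrier[OF M] isom_carrier[OF g] isom_carrier[OF h] B_carrier
  have ic: "inv_m g \<in> carrier_mat n n" using isom_carrier[OF adjm_isom[OF g]] inv_m_isom[OF g] by simp
  have "B * (inv_m g * M * h) = (B * inv_m g) * M * h" using c ic by (simp add: assoc_mult_mat[of _ n n _ n _ n])
  also have "\<dots> = transpose_mat g * (B * M * h)" unfolding B_inv_m[OF g] using c by (simp add: assoc_mult_mat[of _ n n _ n _ n])
  finally have "mf n (B * (inv_m g * M * h)) = mf n (transpose_mat g * (B * M * h))" by simp
  also have "\<dots> = (\<lambda>x y. \<Sum>z<n. mf n (transpose_mat g) x z * mf n (B * M * h) z y)"
    using c by (intro mf_mult) auto
  also have "mf n (B * M * h) = (\<lambda>x y. \<Sum>w<n. mf n (B * M) x w * mf n h w y)"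
    using c by (intro mf_mult) auto
  finally have "mf n (B * (inv_m g * M * h)) = (\<lambda>x y. \<Sum>z<n. mf n g z x * (\<Sum>w<n. mf n (B * M) z w * mf n h w y))"
    unfolding mf_transpose[OF c(2)] .
  then show "cval d (act2 {..<d} (mf n g) (mf n h) X) M = coord_act n (g, h) (cval d X) M"
    using val_act2[of d X "mf n g" "mf n (B * M)" "mf n h"] M
    by (simp add: coord_act_isom cval_isom conj_isom[OF g h M])
qed

text \<open>The quadric q with M^T B M = q(M) B on the cone, recovered by contracting with B; the factor B in
  front of M is harmless since B is itself an isometry.\<close>

definition tq :: "complex mat \<Rightarrow> complex" where
  "tq M = (1 / of_nat n) * (\<Sum>x<n. \<Sum>y<n. mf n B x y *
     (\<Sum>p<n. \<Sum>q<n. mf n B p q * (mf n (B * M) p x * mf n (B * M) q y)))"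

lemma tq_smult: assumes M: "M \<in> isom" shows "tq (c \<cdot>\<^sub>m M) = c\<^sup>2"
proof -
  note cc = isom_carrier[OF M]
  have "B * (c \<cdot>\<^sub>m M) = c \<cdot>\<^sub>m (B * M)" using cc B_carrier by (simp add: mult_smult_distrib[of _ n n _ n])
  then have m: "mf n (B * (c \<cdot>\<^sub>m M)) = (\<lambda>x y. c * mf n (B * M) x y)" using cc B_carrier by (simp add: mf_smult)
  have "(\<Sum>p<n. \<Sum>q<n. mf n B p q * (mf n (B * (c \<cdot>\<^sub>m M)) p x * mf n (B * (c \<cdot>\<^sub>m M)) q y)) = c\<^sup>2 * mf n B x y" if "x < n" "y < n" for x y
  proof -
    have "(\<Sum>p<n. \<Sum>q<n. mf n B p q * (mf n (B * (c \<cdot>\<^sub>m M)) p x * mf n (B * (c \<cdot>\<^sub>m M)) q y)) =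
       c\<^sup>2 * (\<Sum>p<n. \<Sum>q<n. mf n B p q * (mf n (B * M) p x * mf n (B * M) q y))"
      unfolding m by (simp add: sum_distrib_left power2_eq_square mult_ac)
    then show ?thesis unfolding mf_isom_inv(1)[OF mf_B[OF M] that] .
  qed
  then have "tq (c \<cdot>\<^sub>m M) = (1 / of_nat n) * (\<Sum>x<n. \<Sum>y<n. mf n B x y * (mf n B x y * c\<^sup>2))"
    unfolding tq_def by (simp add: mult_ac)
  then show ?thesis unfolding b_contract0 using n_pos by simp
qed

lemma tq_isom: "M \<in> isom \<Longrightarrow> tq M = 1"
proof -
  assume M: "M \<in> isom"
  have "1 \<cdot>\<^sub>m M = M" by (intro eq_matI) auto
  then show ?thesis using tq_smult[OF M, of 1] by simp
qed

definition psi :: "nat \<Rightarrow> (complex mat \<Rightarrow> complex) \<Rightarrow> ((nat \<Rightarrow> nat) \<Rightarrow> (nat \<Rightarrow> nat) \<Rightarrow> complex) \<Rightarrow> complex mat \<Rightarrow> complex" where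
  "psi d q X M = tq M * q M + cval d X M"

lemma homog_psi:
  assumes "homog (d - 2) q" "2 \<le> d" shows "homog d (psi d q X)"
proof -
  obtain m where d: "d = m + 2" using assms(2) by (metis le_add_diff_inverse2)
  show ?thesis unfolding homog_def
  proof (intro conjI allI ballI impI)
    fix M assume "M \<notin> cone isom" then show "psi d q X M = 0" using assms by (simp add: psi_def homog_def cval_def)
  next
    fix c M assume M: "M \<in> isom"
    have "q (c \<cdot>\<^sub>m M) = c ^ m * q M" using assms M d by (simp add: homog_def)
    moreover have "cval d X (c \<cdot>\<^sub>m M) = c ^ d * cval d X M" using homog_cval M by (simp add: homog_def)
    ultimately show "psi d q X (c \<cdot>\<^sub>m M) = c ^ d * psi d q X M"
      unfolding psi_def tq_smult[OF M] tq_isom[OF M] by (simp add: d power_add power2_eq_square algebra_simps)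
  qed
qed

lemma coord_homog: "F \<in> coord n isom d \<Longrightarrow> homog d F"
  unfolding coord_eq using homog_cval by blast

text \<open>On the group the quadric is 1, so equalities become equalities of values. Injectivity is
  then \<open>val_HH_injective\<close>; products with the quadric lie in the coordinate ring by
  \<open>exists_insertion\<close>; surjectivity is \<open>val_decomposition\<close>.\<close>

lemma psi_bij:
  assumes d: "2 \<le> d"
  shows "bij_betw (\<lambda>(q, X). psi d q X) (coord n isom (d - 2) \<times> {X. HH {..<d} X}) (coord n isom d)"
  unfolding bij_betw_def
proof
  obtain m where m: "d = Suc (Suc m)" using d by (metis add_2_eq_Suc le_Suc_ex)
  show "inj_on (\<lambda>(q, X). psi d q X) (coord n isom (d - 2) \<times> {X. HH {..<d} X})"
  proof (rule inj_onI)
    fix a a' assume "a \<in> coord n isom (d - 2) \<times> {X. HH {..<d} X}" "a' \<in> coord n isom (d - 2) \<times> {X. HH {..<d} X}"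
      and eq: "(case a of (q, X) \<Rightarrow> psi d q X) = (case a' of (q, X) \<Rightarrow> psi d q X)"
    then obtain Y X Y' X' where a: "a = (cval (d - 2) Y, X)" "a' = (cval (d - 2) Y', X')" and X: "HH {..<d} X" "HH {..<d} X'"
      unfolding coord_eq by auto
    have HHd: "HH {..<d} (\<lambda>f u. X f u + (-1) * X' f u)" using X by (intro HH_add_scale)
    have e: "cval (d - 2) Y M + cval d X M = cval (d - 2) Y' M + cval d X' M" if "M \<in> isom" for M
      using fun_cong[OF eq, of M] that by (simp add: a psi_def tq_isom)
    have z: "(if 2 \<le> d then val n (d - 2) (\<lambda>f u. Y f u + (-1) * Y' f u) g else 0) + val n d (\<lambda>f u. X f u + (-1) * X' f u) g = 0"
      if g: "g \<in> mf n ` isom" for g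
    proof -
      obtain M where M: "M \<in> isom" "g = mf n (B * M)" using range_mf_B[OF g] by blast
      show ?thesis using e[OF M(1)] d by (simp add: cval_isom[OF M(1)] M(2) val_add val_diff algebra_simps)
    qed
    have "X f u + (-1) * X' f u = 0" for f u by (rule val_HH_injective[OF n_pos HHd z])
    then have XX: "X = X'" by (intro ext) simp
    have "cval (d - 2) Y = cval (d - 2) Y'"
      using e XX by (intro homog_eqI[OF homog_cval homog_cval]) simp
    then show "a = a'" using a XX by simp
  qed
  show "(\<lambda>(q, X). psi d q X) ` (coord n isom (d - 2) \<times> {X. HH {..<d} X}) = coord n isom d"
  proof (intro equalityI subsetI)
    fix F assume "F \<in> (\<lambda>(q, X). psi d q X) ` (coord n isom (d - 2) \<times> {X. HH {..<d} X})"
    then obtain Y X where F: "F = psi d (cval (d - 2) Y) X" unfolding coord_eq by auto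
    obtain Y' where Y': "\<And>g. g \<in> mf n ` isom \<Longrightarrow> val n (Suc (Suc m)) (\<lambda>f u. mf n B (f (Suc m)) (f m) * Y' f u) g = val n m Y g"
      by (rule exists_insertion[OF n_pos, of m Y]) (rule that)
    have "F = cval d (\<lambda>f u. mf n B (f (Suc m)) (f m) * Y' f u + X f u)"
    proof (rule homog_eqI[OF _ homog_cval])
      show "homog d F" unfolding F using d by (intro homog_psi homog_cval)
      fix M assume M: "M \<in> isom"
      show "F M = cval d (\<lambda>f u. mf n B (f (Suc m)) (f m) * Y' f u + X f u) M"
        using Y'[OF mf_B[OF M]] by (simp add: F psi_def tq_isom[OF M] cval_isom[OF M] val_add m)
    qed
    then show "F \<in> coord n isom d" unfolding coord_eq by simp
  next
    fix F assume F: "F \<in> coord n isom d"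
    then obtain X where X: "F = cval d X" unfolding coord_eq by blast
    obtain X' where X': "HH {..<d} X'" "reduces d (\<lambda>f u. X f u - X' f u) (mf n ` isom)"
      using val_decomposition[of d X] by blast
    then obtain Y where Y: "\<And>g. g \<in> mf n ` isom \<Longrightarrow> val n d (\<lambda>f u. X f u - X' f u) g = val n (d - 2) Y g"
      using d unfolding reduces_def by auto
    have "F = psi d (cval (d - 2) Y) X'"
    proof (rule homog_eqI)
      show "homog d F" using coord_homog[OF F] .
      show "homog d (psi d (cval (d - 2) Y) X')" using d by (intro homog_psi homog_cval)
      fix M assume M: "M \<in> isom"
      have "val n d X (mf n (B * M)) = val n d (\<lambda>f u. (X f u - X' f u) + X' f u) (mf n (B * M))" by simp
      also have "\<dots> = val n (d - 2) Y (mf n (B * M)) + val n d X' (mf n (B * M))" unfolding val_add Y[OF mf_B[OF M]] ..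
      finally show "F M = psi d (cval (d - 2) Y) X' M" by (simp add: X psi_def tq_isom[OF M] cval_isom[OF M])
    qed
    then show "F \<in> (\<lambda>(q, X). psi d q X) ` (coord n isom (d - 2) \<times> {X. HH {..<d} X})"
      using X'(1) unfolding coord_eq by (intro image_eqI[of _ _ "(cval (d - 2) Y, X')"]) auto
  qed
qed

lemma cval_bij_small:
  assumes d: "d < 2"
  shows "bij_betw (cval d) {X. HH {..<d} X} (coord n isom d)"
  unfolding bij_betw_def
proof
  show "inj_on (cval d) {X. HH {..<d} X}"
  proof (rule inj_onI)
    fix X X' assume X: "X \<in> {X. HH {..<d} X}" "X' \<in> {X. HH {..<d} X}" and eq: "cval d X = cval d X'"
    have HHd: "HH {..<d} (\<lambda>f u. X f u + (-1) * X' f u)" using X by (intro HH_add_scale) auto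
    have z: "(if 2 \<le> d then val n (d - 2) (\<lambda>f u. 0) g else 0) + val n d (\<lambda>f u. X f u + (-1) * X' f u) g = 0"
      if g: "g \<in> mf n ` isom" for g
    proof -
      obtain M where M: "M \<in> isom" "g = mf n (B * M)" using range_mf_B[OF g] by blast
      show ?thesis using fun_cong[OF eq, of M] d by (simp add: cval_isom[OF M(1)] M(2) val_add val_diff algebra_simps)
    qed
    have "X f u + (-1) * X' f u = 0" for f u by (rule val_HH_injective[OF n_pos HHd z])
    then show "X = X'" by (intro ext) simp
  qed
  show "cval d ` {X. HH {..<d} X} = coord n isom d"
  proof (intro equalityI subsetI)
    fix F assume F: "F \<in> coord n isom d"
    then obtain X where X: "F = cval d X" unfolding coord_eq by blast
    obtain X' where X': "HH {..<d} X'" "reduces d (\<lambda>f u. X f u - X' f u) (mf n ` isom)"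
      using val_decomposition[of d X] by blast
    then have Y: "\<And>g. g \<in> mf n ` isom \<Longrightarrow> val n d (\<lambda>f u. X f u - X' f u) g = 0"
      using d unfolding reduces_def by auto
    have "F = cval d X'"
    proof (rule homog_eqI)
      show "homog d F" using coord_homog[OF F] .
      show "homog d (cval d X')" by (rule homog_cval)
      fix M assume M: "M \<in> isom"
      have "val n d X (mf n (B * M)) = val n d (\<lambda>f u. (X f u - X' f u) + X' f u) (mf n (B * M))" by simp
      also have "\<dots> = val n d X' (mf n (B * M))" unfolding val_add Y[OF mf_B[OF M]] by simp
      finally show "F M = cval d X' M" by (simp add: X cval_isom[OF M])
    qed
    then show "F \<in> cval d ` {X. HH {..<d} X}" using X'(1) by blast
  qed (auto simp: coord_eq)
qed

lemma cval_add_scale: "cval d (\<lambda>f u. X f u + c * Y f u) = (\<lambda>M. cval d X M + c * cval d Y M)"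
  by (auto simp: cval_def val_add val_scale fun_eq_iff)

lemma HH_act: fixes d :: nat shows "g \<in> isom \<Longrightarrow> h \<in> isom \<Longrightarrow> HH {..<d} X \<Longrightarrow> HH {..<d} (act2 {..<d} (mf n g) (mf n h) X)"
  by (intro HH_act2) auto

lemma HH_add: "HH {..<d} X \<Longrightarrow> HH {..<d} Y \<Longrightarrow> HH {..<d} (\<lambda>f u. X f u + Y f u)"
  using HH_add_scale[of "{..<d}" X Y 1] by simp

lemma HH_scale: "HH {..<d} X \<Longrightarrow> HH {..<d} (\<lambda>f u. c * X f u)"
  using HH_add_scale[OF HH_zero, of "{..<d}" X c] by simp

lemma cval_add: "cval d (\<lambda>f u. X f u + Y f u) = (\<lambda>M. cval d X M + cval d Y M)"
  using cval_add_scale[of d X 1 Y] by simp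

lemma cval_scale: "cval d (\<lambda>f u. c * X f u) = (\<lambda>M. c * cval d X M)"
  by (auto simp: cval_def val_scale fun_eq_iff)

lemma chi_add: "chi d (\<lambda>f u. X f u + Y f u) = (\<lambda>M. chi d X M + chi d Y M)"
  using chi_add_scale[of d X 1 Y] by simp

lemma chi_scale: "chi d (\<lambda>f u. c * X f u) = (\<lambda>M. c * chi d X M)"
proof -
  have "chi d (\<lambda>f u. 0) = (\<lambda>x. 0)" using chi_add_scale[of d "\<lambda>f u. 0" "-1" "\<lambda>f u. 0"] by (simp add: fun_eq_iff)
  then show ?thesis using chi_add_scale[of d "\<lambda>f u. 0" c X] by simp
qed

lemma coord_closed:
  "F \<in> coord n isom d \<Longrightarrow> F' \<in> coord n isom d \<Longrightarrow> (\<lambda>M. F M + F' M) \<in> coord n isom d"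
  "F \<in> coord n isom d \<Longrightarrow> (\<lambda>M. c * F M) \<in> coord n isom d"
  "F \<in> coord n isom d \<Longrightarrow> g \<in> isom \<Longrightarrow> h \<in> isom \<Longrightarrow> coord_act n (g, h) F \<in> coord n isom d"
  unfolding coord_eq by (auto simp: cval_add[symmetric] cval_scale[symmetric] cval_act[symmetric])

theorem coord_iso_small:
  assumes d: "d < 2"
  shows "gmod_iso (isom \<times> isom) (coord n isom d) (coord_act n)
      (idx_dsum (Lamd d) (\<lambda>lam. tensor_sq (weyl_module B lam))) (idx_act (\<lambda>lam. pair_act n (sum_list lam)))"
  by (rule gmod_iso_via[where U = "{X. HH {..<d} X}" and \<psi> = "cval d" and \<chi> = "chi d"
        and add = "\<lambda>X Y f u. X f u + Y f u" and scl = "\<lambda>c X f u. c * X f u"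
        and act = "\<lambda>\<gamma>. act2 {..<d} (mf n (fst \<gamma>)) (mf n (snd \<gamma>))"])
    (auto simp: cval_bij_small[OF d] chi_bij HH_add HH_scale HH_act cval_add cval_scale cval_act chi_add chi_scale chi_act2)

theorem coord_iso_step:
  assumes d: "2 \<le> d"
  shows "gmod_iso (isom \<times> isom) (coord n isom d) (coord_act n)
      (sum_carrier (coord n isom (d - 2)) (idx_dsum (Lamd d) (\<lambda>lam. tensor_sq (weyl_module B lam))))
      (sum_act (coord_act n) (idx_act (\<lambda>lam. pair_act n (sum_list lam))))"
proof -
  let ?W = "idx_dsum (Lamd d) (\<lambda>lam. tensor_sq (weyl_module B lam))" and ?V = "coord n isom (d - 2)"
  have cb: "bij_betw (\<lambda>(q, X). case_sum q (chi d X)) (?V \<times> {X. HH {..<d} X}) (sum_carrier ?V ?W)"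
  proof -
    have "bij_betw (\<lambda>(q, Z). case_sum q Z) (?V \<times> ?W) (sum_carrier ?V ?W)"
      by (rule bij_betwI[where g = "\<lambda>X. (X \<circ> Inl, X \<circ> Inr)"])
        (auto simp: sum_carrier_def fun_eq_iff comp_def split: sum.splits)
    moreover have "bij_betw (\<lambda>(q, X). (q, chi d X)) (?V \<times> {X. HH {..<d} X}) (?V \<times> ?W)"
    proof -
      have "bij_betw (map_prod id (chi d)) (?V \<times> {X. HH {..<d} X}) (?V \<times> ?W)"
        by (rule bij_betw_map_prod[OF bij_betw_id chi_bij])
      then show ?thesis unfolding map_prod_def id_apply .
    qed
    ultimately have "bij_betw ((\<lambda>(q, Z). case_sum q Z) \<circ> (\<lambda>(q, X). (q, chi d X))) (?V \<times> {X. HH {..<d} X}) (sum_carrier ?V ?W)"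
      by (intro bij_betw_trans)
    then show ?thesis by (rule bij_betw_cong[THEN iffD1, rotated]) auto
  qed
  \<comment> \<open>Both sides are homogeneous and can be compared on the group, where the quadric
    has the value 1 at M and at the moved matrix alike.\<close>
  have act: "psi d (coord_act n (g, h) q) (act2 {..<d} (mf n g) (mf n h) X) = coord_act n (g, h) (psi d q X)"
    if q: "q \<in> ?V" and gh: "g \<in> isom" "h \<in> isom" for q g h X
  proof (rule homog_eqI)
    show "homog d (psi d (coord_act n (g, h) q) (act2 {..<d} (mf n g) (mf n h) X))"
      using coord_homog[OF q] gh d by (intro homog_psi homog_act)
    show "homog d (coord_act n (g, h) (psi d q X))" using coord_homog[OF q] gh d by (intro homog_psi homog_act)
    fix M assume M: "M \<in> isom"
    show "psi d (coord_act n (g, h) q) (act2 {..<d} (mf n g) (mf n h) X) M = coord_act n (g, h) (psi d q X) M"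
      by (simp add: psi_def cval_act[OF gh] coord_act_isom[OF M] tq_isom M conj_isom[OF gh M])
  qed
  show ?thesis
  proof (rule gmod_iso_via[where U = "?V \<times> {X. HH {..<d} X}" and \<psi> = "\<lambda>(q, X). psi d q X" and \<chi> = "\<lambda>(q, X). case_sum q (chi d X)"
        and add = "\<lambda>(q, X) (q', Y). (\<lambda>M. q M + q' M, \<lambda>f u. X f u + Y f u)" and scl = "\<lambda>c (q, X). (\<lambda>M. c * q M, \<lambda>f u. c * X f u)"
        and act = "\<lambda>\<gamma> (q, X). (coord_act n \<gamma> q, act2 {..<d} (mf n (fst \<gamma>)) (mf n (snd \<gamma>)) X)", OF psi_bij[OF d] cb])
  qed (auto simp: HH_add HH_scale HH_act coord_closed act psi_def cval_add cval_scale chi_add chi_scale chi_act2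
        sum_act_def fun_eq_iff distrib_left mult.left_commute comp_def split: sum.splits)
qed

text \<open>Induction in steps of two: degree d - 2 supplies the summands with k > 0, and below
  degree 2 only k = 0 occurs.\<close>

lemma coord_iso_total:
  "gmod_iso (isom \<times> isom) (coord n isom d) (coord_act n)
      (idx_dsum (sum_index \<Lambda> d) (\<lambda>(k, lam). tensor_sq (weyl_module B lam)))
      (idx_act (\<lambda>(k, lam). pair_act n (sum_list lam)))"
proof (induction d rule: less_induct)
  case (less d)
  show ?case
  proof (cases "d < 2")
    case True
    have J: "sum_index \<Lambda> d = Pair 0 ` Lamd d" using True by (auto simp: sum_index_def Lamd_def)
    have "gmod_iso (isom \<times> isom) (idx_dsum (Lamd d) (\<lambda>lam. tensor_sq (weyl_module B lam))) (idx_act (\<lambda>lam. pair_act n (sum_list lam)))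
       (idx_dsum (sum_index \<Lambda> d) (\<lambda>(k, lam). tensor_sq (weyl_module B lam))) (idx_act (\<lambda>(k, lam). pair_act n (sum_list lam)))"
      by (rule gmod_iso_reindex[where h = "Pair 0"]) (auto simp: J inj_on_def pair_act_def)
    then show ?thesis using coord_iso_small[OF True] gmod_iso_trans by blast
  next
    case False
    then obtain m where m: "d = Suc (Suc m)" by (metis add_2_eq_Suc le_Suc_ex not_less)
    have IH: "gmod_iso (isom \<times> isom) (coord n isom m) (coord_act n)
      (idx_dsum (sum_index \<Lambda> m) (\<lambda>(k, lam). tensor_sq (weyl_module B lam)))
      (idx_act (\<lambda>(k, lam). pair_act n (sum_list lam)))" using less[of m] m by simp
    have st: "gmod_iso (isom \<times> isom) (coord n isom d) (coord_act n)
      (sum_carrier (coord n isom m) (idx_dsum {lam \<in> \<Lambda>. sum_list lam = Suc (Suc m)} (\<lambda>lam. tensor_sq (weyl_module B lam))))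
      (sum_act (coord_act n) (idx_act (\<lambda>lam. pair_act n (sum_list lam))))"
      using coord_iso_step[of d] False m by (simp add: Lamd_def)
    show ?thesis unfolding m
      by (rule gmod_iso_trans[OF st[unfolded m] gmod_iso_sum_index_step[OF IH]])
  qed
qed

end

lemma cone_setup_orth: assumes "0 < n" shows "cone_setup n (1\<^sub>m n) 1 n (LamO n)"
proof -
  interpret real_form n "1\<^sub>m n" 1 by (rule real_form_one)
  have o: "orth n = isom" unfolding orth_def isom_def by auto
  interpret g: bgroup n "mf n (1\<^sub>m n)" 1 "mf n ` isom" using bgroup_orth[of n] unfolding o .
  show ?thesis by unfold_locales (use assms in \<open>auto simp: LamO_def\<close>)
qed

lemma cone_setup_symp: assumes "0 < n" "even n" shows "cone_setup n (Jmat n) (-1) (n div 2) (LamSp (n div 2))"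
proof -
  interpret real_form n "Jmat n" "-1" by (rule real_form_Jmat[OF assms(2)])
  have o: "symp n = isom" unfolding symp_def isom_def ..
  interpret g: bgroup n "mf n (Jmat n)" "-1" "mf n ` isom" using bgroup_symp[OF assms(2)] unfolding o .
  show ?thesis by unfold_locales (use assms in \<open>auto simp: LamSp_def Jmat_def\<close>)
qed

theorem theorem2p3:
  fixes n :: nat and G :: "complex mat set" and B :: "complex mat" and \<Lambda> :: "nat list set"
  assumes "n \<ge> 3"
    and "(G = orth n \<and> B = 1\<^sub>m n \<and> \<Lambda> = LamO n) \<or>
         (even n \<and> G = symp n \<and> B = Jmat n \<and> \<Lambda> = LamSp (n div 2))"
  shows "\<forall>d::nat.
    gmod_iso (G \<times> G) (coord n G d) (coord_act n)
      (idx_dsum (sum_index \<Lambda> d) (\<lambda>(k, lam). tensor_sq (weyl_module B lam)))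
      (idx_act (\<lambda>(k, lam). pair_act n (sum_list lam)))
    \<and> (d \<ge> 2 \<longrightarrow>
    gmod_iso (G \<times> G) (coord n G d) (coord_act n)
      (sum_carrier (coord n G (d - 2))
         (idx_dsum {lam \<in> \<Lambda>. sum_list lam = d} (\<lambda>lam. tensor_sq (weyl_module B lam))))
      (sum_act (coord_act n) (idx_act (\<lambda>lam. pair_act n (sum_list lam)))))"
  using assms(2)
proof (elim disjE conjE)
  assume h: "G = orth n" "B = 1\<^sub>m n" "\<Lambda> = LamO n"
  interpret cone_setup n "1\<^sub>m n" 1 n "LamO n" using assms(1) by (intro cone_setup_orth) simp
  have o: "orth n = isom" unfolding orth_def isom_def by auto
  show ?thesis unfolding h o using coord_iso_total coord_iso_step unfolding Lamd_def by blast
next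
  assume h: "even n" "G = symp n" "B = Jmat n" "\<Lambda> = LamSp (n div 2)"
  interpret cone_setup n "Jmat n" "-1" "n div 2" "LamSp (n div 2)" using assms(1) h(1) by (intro cone_setup_symp) simp_all
  have o: "symp n = isom" unfolding symp_def isom_def ..
  show ?thesis unfolding h(2-4) o using coord_iso_total coord_iso_step unfolding Lamd_def by blast
qed

end
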